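(* Let $F:\mathcal P_2(\mathbb R^d)\to\mathbb R$ be a functional with linear functional derivative $\frac{\delta F}{\delta m}$ and intrinsic derivative $D_mF=\nabla\frac{\delta F}{\delta m}$, and assume that there are constants $M^F_{mm}\ge 0$, $M^F_{mx}\ge 0$, $\rho>0$ such that: (1) $F((1-t)m+tm')\le(1-t)F(m)+tF(m')$ for all $t\in[0,1]$, $m,m'\in\mathcal P_2(\mathbb R^d)$; (2) $|D_mF(m,x)-D_mF(m',x)|\le M^F_{mm}W_1(m,m')$ for all $x\in\mathbb R^d$, $m,m'\in\mathcal P_2(\mathbb R^d)$; (3) for every $m\in\mathcal P_2(\mathbb R^d)$, $\int\exp(-\frac{\delta F}{\delta m}(m,x))\,dx<\infty$ and the probability measure $\hat m(dx)\propto\exp(-\frac{\delta F}{\delta m}(m,x))\,dx$ satisfies $\rho\,\mathrm{Ent}_{\hat m}(f^2)\le\mathbb E_{\hat m}[|\nabla f|^2]$ for all $f\in C^1_b(\mathbb R^d)$; (4) $\sup_{m}\sup_{x}|\nabla D_mF(m,x)|\le M^F_{mx}$. Let $N\ge2$ and let $m^N_t=\mathrm{Law}(X^1_t,\dots,X^N_t)$, $t\ge0$, where $$dX^i_t=-D_mF(\mu_{\mathbf X_t},X^i_t)\,dt+\sqrt2\,dW^i_t,\quad i=1,\dots,N,\qquad\mu_{\mathbf X_t}=\frac1N\sum_{i=1}^N\delta_{X^i_t},$$ with independent standard $d$-dimensional Brownian motions $W^i$. Suppose that $m^N_{t_0}\in\mathcal P_2(\mathbb R^{dN})$ has finite entropy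 for some $t_0\ge0$. Then for every $\rho'\in(0,\rho)$, if $N>C_1/4\rho'$, we have for every $t\ge t_0$ $$H(m^N_t|m_\infty^{\otimes N})\le\mathcal F^N(m^N_t)-N\mathcal F(m_\infty)\le\bigl(\mathcal F^N(m^N_{t_0})-N\mathcal F(m_\infty)\bigr)e^{-(4\rho'-C_1N^{-1})(t-t_0)}+\frac{C_2}{4\rho'-C_1N^{-1}},$$ where $$C_1=M^F_{mm}\Bigl(16+\frac{6M^F_{mm}\rho'}{\rho(\rho-\rho')}\Bigr),\qquad C_2=dM^F_{mm}\Bigl(10+\frac{3M^F_{mm}\rho'}{\rho(\rho-\rho')}\Bigr).$$
   Context: $\mathcal P_2(\mathbb R^n)$ is the set of probability measures on $\mathbb R^n$ with finite second moment; $W_p$ is the $L^p$-Wasserstein distance. The linear functional derivative of $F$ is a function $\frac{\delta F}{\delta m}:\mathcal P_2(\mathbb R^d)\times\mathbb R^d\to\mathbb R$, jointly continuous, of at most quadratic growth in $x$ uniformly for $m$ in bounded subsets of $\mathcal P_2$, with $F(m')-F(m)=\int_0^1\int\frac{\delta F}{\delta m}((1-t)m+tm',x)(m'-m)(dx)\,dt$. $\mathrm{Ent}_m f=\mathbb E_m[f\log f]-\mathbb E_m[f]\log\mathbb E_m[f]$. $H(m|\gamma)=\int\log\frac{dm}{d\gamma}\,dm$ is relative entropy, $H(m)=\int m\log m$ the absolute entropy (relative to Lebesgue measure). For $\mathbf x=(x^1,\dots,x^N)$, $\mu_{\mathbf x}=\frac1N\sum_i\delta_{x^i}$. Free energies: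 $\mathcal F(m)=F(m)+H(m)$ on $\mathcal P_2(\mathbb R^d)$ and $\mathcal F^N(m^N)=N\int F(\mu_{\mathbf x})\,m^N(d\mathbf x)+H(m^N)$ on $\mathcal P_2(\mathbb R^{dN})$. Under (1)–(4), $\mathcal F$ has a unique minimizer $m_\infty\in\mathcal P_2(\mathbb R^d)$, which is also the unique solution in $\mathcal P_2(\mathbb R^d)$ of $m_\infty=\hat m_\infty$. *)

theory Defs
  imports "HOL-Probability.Probability"
begin

section \<open>Probability measures with finite second moment\<close>

definition P2 :: "'a::euclidean_space measure set" where
  "P2 = {m. prob_space m \<and> sets m = sets borel \<and> integrable m (\<lambda>x. (norm x)\<^sup>2)}"

definition couplings :: "'a::euclidean_space measure \<Rightarrow> 'a measure \<Rightarrow> ('a \<times> 'a) measure set" where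
  "couplings m m' =
    {\<pi>. sets \<pi> = sets (borel \<Otimes>\<^sub>M borel) \<and> distr \<pi> borel fst = m \<and> distr \<pi> borel snd = m'}"

text \<open>The infimum is finite for arguments in \<^const>\<open>P2\<close> and \<open>1 \<le> p \<le> 2\<close>; only there is the
  conversion to \<^typ>\<open>real\<close> meaningful.\<close>

definition wasserstein :: "real \<Rightarrow> 'a::euclidean_space measure \<Rightarrow> 'a measure \<Rightarrow> real" where
  "wasserstein p m m' =
    enn2real (INF \<pi>\<in>couplings m m'. \<integral>\<^sup>+z. ennreal (dist (fst z) (snd z) powr p) \<partial>\<pi>) powr (1 / p)"

text \<open>The convex combination \<open>(1 - t) m + t m'\<close> of measures, for \<open>0 \<le> t \<le> 1\<close>.\<close>

definition mixture :: "real \<Rightarrow> 'a measure \<Rightarrow> 'a measure \<Rightarrow> 'a measure" where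
  "mixture t m m' = measure_of (space m) (sets m)
    (\<lambda>A. ennreal (1 - t) * emeasure m A + ennreal t * emeasure m' A)"

definition empirical :: "'a::euclidean_space ^ 'n \<Rightarrow> 'a measure" where
  "empirical x = distr (uniform_count_measure (UNIV :: 'n set)) borel (\<lambda>i. x $ i)"

definition tensor_power :: "'a::euclidean_space measure \<Rightarrow> ('a ^ 'n) measure" where
  "tensor_power m = distr (\<Pi>\<^sub>M i\<in>(UNIV :: 'n set). m) borel (\<lambda>x. \<chi> i. x i)"

section \<open>Derivatives of functionals on measures\<close>

text \<open>Joint continuity is with respect to the Wasserstein-2 topology on \<^const>\<open>P2\<close>, and the bounded
  subsets of \<^const>\<open>P2\<close> are those contained in a Wasserstein-2 ball around the Dirac mass at 0.\<close>

definition linear_functional_derivative ::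
  "('a::euclidean_space measure \<Rightarrow> real) \<Rightarrow> ('a measure \<Rightarrow> 'a \<Rightarrow> real) \<Rightarrow> bool" where
  "linear_functional_derivative F dF \<longleftrightarrow>
    (\<forall>m\<in>P2. \<forall>x. \<forall>\<epsilon>>0. \<exists>\<delta>>0. \<forall>m'\<in>P2. \<forall>y.
        wasserstein 2 m m' < \<delta> \<and> dist x y < \<delta> \<longrightarrow> \<bar>dF m' y - dF m x\<bar> < \<epsilon>) \<and>
    (\<forall>R. \<exists>C. \<forall>m\<in>P2. wasserstein 2 (return borel 0) m \<le> R \<longrightarrow>
        (\<forall>x. \<bar>dF m x\<bar> \<le> C * (1 + (norm x)\<^sup>2))) \<and>
    (\<forall>m\<in>P2. \<forall>m'\<in>P2. F m' - F m =
        integral {0..1} (\<lambda>t. (\<integral>x. dF (mixture t m m') x \<partial>m') - (\<integral>x. dF (mixture t m m') x \<partial>m)))"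

definition intrinsic_derivative ::
  "('a::euclidean_space measure \<Rightarrow> 'a \<Rightarrow> real) \<Rightarrow> ('a measure \<Rightarrow> 'a \<Rightarrow> 'a) \<Rightarrow> bool" where
  "intrinsic_derivative dF DF \<longleftrightarrow> (\<forall>m\<in>P2. \<forall>x. GDERIV (dF m) x :> DF m x)"

section \<open>Entropy and the logarithmic Sobolev inequality\<close>

text \<open>The relative entropy \<open>H(m|\<gamma>) = \<integral> log (dm/d\<gamma>) dm\<close> with values in \<open>[-\<infinity>, \<infinity>]\<close>: the integral of
  the positive part minus that of the negative part, and \<open>\<infinity>\<close> if \<open>m\<close> is not absolutely continuous
  with respect to \<open>\<gamma>\<close>. The negative part has a finite integral whenever \<open>m\<close> and \<open>\<gamma>\<close> are
  probability measures, and also for \<open>m\<close> in \<^const>\<open>P2\<close> and \<open>\<gamma>\<close> the Lebesgue measure.\<close>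

definition rel_entropy :: "'a measure \<Rightarrow> 'a measure \<Rightarrow> ereal" where
  "rel_entropy m \<gamma> =
    (if absolutely_continuous \<gamma> m
     then enn2ereal (\<integral>\<^sup>+x. ennreal (entropy_density (exp 1) \<gamma> m x) \<partial>m)
        - enn2ereal (\<integral>\<^sup>+x. ennreal (- entropy_density (exp 1) \<gamma> m x) \<partial>m)
     else \<infinity>)"

definition abs_entropy :: "'a::euclidean_space measure \<Rightarrow> ereal" where
  "abs_entropy m = rel_entropy m lborel"

definition Ent :: "'a measure \<Rightarrow> ('a \<Rightarrow> real) \<Rightarrow> real" where
  "Ent m f = (\<integral>x. f x * ln (f x) \<partial>m) - (\<integral>x. f x \<partial>m) * ln (\<integral>x. f x \<partial>m)"

text \<open>Test functions range over \<open>C\<^sup>1\<close> functions that are bounded with bounded gradient.\<close>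

definition log_sobolev :: "real \<Rightarrow> 'a::euclidean_space measure \<Rightarrow> bool" where
  "log_sobolev \<rho> m \<longleftrightarrow>
    (\<forall>f g. (\<forall>x. GDERIV f x :> g x) \<and> continuous_on UNIV g \<and> bounded (range f) \<and> bounded (range g) \<longrightarrow>
       \<rho> * Ent m (\<lambda>x. (f x)\<^sup>2) \<le> (\<integral>x. (norm (g x))\<^sup>2 \<partial>m))"

definition hat_measure ::
  "('a::euclidean_space measure \<Rightarrow> 'a \<Rightarrow> real) \<Rightarrow> 'a measure \<Rightarrow> 'a measure" where
  "hat_measure dF m =
    density lborel (\<lambda>x. ennreal (exp (- dF m x) / (\<integral>y. exp (- dF m y) \<partial>lborel)))"

definition free_energy :: "('a::euclidean_space measure \<Rightarrow> real) \<Rightarrow> 'a measure \<Rightarrow> ereal" where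
  "free_energy F m = ereal (F m) + abs_entropy m"

definition particle_free_energy ::
  "('a::euclidean_space measure \<Rightarrow> real) \<Rightarrow> ('a ^ 'n) measure \<Rightarrow> ereal" where
  "particle_free_energy F mN =
    ereal (real CARD('n) * (\<integral>x. F (empirical x) \<partial>mN)) + abs_entropy mN"

section \<open>Brownian motion and the particle system\<close>

definition brownian_motion ::
  "'w measure \<Rightarrow> (real \<Rightarrow> 'w \<Rightarrow> 'a::euclidean_space) \<Rightarrow> bool" where
  "brownian_motion M W \<longleftrightarrow>
    (\<forall>t\<ge>0. W t \<in> borel_measurable M) \<and>
    (AE \<omega> in M. W 0 \<omega> = 0) \<and>
    (AE \<omega> in M. continuous_on {0..} (\<lambda>t. W t \<omega>)) \<and>
    (\<forall>s t. 0 \<le> s \<and> s < t \<longrightarrow>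
       distributed M lborel (\<lambda>\<omega>. W t \<omega> - W s \<omega>)
         (\<lambda>x. ennreal (\<Prod>b\<in>Basis. normal_density 0 (sqrt (t - s)) (x \<bullet> b)))) \<and>
    (\<forall>(\<tau>::nat \<Rightarrow> real) n. 0 \<le> \<tau> 0 \<and> (\<forall>k<n. \<tau> k < \<tau> (Suc k)) \<longrightarrow>
       prob_space.indep_vars M (\<lambda>_. borel) (\<lambda>k \<omega>. W (\<tau> (Suc k)) \<omega> - W (\<tau> k) \<omega>) {..<n})"

text \<open>The noise is additive, so the system of stochastic differential equations is the pathwise
  integral equation below. As usual for such an equation, the initial condition is independent of
  the driving Brownian motions.\<close>

definition particle_system ::
  "('a::euclidean_space measure \<Rightarrow> 'a \<Rightarrow> 'a) \<Rightarrow> 'w measure \<Rightarrow> ('n::finite \<Rightarrow> real \<Rightarrow> 'w \<Rightarrow> 'a)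
    \<Rightarrow> (real \<Rightarrow> 'w \<Rightarrow> 'a ^ 'n) \<Rightarrow> bool" where
  "particle_system DF M W X \<longleftrightarrow>
    prob_space M \<and>
    (\<forall>i. brownian_motion M (W i)) \<and>
    prob_space.indep_vars M (\<lambda>_. \<Pi>\<^sub>M t\<in>{0..}. borel) (\<lambda>i \<omega>. \<lambda>t\<in>{0..}. W i t \<omega>) UNIV \<and>
    (\<forall>t\<ge>0. X t \<in> borel_measurable M) \<and>
    prob_space.indep_set M
      (sets (vimage_algebra (space M) (X 0) borel))
      (sets (vimage_algebra (space M) (\<lambda>\<omega>. \<lambda>(i, t)\<in>UNIV \<times> {0..}. W i t \<omega>)
        (\<Pi>\<^sub>M (i, t)\<in>UNIV \<times> {0..}. borel))) \<and>
    (AE \<omega> in M. continuous_on {0..} (\<lambda>t. X t \<omega>) \<and>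
      (\<forall>t\<ge>0. \<forall>i. X t \<omega> $ i = X 0 \<omega> $ i
         - integral {0..t} (\<lambda>s. DF (empirical (X s \<omega>)) (X s \<omega> $ i))
         + sqrt 2 *\<^sub>R W i t \<omega>))"

end

theory Submission
  imports Defs "HOL-Real_Asymp.Real_Asymp"
begin

text \<open>
  Write \<open>E p = \<integral> p ln p + \<integral> p U\<close> for the free energy of a law on the configuration space, with \<open>U y = N F(\<mu>\<^sub>y)\<close>.
  Instead of the Fokker--Planck equation, the dissipation \<open>E' = - I\<close> (\<open>I\<close> the relative Fisher information) is obtained
  from the Euler scheme with mollified drift: Gibbs' inequality for the joint law of two consecutive positions, against the
  backward Gaussian kernel shifted by the score, gives the decrease of \<open>E\<close> in one step up to a summable error.
  The scheme converges to the diffusion pathwise, and \<open>E\<close> is lower semicontinuous by the Donsker--Varadhan formula, so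
  \<open>I \<ge> \<kappa> (E - c)\<close> for all regular densities implies exponential decay of \<open>E - c\<close> along the diffusion.

  For the functional inequality, the minimizer is first identified as its own Gibbs measure \<open>m_inf\<close>. The entropy relative to
  \<open>m_inf\<^sup>N\<close> is subadditive over coordinates, and each conditional law of a particle is compared by the log-Sobolev inequality
  with the Gibbs measure of the configuration in which that particle is moved to the barycenter of \<open>m_inf\<close>. The errors of order
  \<open>1/N\<close> are quadratic in the distance to the barycenter, hence controlled by entropy through Gaussian concentration; convexity
  of \<open>F\<close> makes the remaining terms nonnegative.\<close>

section \<open>Gaussian smoothing\<close>

text \<open>The obstacle is regularity. The drift is only Lipschitz, so the trapezoid rule for an
  increment of U errs by O(h) in a step of size h, as much as the dissipation. Mollified at variance
  sqrt h, the potential has a trapezoid error cubic in the increment at the price of a factor h powr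
  (-1/4): h powr (5/4) per step, which disappears in the sum over T / h steps. Hence the parameter k
  with h = k^4. The shift by the score is chosen so that Tweedie's formula evaluates the cross term
  and a positive multiple of the squared score is left. On the functional side, log-Sobolev can be
  applied to one particle given the others only if the reference law does not depend on that
  particle. The empirical measure does, so the particle is frozen, a Wasserstein distance |y_i -
  ctr| / N away. The squared error in the score is split off with weights \<rho> / \<rho>' and
  \<rho> / (\<rho> - \<rho>'), which is where \<rho>' enters; bounding the sum of |y_i - ctr|^2 by
  entropy gives both the loss C1 / N in the rate and the constant C2.\<close>

abbreviation edensity :: "'a measure \<Rightarrow> ('a \<Rightarrow> real) \<Rightarrow> 'a measure" where
  "edensity M f \<equiv> density M (\<lambda>x. ennreal (f x))"

lemma integrable_of_le:
  fixes f :: "'a \<Rightarrow> 'b::{banach, second_countable_topology}"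
  assumes "integrable M g" "f \<in> borel_measurable M" "\<And>x. norm (f x) \<le> (g x :: real)"
  shows "integrable M f"
  using assms(1,2) by (rule Bochner_Integration.integrable_bound) (use assms(3) in \<open>auto intro: order_trans[OF _ abs_ge_self]\<close>)

lemma integrable_growth:
  fixes q f :: "'a::euclidean_space \<Rightarrow> real"
  assumes q: "integrable M q" "integrable M (\<lambda>x. q x * (norm x)^2)" "\<And>x. 0 \<le> q x"
    and f: "f \<in> borel_measurable M" "\<And>x. \<bar>f x\<bar> \<le> C * (1 + (norm x)^2)"
  shows "integrable M (\<lambda>x. q x * f x)"
proof (rule integrable_of_le)
  show "integrable M (\<lambda>x. C * (q x + q x * (norm x)^2))" "(\<lambda>x. q x * f x) \<in> borel_measurable M" using q f(1) by auto
  show "norm (q x * f x) \<le> C * (q x + q x * (norm x)^2)" for x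
    using mult_left_mono[OF f(2) q(3), of x x] q(3)[of x] by (simp add: abs_mult algebra_simps)
qed

lemma abs_le_one_plus_square: "\<bar>x\<bar> \<le> 1 + x^2" for x :: real
proof -
  have "0 \<le> (\<bar>x\<bar> - 1)^2" by simp
  then show ?thesis by (simp add: power2_eq_square algebra_simps)
qed

text \<open>The normal density with covariance s times the identity. The product over
  \<open>Basis\<close> is literally the density that \<open>brownian_motion\<close> prescribes for
  increments, and it makes the kernel on a power space factor over particles;
  \<open>gauss_eq\<close> gives the radial form.\<close>

definition gauss :: "real \<Rightarrow> 'a::euclidean_space \<Rightarrow> real" where
  "gauss s z = (\<Prod>b\<in>Basis. normal_density 0 (sqrt s) (z \<bullet> b))"

lemma gauss_eq:
  assumes "s > 0"
  shows "gauss s (z::'a::euclidean_space) = (1 / sqrt (2 * pi * s)) ^ DIM('a) * exp (- (norm z)\<^sup>2 / (2 * s))"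
proof -
  have "gauss s z = (\<Prod>b\<in>(Basis::'a set). (1 / sqrt (2 * pi * s)) * exp (- (z \<bullet> b)\<^sup>2 / (2 * s)))"
    unfolding gauss_def normal_density_def using assms by simp
  also have "... = (1 / sqrt (2 * pi * s)) ^ DIM('a) * exp (\<Sum>b\<in>(Basis::'a set). - (z \<bullet> b)\<^sup>2 / (2 * s))"
    by (simp only: prod.distrib exp_sum finite_Basis prod_constant)
  also have "(\<Sum>b\<in>(Basis::'a set). - (z \<bullet> b)\<^sup>2 / (2 * s)) = - (norm z)\<^sup>2 / (2 * s)"
    unfolding power2_norm_eq_inner by (subst euclidean_inner) (simp add: power2_eq_square sum_divide_distrib sum_negf)
  finally show ?thesis .
qed

lemma gauss_pos: "s > 0 \<Longrightarrow> gauss s z > 0" by (simp add: gauss_eq)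

lemma gauss_nonneg: "s > 0 \<Longrightarrow> 0 \<le> gauss s z" by (rule less_imp_le[OF gauss_pos])

lemma gauss_measurable [measurable]: "gauss s \<in> borel_measurable borel" unfolding gauss_def[abs_def] by simp

lemma nn_integral_gauss:
  assumes "s > 0"
  shows "(\<integral>\<^sup>+z. ennreal (gauss s (z::'a::euclidean_space)) \<partial>lborel) = 1"
proof -
  have *: "(\<integral>\<^sup>+x. ennreal (normal_density 0 (sqrt s) x) \<partial>lborel) = 1"
    using assms by (subst nn_integral_eq_integral) auto
  have "(\<integral>\<^sup>+z. ennreal (gauss s (z::'a)) \<partial>lborel) = (\<integral>\<^sup>+z. (\<Prod>b\<in>Basis. ennreal (normal_density 0 (sqrt s) ((z::'a) \<bullet> b))) \<partial>lborel)"
    unfolding gauss_def by (simp add: prod_ennreal)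
  also have "... = 1" by (subst nn_integral_lborel_prod) (auto simp: *)
  finally show ?thesis .
qed

lemma integrable_gauss: "s > 0 \<Longrightarrow> integrable lborel (gauss s :: 'a::euclidean_space \<Rightarrow> real)"
  by (rule integrableI_nonneg) (auto simp: nn_integral_gauss gauss_nonneg)

lemma integral_gauss: "s > 0 \<Longrightarrow> (LBINT z. gauss s (z::'a::euclidean_space)) = 1"
  by (subst integral_eq_nn_integral) (auto simp: nn_integral_gauss gauss_nonneg)

lemma prob_space_gauss: "s > 0 \<Longrightarrow> prob_space (density lborel (\<lambda>z::'a::euclidean_space. ennreal (gauss s z)))"
  by (rule prob_spaceI) (simp add: emeasure_density nn_integral_gauss)

lemma nn_integral_lborel_isom:
  fixes t :: "'a::euclidean_space"
  assumes [measurable]: "f \<in> borel_measurable borel" and "\<bar>c\<bar> = 1"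
  shows "(\<integral>\<^sup>+x. f (t + c *\<^sub>R x) \<partial>lborel) = (\<integral>\<^sup>+x. f x \<partial>lborel)"
proof -
  have "c \<noteq> 0" using assms by auto
  have "(\<integral>\<^sup>+x. f x \<partial>lborel) = (\<integral>\<^sup>+x. f x \<partial>density (distr lborel borel (\<lambda>x. t + c *\<^sub>R x)) (\<lambda>_. \<bar>c\<bar>^DIM('a)))"
    using lborel_affine[OF \<open>c \<noteq> 0\<close>, of t] by simp
  also have "... = (\<integral>\<^sup>+x. f (t + c *\<^sub>R x) \<partial>lborel)"
    using assms(2) by (simp add: density_1 nn_integral_distr)
  finally show ?thesis by simp
qed

lemma lborel_distr_isom:
  fixes t :: "'a::euclidean_space"
  assumes "\<bar>c\<bar> = 1"
  shows "distr lborel borel (\<lambda>x. t + c *\<^sub>R x) = lborel"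
  using lborel_affine[of c t] assms by (auto simp: density_1)

lemma integral_lborel_isom:
  fixes t :: "'a::euclidean_space" and f :: "'a \<Rightarrow> 'b::{banach, second_countable_topology}"
  assumes [measurable]: "f \<in> borel_measurable borel" and "\<bar>c\<bar> = 1"
  shows "(LBINT x. f (t + c *\<^sub>R x)) = (LBINT x. f x)"
  by (subst (2) lborel_distr_isom[OF assms(2), of t, symmetric]) (simp add: integral_distr)

lemma gauss_uminus: "gauss s (- z) = gauss s z" by (simp add: gauss_def normal_density_def)

lemma nn_integral_gauss_shift:
  assumes "s > 0"
  shows "(\<integral>\<^sup>+z. ennreal (gauss s (z - u::'a::euclidean_space)) \<partial>lborel) = 1"
  using nn_integral_lborel_isom[of "\<lambda>z. ennreal (gauss s z)" 1 "- u"] nn_integral_gauss[OF assms, where 'a='a]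
  by simp

text \<open>Half of the exponent \<open>(norm z)^2 / (2 * s)\<close> cancels, which leaves the
  kernel of doubled variance; \<open>sqrt 2 ^ DIM('a)\<close> is the ratio of the two
  normalisations. The moment constants below and the exponential square moment under log-Sobolev
  come from this identity.\<close>

lemma exp_gauss:
  assumes "s > 0"
  shows "exp ((norm z)^2 / (4 * s)) * gauss s (z::'a::euclidean_space) = sqrt 2 ^ DIM('a) * gauss (2 * s) z"
proof -
  have sq: "sqrt (2 * pi * (2 * s)) = sqrt 2 * sqrt (2 * pi * s)" by (simp add: real_sqrt_mult[symmetric])
  have "sqrt 2 ^ DIM('a) * (1 / sqrt (2 * pi * (2 * s))) ^ DIM('a) = (1 / sqrt (2 * pi * s)) ^ DIM('a)"
    unfolding power_mult_distrib[symmetric] by (rule arg_cong[where f="\<lambda>x. x ^ DIM('a)"]) (subst sq, simp)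
  moreover have "(norm z)^2 / (4 * s) + - (norm z)\<^sup>2 / (2 * s) = - (norm z)\<^sup>2 / (2 * (2 * s))" by simp
  ultimately show ?thesis using assms by (simp add: gauss_eq exp_add[symmetric] mult.assoc[symmetric])
qed

lemma nn_integral_exp_gauss:
  assumes "s > 0"
  shows "(\<integral>\<^sup>+z. ennreal (exp ((norm z)^2 / (4 * s)) * gauss s (z::'a::euclidean_space)) \<partial>lborel) = sqrt 2 ^ DIM('a)"
  using assms by (simp add: ennreal_mult' nn_integral_gauss nn_integral_cmult exp_gauss[OF assms])

text \<open>Powers of the norm are dominated by multiples of
  \<open>exp ((norm z)^2 / (4 * s))\<close>. Only the orders s and s powr (3/2) matter later, so the
  constants are crude.\<close>

lemma gauss_moment:
  assumes "s > 0"
  shows "(\<integral>\<^sup>+z. ennreal ((norm z)^2 * gauss s (z::'a::euclidean_space)) \<partial>lborel) \<le> ennreal (4 * s * sqrt 2 ^ DIM('a))"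
    and "(\<integral>\<^sup>+z. ennreal ((norm z)^3 * gauss s (z::'a::euclidean_space)) \<partial>lborel)
      \<le> ennreal (24 * s * sqrt s * sqrt 2 ^ DIM('a))"
proof -
  have *: "(\<integral>\<^sup>+z. ennreal (f z * gauss s (z::'a)) \<partial>lborel) \<le> ennreal (C * sqrt 2 ^ DIM('a))"
    if f: "\<And>z. f z \<le> C * exp ((norm z)^2 / (4 * s))" and C: "C \<ge> 0" for f C
  proof -
    have "(\<integral>\<^sup>+z. ennreal (f z * gauss s (z::'a)) \<partial>lborel) \<le> (\<integral>\<^sup>+z. ennreal C * ennreal (exp ((norm z)^2 / (4 * s)) * gauss s (z::'a)) \<partial>lborel)"
      using mult_right_mono[OF f gauss_nonneg[OF assms]] C by (intro nn_integral_mono) (auto simp: ennreal_mult'[symmetric] mult.assoc intro!: ennreal_leI)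
    also have "... = ennreal C * ennreal (sqrt 2 ^ DIM('a))"
      using nn_integral_exp_gauss[OF assms, where 'a='a] by (subst nn_integral_cmult) auto
    finally show ?thesis using C by (simp add: ennreal_mult)
  qed
  have exp1: "u + 1 \<le> exp u" for u :: real using exp_ge_add_one_self[of u] by arith
  have "(norm z)^2 \<le> 4 * s * exp ((norm z)^2 / (4 * s))" for z :: 'a
    using exp1[of "(norm z)^2 / (4 * s)"] assms by (simp add: field_simps)
  from *[OF this] assms show "(\<integral>\<^sup>+z. ennreal ((norm z)^2 * gauss s (z::'a)) \<partial>lborel) \<le> ennreal (4 * s * sqrt 2 ^ DIM('a))"
    by simp
  have "(norm z)^3 \<le> 24 * s * sqrt s * exp ((norm z)^2 / (4 * s))" for z :: 'a
  proof -
    \<comment> \<open>24 is 8 times 3: the 8 comes from cubing \<open>2 * sqrt s\<close>, the 3 from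
      \<open>v^3 \<le> 1 + v^4 \<le> 3 * exp (v^2)\<close>.\<close>
    define v where "v = norm z / (2 * sqrt s)"
    have v: "v \<ge> 0" "norm z = 2 * sqrt s * v" using assms by (auto simp: v_def)
    have v2: "(norm z)^2 / (4 * s) = v^2" using assms by (simp add: v_def power_divide)
    have "v ^ 3 \<le> 1 + (v^2)^2"
    proof (cases "v \<le> 1")
      case True then have "v^3 \<le> 1" using v by (simp add: power_le_one)
      then show ?thesis by (smt (verit) zero_le_power2)
    next
      case False then have "v^3 \<le> v^4" by simp
      then show ?thesis by simp
    qed
    also have "... \<le> 3 * exp (v^2)"
      using exp_lower_Taylor_quadratic[of "v^2"] exp1[of "v^2"] zero_le_power2[of v] by arith
    finally have "8 * (s * sqrt s) * v^3 \<le> 8 * (s * sqrt s) * (3 * exp (v^2))"  using assms by simp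
    moreover have "(norm z)^3 = 8 * (s * sqrt s) * v^3" unfolding v(2) using assms by (simp add: power3_eq_cube)
    ultimately show ?thesis unfolding v2 by simp
  qed
  from *[OF this] assms show "(\<integral>\<^sup>+z. ennreal ((norm z)^3 * gauss s (z::'a)) \<partial>lborel)
      \<le> ennreal (24 * s * sqrt s * sqrt 2 ^ DIM('a))" by simp
qed

text \<open>Completing the square: an exponential tilt by u moves the centre to
  \<open>s *\<^sub>R u\<close> and leaves the exponential moment as prefactor.\<close>

lemma exp_inner_gauss:
  assumes "s > 0"
  shows "exp (u \<bullet> z) * gauss s (z::'a::euclidean_space) = exp (s * (norm u)^2 / 2) * gauss s (z - s *\<^sub>R u)"
proof -
  have "(norm (z - s *\<^sub>R u))^2 = (norm z)^2 - 2 * s * (u \<bullet> z) + s^2 * (norm u)^2"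
    unfolding power2_norm_eq_inner by (simp add: inner_commute power2_eq_square algebra_simps)
  then have "u \<bullet> z + - (norm z)\<^sup>2 / (2 * s) = s * (norm u)^2 / 2 + - (norm (z - s *\<^sub>R u))\<^sup>2 / (2 * s)"
    using assms by (simp add: field_simps power2_eq_square)
  then have "exp (u \<bullet> z) * exp (- (norm z)\<^sup>2 / (2 * s)) = exp (s * (norm u)^2 / 2) * exp (- (norm (z - s *\<^sub>R u))\<^sup>2 / (2 * s))"
    by (metis exp_add)
  then show ?thesis using assms by (simp add: gauss_eq)
qed

lemma nn_integral_exp_inner_gauss:
  assumes "s > 0"
  shows "(\<integral>\<^sup>+z. ennreal (exp (u \<bullet> z) * gauss s (z::'a::euclidean_space)) \<partial>lborel) = exp (s * (norm u)^2 / 2)"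
  unfolding exp_inner_gauss[OF assms] using nn_integral_gauss_shift[OF assms, of "s *\<^sub>R u"]
  by (simp add: ennreal_mult' nn_integral_cmult)

lemma gauss_shift_eq:
  assumes "s > 0"
  shows "gauss s (z - u) = exp ((1 / s) *\<^sub>R u \<bullet> z - (norm u)^2 / (2 * s)) * gauss s (z::'a::euclidean_space)"
proof -
  have "s * (norm ((1 / s) *\<^sub>R u))^2 / 2 = (norm u)^2 / (2 * s)" by (simp add: power2_eq_square)
  moreover have "s *\<^sub>R (1 / s) *\<^sub>R u = u" using assms by simp
  ultimately have "exp ((1 / s) *\<^sub>R u \<bullet> z) * gauss s z = exp ((norm u)^2 / (2 * s)) * gauss s (z - u)"
    using exp_inner_gauss[OF assms, of "(1 / s) *\<^sub>R u" z] by simp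
  then show ?thesis by (simp only: exp_diff) simp
qed

lemma (in prob_space) integrable_norm_of_square:
  fixes X :: "'a \<Rightarrow> 'b::euclidean_space"
  assumes [measurable]: "X \<in> borel_measurable M" and i: "integrable M (\<lambda>x. (norm (X x))^2)"
  shows "integrable M (\<lambda>x. norm (X x))" "integrable M X"
proof -
  show *: "integrable M (\<lambda>x. norm (X x))"
    by (rule integrable_of_le[OF Bochner_Integration.integrable_add[OF integrable_const[of 1] i]])
       (use abs_le_one_plus_square[of "norm (X _)"] in auto)
  then show "integrable M X" by (simp add: integrable_norm_iff)
qed

lemma (in prob_space) expectation_square_le:
  fixes X :: "'a \<Rightarrow> real"
  assumes [measurable]: "X \<in> borel_measurable M" and i: "integrable M (\<lambda>x. (X x)^2)"
  shows "(expectation X)^2 \<le> expectation (\<lambda>x. (X x)^2)"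
  using integrable_norm_of_square(2)[of X] i variance_positive[of X] by (simp add: variance_eq)

text \<open>The chi-square divergence of the shifted from the centred kernel is
  \<open>exp w - 1\<close> with \<open>w = (norm u)^2 / s\<close>. By Jensen its root bounds the L1
  distance, and the root is at most \<open>2 * sqrt w\<close> for \<open>w \<le> 1\<close>; for
  larger w the trivial bound 2 suffices.\<close>

lemma gauss_shift_L1:
  assumes s: "s > 0"
  shows "(LBINT z. \<bar>gauss s (z - u) - gauss s z\<bar>) \<le> 2 * norm (u::'a::euclidean_space) / sqrt s"
proof -
  let ?A = "LBINT z. \<bar>gauss s (z - u) - gauss s z\<bar>"
  let ?B = "(2 / s) *\<^sub>R u"
  let ?C = "(1 / s) *\<^sub>R u"
  let ?M = "density lborel (\<lambda>z::'a. ennreal (gauss s z))"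
  interpret prob_space ?M by (rule prob_space_gauss[OF s])
  define r where "r z = exp ((1 / s) *\<^sub>R u \<bullet> z - (norm u)^2 / (2 * s)) - 1" for z
  define w where "w = (norm u)^2 / s"
  have w0: "w \<ge> 0" using s by (simp add: w_def)
  have [measurable]: "r \<in> borel_measurable borel" unfolding r_def by simp
  have gi: "integrable lborel (\<lambda>z. gauss s (z - u))"
    by (rule integrableI_nonneg) (auto simp: nn_integral_gauss_shift s gauss_nonneg)
  have ig: "(LBINT z. gauss s (z - u)) = 1"
    by (subst integral_eq_nn_integral) (auto simp: nn_integral_gauss_shift s gauss_nonneg)
  have eq: "gauss s (z - u) - gauss s z = r z * gauss s z" for z
    unfolding r_def gauss_shift_eq[OF s] by (simp add: algebra_simps)
  have L: "?A = (\<integral>z. \<bar>r z\<bar> \<partial>?M)"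
    using s by (subst integral_density) (auto simp: eq abs_mult gauss_nonneg mult.commute)
  have le2: "?A \<le> 2"
  proof -
    have "?A \<le> (LBINT z. gauss s (z - u) + gauss s z)"
      using s by (intro integral_mono Bochner_Integration.integrable_abs Bochner_Integration.integrable_diff Bochner_Integration.integrable_add gi integrable_gauss)
         (smt (verit) gauss_pos)+
    also have "... = 2" using s by (subst Bochner_Integration.integral_add) (auto simp: gi integrable_gauss ig integral_gauss)
    finally show ?thesis .
  qed
  have e: "has_bochner_integral ?M (\<lambda>z. exp (v \<bullet> z)) (exp (s * (norm v)^2 / 2))" for v
  proof (rule has_bochner_integral_nn_integral)
    show "(\<integral>\<^sup>+z. ennreal (exp (v \<bullet> z)) \<partial>?M) = ennreal (exp (s * (norm v)^2 / 2))"
      unfolding nn_integral_exp_inner_gauss[OF s, symmetric] using s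
      by (subst nn_integral_density) (auto simp: ennreal_mult'[symmetric] gauss_nonneg mult.commute)
  qed auto
  have e1: "has_bochner_integral ?M (\<lambda>z. exp (?C \<bullet> z)) (exp (w / 2))" using e[of ?C] s by (simp add: w_def power2_eq_square mult.commute)
  have e2: "has_bochner_integral ?M (\<lambda>z. exp (?B \<bullet> z)) (exp (2 * w))" using e[of ?B] s by (simp add: w_def power2_eq_square)
  have r2: "(r z)^2 = exp (- w) * exp (?B \<bullet> z) - 2 * (exp (- w / 2) * exp (?C \<bullet> z)) + 1" for z
    by (simp add: exp_add[symmetric] power2_eq_square algebra_simps r_def w_def)
  have "has_bochner_integral ?M (\<lambda>z. (r z)^2) (exp (- w) * exp (2 * w) - 2 * (exp (- w / 2) * exp (w / 2)) + 1)"
    unfolding r2 using e1 e2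
    by (intro has_bochner_integral_add) (use prob_space in \<open>auto simp: has_bochner_integral_iff\<close>)
  also have "exp (- w) * exp (2 * w) - 2 * (exp (- w / 2) * exp (w / 2)) + 1 = exp w - 1" by (simp add: exp_add[symmetric])
  finally have hr: "has_bochner_integral ?M (\<lambda>z. (r z)^2) (exp w - 1)" .
  have jens: "(\<integral>z. \<bar>r z\<bar> \<partial>?M)^2 \<le> exp w - 1"
    using expectation_square_le[of "\<lambda>z. \<bar>r z\<bar>"] hr by (simp add: has_bochner_integral_iff)
  have sq: "sqrt w = norm u / sqrt s" by (simp add: w_def real_sqrt_divide)
  show ?thesis
  proof (cases "w \<le> 1")
    case True
    have "exp w \<le> 1 + w + w^2" using exp_bound[OF w0 True] by simp
    also have "... \<le> 1 + 2 * w" using True w0 by (simp add: power2_eq_square mult_left_le)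
    finally have "(\<integral>z. \<bar>r z\<bar> \<partial>?M)^2 \<le> (2 * sqrt w)^2" using jens w0 by simp
    then have "(\<integral>z. \<bar>r z\<bar> \<partial>?M) \<le> 2 * sqrt w" by (rule power2_le_imp_le) (use w0 in auto)
    then show ?thesis unfolding L sq by simp
  next
    case False
    then have "1 \<le> sqrt w" by simp
    then show ?thesis using le2 unfolding sq by simp
  qed
qed

definition gaussM :: "real \<Rightarrow> 'a::euclidean_space measure" where
  "gaussM s = edensity lborel (gauss s)"

lemma sets_gaussM [simp, measurable_cong]: "sets (gaussM s) = sets borel"
  and space_gaussM [simp]: "space (gaussM s) = UNIV" by (simp_all add: gaussM_def)

lemma prob_space_gaussM: "s > 0 \<Longrightarrow> prob_space (gaussM s)" unfolding gaussM_def by (rule prob_space_gauss)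

lemma nn_integral_gaussM:
  assumes [measurable]: "f \<in> borel_measurable borel"
  shows "(\<integral>\<^sup>+z. f z \<partial>gaussM s) = (\<integral>\<^sup>+z. ennreal (gauss s z) * f z \<partial>lborel)"
  unfolding gaussM_def by (simp add: nn_integral_density)

lemma integral_gaussM:
  fixes f :: "'a::euclidean_space \<Rightarrow> 'b::{banach, second_countable_topology}"
  assumes [measurable]: "f \<in> borel_measurable borel" and "s > 0"
  shows "(\<integral>z. f z \<partial>gaussM s) = (LBINT z. gauss s z *\<^sub>R f z)"
  unfolding gaussM_def using assms(2) by (subst integral_density) (auto simp: gauss_nonneg)

text \<open>A common constant for the second and third Gaussian moments, 24 being the larger of the
  two factors. What matters is that it depends on the dimension alone.\<close>

definition gc :: "'a::euclidean_space itself \<Rightarrow> real" where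
  "gc _ = 24 * sqrt 2 ^ DIM('a)"

lemma gc_pos: "gc TYPE('a::euclidean_space) > 0" by (simp add: gc_def)

lemma gaussM_moment2:
  assumes "s > 0"
  shows "integrable (gaussM s) (\<lambda>z::'a::euclidean_space. (norm z)^2)"
    and "(\<integral>z. (norm (z::'a))^2 \<partial>gaussM s) \<le> gc TYPE('a) * s"
proof -
  let ?A = "\<integral>\<^sup>+z. ennreal ((norm (z::'a))^2) \<partial>gaussM s"
  have "?A = (\<integral>\<^sup>+z. ennreal ((norm z)^2 * gauss s (z::'a)) \<partial>lborel)"
    using assms by (subst nn_integral_gaussM) (auto simp: ennreal_mult'[symmetric] gauss_nonneg mult.commute)
  also have "... \<le> ennreal (4 * s * sqrt 2 ^ DIM('a))" by (rule gauss_moment[OF assms])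
  also have "... \<le> ennreal (gc TYPE('a) * s)" using assms by (intro ennreal_leI) (auto simp: gc_def)
  finally have *: "?A \<le> ennreal (gc TYPE('a) * s)" .
  show i: "integrable (gaussM s) (\<lambda>z::'a. (norm z)^2)"
    using * by (intro integrableI_nonneg) (auto simp: le_less_trans)
  show "(\<integral>z. (norm (z::'a))^2 \<partial>gaussM s) \<le> gc TYPE('a) * s"
    using * assms gc_pos[where 'a='a] i by (subst (asm) nn_integral_eq_integral) auto
qed

lemma gaussM_moment3:
  assumes "s > 0"
  shows "integrable (gaussM s) (\<lambda>z::'a::euclidean_space. (norm z)^3)"
    and "(\<integral>z. (norm (z::'a))^3 \<partial>gaussM s) \<le> gc TYPE('a) * s * sqrt s"
proof -
  let ?A = "\<integral>\<^sup>+z. ennreal ((norm (z::'a))^3) \<partial>gaussM s"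
  have "?A = (\<integral>\<^sup>+z. ennreal ((norm z)^3 * gauss s (z::'a)) \<partial>lborel)"
    using assms by (subst nn_integral_gaussM) (auto simp: ennreal_mult'[symmetric] gauss_nonneg mult.commute)
  also have "... \<le> ennreal (24 * s * sqrt s * sqrt 2 ^ DIM('a))" by (rule gauss_moment[OF assms])
  also have "... = ennreal (gc TYPE('a) * s * sqrt s)" by (simp add: gc_def mult_ac)
  finally have *: "?A \<le> ennreal (gc TYPE('a) * s * sqrt s)" .
  show i: "integrable (gaussM s) (\<lambda>z::'a. (norm z)^3)"
    using * by (intro integrableI_nonneg) (auto simp: le_less_trans)
  show "(\<integral>z. (norm (z::'a))^3 \<partial>gaussM s) \<le> gc TYPE('a) * s * sqrt s"
    using * assms gc_pos[where 'a='a] i by (subst (asm) nn_integral_eq_integral) auto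
qed

lemma gaussM_norm_le:
  assumes "s > 0"
  shows "(\<integral>z. norm (z::'a::euclidean_space) \<partial>gaussM s) \<le> sqrt (gc TYPE('a) * s)"
proof -
  interpret prob_space "gaussM s :: 'a measure" by (rule prob_space_gaussM[OF assms])
  show ?thesis using expectation_square_le[of norm] gaussM_moment2[OF assms, where 'a='a] by (simp add: real_le_rsqrt)
qed

lemma gaussM_mean_zero:
  assumes "s > 0"
  shows "(\<integral>z. v \<bullet> (z::'a::euclidean_space) \<partial>gaussM s) = 0"
proof -
  let ?A = "LBINT z. gauss s z * (v \<bullet> z)"
  have "(\<integral>z. v \<bullet> (z::'a) \<partial>gaussM s) = ?A" using assms by (subst integral_gaussM) auto
  also have "... = (LBINT z. gauss s (0 + (-1) *\<^sub>R z) * (v \<bullet> (0 + (-1) *\<^sub>R z)))"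
    by (subst integral_lborel_isom) auto
  also have "... = - ?A" by (simp add: gauss_uminus)
  also have "?A = (\<integral>z. v \<bullet> (z::'a) \<partial>gaussM s)" using assms by (subst integral_gaussM) auto
  finally show ?thesis by simp
qed

section \<open>Potentials with Lipschitz gradient and their mollification\<close>

lemma GDERIV_of_quadratic_bound:
  fixes f :: "'a::real_inner \<Rightarrow> real"
  assumes "\<And>y. \<bar>f y - f x - g \<bullet> (y - x)\<bar> \<le> C * (norm (y - x))^2"
  shows "GDERIV f x :> g" unfolding gderiv_def has_derivative_iff_norm
proof
  show "bounded_linear (\<lambda>h. h \<bullet> g)" by auto
  have "((\<lambda>y. C * norm (y - x)) \<longlongrightarrow> C * norm (x - x)) (at x)" by (intro tendsto_intros)
  then have l: "((\<lambda>y. C * norm (y - x)) \<longlongrightarrow> 0) (at x)" by simp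
  have "norm (norm (f y - f x - (y - x) \<bullet> g) / norm (y - x)) \<le> C * norm (y - x)" if "y \<noteq> x" for y
    using assms[of y] by (simp add: divide_simps inner_commute power2_eq_square)
  then show "((\<lambda>y. norm (f y - f x - (y - x) \<bullet> g) / norm (y - x)) \<longlongrightarrow> 0) (at x)"
    by (intro Lim_null_comparison[OF _ l]) (auto simp: eventually_at_filter)
qed

text \<open>A differentiable U whose gradient b is L-Lipschitz, stated by inequalities without
  derivatives. Both pass to averages over translates with the same L, so the mollifications satisfy
  them too, and differentiability is recovered by \<open>GDERIV_of_quadratic_bound\<close>.\<close>

locale potential =
  fixes U :: "'a::euclidean_space \<Rightarrow> real" and b :: "'a \<Rightarrow> 'a" and L :: real
  assumes U_quad: "\<bar>U y - U x - b x \<bullet> (y - x)\<bar> \<le> L * (norm (y - x))^2"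
    and b_lip: "norm (b y - b x) \<le> L * norm (y - x)"
begin

lemma L_nonneg: "L \<ge> 0"
proof -
  obtain e :: 'a where "e \<in> Basis" by force
  have "0 \<le> L * norm (e - 0)" using b_lip[of e 0] by (meson norm_ge_zero order_trans)
  then show ?thesis using \<open>e \<in> Basis\<close> by simp
qed

lemma b_continuous: "continuous_on A b"
proof (rule continuous_on_subset[OF _ subset_UNIV])
  have "L-lipschitz_on UNIV b" by (rule lipschitz_onI) (use b_lip L_nonneg in \<open>auto simp: dist_norm\<close>)
  then show "continuous_on UNIV b" by (rule lipschitz_on_continuous_on)
qed

lemma b_measurable [measurable]: "b \<in> borel_measurable borel" by (intro borel_measurable_continuous_onI b_continuous)

lemma U_GDERIV: "GDERIV U x :> b x" by (rule GDERIV_of_quadratic_bound) (rule U_quad)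

lemma U_continuous: "continuous_on A U"
  using U_GDERIV by (meson continuous_at_imp_continuous_on gderiv_def has_derivative_continuous)

lemma U_measurable [measurable]: "U \<in> borel_measurable borel" by (intro borel_measurable_continuous_onI U_continuous)

lemma b_growth: "norm (b x) \<le> norm (b 0) + L * norm x" using b_lip[of x 0] norm_triangle_ineq2[of "b x" "b 0"] by simp

lemma U_growth: "\<bar>U x\<bar> \<le> (\<bar>U 0\<bar> + norm (b 0) + L) * (1 + (norm x)^2)"
proof -
  have "\<bar>U x\<bar> \<le> \<bar>U 0\<bar> + \<bar>b 0 \<bullet> x\<bar> + L * (norm x)^2" using U_quad[of x 0] by simp
  also have "\<bar>b 0 \<bullet> x\<bar> \<le> norm (b 0) * norm x" by (rule Cauchy_Schwarz_ineq2)
  also have "... \<le> norm (b 0) * (1 + (norm x)^2)"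
    using abs_le_one_plus_square[of "norm x"] by (intro mult_left_mono) auto
  finally show ?thesis using L_nonneg by (simp add: algebra_simps) (smt (verit) mult_nonneg_nonneg zero_le_power2)
qed

definition Um :: "real \<Rightarrow> 'a \<Rightarrow> real" where
  "Um s x = (\<integral>z. U (x + z) \<partial>gaussM s)"

definition bm :: "real \<Rightarrow> 'a \<Rightarrow> 'a" where
  "bm s x = (\<integral>z. b (x + z) \<partial>gaussM s)"

context
  fixes s :: real
  assumes s: "s > 0"
begin

interpretation G: prob_space "gaussM s :: 'a measure" by (rule prob_space_gaussM[OF s])

lemma norm_int_gaussM: "integrable (gaussM s) (\<lambda>z::'a. norm z)"
  using G.integrable_norm_of_square(1)[of "\<lambda>z. z"] gaussM_moment2(1)[OF s] by simp

lemma U_shift_integrable: "integrable (gaussM s) (\<lambda>z. U (x + z))"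
proof -
  let ?C = "\<bar>U 0\<bar> + norm (b 0) + L"
  have "\<bar>U (x + z)\<bar> \<le> ?C * (1 + 2 * (norm x)^2) + ?C * (2 * (norm z)^2)" for z
  proof -
    have "(norm (x + z))^2 \<le> (norm x + norm z)^2" by (intro power_mono norm_triangle_ineq) auto
    also have "... \<le> 2 * (norm x)^2 + 2 * (norm z)^2"
      using zero_le_power2[of "norm x - norm z"] by (simp add: power2_eq_square algebra_simps)
    finally have "?C * (1 + (norm (x + z))^2) \<le> ?C * (1 + (2 * (norm x)^2 + 2 * (norm z)^2))"
      using L_nonneg by (intro mult_left_mono) auto
    with U_growth[of "x + z"] show ?thesis by (simp add: algebra_simps)
  qed
  then show ?thesis
    by (intro Bochner_Integration.integrable_bound[where f="\<lambda>z. ?C * (1 + 2 * (norm x)^2) + ?C * (2 * (norm z)^2)" and g="\<lambda>z. U (x + z)"])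
       (use gaussM_moment2(1)[OF s] in \<open>auto intro!: AE_I2 Bochner_Integration.integrable_add\<close>,
         smt (verit, best))
qed

lemma b_shift_integrable: "integrable (gaussM s) (\<lambda>z. b (x + z))"
proof (rule integrable_of_le[where g="\<lambda>z. norm (b x) + L * norm z"])
  show "norm (b (x + z)) \<le> norm (b x) + L * norm z" for z
    using b_lip[of "x + z" x] norm_triangle_ineq2[of "b (x + z)" "b x"] by simp
qed (use norm_int_gaussM in auto)

lemma Um_quad: "\<bar>Um s y - Um s x - bm s x \<bullet> (y - x)\<bar> \<le> L * (norm (y - x))^2"
proof -
  have i: "integrable (gaussM s) (\<lambda>z. U (y + z) - U (x + z) - b (x + z) \<bullet> (y - x))"
    using U_shift_integrable b_shift_integrable by auto
  have "Um s y - Um s x - bm s x \<bullet> (y - x) = (\<integral>z. U (y + z) - U (x + z) - b (x + z) \<bullet> (y - x) \<partial>gaussM s)"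
    unfolding Um_def bm_def using U_shift_integrable b_shift_integrable by simp
  moreover have "\<bar>\<integral>z. U (y + z) - U (x + z) - b (x + z) \<bullet> (y - x) \<partial>gaussM s\<bar> \<le> (\<integral>z. \<bar>U (y + z) - U (x + z) - b (x + z) \<bullet> (y - x)\<bar> \<partial>gaussM s)"
    by simp
  moreover have "... \<le> L * (norm (y - x))^2"
    using i U_quad[of "y + z" "x + z" for z] by (intro G.integral_le_const) simp_all
  ultimately show ?thesis by arith
qed

lemma bm_lip: "norm (bm s y - bm s x) \<le> L * norm (y - x)"
proof -
  have e: "bm s y - bm s x = (\<integral>z. b (y + z) - b (x + z) \<partial>gaussM s)"
    unfolding bm_def using b_shift_integrable by simp
  have "norm (\<integral>z. b (y + z) - b (x + z) \<partial>gaussM s) \<le> (\<integral>z. norm (b (y + z) - b (x + z)) \<partial>gaussM s)"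
    by simp
  also have "... \<le> L * norm (y - x)"
    using b_shift_integrable b_lip[of "y + z" "x + z" for z] by (intro G.integral_le_const) simp_all
  finally show ?thesis unfolding e .
qed

lemma bm_close: "norm (bm s x - b x) \<le> L * sqrt (gc TYPE('a) * s)"
proof -
  have e: "bm s x - b x = (\<integral>z. b (x + z) - b x \<partial>gaussM s)"
    unfolding bm_def using b_shift_integrable G.prob_space by simp
  have "norm (\<integral>z. b (x + z) - b x \<partial>gaussM s) \<le> (\<integral>z. norm (b (x + z) - b x) \<partial>gaussM s)"
    by simp
  also have "... \<le> (\<integral>z. L * norm (z::'a) \<partial>gaussM s)"
    using b_shift_integrable[of x] b_lip[of "x + _" x] norm_int_gaussM by (intro integral_mono) auto
  also have "... \<le> L * sqrt (gc TYPE('a) * s)"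
    using gaussM_norm_le[OF s, where 'a='a] L_nonneg by (simp add: mult_left_mono)
  finally show ?thesis unfolding e .
qed

text \<open>The linear Taylor term averages to zero by symmetry of the kernel, so the error has
  order s and not sqrt s.\<close>

lemma Um_close: "\<bar>Um s x - U x\<bar> \<le> L * (gc TYPE('a) * s)"
proof -
  let ?A = "\<integral>z. U (x + z) - U x - b x \<bullet> z \<partial>gaussM s"
  have iz: "integrable (gaussM s) (\<lambda>z::'a. b x \<bullet> z)"
    using G.integrable_norm_of_square(2)[of "\<lambda>z. z"] gaussM_moment2(1)[OF s, where 'a='a] by auto
  have "Um s x - U x = (\<integral>z. U (x + z) - U x \<partial>gaussM s)"
    unfolding Um_def using U_shift_integrable G.prob_space by simp
  also have "... = ?A" using U_shift_integrable[of x] iz gaussM_mean_zero[OF s, of "b x"] by simp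
  finally have e: "Um s x - U x = ?A" .
  have "\<bar>\<integral>z. U (x + z) - U x - b x \<bullet> z \<partial>gaussM s\<bar> \<le> (\<integral>z. \<bar>U (x + z) - U x - b x \<bullet> z\<bar> \<partial>gaussM s)"
    by simp
  also have "... \<le> (\<integral>z. L * (norm (z::'a))^2 \<partial>gaussM s)"
    using U_shift_integrable[of x] iz U_quad[of "x + _" x] gaussM_moment2(1)[OF s, where 'a='a] by (intro integral_mono) auto
  also have "... \<le> L * (gc TYPE('a) * s)"
    using gaussM_moment2(2)[OF s, where 'a='a] L_nonneg by (simp add: mult_left_mono)
  finally show ?thesis unfolding e .
qed

lemma Um_GDERIV: "GDERIV (Um s) x :> bm s x" by (rule GDERIV_of_quadratic_bound) (rule Um_quad)

text \<open>b need not be differentiable, so the translation by u is moved onto the kernel: the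
  second difference is the integral of a first difference of b, at most \<open>L * norm w\<close>,
  against \<open>gauss s (z - u) - gauss s z\<close>. The L1 bound for the shift then costs
  \<open>1 / sqrt s\<close>.\<close>

lemma bm_second_difference:
  "norm ((bm s (x + w + u) - bm s (x + u)) - (bm s (x + w) - bm s x)) \<le> 2 * L * norm w * norm u / sqrt s"
proof -
  define D where "D z = b (x + w + z) - b (x + z)" for z
  have [measurable]: "D \<in> borel_measurable borel" unfolding D_def by simp
  have Db: "norm (D z) \<le> L * norm w" for z using b_lip[of "x + w + z" "x + z"] by (simp add: D_def)
  have gs: "integrable lborel (\<lambda>z. gauss s (z - u))"
    by (rule integrableI_nonneg) (auto simp: nn_integral_gauss_shift s gauss_nonneg)
  have i1: "integrable lborel (\<lambda>z. gauss s (z - u) *\<^sub>R D z)"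
    by (rule integrable_of_le[OF integrable_mult_left[OF gs, of "L * norm w"]]) (use Db in \<open>auto intro!: mult_mono simp: gauss_nonneg[OF s] abs_mult\<close>)
  have i2: "integrable lborel (\<lambda>z. gauss s z *\<^sub>R D z)"
    by (rule integrable_of_le[OF integrable_mult_left[OF integrable_gauss[OF s], of "L * norm w"]]) (use Db in \<open>auto intro!: mult_mono simp: gauss_nonneg[OF s] abs_mult\<close>)
  have "bm s (x + w + u) - bm s (x + u) = (\<integral>z. b (x + w + u + z) - b (x + u + z) \<partial>gaussM s)"
    unfolding bm_def using b_shift_integrable by simp
  also have "... = (LBINT z. gauss s (u + 1 *\<^sub>R z - u) *\<^sub>R D (u + 1 *\<^sub>R z))"
    by (simp add: D_def add_ac s integral_gaussM)
  also have "... = (LBINT z. gauss s (z - u) *\<^sub>R D z)" by (rule integral_lborel_isom) auto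
  finally have e1: "bm s (x + w + u) - bm s (x + u) = (LBINT z. gauss s (z - u) *\<^sub>R D z)" .
  have "bm s (x + w) - bm s x = (\<integral>z. D z \<partial>gaussM s)"
    unfolding bm_def D_def using b_shift_integrable by simp
  also have "... = (LBINT z. gauss s z *\<^sub>R D z)" by (rule integral_gaussM) (use s in auto)
  finally have e2: "bm s (x + w) - bm s x = (LBINT z. gauss s z *\<^sub>R D z)" .
  have "norm ((bm s (x + w + u) - bm s (x + u)) - (bm s (x + w) - bm s x))
    = norm (LBINT z. (gauss s (z - u) - gauss s z) *\<^sub>R D z)"
    unfolding e1 e2 using i1 i2 by (simp add: scaleR_diff_left)
  also have "... \<le> (LBINT z. norm ((gauss s (z - u) - gauss s z) *\<^sub>R D z))" by (rule integral_norm_bound)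
  also have "... \<le> (LBINT z. \<bar>gauss s (z - u) - gauss s z\<bar> * (L * norm w))"
  proof (rule integral_mono)
    show "integrable lborel (\<lambda>z. norm ((gauss s (z - u) - gauss s z) *\<^sub>R D z))"
      using i1 i2 by (auto simp: scaleR_diff_left)
    show "integrable lborel (\<lambda>z. \<bar>gauss s (z - u) - gauss s z\<bar> * (L * norm w))"
      using gs integrable_gauss[OF s, where 'a='a] by auto
  qed (use Db in \<open>auto intro!: mult_left_mono\<close>)
  also have "... \<le> (2 * norm u / sqrt s) * (L * norm w)"
    using mult_right_mono[OF gauss_shift_L1[OF s, of u], of "L * norm w"] L_nonneg by simp
  finally show ?thesis by (simp add: mult_ac)
qed

text \<open>The mean value theorem for \<open>g rr - g (1 - rr)\<close> on [1/2, 1] produces the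
  gradient at two points symmetric about the midpoint. Compared with its values at the ends, this is
  a second difference of \<open>bm s\<close>, hence quadratic in the displacement with factor
  \<open>1 / sqrt s\<close>; one more power comes from the inner product.\<close>

lemma trapezoid_cubic:
  "\<bar>Um s y - Um s x - (1/2) * ((bm s x + bm s y) \<bullet> (y - x))\<bar> \<le> L * (norm (y - x))^3 / sqrt s"
proof -
  let ?A = "\<lambda>\<xi> v. (bm s (x + (1 - \<xi>) *\<^sub>R v + \<xi> *\<^sub>R v) - bm s (x + \<xi> *\<^sub>R v)) - (bm s (x + (1 - \<xi>) *\<^sub>R v) - bm s x)"
  define v where "v = y - x"
  define g where "g rr = Um s (x + rr *\<^sub>R v)" for rr
  define f where "f rr = bm s (x + rr *\<^sub>R v) \<bullet> v" for rr
  have g': "(g has_real_derivative f rr) (at rr)" for rr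
  proof -
    have "GDERIV g rr :> f rr"
    proof (rule GDERIV_of_quadratic_bound)
      fix \<mu> show "\<bar>g \<mu> - g rr - f rr \<bullet> (\<mu> - rr)\<bar> \<le> L * (norm v)^2 * (norm (\<mu> - rr))^2"
        using Um_quad[of "x + \<mu> *\<^sub>R v" "x + rr *\<^sub>R v"]
        by (simp add: g_def f_def scaleR_diff_left[symmetric] power_mult_distrib mult_ac)
    qed
    then show ?thesis by simp
  qed
  define k where "k rr = g rr - g (1 - rr)" for rr
  have k': "(k has_real_derivative (f rr + f (1 - rr))) (at rr)" for rr
  proof -
    have "((\<lambda>rr. g rr - g (1 - rr)) has_real_derivative f rr - f (1 - rr) * (0 - 1)) (at rr)"
      by (auto intro!: derivative_eq_intros DERIV_chain2[OF g'])
    then show ?thesis by (simp add: k_def[abs_def])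
  qed
  obtain \<xi> where \<xi>: "1/2 < \<xi>" "\<xi> < 1" "k 1 - k (1/2) = (1 - 1/2) * (f \<xi> + f (1 - \<xi>))"
    using MVT2[of "1/2" 1 k "\<lambda>rr. f rr + f (1 - rr)"] k' by auto
  have "f \<xi> + f (1 - \<xi>) - (f 0 + f 1) = - ((?A \<xi> v) \<bullet> v)" by (simp add: f_def inner_diff_left add.assoc)
  also have "\<bar>...\<bar> \<le> norm (?A \<xi> v) * norm v" unfolding abs_minus_cancel by (rule Cauchy_Schwarz_ineq2)
  also have "... \<le> (2 * L * norm ((1 - \<xi>) *\<^sub>R v) * norm (\<xi> *\<^sub>R v) / sqrt s) * norm v"
    by (intro mult_right_mono bm_second_difference) auto
  also have "... = (2 * L * (norm v)^3 / sqrt s) * ((1 - \<xi>) * \<xi>)" using \<xi> by (simp add: power3_eq_cube)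
  also have "... \<le> (2 * L * (norm v)^3 / sqrt s) * 1" using \<xi> L_nonneg s by (intro mult_left_mono mult_le_one) auto
  finally have B: "\<bar>f \<xi> + f (1 - \<xi>) - (f 0 + f 1)\<bar> \<le> 2 * (L * (norm v)^3 / sqrt s)" by simp
  show ?thesis using \<xi>(3) B by (simp add: k_def g_def f_def v_def inner_add_left field_simps)
qed

text \<open>Free of \<open>1 / sqrt s\<close>: it serves for displacements caused mainly by the
  drift, for which only second moments are available and a cubic bound could not be
  integrated.\<close>

lemma trapezoid_quadratic:
  "\<bar>Um s y - Um s x - (1/2) * ((bm s x + bm s y) \<bullet> (y - x))\<bar> \<le> 2 * L * (norm (y - x))^2"
proof -
  have "\<bar>(bm s y - bm s x) \<bullet> (y - x)\<bar> \<le> L * norm (y - x) * norm (y - x)"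
    by (rule order_trans[OF Cauchy_Schwarz_ineq2]) (intro mult_right_mono bm_lip norm_ge_zero)
  then have "\<bar>(bm s y - bm s x) \<bullet> (y - x)\<bar> \<le> L * (norm (y - x))^2" by (simp add: power2_eq_square)
  moreover have "Um s y - Um s x - (1/2) * ((bm s x + bm s y) \<bullet> (y - x))
    = (Um s y - Um s x - bm s x \<bullet> (y - x)) - (1/2) * ((bm s y - bm s x) \<bullet> (y - x))"
    by (simp add: algebra_simps)
  moreover have "L * (norm (y - x))^2 \<ge> 0" using L_nonneg by simp
  ultimately show ?thesis using Um_quad[of y x] by simp
qed

end

end

section \<open>Taylor bounds, the Gaussian kernel and Gaussian mixtures\<close>

lemma GDERIV_along_line:
  fixes f :: "'a::real_inner \<Rightarrow> real"
  assumes "\<And>x. GDERIV f x :> g x"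
  shows "((\<lambda>r. f (x + r *\<^sub>R v)) has_real_derivative (g (x + r *\<^sub>R v) \<bullet> v)) (at r)"
proof -
  have 1: "((\<lambda>r. x + r *\<^sub>R v) has_derivative (\<lambda>r. r *\<^sub>R v)) (at r)"
    by (auto intro!: derivative_eq_intros)
  have "(f has_derivative (\<lambda>h. h \<bullet> g (x + r *\<^sub>R v))) (at (x + r *\<^sub>R v))"
    using assms by (simp add: gderiv_def)
  from has_derivative_compose[OF 1 this]
  have "((\<lambda>r. f (x + r *\<^sub>R v)) has_derivative (\<lambda>h. h *\<^sub>R v \<bullet> g (x + r *\<^sub>R v))) (at r)" .
  moreover have "(\<lambda>h. h *\<^sub>R v \<bullet> g (x + r *\<^sub>R v)) = (*) (g (x + r *\<^sub>R v) \<bullet> v)"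
    by (auto simp: inner_commute)
  ultimately show ?thesis by (simp add: has_field_derivative_def)
qed

lemma GDERIV_mvt:
  fixes f :: "'a::real_inner \<Rightarrow> real"
  assumes "\<And>x. GDERIV f x :> g x"
  obtains r where "0 < r" "r < 1" "f y - f x = g (x + r *\<^sub>R (y - x)) \<bullet> (y - x)"
proof -
  from MVT2[of 0 1 "\<lambda>r. f (x + r *\<^sub>R (y - x))" "\<lambda>r. g (x + r *\<^sub>R (y - x)) \<bullet> (y - x)"] GDERIV_along_line[OF assms]
  show ?thesis using that by auto
qed

lemma GDERIV_lipschitz_quadratic_bound:
  fixes f :: "'a::real_inner \<Rightarrow> real"
  assumes d: "\<And>x. GDERIV f x :> g x" and l: "\<And>x y. norm (g y - g x) \<le> C * norm (y - x)"
  shows "\<bar>f y - f x - g x \<bullet> (y - x)\<bar> \<le> C * (norm (y - x))^2"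
proof -
  let ?A = "y - x"
  obtain r where r: "0 < r" "r < 1" "f y - f x = g (x + r *\<^sub>R ?A) \<bullet> ?A" using GDERIV_mvt[OF d] by auto
  have C: "0 \<le> C * norm ?A" using l[of y x] by (meson norm_ge_zero order_trans)
  have "\<bar>f y - f x - g x \<bullet> ?A\<bar> \<le> norm (g (x + r *\<^sub>R ?A) - g x) * norm ?A"
    by (metis r inner_diff_left Cauchy_Schwarz_ineq2)
  also have "... \<le> (C * norm ?A) * norm ?A"
  proof (intro mult_right_mono norm_ge_zero)
    have "norm (g (x + r *\<^sub>R ?A) - g x) \<le> C * norm (r *\<^sub>R ?A)" using l[of "x + r *\<^sub>R ?A" x] by simp
    also have "... = r * (C * norm ?A)" using r by simp
    also have "... \<le> C * norm ?A" using r C by (intro mult_left_le_one_le) auto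
    finally show "norm (g (x + r *\<^sub>R ?A) - g x) \<le> C * norm ?A" .
  qed
  finally show ?thesis by (simp add: power2_eq_square)
qed

text \<open>The gradient of \<open>gauss s\<close>, see \<open>gauss_has_derivative\<close>.
  Averaged over a mixture it becomes the gradient of the mixed density.\<close>

definition ggauss :: "real \<Rightarrow> 'a::euclidean_space \<Rightarrow> 'a" where
  "ggauss s z = (- gauss s z / s) *\<^sub>R z"

definition gmax :: "'a::euclidean_space itself \<Rightarrow> real \<Rightarrow> real" where
  "gmax _ s = (1 / sqrt (2 * pi * s)) ^ DIM('a)"

lemma gmax_pos: "s > 0 \<Longrightarrow> gmax TYPE('a::euclidean_space) s > 0" by (simp add: gmax_def)

lemma gauss_eq_gmax:
  "s > 0 \<Longrightarrow> gauss s (z::'a::euclidean_space) = gmax TYPE('a) s * exp (- (norm z)\<^sup>2 / (2 * s))"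
  by (simp add: gauss_eq gmax_def)

lemma gauss_le_gmax: "s > 0 \<Longrightarrow> gauss s (z::'a::euclidean_space) \<le> gmax TYPE('a) s"
  using gmax_pos[of s, where 'a='a] by (simp add: gauss_eq_gmax)

lemma ggauss_measurable [measurable]: "ggauss s \<in> borel_measurable borel" unfolding ggauss_def[abs_def] by simp

lemma gauss_has_derivative:
  fixes z :: "'a::euclidean_space"
  assumes "s > 0"
  shows "(gauss s has_derivative (\<lambda>v. v \<bullet> ggauss s z)) (at z)"
proof -
  let ?B = "\<lambda>z. \<lambda>v. gmax TYPE('a) s * (exp (- (z \<bullet> z) / (2 * s)) * (- (z \<bullet> v + v \<bullet> z) / (2 * s)))"
  let ?A = "\<lambda>z::'a. gmax TYPE('a) s * exp (- (z \<bullet> z) / (2 * s))"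
  have eq: "gauss s = ?A" using assms by (simp add: fun_eq_iff gauss_eq_gmax power2_norm_eq_inner)
  have "(?A has_derivative (?B z)) (at z)" using assms by (auto intro!: derivative_eq_intros simp: inner_commute)
  moreover have "(?B z) = (\<lambda>v. v \<bullet> ggauss s z)"
    using assms by (auto simp: ggauss_def gauss_eq_gmax power2_norm_eq_inner inner_commute)
  ultimately show ?thesis unfolding eq by simp
qed

lemma gauss_square_le:
  assumes "s > 0"
  shows "gauss s z * (norm (z::'a::euclidean_space))^2 \<le> 2 * s * gmax TYPE('a) s"
proof -
  define u where "u = (norm z)^2 / (2 * s)"
  have u: "(norm z)^2 = 2 * s * u" "u \<ge> 0" using assms by (auto simp: u_def)
  have "u \<le> exp u" using exp_ge_add_one_self[of u] by arith
  then have "gmax TYPE('a) s * (2 * s) * (u * exp (- u)) \<le> gmax TYPE('a) s * (2 * s) * 1"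
    using gmax_pos[OF assms, where 'a='a] assms by (simp add: exp_minus divide_simps)
  then show ?thesis using assms by (simp add: gauss_eq_gmax u)
qed

text \<open>The Hessian of the kernel is a multiple of the identity, at most the maximum of the
  kernel over s, plus a rank-one term that \<open>gauss_square_le\<close> bounds by twice that;
  hence the 3.\<close>

lemma ggauss_lipschitz:
  fixes x y :: "'a::euclidean_space"
  assumes s: "s > 0"
  shows "norm (ggauss s y - ggauss s x) \<le> (3 * gmax TYPE('a) s / s) * norm (y - x)"
proof (rule differentiable_bound[of UNIV "ggauss s" "\<lambda>z v. (- gauss s z / s) *\<^sub>R v + (- (v \<bullet> ggauss s z) / s) *\<^sub>R z"])
  let ?A = "\<lambda>v z. - (v \<bullet> ggauss s z) / s"
  fix z :: 'a
  show "(ggauss s has_derivative (\<lambda>v. (- gauss s z / s) *\<^sub>R v + (?A v z) *\<^sub>R z)) (at z within UNIV)"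
    unfolding ggauss_def[abs_def] using gauss_has_derivative[OF s, of z]
    by (auto intro!: derivative_eq_intros simp: ggauss_def divide_inverse)
  show "onorm (\<lambda>v. (- gauss s z / s) *\<^sub>R v + (?A v z) *\<^sub>R z) \<le> 3 * gmax TYPE('a) s / s"
  proof (rule onorm_bound)
    show "0 \<le> 3 * gmax TYPE('a) s / s" using s gmax_pos[OF s, where 'a='a] by simp
    fix v :: 'a
    have "norm ((- gauss s z / s) *\<^sub>R v) \<le> (gmax TYPE('a) s / s) * norm v"
      using s gauss_le_gmax[OF s, of z] gauss_nonneg[OF s, of z] by (auto intro!: mult_right_mono divide_right_mono)
    moreover have "norm ((?A v z) *\<^sub>R z) \<le> (2 * gmax TYPE('a) s / s) * norm v"
    proof -
      have "\<bar>v \<bullet> ggauss s z\<bar> \<le> norm v * norm (ggauss s z)" by (rule Cauchy_Schwarz_ineq2)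
      also have "norm (ggauss s z) = gauss s z * norm z / s" using s gauss_nonneg[OF s, of z] by (simp add: ggauss_def)
      finally have "\<bar>v \<bullet> ggauss s z\<bar> * norm z / s \<le> norm v * (gauss s z * norm z / s) * norm z / s"
        using s by (intro divide_right_mono mult_right_mono) auto
      also have "... = (gauss s z * (norm z)^2) * (norm v / s^2)" by (simp add: power2_eq_square)
      also have "... \<le> (2 * s * gmax TYPE('a) s) * (norm v / s^2)"
        using gauss_square_le[OF s, of z] by (intro mult_right_mono) auto
      also have "... = (2 * gmax TYPE('a) s / s) * norm v" by (simp add: power2_eq_square)
      finally show ?thesis using s by simp
    qed
    moreover have split3: "3 * gmax TYPE('a) s / s * norm v = (gmax TYPE('a) s / s) * norm v + (2 * gmax TYPE('a) s / s) * norm v"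
      by simp
    ultimately show "norm ((- gauss s z / s) *\<^sub>R v + (?A v z) *\<^sub>R z) \<le> 3 * gmax TYPE('a) s / s * norm v"
      using norm_triangle_ineq[of "(- gauss s z / s) *\<^sub>R v" "(?A v z) *\<^sub>R z"] by simp
  qed
qed auto

lemma gauss_quadratic_bound:
  fixes x y :: "'a::euclidean_space"
  assumes s: "s > 0"
  shows "\<bar>gauss s y - gauss s x - ggauss s x \<bullet> (y - x)\<bar> \<le> (3 * gmax TYPE('a) s / s) * (norm (y - x))^2"
  by (rule GDERIV_lipschitz_quadratic_bound)
     (use gauss_has_derivative[OF s] ggauss_lipschitz[OF s] in \<open>auto simp: gderiv_def\<close>)

lemma ggauss_norm_square:
  fixes z :: "'a::euclidean_space"
  assumes s: "s > 0"
  shows "norm (ggauss s z) \<le> gmax TYPE('a) s * (1 + 2 * s) / s"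
proof -
  have "norm (ggauss s z) \<le> gauss s z * (1 + (norm z)^2) / s"
    using s gauss_nonneg[OF s, of z] abs_le_one_plus_square[of "norm z"] by (simp add: ggauss_def divide_right_mono mult_left_mono)
  also have "... \<le> (gmax TYPE('a) s * (1 + 2 * s)) / s" using s gauss_le_gmax[OF s, of z] gauss_square_le[OF s, of z]
    by (intro divide_right_mono) (auto simp: algebra_simps)
  finally show ?thesis .
qed

text \<open>The domain of the free energy: probability densities with finite second moment and
  finite entropy. Functions of quadratic growth are integrable against them.\<close>

definition dens2 :: "('a::euclidean_space \<Rightarrow> real) \<Rightarrow> bool" where
  "dens2 p \<longleftrightarrow> p \<in> borel_measurable borel \<and> (\<forall>x. 0 \<le> p x) \<and> (\<integral>\<^sup>+x. ennreal (p x) \<partial>lborel) = 1 \<and>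
    integrable lborel (\<lambda>x. p x * (norm x)^2) \<and> integrable lborel (\<lambda>x. p x * ln (p x))"

text \<open>What the dissipation needs: positivity, a continuous gradient D and finite Fisher
  information of p itself. Every density produced by a step with Gaussian noise qualifies
  (\<open>regdens_q\<close>), so the functional inequality is required only here.\<close>

definition regdens :: "('a::euclidean_space \<Rightarrow> real) \<Rightarrow> ('a \<Rightarrow> 'a) \<Rightarrow> bool" where
  "regdens p D \<longleftrightarrow> dens2 p \<and> (\<forall>x. p x > 0) \<and> (\<forall>x. GDERIV p x :> D x) \<and> continuous_on UNIV D \<and>
    integrable lborel (\<lambda>x. (norm (D x))^2 / p x)"

lemma norm_add_square_le: "(norm (x + y))^2 \<le> 2 * (norm x)^2 + 2 * (norm (y::'a::real_normed_vector))^2"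
proof -
  have "(norm (x + y))^2 \<le> (norm x + norm y)^2" by (intro power_mono norm_triangle_ineq) auto
  also have "... \<le> 2 * (norm x)^2 + 2 * (norm y)^2"
    using zero_le_power2[of "norm x - norm y"] by (simp add: power2_eq_square algebra_simps)
  finally show ?thesis .
qed

lemma norm_diff_square_le: "(norm (x - y))^2 \<le> 2 * (norm x)^2 + 2 * (norm (y::'a::real_normed_vector))^2"
  using norm_add_square_le[of x "- y"] by simp

text \<open>One step of a scheme seen from the law M: T is the deterministic map, q below the
  density of T plus independent Gaussian noise of variance s, and D the gradient of q.\<close>

locale gauss_mixture = prob_space M for M :: "'m measure" +
  fixes T :: "'m \<Rightarrow> 'a::euclidean_space" and s :: real
  assumes T [measurable]: "T \<in> borel_measurable M"
    and T2: "integrable M (\<lambda>x. (norm (T x))^2)"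
    and s: "s > 0"
begin

definition q :: "'a \<Rightarrow> real" where "q y = (\<integral>x. gauss s (y - T x) \<partial>M)"

definition D :: "'a \<Rightarrow> 'a" where "D y = (\<integral>x. ggauss s (y - T x) \<partial>M)"

lemma gauss_integrable: "integrable M (\<lambda>x. gauss s (y - T x))"
  by (rule integrable_const_bound[where B="gmax TYPE('a) s"])
     (use gauss_le_gmax[OF s, where 'a='a] gauss_nonneg[OF s, where 'a='a] in auto)

lemma ggauss_integrable: "integrable M (\<lambda>x. ggauss s (y - T x))"
  by (rule integrable_const_bound[where B="gmax TYPE('a) s * (1 + 2 * s) / s"]) (use ggauss_norm_square[OF s] in auto)

lemma q_quadratic: "\<bar>q y - q x - D x \<bullet> (y - x)\<bar> \<le> (3 * gmax TYPE('a) s / s) * (norm (y - x))^2"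
proof -
  have "q y - q x - D x \<bullet> (y - x) = (\<integral>w. gauss s (y - T w) - gauss s (x - T w) - ggauss s (x - T w) \<bullet> (y - x) \<partial>M)"
    unfolding q_def D_def using gauss_integrable ggauss_integrable by simp
  also have "\<bar>...\<bar> \<le> (\<integral>w. \<bar>gauss s (y - T w) - gauss s (x - T w) - ggauss s (x - T w) \<bullet> (y - x)\<bar> \<partial>M)"
    by simp
  also have "... \<le> (3 * gmax TYPE('a) s / s) * (norm (y - x))^2"
    using gauss_integrable ggauss_integrable gauss_quadratic_bound[OF s, of "y - T w" "x - T w" for w]
    by (intro integral_le_const) auto
  finally show ?thesis .
qed

lemma q_GDERIV: "GDERIV q x :> D x" by (rule GDERIV_of_quadratic_bound) (rule q_quadratic)

lemma D_lipschitz: "norm (D y - D x) \<le> (3 * gmax TYPE('a) s / s) * norm (y - x)"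
proof -
  have e: "D y - D x = (\<integral>w. ggauss s (y - T w) - ggauss s (x - T w) \<partial>M)"
    unfolding D_def using ggauss_integrable by simp
  have "norm (\<integral>w. ggauss s (y - T w) - ggauss s (x - T w) \<partial>M) \<le> (\<integral>w. norm (ggauss s (y - T w) - ggauss s (x - T w)) \<partial>M)"
    by simp
  also have "... \<le> (3 * gmax TYPE('a) s / s) * norm (y - x)"
    using ggauss_integrable ggauss_lipschitz[OF s, of "y - T w" "x - T w" for w] by (intro integral_le_const) auto
  finally show ?thesis unfolding e .
qed

lemma D_continuous: "continuous_on A D"
proof (rule continuous_on_subset[OF _ subset_UNIV])
  have "(3 * gmax TYPE('a) s / s)-lipschitz_on UNIV D"
    by (rule lipschitz_onI) (use D_lipschitz s gmax_pos[OF s, where 'a='a] in \<open>auto simp: dist_norm\<close>)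
  then show "continuous_on UNIV D" by (rule lipschitz_on_continuous_on)
qed

lemma q_continuous: "continuous_on A q"
  using q_GDERIV by (meson continuous_at_imp_continuous_on gderiv_def has_derivative_continuous)

lemma q_measurable [measurable]: "q \<in> borel_measurable borel"
  and D_measurable [measurable]: "D \<in> borel_measurable borel"
  by (intro borel_measurable_continuous_onI q_continuous D_continuous)+

lemma q_le: "q y \<le> gmax TYPE('a) s"
  unfolding q_def using gauss_integrable gauss_le_gmax[OF s] by (intro integral_le_const) auto

definition lower :: "'a \<Rightarrow> real" where
  "lower y = ln (gmax TYPE('a) s) - ((norm y)^2 + (\<integral>x. (norm (T x))^2 \<partial>M)) / s"

text \<open>Jensen's inequality for the exponential, in the form \<open>exp u \<ge> exp v * (1 + u - v)\<close>.\<close>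

lemma q_lower: "exp (lower y) \<le> q y"
proof -
  define u where "u x = ln (gmax TYPE('a) s) - ((norm y)^2 + (norm (T x))^2) / s" for x
  have iu: "integrable M u" unfolding u_def using T2 by auto
  have eu: "(\<integral>x. u x \<partial>M) = lower y" unfolding u_def lower_def using T2 prob_space by simp
  have le: "exp (lower y) * (1 + u x - lower y) \<le> gauss s (y - T x)" for x
  proof -
    have "1 + u x - lower y \<le> exp (u x - lower y)" using exp_ge_add_one_self[of "u x - lower y"] by arith
    then have "exp (lower y) * (1 + u x - lower y) \<le> exp (lower y) * exp (u x - lower y)" by simp
    also have "... = exp (u x)" by (simp add: exp_add[symmetric])
    also have "... \<le> gmax TYPE('a) s * exp (- (norm (y - T x))\<^sup>2 / (2 * s))"
    proof -
      have "- ((norm y)^2 + (norm (T x))^2) / s \<le> - (norm (y - T x))\<^sup>2 / (2 * s)"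
        using divide_right_mono[OF norm_diff_square_le[of y "T x"], of "2 * s"] s by (simp add: add_divide_distrib diff_divide_distrib)
      moreover have "exp (u x) = gmax TYPE('a) s * exp (- ((norm y)^2 + (norm (T x))^2) / s)"
        using gmax_pos[OF s, where 'a='a] unfolding u_def diff_conv_add_uminus exp_add
        by (simp add: diff_divide_distrib add_divide_distrib)
      ultimately show ?thesis using gmax_pos[OF s, where 'a='a] by simp
    qed
    also have "... = gauss s (y - T x)" using s by (simp add: gauss_eq_gmax)
    finally show ?thesis .
  qed
  have "exp (lower y) = (\<integral>x. exp (lower y) * (1 + u x - lower y) \<partial>M)" using iu eu prob_space by simp
  also have "... \<le> q y" unfolding q_def by (intro integral_mono gauss_integrable le) (use iu in auto)
  finally show ?thesis .
qed

lemma q_pos: "q y > 0" using q_lower[of y] exp_gt_zero[of "lower y"] by arith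

text \<open>The kernel is bounded above and \<open>q_lower\<close> is a Gaussian lower bound, so
  \<open>ln q\<close> grows at most quadratically; the entropy of q is then finite because its
  second moment is.\<close>

lemma ln_q_bound:
  "\<bar>ln (q y)\<bar> \<le> (\<bar>ln (gmax TYPE('a) s)\<bar> + (1 + (\<integral>x. (norm (T x))^2 \<partial>M)) / s) * (1 + (norm y)^2)"
proof -
  let ?m = "\<integral>x. (norm (T x))^2 \<partial>M" and ?c = "\<bar>ln (gmax TYPE('a) s)\<bar>"
  have m: "?m \<ge> 0" by simp
  have 1: "ln (q y) \<le> ln (gmax TYPE('a) s)" using q_pos[of y] q_le[of y] by simp
  have 2: "lower y \<le> ln (q y)" using q_lower[of y] q_pos[of y] by (simp add: ln_ge_iff)
  have 3: "((norm y)^2 + ?m) / s \<le> ((1 + ?m) / s) * (1 + (norm y)^2)" using s by (simp add: field_simps)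
  have 4: "?c \<le> ?c * (1 + (norm y)^2)" by (simp add: algebra_simps)
  have 5: "0 \<le> ((1 + ?m) / s) * (1 + (norm y)^2)" using s by simp
  have "\<bar>ln (q y)\<bar> \<le> ?c * (1 + (norm y)^2) + ((1 + ?m) / s) * (1 + (norm y)^2)"
    using 1 2 3 4 5 unfolding lower_def by simp
  then show ?thesis by (simp add: algebra_simps)
qed

lemma nn_integral_q:
  assumes f [measurable]: "f \<in> borel_measurable (M \<Otimes>\<^sub>M borel)"
  shows "(\<integral>\<^sup>+y. (\<integral>\<^sup>+x. ennreal (gauss s (y - T x)) * f (x, y) \<partial>M) \<partial>lborel)
    = (\<integral>\<^sup>+x. (\<integral>\<^sup>+z. ennreal (gauss s z) * f (x, T x + z) \<partial>lborel) \<partial>M)"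
proof -
  interpret P: pair_sigma_finite M "lborel :: 'a measure" ..
  have "(\<integral>\<^sup>+y. (\<integral>\<^sup>+x. ennreal (gauss s (y - T x)) * f (x, y) \<partial>M) \<partial>lborel)
    = (\<integral>\<^sup>+x. (\<integral>\<^sup>+y. ennreal (gauss s (y - T x)) * f (x, y) \<partial>lborel) \<partial>M)"
    by (rule P.Fubini') measurable
  also have "... = (\<integral>\<^sup>+x. (\<integral>\<^sup>+z. ennreal (gauss s z) * f (x, T x + z) \<partial>lborel) \<partial>M)"
  proof (rule nn_integral_cong)
    fix x assume [measurable]: "x \<in> space M"
    show "(\<integral>\<^sup>+y. ennreal (gauss s (y - T x)) * f (x, y) \<partial>lborel) = (\<integral>\<^sup>+z. ennreal (gauss s z) * f (x, T x + z) \<partial>lborel)"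
      using nn_integral_lborel_isom[of "\<lambda>y. ennreal (gauss s (y - T x)) * f (x, y)" 1 "T x"] by simp
  qed
  finally show ?thesis .
qed

lemma ennreal_q: "ennreal (q y) = (\<integral>\<^sup>+x. ennreal (gauss s (y - T x)) \<partial>M)"
  unfolding q_def using gauss_integrable gauss_nonneg[OF s] by (subst nn_integral_eq_integral) auto

lemma nn_integral_q1:
  assumes f [measurable]: "f \<in> borel_measurable borel"
  shows "(\<integral>\<^sup>+y. ennreal (q y) * f y \<partial>lborel) = (\<integral>\<^sup>+x. (\<integral>\<^sup>+z. ennreal (gauss s z) * f (T x + z) \<partial>lborel) \<partial>M)"
  using nn_integral_q[of "\<lambda>(x, y). f y"] by (simp add: ennreal_q nn_integral_multc)

lemma nn_integral_q_one: "(\<integral>\<^sup>+y. ennreal (q y) \<partial>lborel) = 1"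
  using nn_integral_q1[of "\<lambda>_. 1"] s emeasure_space_1 by (simp add: nn_integral_gauss)

lemma nn_integral_increment:
  assumes f [measurable]: "f \<in> borel_measurable borel"
  shows "(\<integral>\<^sup>+y. (\<integral>\<^sup>+x. ennreal (gauss s (y - T x)) * f (y - T x) \<partial>M) \<partial>lborel) = (\<integral>\<^sup>+z. f z \<partial>gaussM s)"
  using nn_integral_q[of "\<lambda>(x, y). f (y - T x)"] emeasure_space_1 by (simp add: nn_integral_gaussM)

text \<open>Averaging over z and -z removes the cross term by the parallelogram identity, so that
  the old second moment enters with coefficient exactly 1. A larger coefficient would explode when
  the bound is iterated over many small steps.\<close>

lemma q_second_moment:
  "(\<integral>\<^sup>+y. ennreal (q y * (norm y)^2) \<partial>lborel) \<le> ennreal ((\<integral>x. (norm (T x))^2 \<partial>M) + gc TYPE('a) * s)"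
proof -
  let ?g = "\<lambda>z. ennreal (gauss s z)"
  have g2: "(\<integral>\<^sup>+z. ?g z * ennreal ((norm (z::'a))^2) \<partial>lborel) \<le> ennreal (gc TYPE('a) * s)"
    unfolding nn_integral_gaussM[symmetric, of "\<lambda>z. ennreal ((norm z)^2)", simplified]
    using gaussM_moment2[OF s, where 'a='a] by (subst nn_integral_eq_integral) (auto intro!: ennreal_leI)
  have *: "(\<integral>\<^sup>+z. ?g z * ennreal ((norm (t + z))^2) \<partial>lborel) \<le> ennreal ((norm t)^2 + gc TYPE('a) * s)" for t :: 'a
  proof -
    let ?I = "\<integral>\<^sup>+z. ?g z * ennreal ((norm (t + z))^2) \<partial>lborel"
    have "?I = (\<integral>\<^sup>+z. ?g (0 + (-1) *\<^sub>R z) * ennreal ((norm (t + (0 + (-1) *\<^sub>R z)))^2) \<partial>lborel)"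
      by (rule nn_integral_lborel_isom[symmetric]) auto
    also have "... = (\<integral>\<^sup>+z. ?g z * ennreal ((norm (t - z))^2) \<partial>lborel)" by (simp add: gauss_uminus)
    finally have "2 * ?I = ?I + (\<integral>\<^sup>+z. ?g z * ennreal ((norm (t - z))^2) \<partial>lborel)" by (simp add: mult_2)
    also have "... = (\<integral>\<^sup>+z. ?g z * ennreal ((norm (t + z))^2) + ?g z * ennreal ((norm (t - z))^2) \<partial>lborel)"
      by (rule nn_integral_add[symmetric]) auto
    also have "... = (\<integral>\<^sup>+z. 2 * (ennreal ((norm t)^2) * ?g (z::'a) + ?g z * ennreal ((norm z)^2)) \<partial>lborel)"
    proof (intro nn_integral_cong)
      fix z :: 'a
      have "(norm (t + z))^2 + (norm (t - z))^2 = 2 * ((norm t)^2 + (norm z)^2)"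
        unfolding power2_norm_eq_inner by (simp add: inner_add_right inner_diff_right inner_commute)
      then have e: "ennreal ((norm (t + z))^2) + ennreal ((norm (t - z))^2) = 2 * (ennreal ((norm t)^2) + ennreal ((norm z)^2))"
        by (simp flip: ennreal_plus ennreal_numeral ennreal_mult)
      have "?g z * ennreal ((norm (t + z))^2) + ?g z * ennreal ((norm (t - z))^2) = ?g z * (ennreal ((norm (t + z))^2) + ennreal ((norm (t - z))^2))"
        by (simp add: distrib_left)
      also have "... = 2 * (ennreal ((norm t)^2) * ?g z + ?g z * ennreal ((norm z)^2))"
        unfolding e by (simp add: algebra_simps)
      finally show "?g z * ennreal ((norm (t + z))^2) + ?g z * ennreal ((norm (t - z))^2)
        = 2 * (ennreal ((norm t)^2) * ?g z + ?g z * ennreal ((norm z)^2))" .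
    qed
    also have "... = 2 * (ennreal ((norm t)^2) + (\<integral>\<^sup>+z. ?g z * ennreal ((norm (z::'a))^2) \<partial>lborel))"
      using s by (simp add: nn_integral_cmult nn_integral_add nn_integral_gauss)
    finally have "?I = ennreal ((norm t)^2) + (\<integral>\<^sup>+z. ?g z * ennreal ((norm (z::'a))^2) \<partial>lborel)"
      by (subst (asm) ennreal_mult_cancel_left) auto
    also have "... \<le> ennreal ((norm t)^2) + ennreal (gc TYPE('a) * s)" using g2 by simp
    finally show ?thesis using s gc_pos[where 'a='a] by simp
  qed
  have "(\<integral>\<^sup>+y. ennreal (q y * (norm y)^2) \<partial>lborel) \<le> (\<integral>\<^sup>+x. ennreal ((norm (T x))^2 + gc TYPE('a) * s) \<partial>M)"
    using less_imp_le[OF q_pos] by (simp add: ennreal_mult' nn_integral_q1 nn_integral_mono *)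
  also have "... = ennreal ((\<integral>x. (norm (T x))^2 \<partial>M) + gc TYPE('a) * s)"
    using T2 s gc_pos[where 'a='a] prob_space by (subst nn_integral_eq_integral) auto
  finally show ?thesis .
qed

lemma q_moment_integrable: "integrable lborel (\<lambda>y. q y * (norm y)^2)"
  and q_moment_le: "(LBINT y. q y * (norm y)^2) \<le> (\<integral>x. (norm (T x))^2 \<partial>M) + gc TYPE('a) * s"
proof -
  show i: "integrable lborel (\<lambda>y. q y * (norm y)^2)"
    using q_second_moment by (intro integrableI_nonneg) (auto simp: less_imp_le[OF q_pos] le_less_trans)
  show "(LBINT y. q y * (norm y)^2) \<le> (\<integral>x. (norm (T x))^2 \<partial>M) + gc TYPE('a) * s"
    using q_second_moment i s gc_pos[where 'a='a] by (subst (asm) nn_integral_eq_integral) (auto simp: less_imp_le[OF q_pos] simp flip: ennreal_plus)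
qed

lemma q_integrable: "integrable lborel q" by (rule integrableI_nonneg) (auto simp: nn_integral_q_one less_imp_le[OF q_pos])

lemma q_growth:
  assumes [measurable]: "f \<in> borel_measurable borel" and "\<And>y. \<bar>f y\<bar> \<le> C * (1 + (norm y)^2)"
  shows "integrable lborel (\<lambda>y. q y * f y)"
  by (rule integrable_growth[OF q_integrable q_moment_integrable less_imp_le[OF q_pos] _ assms(2)]) measurable

text \<open>Joint convexity of |v|^2 / r in (v, r), carried out as Young's inequality against the
  fixed vector e = D / q at y. It bounds the Fisher information of the mixture by that of the
  kernel.\<close>

lemma D_square_le: "(norm (D y))^2 / q y \<le> (\<integral>x. gauss s (y - T x) * (norm (y - T x))^2 \<partial>M) / s^2"
proof -
  have i2: "integrable M (\<lambda>x. gauss s (y - T x) * (norm (y - T x))^2)"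
    by (rule integrable_const_bound[where B="2 * s * gmax TYPE('a) s"])
       (use gauss_square_le[OF s, where 'a='a] gauss_nonneg[OF s, where 'a='a] in \<open>auto simp: abs_mult\<close>)
  define e where "e = (1 / q y) *\<^sub>R D y"
  have "(norm (D y))^2 / q y = e \<bullet> D y" by (simp add: e_def power2_norm_eq_inner)
  also have "... = (\<integral>x. e \<bullet> ggauss s (y - T x) \<partial>M)" unfolding D_def using ggauss_integrable by simp
  also have "... \<le> (\<integral>x. (norm e)^2 / 2 * gauss s (y - T x) + (1 / (2 * s^2)) * (gauss s (y - T x) * (norm (y - T x))^2) \<partial>M)"
  proof (rule integral_mono)
    fix x
    let ?g = "gauss s (y - T x)" and ?n = "norm (y - T x)"
    have "e \<bullet> ggauss s (y - T x) \<le> norm e * norm (ggauss s (y - T x))" by (rule norm_cauchy_schwarz)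
    also have "norm (ggauss s (y - T x)) = ?g * (?n / s)" using s gauss_nonneg[OF s, of "y - T x"] by (simp add: ggauss_def)
    also have "norm e * (?g * (?n / s)) \<le> ?g * ((norm e)^2 / 2 + (?n / s)^2 / 2)"
    proof -
      have "norm e * (?n / s) \<le> (norm e)^2 / 2 + (?n / s)^2 / 2"
        using zero_le_power2[of "norm e - ?n / s"] by (simp add: power2_diff)
      then have "?g * (norm e * (?n / s)) \<le> ?g * ((norm e)^2 / 2 + (?n / s)^2 / 2)"
        using gauss_nonneg[OF s] by (intro mult_left_mono) auto
      then show ?thesis by (simp add: mult_ac)
    qed
    finally show "e \<bullet> ggauss s (y - T x) \<le> (norm e)^2 / 2 * ?g + (1 / (2 * s^2)) * (?g * ?n^2)"
      by (simp add: algebra_simps power_divide)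
  qed (use ggauss_integrable gauss_integrable i2 in auto)
  also have "... = (norm e)^2 / 2 * q y + (1 / (2 * s^2)) * (\<integral>x. gauss s (y - T x) * (norm (y - T x))^2 \<partial>M)"
    unfolding q_def using gauss_integrable i2 by simp
  also have "(norm e)^2 / 2 * q y = (norm (D y))^2 / q y / 2" by (simp add: e_def power2_eq_square)
  finally show ?thesis by simp
qed

lemma fisher_integrable: "integrable lborel (\<lambda>y. (norm (D y))^2 / q y)"
proof (rule integrableI_nonneg)
  let ?B = "\<lambda>y. \<integral>\<^sup>+x. ennreal (gauss s (y - T x)) * ennreal ((norm (y - T x))^2 / s^2) \<partial>M"
  let ?A = "\<integral>\<^sup>+y. ennreal ((norm (D y))^2 / q y) \<partial>lborel"
  have "?A \<le> (\<integral>\<^sup>+y. (?B y) \<partial>lborel)"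
  proof (intro nn_integral_mono)
    fix y
    have "ennreal ((norm (D y))^2 / q y) \<le> ennreal (\<integral>x. gauss s (y - T x) * ((norm (y - T x))^2 / s^2) \<partial>M)"
      using D_square_le[of y] by (intro ennreal_leI) simp
    also have "... = (\<integral>\<^sup>+x. ennreal (gauss s (y - T x) * ((norm (y - T x))^2 / s^2)) \<partial>M)"
    proof (rule nn_integral_eq_integral[symmetric])
      show "integrable M (\<lambda>x. gauss s (y - T x) * ((norm (y - T x))^2 / s^2))"
        by (rule integrable_const_bound[where B="2 * s * gmax TYPE('a) s / s^2"])
          (use gauss_square_le[OF s, where 'a='a] gauss_nonneg[OF s, where 'a='a] in \<open>auto simp: abs_mult intro!: divide_right_mono AE_I2\<close>)
    qed (use gauss_nonneg[OF s, where 'a='a] in auto)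
    finally show "ennreal ((norm (D y))^2 / q y) \<le> (?B y)" by (simp only: ennreal_mult'[OF gauss_nonneg[OF s]])
  qed
  also have "... = (\<integral>\<^sup>+z. ennreal ((norm (z::'a))^2 / s^2) \<partial>gaussM s)"
    by (rule nn_integral_increment) auto
  also have "... < \<infinity>" using gaussM_moment2(1)[OF s, where 'a='a] by (subst nn_integral_eq_integral) auto
  finally show "?A < \<infinity>" .
qed (use less_imp_le[OF q_pos] in auto)

lemma regdens_q: "regdens q D" unfolding regdens_def dens2_def
  using q_pos q_GDERIV D_continuous fisher_integrable nn_integral_q_one q_moment_integrable
    q_growth[OF _ ln_q_bound] by (auto simp: less_imp_le)

lemma distr_mixture:
  "distr (M \<Otimes>\<^sub>M gaussM s) borel (\<lambda>(x, z). T x + z) = edensity lborel q"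
proof (rule measure_eqI)
  let ?A = "distr (M \<Otimes>\<^sub>M gaussM s) borel (\<lambda>(x, z). T x + z)"
  fix A assume "A \<in> sets ?A"
  then have [measurable]: "A \<in> sets borel" by simp
  interpret G: prob_space "gaussM s :: 'a measure" by (rule prob_space_gaussM[OF s])
  interpret P: pair_sigma_finite M "gaussM s :: 'a measure" ..
  have "emeasure ?A A
    = (\<integral>\<^sup>+y. indicator A y \<partial>distr (M \<Otimes>\<^sub>M gaussM s) borel (\<lambda>(x, z). T x + z))"
    by simp
  also have "... = (\<integral>\<^sup>+xz. indicator A (case xz of (x, z) \<Rightarrow> T x + z) \<partial>(M \<Otimes>\<^sub>M gaussM s))"
    by (rule nn_integral_distr) auto
  also have "... = (\<integral>\<^sup>+y. ennreal (q y) * indicator A y \<partial>lborel)"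
    by (simp add: G.nn_integral_fst[symmetric] nn_integral_gaussM nn_integral_q1)
  finally show "emeasure ?A A = emeasure (edensity lborel q) A" by (simp add: emeasure_density)
qed simp

end

section \<open>Energy decrease in one step of the scheme\<close>

text \<open>From \<open>ln u \<le> u - 1\<close>. For likelihood ratios this is Gibbs' inequality;
  allowing total mass below 1 covers ratios that lose mass where the base density vanishes.\<close>

lemma (in prob_space) expectation_ln_le_0:
  fixes u :: "'a \<Rightarrow> real"
  assumes [measurable]: "u \<in> borel_measurable M" and pos: "AE x in M. u x > 0"
    and le: "(\<integral>\<^sup>+x. ennreal (u x) \<partial>M) \<le> 1" and i: "integrable M (\<lambda>x. ln (u x))"
  shows "expectation (\<lambda>x. ln (u x)) \<le> 0"
proof -
  have iu: "integrable M u" using le pos by (intro integrableI_nonneg) (auto simp: le_less_trans)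
  have "expectation (\<lambda>x. ln (u x)) \<le> expectation (\<lambda>x. u x - 1)"
    by (intro integral_mono_AE i Bochner_Integration.integrable_diff iu) (use pos in \<open>auto elim!: eventually_mono intro: ln_le_minus_one\<close>)
  also have "... = expectation u - 1" using iu prob_space by simp
  also have "ennreal (expectation u) \<le> 1" using le iu pos by (subst (asm) nn_integral_eq_integral) auto
  then have "expectation u - 1 \<le> 0" by simp
  finally show ?thesis .
qed

lemma dens2D:
  assumes "dens2 p"
  shows "p \<in> borel_measurable borel" "\<And>x. 0 \<le> p x" "(\<integral>\<^sup>+x. ennreal (p x) \<partial>lborel) = 1"
    "integrable lborel (\<lambda>x. p x * (norm x)^2)" "integrable lborel (\<lambda>x. p x * ln (p x))"
  using assms by (auto simp: dens2_def)

lemma prob_space_dens2: "dens2 p \<Longrightarrow> prob_space (edensity lborel p)"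
  by (intro prob_spaceI) (simp add: emeasure_density dens2D)

lemma integrable_dens2_iff:
  fixes f :: "'a::euclidean_space \<Rightarrow> real"
  assumes "dens2 p" "f \<in> borel_measurable borel"
  shows "integrable (edensity lborel p) f \<longleftrightarrow> integrable lborel (\<lambda>x. p x * f x)"
  using assms dens2D[OF assms(1)] by (subst integrable_density) auto

lemma integral_dens2:
  fixes f :: "'a::euclidean_space \<Rightarrow> real"
  assumes "dens2 p" "f \<in> borel_measurable borel"
  shows "(\<integral>x. f x \<partial>edensity lborel p) = (LBINT x. p x * f x)"
  using assms dens2D[OF assms(1)] by (subst integral_density) auto

lemma dens2_growth:
  fixes f :: "'a::euclidean_space \<Rightarrow> real"
  assumes p: "dens2 p" and [measurable]: "f \<in> borel_measurable borel" and "\<And>y. \<bar>f y\<bar> \<le> C * (1 + (norm y)^2)"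
  shows "integrable lborel (\<lambda>y. p y * f y)"
  by (rule integrable_growth[OF _ dens2D(4,2)[OF p] _ assms(3)]) (use dens2D[OF p] in \<open>auto intro!: integrableI_nonneg\<close>)

lemma integral_dens2_one: "dens2 p \<Longrightarrow> integrable lborel p" "dens2 p \<Longrightarrow> (LBINT x. p x) = 1"
proof -
  assume p: "dens2 p"
  show i: "integrable lborel p" using dens2D[OF p] by (intro integrableI_nonneg) auto
  show "(LBINT x. p x) = 1" using dens2D[OF p] by (simp add: integral_eq_nn_integral)
qed

definition mom2 :: "('a::euclidean_space \<Rightarrow> real) \<Rightarrow> real" where
  "mom2 p = (LBINT x. p x * (norm x)^2)"

lemma mom2_nonneg: "dens2 p \<Longrightarrow> 0 \<le> mom2 p"
  unfolding mom2_def by (intro Bochner_Integration.integral_nonneg) (simp_all add: dens2D(2))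

definition sqint :: "'m measure \<Rightarrow> ('m \<Rightarrow> 'a::euclidean_space) \<Rightarrow> bool" where
  "sqint M f \<longleftrightarrow> f \<in> borel_measurable M \<and> integrable M (\<lambda>x. (norm (f x))^2)"

lemma sqint_add:
  assumes "sqint M f" "sqint M g"
  shows "sqint M (\<lambda>x. f x + g x)" unfolding sqint_def
proof
  have [measurable]: "f \<in> borel_measurable M" "g \<in> borel_measurable M" using assms by (auto simp: sqint_def)
  show "(\<lambda>x. f x + g x) \<in> borel_measurable M" by simp
  have "integrable M (\<lambda>x. 2 * (norm (f x))^2 + 2 * (norm (g x))^2)" using assms by (auto simp: sqint_def)
  then show "integrable M (\<lambda>x. (norm (f x + g x))^2)"
    by (rule Bochner_Integration.integrable_bound) (auto intro!: order_trans[OF norm_add_square_le])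
qed

lemma sqint_scale: "sqint M f \<Longrightarrow> sqint M (\<lambda>x. c *\<^sub>R f x)"
  unfolding sqint_def by (auto simp: power_mult_distrib)

lemma sqint_diff: "sqint M f \<Longrightarrow> sqint M g \<Longrightarrow> sqint M (\<lambda>x. f x - g x)"
  using sqint_add[of M f "\<lambda>x. (-1) *\<^sub>R g x"] sqint_scale[of M g "-1"] by simp

lemma sqint_inner: "sqint M f \<Longrightarrow> sqint M g \<Longrightarrow> integrable M (\<lambda>x. f x \<bullet> g x)"
  unfolding sqint_def
proof (elim conjE, rule integrable_of_le[where g="\<lambda>x. (norm (f x))^2 + (norm (g x))^2"])
  show "norm (f x \<bullet> g x) \<le> (norm (f x))^2 + (norm (g x))^2" for x
    using Cauchy_Schwarz_ineq2[of "f x" "g x"] zero_le_power2[of "norm (f x) - norm (g x)"] mult_nonneg_nonneg[OF norm_ge_zero[of "f x"] norm_ge_zero[of "g x"]]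
    unfolding power2_diff real_norm_def by simp
qed auto

lemma sqintD: "sqint M f \<Longrightarrow> integrable M (\<lambda>x. (norm (f x))^2)" by (simp add: sqint_def)

text \<open>Here u and v are the drifts at x and y, s is the score at y and h the step. The first
  term on the right is the trapezoid approximation of an increment of the potential; the vector
  \<open>y - x + h *\<^sub>R u\<close> is the noise of the step, whose mean given y is
  known.\<close>

lemma gibbs_exponent:
  fixes x y u v s :: "'a::real_inner"
  assumes "h \<noteq> 0"
  shows "((norm (y - x + h *\<^sub>R u))^2 - (norm (x - y + h *\<^sub>R v - (2 * h) *\<^sub>R s))^2) / (4 * h)
    = (1/2) * ((u + v) \<bullet> (y - x)) + (h / 4) * ((norm u)^2 - (norm v)^2)
      - (y - x + h *\<^sub>R u) \<bullet> s + h * ((u + v) \<bullet> s) - h * (norm s)^2"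
proof -
  define a where "a = y - x"
  have e: "y - x = a" "x - y + h *\<^sub>R v - (2 * h) *\<^sub>R s = - a + h *\<^sub>R v - (2 * h) *\<^sub>R s" by (simp_all add: a_def)
  have 1: "(norm (a + h *\<^sub>R u))^2 = a \<bullet> a + 2 * h * (a \<bullet> u) + h^2 * (u \<bullet> u)"
    unfolding power2_norm_eq_inner by (simp add: inner_commute[of u a] power2_eq_square algebra_simps)
  have 2: "(norm (- a + h *\<^sub>R v - (2 * h) *\<^sub>R s))^2
     = a \<bullet> a + h^2 * (v \<bullet> v) + 4 * h^2 * (s \<bullet> s) - 2 * h * (a \<bullet> v) + 4 * h * (a \<bullet> s) - 4 * h^2 * (v \<bullet> s)"
    unfolding power2_norm_eq_inner
    by (simp add: inner_commute[of v a] inner_commute[of s a] inner_commute[of s v] power2_eq_square algebra_simps)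
  have 3: "(u + v) \<bullet> a = a \<bullet> u + a \<bullet> v" "(a + h *\<^sub>R u) \<bullet> s = a \<bullet> s + h * (u \<bullet> s)" "(u + v) \<bullet> s = u \<bullet> s + v \<bullet> s"
    by (simp_all add: inner_add_left inner_commute[of u a] inner_commute[of v a])
  show ?thesis unfolding e 1 2 3 power2_norm_eq_inner[of u] power2_norm_eq_inner[of v] power2_norm_eq_inner[of s] using assms
    by (simp add: divide_simps power2_eq_square) (simp add: algebra_simps)
qed

text \<open>Dictionary: \<open>k ^ 4\<close> is the step h, v the displacement, and nz, nb, ns are
  the norms of noise, drift and score; a is the trapezoid error, b the difference of squared drifts,
  c the mismatch of mollified and true drift tested with the score. With nz^2 of mean order k^4 and
  nz^3 of mean order k^6, the error on the right has mean of order k^5, that is h k.\<close>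

lemma step_error_bound:
  fixes k L g v nz nb ns :: real
  assumes k: "0 < k" "k \<le> 1" and L: "0 \<le> L" and g: "0 \<le> g" and nn: "0 \<le> v" "0 \<le> nz" "0 \<le> nb" "0 \<le> ns"
    and v: "v \<le> nz + k ^ 4 * nb"
    and a: "\<bar>a\<bar> \<le> L * v ^ 3 / k" "\<bar>a\<bar> \<le> 2 * L * v^2"
    and b: "\<bar>b\<bar> \<le> L * v * (2 * nb + L * v)"
    and c: "\<bar>c\<bar> \<le> (L * v + 2 * (L * (g * k))) * ns"
  shows "a + (k ^ 4 / 4) * b + k ^ 4 * ns^2 + k ^ 4 * c \<ge> k ^ 4 * (1 - k) * ns^2
    - (9 * L + 2 * L^2 + 2 * L^2 * g^2) * (k ^ 5 + k^2 * nz^2 + k ^ 5 * nb^2 + nz ^ 3 / k)"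
proof -
  have pw: "k ^ n \<le> k ^ m" if "m \<le> n" for m n using k that by (intro power_decreasing) auto
  have k34: "k ^ 3 * k = k ^ 4" and k35: "k ^ 3 * k^2 = k ^ 5" and k45: "k ^ 4 * k = k ^ 5"
    by (simp_all add: eval_nat_numeral)
  define P where "P = k^2 * nz^2"
  define B where "B = k ^ 5 * nb^2"
  define W where "W = nz ^ 3 / k"
  have PBW: "P \<ge> 0" "B \<ge> 0" "W \<ge> 0" using k nn by (auto simp: P_def B_def W_def)
  have k8: "k ^ 8 * nb^2 \<le> B" unfolding B_def by (intro mult_right_mono pw) auto
  \<comment> \<open>If the noise dominates, the cubic bound is applied with v at most
    \<open>2 * nz\<close>. Otherwise v is at most \<open>2 * (k ^ 4 * nb)\<close>, and the quadratic
    bound gives a term with \<open>k ^ 8\<close>, which is below \<open>k ^ 5\<close>.\<close>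
  have A: "\<bar>a\<bar> \<le> 8 * L * (W + B)"
  proof (cases "k ^ 4 * nb \<le> nz")
    case True
    then have "v ^ 3 \<le> (2 * nz) ^ 3" using v nn by (intro power_mono) auto
    then have "L * v ^ 3 / k \<le> L * (2 * nz) ^ 3 / k" using L k by (intro divide_right_mono mult_left_mono) auto
    also have "... = 8 * L * W" by (simp add: W_def)
    finally have "\<bar>a\<bar> \<le> 8 * L * W" using a by simp
    moreover have "0 \<le> 8 * L * B" using L PBW by simp
    ultimately show ?thesis unfolding distrib_left by arith
  next
    case False
    then have "v^2 \<le> (2 * (k ^ 4 * nb))^2" using v nn by (intro power_mono) auto
    then have "2 * L * v^2 \<le> 2 * L * (2 * (k ^ 4 * nb))^2" using L by (intro mult_left_mono) auto
    also have "... \<le> 8 * L * B" using L by (simp add: power_mult_distrib mult_left_mono k8)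
    finally have "\<bar>a\<bar> \<le> 8 * L * B" using a by arith
    moreover have "0 \<le> 8 * L * W" using L PBW by simp
    ultimately show ?thesis unfolding distrib_left by simp
  qed
  have v2: "v^2 \<le> 2 * nz^2 + 2 * (k ^ 8 * nb^2)"
  proof -
    have "v^2 \<le> (nz + k ^ 4 * nb)^2" using v nn by simp
    also have "... \<le> 2 * nz^2 + 2 * (k ^ 4 * nb)^2"
      using zero_le_power2[of "nz - k ^ 4 * nb"] by (simp add: power2_eq_square algebra_simps)
    finally show ?thesis by (simp add: power_mult_distrib)
  qed
  have kv: "k^2 * v^2 \<le> 2 * P + 2 * B"
  proof -
    have "k^2 * v^2 \<le> k^2 * (2 * nz^2 + 2 * (k ^ 8 * nb^2))" using v2 by (intro mult_left_mono) auto
    also have "... = 2 * P + 2 * (k ^ 10 * nb^2)" by (simp add: P_def algebra_simps)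
    also have "k ^ 10 * nb^2 \<le> B" unfolding B_def by (intro mult_right_mono pw) auto
    finally show ?thesis by simp
  qed
  have kn: "k ^ n * v^2 \<le> 2 * P + 2 * B" if "2 \<le> n" for n using mult_right_mono[OF pw[OF that], of "v^2"] kv by simp
  have Bb: "(k ^ 4 / 4) * \<bar>b\<bar> \<le> (L + L^2) * (P + B)"
  proof -
    have vn: "k ^ 4 * (v * nb) \<le> (k^2 * v^2 + B) / 2"
    proof -
      have "0 \<le> (k * v - k ^ 3 * nb)^2" by simp
      also have "... = k^2 * v^2 + k ^ 6 * nb^2 - 2 * (k ^ 4 * (v * nb))"
        unfolding power2_diff by (simp add: power_mult_distrib k34[symmetric])
      finally have "2 * (k ^ 4 * (v * nb)) \<le> k^2 * v^2 + k ^ 6 * nb^2" by simp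
      moreover have "k ^ 6 * nb^2 \<le> B" unfolding B_def by (intro mult_right_mono pw) auto
      ultimately show ?thesis by simp
    qed
    have "(k ^ 4 / 4) * \<bar>b\<bar> \<le> (k ^ 4 / 4) * (L * v * (2 * nb + L * v))" using b k by simp
    also have "... = (L / 2) * (k ^ 4 * (v * nb)) + (L^2 / 4) * (k ^ 4 * v^2)" by (simp add: power2_eq_square algebra_simps)
    also have "... \<le> (L / 2) * ((2 * P + 2 * B + B) / 2) + (L^2 / 4) * (2 * P + 2 * B)"
      using vn kv kn[of 4] L by (intro add_mono mult_left_mono) auto
    also have "... \<le> (L + L^2) * (P + B)" using L PBW by (simp add: field_simps)
    finally show ?thesis .
  qed
  have Cc: "k ^ 4 * \<bar>c\<bar> \<le> k ^ 5 * ns^2 + L^2 * (P + B) + 2 * L^2 * g^2 * k ^ 5"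
  proof -
    let ?w = "L * v + 2 * (L * (g * k))"
    \<comment> \<open>Young's inequality with weight k: after multiplication by \<open>k ^ 3\<close>
      the score enters as \<open>k ^ 5 * ns^2\<close>, which is the loss from \<open>k ^ 4\<close>
      to \<open>k ^ 4 * (1 - k)\<close> in the dissipation.\<close>
    have "0 \<le> (k * ns - ?w / 2)^2" by simp
    also have "... = k^2 * ns^2 + ?w^2 / 4 - k * (?w * ns)" by (simp add: power2_diff power_mult_distrib power_divide)
    finally have "k * (?w * ns) \<le> k^2 * ns^2 + ?w^2 / 4" by simp
    then have "k ^ 3 * (k * (?w * ns)) \<le> k ^ 3 * (k^2 * ns^2 + ?w^2 / 4)" using k by simp
    moreover have "k ^ 3 * (k * (?w * ns)) = k ^ 4 * (?w * ns)" unfolding k34[symmetric] by simp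
    moreover have "k ^ 3 * (k^2 * ns^2 + ?w^2 / 4) = k ^ 5 * ns^2 + k ^ 3 * ?w^2 / 4"
      unfolding k35[symmetric] by (simp only: distrib_left)
    moreover have "k ^ 3 * ?w^2 / 4 \<le> L^2 * (P + B) + 2 * L^2 * g^2 * k ^ 5"
    proof -
      have "?w^2 \<le> 2 * (L * v)^2 + 2 * (2 * (L * (g * k)))^2"
        using zero_le_power2[of "L * v - 2 * (L * (g * k))"] unfolding power2_diff power2_sum by simp
      also have "... = 2 * L^2 * v^2 + 8 * L^2 * g^2 * k^2" by (simp add: power_mult_distrib)
      finally have "k ^ 3 * ?w^2 \<le> k ^ 3 * (2 * L^2 * v^2 + 8 * L^2 * g^2 * k^2)" using k by simp
      also have "... = 2 * L^2 * (k ^ 3 * v^2) + 8 * L^2 * g^2 * k ^ 5"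
        unfolding k35[symmetric] by (simp only: distrib_left mult_ac)
      also have "... \<le> 2 * L^2 * (2 * P + 2 * B) + 8 * L^2 * g^2 * k ^ 5"
        by (intro add_right_mono mult_left_mono kn) auto
      finally show ?thesis by (simp add: algebra_simps)
    qed
    moreover have "k ^ 4 * \<bar>c\<bar> \<le> k ^ 4 * (?w * ns)" using c k by simp
    ultimately show ?thesis by simp
  qed
  have lin: "x \<ge> y - R" if "x \<ge> n - aa - bb - cc" "aa \<le> a1" "bb \<le> b1" "cc \<le> m + c1 + c2" "a1 + b1 + (m + c1 + c2) \<le> m + R" "y = n - m"
    for n aa bb cc x a1 b1 m c1 c2 R y :: real using that by simp
  have "a + (k ^ 4 / 4) * b + k ^ 4 * ns^2 + k ^ 4 * c \<ge> k ^ 4 * ns^2 - \<bar>a\<bar> - (k ^ 4 / 4) * \<bar>b\<bar> - k ^ 4 * \<bar>c\<bar>"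
    using mult_left_mono[of "- \<bar>b\<bar>" b "k ^ 4 / 4"] mult_left_mono[of "- \<bar>c\<bar>" c "k ^ 4"] by force
  moreover have "8 * L * (W + B) + (L + L^2) * (P + B) + (k ^ 5 * ns^2 + L^2 * (P + B) + 2 * L^2 * g^2 * k ^ 5)
     \<le> k ^ 5 * ns^2 + (9 * L + 2 * L^2 + 2 * L^2 * g^2) * (k ^ 5 + P + B + W)" using L PBW k by (simp add: algebra_simps)
  moreover have "k ^ 4 * (1 - k) * ns^2 = k ^ 4 * ns^2 - k ^ 5 * ns^2"
    unfolding k45[symmetric] by (simp only: right_diff_distrib left_diff_distrib)
  ultimately have "a + (k ^ 4 / 4) * b + k ^ 4 * ns^2 + k ^ 4 * c
    \<ge> k ^ 4 * (1 - k) * ns^2 - (9 * L + 2 * L^2 + 2 * L^2 * g^2) * (k ^ 5 + P + B + W)"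
    using A Bb Cc by - (rule lin[of "k ^ 4 * ns^2" "\<bar>a\<bar>" "(k ^ 4 / 4) * \<bar>b\<bar>" "k ^ 4 * \<bar>c\<bar>" "a + (k ^ 4 / 4) * b + k ^ 4 * ns^2 + k ^ 4 * c"
      "8 * L * (W + B)" "(L + L^2) * (P + B)" "k ^ 5 * ns^2" "L^2 * (P + B)" "2 * L^2 * g^2 * k ^ 5"
      "(9 * L + 2 * L^2 + 2 * L^2 * g^2) * (k ^ 5 + P + B + W)" "k ^ 4 * (1 - k) * ns^2"]; assumption)
  then show ?thesis unfolding P_def B_def W_def .
qed

section \<open>One step of the Euler scheme with mollified drift\<close>

context potential
begin

definition drift :: "real \<Rightarrow> 'a \<Rightarrow> 'a" where
  "drift k x = x - k ^ 4 *\<^sub>R bm (k^2) x"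

text \<open>The noise of the equation is sqrt 2 times a Brownian motion, so a step of length
  \<open>k ^ 4\<close> has variance \<open>2 * k ^ 4\<close>.\<close>

definition stepd :: "real \<Rightarrow> ('a \<Rightarrow> real) \<Rightarrow> 'a \<Rightarrow> real" where
  "stepd k p = gauss_mixture.q (edensity lborel p) (drift k) (2 * k ^ 4)"

definition stepD :: "real \<Rightarrow> ('a \<Rightarrow> real) \<Rightarrow> 'a \<Rightarrow> 'a" where
  "stepD k p = gauss_mixture.D (edensity lborel p) (drift k) (2 * k ^ 4)"

text \<open>The mollified potential enters the energy because the trapezoid bounds hold for it,
  whereas \<open>fisher\<close> uses the true gradient b, for which the functional inequality is
  available. Replacing \<open>fenergy\<close> by \<open>free\<close> costs order \<open>k^2\<close>,
  and these costs do not accumulate over the steps.\<close>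

definition fenergy :: "real \<Rightarrow> ('a \<Rightarrow> real) \<Rightarrow> real" where
  "fenergy k p = (LBINT x. p x * ln (p x)) + (LBINT x. p x * Um (k^2) x)"

definition fisher :: "('a \<Rightarrow> real) \<Rightarrow> ('a \<Rightarrow> 'a) \<Rightarrow> real" where
  "fisher p D = (LBINT x. p x * (norm ((1 / p x) *\<^sub>R D x + b x))^2)"

definition B0 :: real where "B0 = norm (b 0) + L + L * sqrt (gc TYPE('a))"

lemma B0_nonneg: "B0 \<ge> 0" using L_nonneg gc_pos[where 'a='a] by (simp add: B0_def)

lemma bm_continuous: "s > 0 \<Longrightarrow> continuous_on A (bm s)"
proof (rule continuous_on_subset[OF _ subset_UNIV])
  assume "s > 0"
  then have "L-lipschitz_on UNIV (bm s)"
    by (intro lipschitz_onI) (use bm_lip L_nonneg in \<open>auto simp: dist_norm\<close>)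
  then show "continuous_on UNIV (bm s)" by (rule lipschitz_on_continuous_on)
qed

lemma bm_measurable: "s > 0 \<Longrightarrow> bm s \<in> borel_measurable borel"
  by (intro borel_measurable_continuous_onI bm_continuous)

lemma Um_measurable: "s > 0 \<Longrightarrow> Um s \<in> borel_measurable borel"
  by (intro borel_measurable_continuous_onI continuous_at_imp_continuous_on)
     (use Um_GDERIV in \<open>auto simp: gderiv_def intro: has_derivative_continuous\<close>)

lemma linear_growth_square:
  assumes "norm v \<le> B0 * (1 + norm x)"
  shows "(norm v)^2 \<le> 2 * B0^2 * (1 + (norm x)^2)"
proof -
  have "(norm v)^2 \<le> (B0 * (1 + norm x))^2" using assms by (intro power_mono) auto
  also have "... = B0^2 * (1 + norm x)^2" by (simp add: power_mult_distrib)
  also have "... \<le> B0^2 * (2 * (1 + (norm x)^2))"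
    using zero_le_power2[of "1 - norm x"] by (intro mult_left_mono) (auto simp: power2_eq_square algebra_simps)
  finally show ?thesis by (simp add: algebra_simps)
qed

lemma bm_growth:
  assumes "0 < k" "k \<le> 1"
  shows "norm (bm (k^2) x) \<le> B0 * (1 + norm x)" and "(norm (bm (k^2) x))^2 \<le> 2 * B0^2 * (1 + (norm x)^2)"
proof -
  have "L * sqrt (gc TYPE('a) * k^2) \<le> L * sqrt (gc TYPE('a))"
    using assms gc_pos[where 'a='a] L_nonneg by (simp add: power_le_one mult_left_mono)
  then have "norm (bm (k^2) x) \<le> norm (b 0) + L * norm x + L * sqrt (gc TYPE('a))"
    using bm_close[of "k^2" x] b_growth[of x] norm_triangle_ineq2[of "bm (k^2) x" "b x"] assms by simp
  also have "... \<le> B0 * (1 + norm x)" using L_nonneg gc_pos[where 'a='a] by (simp add: B0_def algebra_simps)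
  finally show 1: "norm (bm (k^2) x) \<le> B0 * (1 + norm x)" .
  then show "(norm (bm (k^2) x))^2 \<le> 2 * B0^2 * (1 + (norm x)^2)" by (rule linear_growth_square)
qed

lemma drift_measurable: "0 < k \<Longrightarrow> drift k \<in> borel_measurable borel"
  unfolding drift_def[abs_def] using bm_measurable[of "k^2"] by simp

definition C1 :: real where "C1 = 4 * B0 + 2 * B0^2"

text \<open>The coefficient of \<open>(norm x)^2\<close> is 1 plus a multiple of the step, so second
  moments stay bounded on a fixed time interval, uniformly in the step.\<close>

lemma drift_square:
  assumes "0 < k" "k \<le> 1"
  shows "(norm (drift k x))^2 \<le> (norm x)^2 + C1 * k ^ 4 * (1 + (norm x)^2)"
proof -
  let ?h = "k ^ 4" and ?n = "norm x" and ?c = "norm (bm (k^2) x)"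
  have h: "0 \<le> ?h" "?h \<le> 1" using assms by (auto simp: power_le_one)
  have "norm (drift k x) \<le> ?n + ?h * ?c"
    unfolding drift_def using norm_triangle_ineq4[of x "?h *\<^sub>R bm (k^2) x"] by simp
  then have "(norm (drift k x))^2 \<le> (?n + ?h * ?c)^2" by simp
  also have "... = ?n^2 + ?h * (2 * (?n * ?c)) + ?h * (?h * ?c^2)" by (simp add: power2_eq_square algebra_simps)
  also have "... \<le> ?n^2 + ?h * (4 * B0 * (1 + ?n^2)) + ?h * (2 * B0^2 * (1 + ?n^2))"
  proof (intro add_mono mult_left_mono h order_refl)
    have "?n * ?c \<le> ?n * (B0 * (1 + ?n))" using bm_growth(1)[OF assms, of x] by (intro mult_left_mono) auto
    also have "... = B0 * (?n + ?n^2)" by (simp add: power2_eq_square algebra_simps)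
    also have "... \<le> B0 * (2 * (1 + ?n^2))"
    proof (intro mult_left_mono B0_nonneg)
      show "?n + ?n^2 \<le> 2 * (1 + ?n^2)" using abs_le_one_plus_square[of ?n] by simp
    qed
    finally show "2 * (?n * ?c) \<le> 4 * B0 * (1 + ?n^2)" by arith
    have "?h * ?c^2 \<le> ?c^2" using h by (intro mult_left_le_one_le) auto
    then show "?h * ?c^2 \<le> 2 * B0^2 * (1 + ?n^2)" using bm_growth(2)[OF assms, of x] by simp
  qed
  finally show ?thesis by (simp add: C1_def algebra_simps)
qed

definition K1 :: real where "K1 = 9 * L + 2 * L^2 + 2 * L^2 * (sqrt (gc TYPE('a)))^2"

lemma K1_nonneg: "K1 \<ge> 0" using L_nonneg by (simp add: K1_def)

lemma C1_nonneg: "C1 \<ge> 0" using B0_nonneg by (simp add: C1_def)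

lemma Um_growth:
  assumes "0 < k" "k \<le> 1"
  shows "\<bar>Um (k^2) x\<bar> \<le> (\<bar>U 0\<bar> + norm (b 0) + L + L * gc TYPE('a)) * (1 + (norm x)^2)"
proof -
  have "L * (gc TYPE('a) * k^2) \<le> L * (gc TYPE('a) * 1)"
    using assms gc_pos[where 'a='a] L_nonneg by (intro mult_left_mono) (auto simp: power_le_one)
  then have "\<bar>Um (k^2) x\<bar> \<le> (\<bar>U 0\<bar> + norm (b 0) + L) * (1 + (norm x)^2) + L * gc TYPE('a)"
    using Um_close[of "k^2" x] U_growth[of x] assms by simp
  also have "L * gc TYPE('a) \<le> L * gc TYPE('a) * (1 + (norm x)^2)"
    using mult_left_mono[of 1 "1 + (norm x)^2" "L * gc TYPE('a)"] L_nonneg gc_pos[where 'a='a] by simp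
  finally show ?thesis by (simp add: algebra_simps)
qed

lemma b_growth2: "(norm (b x))^2 \<le> 2 * B0^2 * (1 + (norm x)^2)"
proof (rule linear_growth_square)
  have "norm (b 0) * 1 \<le> B0 * 1" "L * norm x \<le> B0 * norm x"
    using L_nonneg gc_pos[where 'a='a] by (auto simp: B0_def intro!: mult_right_mono)
  then show "norm (b x) \<le> B0 * (1 + norm x)" using b_growth[of x] unfolding distrib_left by simp
qed

lemma fisher_integrable:
  assumes p: "regdens p D"
  shows "integrable lborel (\<lambda>x. p x * (norm ((1 / p x) *\<^sub>R D x + b x))^2)"
proof (rule integrable_of_le)
  let ?A = "\<lambda>x. 2 * ((norm (D x))^2 / p x) + 2 * (p x * (norm (b x))^2)"
  have p2: "dens2 p" and pp: "\<And>x. p x > 0" and Dc: "continuous_on UNIV D"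
    and Di: "integrable lborel (\<lambda>x. (norm (D x))^2 / p x)" using p by (auto simp: regdens_def)
  note [measurable] = dens2D(1)[OF p2] borel_measurable_continuous_onI[OF Dc]
  show "integrable lborel (\<lambda>x. ?A x)"
    using Di dens2_growth[OF p2, of "\<lambda>y. (norm (b y))^2" "2 * B0^2"] b_growth2
    by (intro Bochner_Integration.integrable_add integrable_mult_right) simp_all
  show "norm (p x * (norm ((1 / p x) *\<^sub>R D x + b x))^2) \<le> ?A x" for x
  proof -
    have "p x * (norm ((1 / p x) *\<^sub>R D x + b x))^2 \<le> p x * (2 * (norm ((1 / p x) *\<^sub>R D x))^2 + 2 * (norm (b x))^2)"
      using pp[of x] by (intro mult_left_mono norm_add_square_le) auto
    also have "... = ?A x" by (simp add: power2_eq_square field_simps)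
    finally show ?thesis using pp[of x] by simp
  qed
  show "(\<lambda>x. p x * (norm ((1 / p x) *\<^sub>R D x + b x))^2) \<in> borel_measurable lborel" by simp
qed

context
  fixes k :: real and p :: "'a \<Rightarrow> real"
  assumes k: "0 < k" "k \<le> 1" and p: "dens2 p"
begin

private abbreviation "h \<equiv> k ^ 4"
private abbreviation "\<beta> \<equiv> bm (k^2)"
private abbreviation "T \<equiv> drift k"
private abbreviation "Mp \<equiv> edensity lborel p"

private lemma hpos: "h > 0" using k by simp
private lemma spos: "k^2 > 0" using k by simp

lemmas [measurable] = dens2D(1)[OF p] bm_measurable[OF spos] drift_measurable[OF k(1)] Um_measurable[OF spos]

private lemma mom2_Mp: "integrable Mp (\<lambda>x. (norm x)^2)" "(\<integral>x. (norm x)^2 \<partial>Mp) = mom2 p"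
  using dens2D(4)[OF p] by (simp_all add: integrable_dens2_iff[OF p] integral_dens2[OF p] mom2_def)

interpretation Mp: prob_space Mp by (rule prob_space_dens2[OF p])

private lemma T2_Mp: "integrable Mp (\<lambda>x. (norm (T x))^2)" "(\<integral>x. (norm (T x))^2 \<partial>Mp) \<le> mom2 p + C1 * h * (1 + mom2 p)"
proof -
  have i: "integrable Mp (\<lambda>x. (norm x)^2 + C1 * h * (1 + (norm x)^2))" using mom2_Mp by auto
  show j: "integrable Mp (\<lambda>x. (norm (T x))^2)" by (rule integrable_of_le[OF i]) (use drift_square[OF k] in auto)
  have "(\<integral>x. (norm (T x))^2 \<partial>Mp) \<le> (\<integral>x. (norm x)^2 + C1 * h * (1 + (norm x)^2) \<partial>Mp)"
    by (intro integral_mono j i drift_square[OF k])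
  also have "... = mom2 p + C1 * h * (1 + mom2 p)" using mom2_Mp Mp.prob_space by simp
  finally show "(\<integral>x. (norm (T x))^2 \<partial>Mp) \<le> mom2 p + C1 * h * (1 + mom2 p)" .
qed

interpretation gm: gauss_mixture Mp T "2 * h" by unfold_locales (use T2_Mp hpos in auto)

private abbreviation "q \<equiv> gm.q"
private abbreviation "D \<equiv> gm.D"
private abbreviation "\<sigma> y \<equiv> (1 / q y) *\<^sub>R D y + b y"

private lemma q_dens2: "dens2 q" using gm.regdens_q by (simp add: regdens_def)

text \<open>\<open>Q\<close> below is the joint law of a position x and its successor y. As a
  density on this product it can be integrated by Fubini in either order: along the noise for given
  x, or over x for given y.\<close>

private definition "N = Mp \<Otimes>\<^sub>M (lborel :: 'a measure)"
private definition "J = (\<lambda>(x, y). gauss (2 * h) (y - T x))"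
private definition "Q = edensity N J"

private lemma N_sets [measurable_cong, simp]: "sets N = sets (borel \<Otimes>\<^sub>M borel)" unfolding N_def by simp

private lemma Q_sets [measurable_cong, simp]: "sets Q = sets (borel \<Otimes>\<^sub>M borel)" unfolding Q_def by simp

private lemma J_measurable [measurable]: "J \<in> borel_measurable (borel \<Otimes>\<^sub>M borel)" unfolding J_def by simp

private lemma J_nonneg: "J z \<ge> 0" unfolding J_def using hpos by (auto split: prod.split intro: gauss_nonneg)

interpretation P: pair_sigma_finite Mp "lborel :: 'a measure" ..

private lemma nn_integral_Q:
  assumes [measurable]: "f \<in> borel_measurable (borel \<Otimes>\<^sub>M borel)"
  shows "(\<integral>\<^sup>+z. f z \<partial>Q) = (\<integral>\<^sup>+y. (\<integral>\<^sup>+x. ennreal (gauss (2 * h) (y - T x)) * f (x, y) \<partial>Mp) \<partial>lborel)"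
    and "(\<integral>\<^sup>+z. f z \<partial>Q) = (\<integral>\<^sup>+x. (\<integral>\<^sup>+z. ennreal (gauss (2 * h) z) * f (x, T x + z) \<partial>lborel) \<partial>Mp)"
proof -
  let ?A = "\<integral>\<^sup>+y. (\<integral>\<^sup>+x. ennreal (gauss (2 * h) (y - T x)) * f (x, y) \<partial>Mp) \<partial>lborel"
  let ?B = "\<integral>\<^sup>+z. f z \<partial>Q"
  have "?B = (\<integral>\<^sup>+z. ennreal (J z) * f z \<partial>N)" unfolding Q_def by (rule nn_integral_density) auto
  also have "... = ?A" unfolding N_def by (subst P.nn_integral_snd[symmetric]) (auto simp: J_def)
  finally show 1: "?B = ?A" .
  show "?B = (\<integral>\<^sup>+x. (\<integral>\<^sup>+z. ennreal (gauss (2 * h) z) * f (x, T x + z) \<partial>lborel) \<partial>Mp)"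
    unfolding 1 by (rule gm.nn_integral_q) measurable
qed

interpretation Q: prob_space Q
proof
  have "emeasure Q (space Q) = (\<integral>\<^sup>+z. 1 \<partial>Q)" by simp
  also have "... = 1" using hpos Mp.emeasure_space_1 by (subst nn_integral_Q(2)) (auto simp: nn_integral_gauss)
  finally show "emeasure Q (space Q) = 1" .
qed

private lemma distr_Q_eqI:
  assumes [measurable]: "f \<in> measurable (borel \<Otimes>\<^sub>M borel) borel" and "sets R = sets borel"
    and eq: "\<And>A. A \<in> sets borel \<Longrightarrow> (\<integral>\<^sup>+z. indicator A (f z) \<partial>Q) = emeasure R A"
  shows "distr Q borel f = R"
proof (rule measure_eqI)
  fix A assume "A \<in> sets (distr Q borel f)"
  then have [measurable]: "A \<in> sets borel" by simp
  have "emeasure (distr Q borel f) A = (\<integral>\<^sup>+y. indicator A y \<partial>distr Q borel f)" by simp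
  also have "... = (\<integral>\<^sup>+z. indicator A (f z) \<partial>Q)" by (rule nn_integral_distr) auto
  finally show "emeasure (distr Q borel f) A = emeasure R A" using eq by simp
qed (use assms in simp)

private lemma distr_Q_fst: "distr Q borel fst = Mp"
  by (rule distr_Q_eqI) (use hpos in \<open>auto simp: nn_integral_Q(2) nn_integral_multc nn_integral_gauss\<close>)

private lemma distr_Q_snd: "distr Q borel snd = edensity lborel q"
  by (rule distr_Q_eqI) (auto simp: nn_integral_Q(1) nn_integral_multc gm.ennreal_q[symmetric] emeasure_density)

private definition "Z = (\<lambda>(x, y). y - T x)"

private lemma Z_measurable [measurable]: "Z \<in> measurable (borel \<Otimes>\<^sub>M borel) borel" unfolding Z_def by simp

private lemma distr_Q_Z: "distr Q borel Z = gaussM (2 * h)"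
  by (rule distr_Q_eqI) (use Mp.emeasure_space_1 in \<open>auto simp: Z_def nn_integral_Q(2) nn_integral_gaussM[symmetric]\<close>)

private lemma Q_fst:
  fixes f :: "'a \<Rightarrow> real"
  assumes [measurable]: "f \<in> borel_measurable borel"
  shows "integrable Q (\<lambda>z. f (fst z)) \<longleftrightarrow> integrable lborel (\<lambda>x. p x * f x)"
    and "(\<integral>z. f (fst z) \<partial>Q) = (LBINT x. p x * f x)"
  using integrable_distr_eq[of fst Q borel f] integral_distr[of fst Q borel f] integrable_dens2_iff[OF p assms] integral_dens2[OF p assms]
  by (auto simp: distr_Q_fst)

private lemma Q_snd:
  fixes f :: "'a \<Rightarrow> real"
  assumes [measurable]: "f \<in> borel_measurable borel"
  shows "integrable Q (\<lambda>z. f (snd z)) \<longleftrightarrow> integrable lborel (\<lambda>x. q x * f x)"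
    and "(\<integral>z. f (snd z) \<partial>Q) = (LBINT x. q x * f x)"
  using integrable_distr_eq[of snd Q borel f] integral_distr[of snd Q borel f] integrable_dens2_iff[OF q_dens2 assms] integral_dens2[OF q_dens2 assms]
  by (auto simp: distr_Q_snd)

private lemma Q_Z:
  fixes f :: "'a \<Rightarrow> real"
  assumes [measurable]: "f \<in> borel_measurable borel"
  shows "integrable Q (\<lambda>z. f (Z z)) \<longleftrightarrow> integrable (gaussM (2 * h)) f"
    and "(\<integral>z. f (Z z) \<partial>Q) = (\<integral>x. f x \<partial>gaussM (2 * h))"
  using integrable_distr_eq[of Z Q borel f] integral_distr[of Z Q borel f] by (auto simp: distr_Q_Z)

private lemma sigma_measurable [measurable]: "(\<lambda>y. \<sigma> y) \<in> borel_measurable borel" by simp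

private lemma sigma_integrable: "integrable lborel (\<lambda>y. q y * (norm (\<sigma> y))^2)"
  by (rule fisher_integrable[OF gm.regdens_q])

private lemma sqint_Q:
  "sqint Q fst" "sqint Q snd" "sqint Q Z" "sqint Q (\<lambda>z. \<beta> (fst z))" "sqint Q (\<lambda>z. \<beta> (snd z))"
  "sqint Q (\<lambda>z. b (snd z))" "sqint Q (\<lambda>z. \<sigma> (snd z))"
proof -
  have i1: "integrable lborel (\<lambda>x. p x * (norm x)^2)" using dens2D(4)[OF p] .
  have i2: "integrable lborel (\<lambda>x. q x * (norm x)^2)" by (rule gm.q_moment_integrable)
  show "sqint Q fst" using Q_fst(1)[of "\<lambda>x. (norm x)^2"] i1 by (simp add: sqint_def)
  show "sqint Q snd" using Q_snd(1)[of "\<lambda>x. (norm x)^2"] i2 by (simp add: sqint_def)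
  show "sqint Q Z" using Q_Z(1)[of "\<lambda>x. (norm x)^2"] gaussM_moment2(1)[of "2 * h", where 'a='a] hpos by (simp add: sqint_def)
  show "sqint Q (\<lambda>z. \<beta> (fst z))"
    using Q_fst(1)[of "\<lambda>x. (norm (\<beta> x))^2"] dens2_growth[OF p, of "\<lambda>x. (norm (\<beta> x))^2" "2 * B0^2"] bm_growth(2)[OF k]
    by (simp add: sqint_def)
  show "sqint Q (\<lambda>z. \<beta> (snd z))"
    using Q_snd(1)[of "\<lambda>x. (norm (\<beta> x))^2"] dens2_growth[OF q_dens2, of "\<lambda>x. (norm (\<beta> x))^2" "2 * B0^2"] bm_growth(2)[OF k]
    by (simp add: sqint_def)
  show "sqint Q (\<lambda>z. b (snd z))"
    using Q_snd(1)[of "\<lambda>x. (norm (b x))^2"] dens2_growth[OF q_dens2, of "\<lambda>x. (norm (b x))^2" "2 * B0^2"] b_growth2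
    by (simp add: sqint_def)
  show "sqint Q (\<lambda>z. \<sigma> (snd z))"
    using Q_snd(1)[of "\<lambda>x. (norm (\<sigma> x))^2"] sigma_integrable by (simp add: sqint_def)
qed

text \<open>The kernel satisfies \<open>gauss (2 * h) z *\<^sub>R z = - (2 * h) *\<^sub>R ggauss (2
  * h) z\<close>, so the mean of the noise given y is -2h times D / q at y, which equals
  \<open>\<sigma> y - b y\<close>.\<close>

private lemma tweedie: "(\<integral>z. Z z \<bullet> \<sigma> (snd z) \<partial>Q) = - 2 * h * (\<integral>z. (\<sigma> (snd z) - b (snd z)) \<bullet> \<sigma> (snd z) \<partial>Q)"
proof -
  let ?A = "\<lambda>y. \<integral>x. J (x, y) * (Z (x, y) \<bullet> \<sigma> y) \<partial>Mp"
  have iQ: "integrable Q (\<lambda>z. Z z \<bullet> \<sigma> (snd z))" by (intro sqint_inner sqint_Q)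
  then have iN: "integrable N (\<lambda>z. J z * (Z z \<bullet> \<sigma> (snd z)))"
    unfolding Q_def by (subst (asm) integrable_density) (auto simp: J_nonneg)
  have "(\<integral>z. Z z \<bullet> \<sigma> (snd z) \<partial>Q) = (\<integral>z. J z * (Z z \<bullet> \<sigma> (snd z)) \<partial>N)"
    unfolding Q_def by (subst integral_density) (auto simp: J_nonneg)
  also have "... = (LBINT y. (?A y))" using iN unfolding N_def by (subst P.integral_snd) (auto simp: case_prod_beta')
  also have "... = (LBINT y. q y * (- 2 * h * ((\<sigma> y - b y) \<bullet> \<sigma> y)))"
  proof (rule Bochner_Integration.integral_cong)
    fix y
    have "(?A y) = (\<integral>x. - 2 * h * (ggauss (2 * h) (y - T x) \<bullet> \<sigma> y) \<partial>Mp)"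
      using hpos by (intro Bochner_Integration.integral_cong) (auto simp: J_def Z_def ggauss_def)
    also have "... = - 2 * h * (D y \<bullet> \<sigma> y)" unfolding gm.D_def using gm.ggauss_integrable[of y] by simp
    also have "D y \<bullet> \<sigma> y = q y * ((\<sigma> y - b y) \<bullet> \<sigma> y)" using gm.q_pos[of y] by simp
    finally show "(?A y) = q y * (- 2 * h * ((\<sigma> y - b y) \<bullet> \<sigma> y))" by simp
  qed simp
  also have "... = (\<integral>z. - 2 * h * ((\<sigma> (snd z) - b (snd z)) \<bullet> \<sigma> (snd z)) \<partial>Q)"
    by (rule Q_snd(2)[symmetric]) measurable
  also have "... = - 2 * h * (\<integral>z. (\<sigma> (snd z) - b (snd z)) \<bullet> \<sigma> (snd z) \<partial>Q)"
    by (rule integral_mult_right_zero)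
  finally show ?thesis .
qed

text \<open>The logarithm of the ratio of the backward to the forward kernel; both have variance
  \<open>2 * h\<close>, so their normalisations cancel.\<close>

private definition "Rx = (\<lambda>z. ((norm (Z z))^2 - (norm (fst z - snd z + h *\<^sub>R \<beta> (snd z) - (2 * h) *\<^sub>R \<sigma> (snd z)))^2) / (4 * h))"

private lemma Rx_integrable: "integrable Q Rx" by (simp add: sqint_add sqint_diff sqint_scale sqint_Q sqintD Rx_def)

private lemma ln_integrable: "integrable Q (\<lambda>z. ln (p (fst z)))" "integrable Q (\<lambda>z. ln (q (snd z)))"
  using Q_fst(1)[of "\<lambda>x. ln (p x)"] dens2D(5)[OF p] Q_snd(1)[of "\<lambda>x. ln (q x)"] dens2D(5)[OF q_dens2] by auto

private lemma p_pos_AE: "AE z in Q. p (fst z) > 0"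
proof -
  have "AE x in Mp. p x > 0" by (subst AE_density) auto
  then have "AE x in distr Q borel fst. p x > 0" unfolding distr_Q_fst .
  then show ?thesis by (subst (asm) AE_distr_iff) auto
qed

text \<open>Gibbs' inequality for the joint law \<open>Q\<close> of consecutive positions \<open>(x, y)\<close> against the law with the same second marginal
  and with \<open>x\<close> given \<open>y\<close> normal around \<open>y - h \<beta> y + 2 h \<sigma> y\<close>.\<close>

private lemma gibbs: "(\<integral>z. ln (q (snd z)) \<partial>Q) - (\<integral>z. ln (p (fst z)) \<partial>Q) + (\<integral>z. Rx z \<partial>Q) \<le> 0"
proof -
  let ?C = "\<lambda>z. ln (q (snd z)) - ln (p (fst z)) + Rx z"
  let ?B = "\<lambda>w y. \<integral>\<^sup>+x. ennreal (w (x, y)) \<partial>lborel"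
  let ?A = "2 * h"
  \<comment> \<open>w is the Lebesgue density of the comparison law and u its ratio to that of
    \<open>Q\<close>. Division by zero makes u vanish where p does, so its integral is at most 1 and
    possibly smaller.\<close>
  define w where "w z = q (snd z) * gauss ?A (fst z - snd z + h *\<^sub>R \<beta> (snd z) - ?A *\<^sub>R \<sigma> (snd z))" for z
  define u where "u z = w z / (p (fst z) * J z)" for z
  have [measurable]: "w \<in> borel_measurable (borel \<Otimes>\<^sub>M borel)" unfolding w_def by simp
  have [measurable]: "u \<in> borel_measurable (borel \<Otimes>\<^sub>M borel)" unfolding u_def by simp
  have wpos: "w z > 0" for z unfolding w_def by (intro mult_pos_pos gm.q_pos gauss_pos hpos zero_less_numeral)
  have Jpos: "J z > 0" for z using hpos by (auto simp: J_def split: prod.split intro: gauss_pos)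
  have lng: "ln (gauss ?A v) = ln (gmax TYPE('a) ?A) - (norm v)^2 / (4 * h)" for v :: 'a
    using hpos gmax_pos[of "2 * h", where 'a='a] by (simp add: gauss_eq_gmax ln_mult)
  have lnu: "ln (u z) = ?C z" if "p (fst z) > 0" for z
  proof -
    have "ln (u z) = ln (w z) - (ln (p (fst z)) + ln (J z))"
      unfolding u_def using that Jpos[of z] wpos[of z] by (simp add: ln_div ln_mult)
    also have "ln (w z) = ln (q (snd z)) + (ln (gmax TYPE('a) ?A) - (norm (fst z - snd z + h *\<^sub>R \<beta> (snd z) - ?A *\<^sub>R \<sigma> (snd z)))^2 / (4 * h))"
      unfolding w_def lng[symmetric] using gm.q_pos[of "snd z"] gauss_pos[of "2 * h" "fst z - snd z + h *\<^sub>R \<beta> (snd z) - ?A *\<^sub>R \<sigma> (snd z)"] hpos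
      by (subst ln_mult) auto
    also have "ln (J z) = ln (gmax TYPE('a) ?A) - (norm (Z z))^2 / (4 * h)" by (cases z) (simp add: J_def Z_def lng)
    finally show ?thesis by (simp add: Rx_def diff_divide_distrib)
  qed
  have i: "integrable Q (\<lambda>z. ?C z)" using ln_integrable Rx_integrable by auto
  have ae: "AE z in Q. ln (u z) = ?C z" using p_pos_AE by (auto simp: lnu)
  have "(\<integral>z. ln (u z) \<partial>Q) \<le> 0"
  proof (rule Q.expectation_ln_le_0)
    show "u \<in> borel_measurable Q" by simp
    show "AE z in Q. 0 < u z" using p_pos_AE by (auto simp: u_def wpos Jpos)
    show "integrable Q (\<lambda>z. ln (u z))" using ae i by (subst integrable_cong_AE) auto
    have "(\<integral>\<^sup>+z. ennreal (u z) \<partial>Q) = (\<integral>\<^sup>+y. (\<integral>\<^sup>+x. ennreal (gauss ?A (y - T x)) * ennreal (u (x, y)) \<partial>Mp) \<partial>lborel)"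
      by (rule nn_integral_Q(1)) measurable
    also have "... \<le> (\<integral>\<^sup>+y. (?B w y) \<partial>lborel)"
    proof (rule nn_integral_mono)
      fix y
      have "(\<integral>\<^sup>+x. ennreal (gauss ?A (y - T x)) * ennreal (u (x, y)) \<partial>Mp)
        = (\<integral>\<^sup>+x. ennreal (p x) * (ennreal (gauss ?A (y - T x)) * ennreal (u (x, y))) \<partial>lborel)"
        by (rule nn_integral_density) measurable
      also have "... \<le> (?B w y)"
      proof (rule nn_integral_mono)
        fix x
        show "ennreal (p x) * (ennreal (gauss ?A (y - T x)) * ennreal (u (x, y))) \<le> ennreal (w (x, y))"
          using dens2D(2)[OF p, of x] Jpos[of "(x, y)"] by (simp add: u_def J_def ennreal_mult'[symmetric])
      qed
      finally show "(\<integral>\<^sup>+x. ennreal (gauss ?A (y - T x)) * ennreal (u (x, y)) \<partial>Mp) \<le> (?B w y)" .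
    qed
    also have "... = (\<integral>\<^sup>+y. ennreal (q y) \<partial>lborel)"
    proof (rule nn_integral_cong)
      fix y
      have "(?B w y) = (\<integral>\<^sup>+x. ennreal (q y) * ennreal (gauss ?A (x - (y - h *\<^sub>R \<beta> y + ?A *\<^sub>R \<sigma> y))) \<partial>lborel)"
        unfolding w_def using gm.q_pos[of y] by (intro nn_integral_cong) (simp add: ennreal_mult'[symmetric] algebra_simps)
      also have "... = ennreal (q y)" using hpos by (simp add: nn_integral_cmult nn_integral_gauss_shift)
      finally show "(?B w y) = ennreal (q y)" .
    qed
    also have "... = 1" by (rule gm.nn_integral_q_one)
    finally show "(\<integral>\<^sup>+z. ennreal (u z) \<partial>Q) \<le> 1" .
  qed
  also have "(\<integral>z. ln (u z) \<partial>Q) = (\<integral>z. ?C z \<partial>Q)"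
    using ae borel_measurable_integrable[OF i] by (intro integral_cong_AE) auto
  finally show ?thesis using ln_integrable Rx_integrable by simp
qed

private definition "Err = (\<lambda>z. K1 * (k ^ 5 + k^2 * (norm (Z z))^2 + k ^ 5 * (norm (\<beta> (fst z)))^2 + (norm (Z z)) ^ 3 / k))"

private lemma Z3_integrable: "integrable Q (\<lambda>z. (norm (Z z)) ^ 3)"
  using Q_Z(1)[of "\<lambda>x. (norm x)^3"] gaussM_moment3(1)[of "2 * h", where 'a='a] hpos by simp

private lemma Err_integral:
  "integrable Q Err" "(\<integral>z. Err z \<partial>Q) \<le> K1 * (1 + 6 * gc TYPE('a) + 2 * B0^2) * k ^ 5 * (1 + mom2 p)"
proof -
  let ?A = "1 + mom2 p"
  let ?B = "\<integral>z. (norm (\<beta> (fst z)))^2 \<partial>Q"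
  let ?C = "\<integral>z. (norm (Z z)) ^ 3 \<partial>Q"
  let ?D = "gc TYPE('a) * (2 * h)"
  let ?E = "4 * gc TYPE('a) * k ^ 6"
  have i: "integrable Q (\<lambda>z. (norm (Z z))^2)" "integrable Q (\<lambda>z. (norm (\<beta> (fst z)))^2)"
    using sqint_Q by (auto dest: sqintD)
  show "integrable Q Err" unfolding Err_def using i Z3_integrable by auto
  have g: "gc TYPE('a) > 0" by (rule gc_pos)
  have k46: "k ^ 4 * k^2 = k ^ 6" and k56: "k ^ 5 * k = k ^ 6" by (simp_all add: eval_nat_numeral)
  have e2: "(\<integral>z. (norm (Z z))^2 \<partial>Q) \<le> gc TYPE('a) * (2 * h)"
    using Q_Z(2)[of "\<lambda>x. (norm x)^2"] gaussM_moment2(2)[of "2 * h", where 'a='a] hpos by simp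
  have e3: "?C \<le> gc TYPE('a) * (2 * h) * sqrt (2 * h)"
    using Q_Z(2)[of "\<lambda>x. (norm x)^3"] gaussM_moment3(2)[of "2 * h", where 'a='a] hpos by simp
  have "sqrt (2 * h) \<le> 2 * k^2"
    by (rule real_le_lsqrt) (use in \<open>auto simp: power_mult_distrib power_mult[symmetric]\<close>)
  then have "gc TYPE('a) * (2 * h) * sqrt (2 * h) \<le> gc TYPE('a) * (2 * h) * (2 * k^2)"
    using g by (intro mult_left_mono) auto
  moreover have "gc TYPE('a) * (2 * h) * (2 * k^2) = 4 * gc TYPE('a) * k ^ 6" unfolding k46[symmetric] by simp
  ultimately have e3': "?C \<le> 4 * gc TYPE('a) * k ^ 6" using e3 by simp
  have eb: "?B \<le> 2 * B0^2 * ?A"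
  proof -
    have "?B \<le> (\<integral>z. 2 * B0^2 * (1 + (norm (fst z))^2) \<partial>Q)"
      using i sqint_Q(1) by (intro integral_mono bm_growth(2)[OF k]) (auto dest!: sqintD)
    also have "... = 2 * B0^2 * ?A"
      using sqint_Q(1) Q_fst(2)[of "\<lambda>x. (norm x)^2"] Q.prob_space by (auto dest!: sqintD simp: mom2_def)
    finally show ?thesis .
  qed
  have m: "mom2 p \<ge> 0" by (rule mom2_nonneg[OF p])
  have "(\<integral>z. Err z \<partial>Q) = K1 * (k ^ 5 + k^2 * (\<integral>z. (norm (Z z))^2 \<partial>Q) + k ^ 5 * ?B + ?C / k)"
    unfolding Err_def using i Z3_integrable Q.prob_space by simp
  also have "... \<le> K1 * (k ^ 5 + k^2 * ?D + k ^ 5 * (2 * B0^2 * ?A) + ?E / k)"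
    using e2 e3' eb k K1_nonneg by (intro mult_left_mono add_mono divide_right_mono) auto
  also have "... \<le> K1 * ((1 + 6 * gc TYPE('a) + 2 * B0^2) * k ^ 5 * ?A)"
  proof (intro mult_left_mono K1_nonneg)
    have "k^2 * ?D = 2 * gc TYPE('a) * k ^ 6" unfolding k46[symmetric] by simp
    also have "... \<le> 2 * gc TYPE('a) * k ^ 5" using k g by (intro mult_left_mono power_decreasing) auto
    finally have 1: "k^2 * ?D \<le> 2 * gc TYPE('a) * k ^ 5" .
    have 2: "?E / k = 4 * gc TYPE('a) * k ^ 5" using k unfolding k56[symmetric] by simp
    have 3: "(1 + 6 * gc TYPE('a)) * k ^ 5 \<le> (1 + 6 * gc TYPE('a)) * k ^ 5 * ?A" using m g k by simp
    have "k ^ 5 + k^2 * ?D + k ^ 5 * (2 * B0^2 * ?A) + ?E / k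
      \<le> (1 + 6 * gc TYPE('a)) * k ^ 5 + k ^ 5 * (2 * B0^2 * ?A)" using 1 unfolding 2 by (simp add: algebra_simps)
    also have "... \<le> (1 + 6 * gc TYPE('a)) * k ^ 5 * ?A + k ^ 5 * (2 * B0^2 * ?A)" using 3 by simp
    finally show "k ^ 5 + k^2 * ?D + k ^ 5 * (2 * B0^2 * ?A) + ?E / k
      \<le> (1 + 6 * gc TYPE('a) + 2 * B0^2) * k ^ 5 * ?A" by (simp add: algebra_simps)
  qed
  finally show "(\<integral>z. Err z \<partial>Q) \<le> K1 * (1 + 6 * gc TYPE('a) + 2 * B0^2) * k ^ 5 * ?A" by simp
qed

text \<open>The second and third terms have \<open>Q\<close>-integrals that cancel by
  \<open>tweedie\<close>. Adding them removes the product of noise and score from \<open>Rx\<close>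
  and turns minus h times the squared score into plus h times it, the dissipation. What remains has
  the form treated by \<open>step_error_bound\<close>.\<close>

private lemma pointwise:
  "Rx z + Z z \<bullet> \<sigma> (snd z) + 2 * h * ((\<sigma> (snd z) - b (snd z)) \<bullet> \<sigma> (snd z)) + Um (k^2) (fst z) - Um (k^2) (snd z)
    \<ge> h * (1 - k) * (norm (\<sigma> (snd z)))^2 - Err z"
proof -
  obtain x y where z: "z = (x, y)" by (cases z)
  let ?s = "\<sigma> y"
  define v where "v = norm (y - x)"
  define a where "a = (1/2) * ((\<beta> x + \<beta> y) \<bullet> (y - x)) - (Um (k^2) y - Um (k^2) x)"
  define bb where "bb = (norm (\<beta> x))^2 - (norm (\<beta> y))^2"
  define c where "c = (\<beta> x + \<beta> y - 2 *\<^sub>R b y) \<bullet> ?s"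
  have Zz: "Z z = y - x + h *\<^sub>R \<beta> x" by (simp add: z Z_def drift_def)
  have g: "sqrt (gc TYPE('a) * k^2) = sqrt (gc TYPE('a)) * k" using k by (simp add: real_sqrt_mult)
  have sk: "sqrt (k^2) = k" using k by simp
  have bl: "norm (\<beta> y - \<beta> x) \<le> L * v" unfolding v_def by (rule bm_lip[OF spos])
  have eq: "Rx z + Z z \<bullet> ?s + 2 * h * ((?s - b y) \<bullet> ?s) + Um (k^2) x - Um (k^2) y
    = a + (h / 4) * bb + h * (norm ?s)^2 + h * c"
    unfolding Rx_def Zz using gibbs_exponent[of h y x "\<beta> x" "\<beta> y" ?s] hpos
    by (simp add: z a_def bb_def c_def power2_norm_eq_inner algebra_simps)
  have "a + (h / 4) * bb + h * (norm ?s)^2 + h * c \<ge> h * (1 - k) * (norm ?s)^2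
    - K1 * (k ^ 5 + k^2 * (norm (Z z))^2 + k ^ 5 * (norm (\<beta> x))^2 + (norm (Z z)) ^ 3 / k)" unfolding K1_def
  proof (rule step_error_bound[OF k L_nonneg])
    show "0 \<le> sqrt (gc TYPE('a))" using gc_pos[where 'a='a] by simp
    show "0 \<le> v" "0 \<le> norm (Z z)" "0 \<le> norm (\<beta> x)" "0 \<le> norm ?s" by (auto simp: v_def)
    have "y - x = Z z - h *\<^sub>R \<beta> x" by (simp add: Zz)
    then have "v \<le> norm (Z z) + norm (h *\<^sub>R \<beta> x)" unfolding v_def by (metis norm_triangle_ineq4)
    then show "v \<le> norm (Z z) + h * norm (\<beta> x)" by simp
    show "\<bar>a\<bar> \<le> L * v ^ 3 / k" using trapezoid_cubic[OF spos, of y x] unfolding sk by (simp add: a_def v_def)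
    show "\<bar>a\<bar> \<le> 2 * L * v^2" using trapezoid_quadratic[OF spos, of y x] by (simp add: a_def v_def)
    have n1: "\<bar>norm (\<beta> x) - norm (\<beta> y)\<bar> \<le> L * v" using bl norm_triangle_ineq3[of "\<beta> y" "\<beta> x"] by simp
    have "\<bar>bb\<bar> = \<bar>norm (\<beta> x) - norm (\<beta> y)\<bar> * (norm (\<beta> x) + norm (\<beta> y))"
    proof -
      have "bb = (norm (\<beta> x) - norm (\<beta> y)) * (norm (\<beta> x) + norm (\<beta> y))"
        by (simp add: bb_def power2_eq_square algebra_simps)
      then show ?thesis by (simp add: abs_mult)
    qed
    also have "... \<le> (L * v) * (2 * norm (\<beta> x) + L * v)" using n1 by (intro mult_mono) auto
    finally show "\<bar>bb\<bar> \<le> L * v * (2 * norm (\<beta> x) + L * v)" .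
    have "\<bar>c\<bar> \<le> norm (\<beta> x + \<beta> y - 2 *\<^sub>R b y) * norm ?s" unfolding c_def by (rule Cauchy_Schwarz_ineq2)
    also have "\<beta> x + \<beta> y - 2 *\<^sub>R b y = - (\<beta> y - \<beta> x) + 2 *\<^sub>R (\<beta> y - b y)" by (simp add: scaleR_2)
    also have "norm ... \<le> norm (\<beta> y - \<beta> x) + 2 * norm (\<beta> y - b y)"
      using norm_triangle_ineq[of "- (\<beta> y - \<beta> x)" "2 *\<^sub>R (\<beta> y - b y)"] by (simp add: norm_minus_commute)
    also have "... \<le> L * v + 2 * (L * (sqrt (gc TYPE('a)) * k))" using bl bm_close[OF spos, of y] unfolding g by simp
    finally show "\<bar>c\<bar> \<le> (L * v + 2 * (L * (sqrt (gc TYPE('a)) * k))) * norm ?s" by (simp add: mult_right_mono)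
  qed
  then show ?thesis using eq by (simp add: Err_def z)
qed

text \<open>Integrate \<open>pointwise\<close>: the two added terms cancel, and \<open>gibbs\<close>
  bounds the integral of \<open>Rx\<close> by the decrease of the entropy.\<close>

private lemma step_dissipation:
  "fenergy k q + h * (1 - k) * fisher q D \<le> fenergy k p + K1 * (1 + 6 * gc TYPE('a) + 2 * B0^2) * k ^ 5 * (1 + mom2 p)"
proof -
  let ?A = "\<lambda>z. (\<sigma> (snd z) - b (snd z)) \<bullet> \<sigma> (snd z)"
  have iU: "integrable lborel (\<lambda>x. p x * Um (k^2) x)" "integrable lborel (\<lambda>x. q x * Um (k^2) x)"
    using dens2_growth[OF p _ Um_growth[OF k]] dens2_growth[OF q_dens2 _ Um_growth[OF k]] by auto
  have iUQ: "integrable Q (\<lambda>z. Um (k^2) (fst z))" "integrable Q (\<lambda>z. Um (k^2) (snd z))"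
    using Q_fst(1)[of "Um (k^2)"] Q_snd(1)[of "Um (k^2)"] iU by auto
  have iT: "integrable Q (\<lambda>z. Z z \<bullet> \<sigma> (snd z))" "integrable Q (\<lambda>z. ?A z)"
    by (intro sqint_inner sqint_diff sqint_Q)+
  have iS: "integrable Q (\<lambda>z. (norm (\<sigma> (snd z)))^2)" using sqint_Q by (auto dest: sqintD)
  have lin: "(\<integral>z. f z + g z + c * e z + u z - w z \<partial>Q) = (\<integral>z. f z \<partial>Q) + ((\<integral>z. g z \<partial>Q) + c * (\<integral>z. e z \<partial>Q)) + (\<integral>z. u z \<partial>Q) - (\<integral>z. w z \<partial>Q)"
    if "integrable Q f" "integrable Q g" "integrable Q e" "integrable Q u" "integrable Q w" for f g e u w :: "'a \<times> 'a \<Rightarrow> real" and c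
    using that by simp
  have "h * (1 - k) * fisher q D - (\<integral>z. Err z \<partial>Q) = (\<integral>z. h * (1 - k) * (norm (\<sigma> (snd z)))^2 - Err z \<partial>Q)"
    using iS Err_integral(1) Q_snd(2)[of "\<lambda>y. (norm (\<sigma> y))^2"] by (simp add: fisher_def)
  also have "... \<le> (\<integral>z. Rx z + Z z \<bullet> \<sigma> (snd z) + 2 * h * (?A z) + Um (k^2) (fst z) - Um (k^2) (snd z) \<partial>Q)"
    by (intro integral_mono pointwise Bochner_Integration.integrable_add Bochner_Integration.integrable_diff
        integrable_mult_right Rx_integrable iT iUQ iS Err_integral(1))
  also have "... = (\<integral>z. Rx z \<partial>Q) + ((\<integral>z. Z z \<bullet> \<sigma> (snd z) \<partial>Q) + 2 * h * (\<integral>z. ?A z \<partial>Q))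
     + (\<integral>z. Um (k^2) (fst z) \<partial>Q) - (\<integral>z. Um (k^2) (snd z) \<partial>Q)"
    by (rule lin[OF Rx_integrable iT iUQ])
  also have "... = (\<integral>z. Rx z \<partial>Q) + (\<integral>z. Um (k^2) (fst z) \<partial>Q) - (\<integral>z. Um (k^2) (snd z) \<partial>Q)"
    unfolding tweedie by simp
  also have "... \<le> fenergy k p - fenergy k q"
    using gibbs Q_fst(2)[of "Um (k^2)"] Q_snd(2)[of "Um (k^2)"] Q_fst(2)[of "\<lambda>x. ln (p x)"] Q_snd(2)[of "\<lambda>x. ln (q x)"] by (simp add: fenergy_def)
  finally show ?thesis using Err_integral(2) by simp
qed

lemma step_summary:
  "regdens (stepd k p) (stepD k p)"
  "mom2 (stepd k p) \<le> mom2 p + (C1 + 2 * gc TYPE('a)) * k ^ 4 * (1 + mom2 p)"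
  "fenergy k (stepd k p) + k ^ 4 * (1 - k) * fisher (stepd k p) (stepD k p)
    \<le> fenergy k p + K1 * (1 + 6 * gc TYPE('a) + 2 * B0^2) * k ^ 5 * (1 + mom2 p)"
  "distr (Mp \<Otimes>\<^sub>M gaussM (2 * k ^ 4)) borel (\<lambda>(x, z). drift k x + z) = edensity lborel (stepd k p)"
proof -
  show "regdens (stepd k p) (stepD k p)" unfolding stepd_def stepD_def by (rule gm.regdens_q)
  show "fenergy k (stepd k p) + k ^ 4 * (1 - k) * fisher (stepd k p) (stepD k p)
    \<le> fenergy k p + K1 * (1 + 6 * gc TYPE('a) + 2 * B0^2) * k ^ 5 * (1 + mom2 p)"
    unfolding stepd_def stepD_def by (rule step_dissipation)
  show "distr (Mp \<Otimes>\<^sub>M gaussM (2 * k ^ 4)) borel (\<lambda>(x, z). drift k x + z) = edensity lborel (stepd k p)"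
    unfolding stepd_def by (rule gm.distr_mixture)
  have "2 * gc TYPE('a) * h \<le> 2 * gc TYPE('a) * h * (1 + mom2 p)"
    using mult_left_mono[of 1 "1 + mom2 p" "2 * gc TYPE('a) * h"] mom2_nonneg[OF p] gc_pos[where 'a='a] by simp
  then show "mom2 (stepd k p) \<le> mom2 p + (C1 + 2 * gc TYPE('a)) * k ^ 4 * (1 + mom2 p)"
    using gm.q_moment_le T2_Mp(2) unfolding stepd_def mom2_def[of q] by (simp add: algebra_simps)
qed

end

lemma euler_step:
  obtains K where "K \<ge> 0"
    "\<And>k p. 0 < k \<Longrightarrow> k \<le> 1 \<Longrightarrow> dens2 p \<Longrightarrow> mom2 (stepd k p) \<le> mom2 p + K * k ^ 4 * (1 + mom2 p)"
    "\<And>k p. 0 < k \<Longrightarrow> k \<le> 1 \<Longrightarrow> dens2 p \<Longrightarrow> fenergy k (stepd k p) + k ^ 4 * (1 - k) * fisher (stepd k p) (stepD k p)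
      \<le> fenergy k p + K * k ^ 5 * (1 + mom2 p)"
proof -
  define Ka where "Ka = C1 + 2 * gc TYPE('a)"
  define Kb where "Kb = K1 * (1 + 6 * gc TYPE('a) + 2 * B0^2)"
  have nn: "Ka \<ge> 0" "Kb \<ge> 0" using C1_nonneg K1_nonneg gc_pos[where 'a='a] by (auto simp: Ka_def Kb_def)
  show thesis
  proof (rule that[of "Ka + Kb"])
    show "0 \<le> Ka + Kb" using nn by simp
    fix k :: real and p :: "'a \<Rightarrow> real" assume k: "0 < k" "k \<le> 1" and p: "dens2 p"
    have m: "mom2 p \<ge> 0" by (rule mom2_nonneg[OF p])
    have "Ka * (k ^ 4 * (1 + mom2 p)) \<le> (Ka + Kb) * (k ^ 4 * (1 + mom2 p))" using nn m k by simp
    then show "mom2 (stepd k p) \<le> mom2 p + (Ka + Kb) * k ^ 4 * (1 + mom2 p)"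
      using step_summary(2)[OF k p] unfolding Ka_def[symmetric] by simp
    have "Kb * (k ^ 5 * (1 + mom2 p)) \<le> (Ka + Kb) * (k ^ 5 * (1 + mom2 p))" using nn m k by simp
    then show "fenergy k (stepd k p) + k ^ 4 * (1 - k) * fisher (stepd k p) (stepD k p)
      \<le> fenergy k p + (Ka + Kb) * k ^ 5 * (1 + mom2 p)" using step_summary(3)[OF k p] unfolding Kb_def[symmetric] by simp
  qed
qed

end

section \<open>Iteration of the one-step estimate\<close>

lemma recursion_decay:
  fixes a :: "nat \<Rightarrow> real"
  assumes "\<theta> \<ge> 0" and "\<And>j. j < n \<Longrightarrow> (a (Suc j) - c) * (1 + \<theta>) \<le> a j - c" and "j \<le> n"
  shows "(a j - c) * (1 + \<theta>) ^ j \<le> a 0 - c" using assms(3)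
proof (induction j)
  case (Suc j)
  have "(a (Suc j) - c) * (1 + \<theta>) ^ Suc j \<le> (a j - c) * (1 + \<theta>) ^ j" using Suc assms(1,2) by simp
  then show ?case using Suc by simp
qed simp

lemma discrete_gronwall:
  fixes e :: "nat \<Rightarrow> real"
  assumes L: "L \<ge> 0" and h: "h > 0" and \<eta>: "\<eta> > 0" and e0: "e 0 = 0"
    and step: "\<And>j. j < n \<Longrightarrow> e (Suc j) \<le> (1 + L * h) * e j + h * \<eta>" and "j \<le> n"
  shows "e j \<le> exp (L * (real j * h)) * (real j * h * \<eta>)" using assms(6)
proof (induction j)
  case (Suc j)
  let ?E = "exp (L * (real j * h))"
  have E: "exp (L * h) * ?E = exp (L * (real (Suc j) * h))" by (simp add: exp_add[symmetric] algebra_simps)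
  have nn: "0 \<le> 1 + L * h" and jn: "j < n" "j \<le> n" using L h Suc.prems by auto
  have "e (Suc j) \<le> (1 + L * h) * (?E * (real j * h * \<eta>)) + h * \<eta>"
    using step[OF jn(1)] mult_left_mono[OF Suc.IH[OF jn(2)] nn] by simp
  also have "... \<le> exp (L * h) * (?E * (real j * h * \<eta>)) + (exp (L * h) * ?E) * (h * \<eta>)"
  proof (intro add_mono mult_right_mono)
    show "0 \<le> ?E * (real j * h * \<eta>)" using h \<eta> by simp
    have "1 \<le> exp (L * (real (Suc j) * h))" using L h by simp
    then have "1 * (h * \<eta>) \<le> (exp (L * h) * ?E) * (h * \<eta>)" unfolding E using h \<eta> by simp
    then show "h * \<eta> \<le> (exp (L * h) * ?E) * (h * \<eta>)" by simp
  qed simp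
  also have "... = (exp (L * h) * ?E) * (real (Suc j) * h * \<eta>)" by (simp add: algebra_simps)
  finally show ?case unfolding E .
qed (simp add: e0)

lemma exp_limit_aux:
  fixes \<kappa> T :: real
  assumes "\<kappa> > 0" "T > 0"
  shows "(\<lambda>n. (1 + \<kappa> * (T / real n) * (1 - (T / real n) powr (1/4))) ^ n) \<longlonglongrightarrow> exp (\<kappa> * T)"
  using assms by real_asymp

context potential
begin

definition free :: "('a \<Rightarrow> real) \<Rightarrow> real" where
  "free p = (LBINT x. p x * ln (p x)) + (LBINT x. p x * U x)"

lemma fenergy_free:
  assumes k: "0 < k" "k \<le> 1" and p: "dens2 p"
  shows "\<bar>fenergy k p - free p\<bar> \<le> L * gc TYPE('a) * k^2"
proof -
  have s: "k^2 > 0" using k by simp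
  note [measurable] = dens2D(1)[OF p] Um_measurable[OF s]
  have i: "integrable lborel (\<lambda>x. p x * Um (k^2) x)" "integrable lborel (\<lambda>x. p x * U x)"
    using dens2_growth[OF p _ Um_growth[OF k]] dens2_growth[OF p _ U_growth] by auto
  have "fenergy k p - free p = (LBINT x. p x * (Um (k^2) x - U x))"
    using i by (simp add: fenergy_def free_def right_diff_distrib)
  also have "\<bar>...\<bar> \<le> (LBINT x. \<bar>p x * (Um (k^2) x - U x)\<bar>)" by simp
  also have "... \<le> (LBINT x. p x * (L * gc TYPE('a) * k^2))"
  proof (rule integral_mono)
    show "integrable lborel (\<lambda>x. \<bar>p x * (Um (k^2) x - U x)\<bar>)"
      using i by (intro integrable_abs) (simp add: right_diff_distrib)
    show "integrable lborel (\<lambda>x. p x * (L * gc TYPE('a) * k^2))" using integral_dens2_one[OF p] by simp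
    show "\<bar>p x * (Um (k^2) x - U x)\<bar> \<le> p x * (L * gc TYPE('a) * k^2)" for x
      using Um_close[OF s, of x] dens2D(2)[OF p, of x] by (simp add: abs_mult mult_left_mono)
  qed
  also have "... = L * gc TYPE('a) * k^2" using integral_dens2_one[OF p] by simp
  finally show ?thesis .
qed

lemma dens2_iterate:
  assumes k: "0 < k" "k \<le> 1" and p: "dens2 p"
  shows "dens2 ((stepd k ^^ j) p)"
proof (induction j)
  case (Suc j)
  show ?case using step_summary(1)[OF k Suc.IH] by (simp add: regdens_def)
qed (use p in simp)

text \<open>A step of size \<open>h = k^4\<close> uses the potential mollified at variance \<open>k^2\<close>; the errors per step are then
  of order \<open>h * k\<close>, so they vanish after \<open>T / h\<close> steps.\<close>

lemma discrete_decay: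
  assumes \<kappa>: "\<kappa> > 0" and T: "T > 0" and p: "dens2 p"
    and ineq: "\<And>p D. regdens p D \<Longrightarrow> fisher p D \<ge> \<kappa> * (free p - c)"
  defines "k \<equiv> \<lambda>n. (T / real n) powr (1/4)"
  obtains B m where "B \<longlonglongrightarrow> c + (free p - c) * exp (- \<kappa> * T)"
    "eventually (\<lambda>n. 0 < k n \<and> k n \<le> 1 \<and> free ((stepd (k n) ^^ n) p) \<le> B n \<and> mom2 ((stepd (k n) ^^ n) p) \<le> m) sequentially"
proof -
  obtain K where K: "K \<ge> 0"
    "\<And>k p. 0 < k \<Longrightarrow> k \<le> 1 \<Longrightarrow> dens2 p \<Longrightarrow> mom2 (stepd k p) \<le> mom2 p + K * k ^ 4 * (1 + mom2 p)"
    "\<And>k p. 0 < k \<Longrightarrow> k \<le> 1 \<Longrightarrow> dens2 p \<Longrightarrow> fenergy k (stepd k p) + k ^ 4 * (1 - k) * fisher (stepd k p) (stepD k p)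
      \<le> fenergy k p + K * k ^ 5 * (1 + mom2 p)" using euler_step by auto
  define m where "m = exp (K * T) * (1 + mom2 p)"
  define \<delta> where "\<delta> n = L * gc TYPE('a) * (k n)^2" for n
  \<comment> \<open>The level c is raised by the mollification error \<open>\<delta>\<close> and by
    the fixed point of the affine recursion. The distance of \<open>fenergy\<close> to the raised
    level then shrinks by the factor \<open>1 / (1 + \<theta>)\<close> per step without an error
    term; both shifts vanish as n grows.\<close>
  define c' where "c' n = c + \<delta> n + k n * K * m / (\<kappa> * (1 - k n))" for n
  define B where "B n = \<delta> n + c' n + (free p + \<delta> n - c' n) / (1 + \<kappa> * (T / real n) * (1 - k n)) ^ n" for n
  have k0: "k \<longlonglongrightarrow> 0" unfolding k_def using T by real_asymp
  have \<delta>0: "\<delta> \<longlonglongrightarrow> L * gc TYPE('a) * 0^2" unfolding \<delta>_def by (intro tendsto_intros k0)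
  have c0: "c' \<longlonglongrightarrow> c + L * gc TYPE('a) * 0^2 + 0 * K * m / (\<kappa> * (1 - 0))"
    unfolding c'_def using \<kappa> by (intro tendsto_intros k0 \<delta>0) auto
  have "B \<longlonglongrightarrow> 0 + c + (free p + 0 - c) / exp (\<kappa> * T)"
    unfolding B_def using exp_limit_aux[OF \<kappa> T] \<delta>0 c0 by (intro tendsto_intros) (auto simp: k_def)
  then have B: "B \<longlonglongrightarrow> c + (free p - c) * exp (- \<kappa> * T)" by (simp add: exp_minus divide_inverse)
  have ev: "eventually (\<lambda>n. k n < 1) sequentially" using k0 by (rule order_tendstoD) simp
  have "eventually (\<lambda>n. 0 < k n \<and> k n \<le> 1 \<and> free ((stepd (k n) ^^ n) p) \<le> B n \<and> mom2 ((stepd (k n) ^^ n) p) \<le> m) sequentially"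
    using ev eventually_gt_at_top[of 0]
  proof eventually_elim
    fix n :: nat assume n: "k n < 1" "0 < n"
    let ?k = "k n"
    have kp: "0 < ?k" "?k \<le> 1" using n T by (auto simp: k_def)
    have k4: "?k ^ 4 = T / real n" using n T by (simp add: k_def powr_powr powr_realpow[symmetric])
    define P where "P j = (stepd ?k ^^ j) p" for j
    have PS: "P (Suc j) = stepd ?k (P j)" for j by (simp add: P_def)
    have dP: "dens2 (P j)" for j unfolding P_def by (rule dens2_iterate[OF kp p])
    have mj: "1 + mom2 (P j) \<le> (1 + K * ?k ^ 4) ^ j * (1 + mom2 p)" for j
    proof (induction j)
      case (Suc j)
      have "1 + mom2 (P (Suc j)) \<le> (1 + K * ?k ^ 4) * (1 + mom2 (P j))"
        using K(2)[OF kp dP[of j]] unfolding PS by (simp add: algebra_simps)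
      also have "... \<le> (1 + K * ?k ^ 4) * ((1 + K * ?k ^ 4) ^ j * (1 + mom2 p))"
        using Suc K(1) by (intro mult_left_mono) auto
      finally show ?case by simp
    qed (simp add: P_def)
    have mb: "1 + mom2 (P j) \<le> m" if "j \<le> n" for j
    proof -
      have "(1 + K * ?k ^ 4) ^ j \<le> (1 + K * ?k ^ 4) ^ n" using that K(1) by (intro power_increasing) auto
      also have "... \<le> exp (K * ?k ^ 4) ^ n" using K(1) by (intro power_mono) auto
      also have "... = exp (K * T)" using n by (simp add: exp_of_nat_mult[symmetric] k4)
      finally have "(1 + K * ?k ^ 4) ^ j * (1 + mom2 p) \<le> m" unfolding m_def using mom2_nonneg[OF p] by simp
      then show ?thesis using mj[of j] by simp
    qed
    define \<theta> where "\<theta> = \<kappa> * ?k ^ 4 * (1 - ?k)"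
    have \<theta>: "\<theta> > 0" using \<kappa> kp n by (simp add: \<theta>_def)
    define r where "r = ?k * K * m / (\<kappa> * (1 - ?k))"
    have c'r: "c' n = c + \<delta> n + r" by (simp add: c'_def r_def)
    have rec: "(fenergy ?k (P (Suc j)) - c' n) * (1 + \<theta>) \<le> fenergy ?k (P j) - c' n" if "j < n" for j
    proof -
      have rd: "regdens (P (Suc j)) (stepD ?k (P j))" unfolding PS by (rule step_summary(1)[OF kp dP])
      have "\<kappa> * (fenergy ?k (P (Suc j)) - \<delta> n - c) \<le> \<kappa> * (free (P (Suc j)) - c)"
        using fenergy_free[OF kp dP[of "Suc j"]] \<kappa> by (simp add: \<delta>_def)
      also have "... \<le> fisher (P (Suc j)) (stepD ?k (P j))" by (rule ineq[OF rd])
      finally have "?k ^ 4 * (1 - ?k) * (\<kappa> * (fenergy ?k (P (Suc j)) - \<delta> n - c)) \<le> ?k ^ 4 * (1 - ?k) * fisher (P (Suc j)) (stepD ?k (P j))"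
        using kp n by simp
      then have 1: "fenergy ?k (P (Suc j)) + \<theta> * (fenergy ?k (P (Suc j)) - \<delta> n - c) \<le> fenergy ?k (P j) + K * ?k ^ 5 * (1 + mom2 (P j))"
        using K(3)[OF kp dP[of j]] unfolding PS[symmetric] by (simp add: \<theta>_def mult_ac)
      have "K * ?k ^ 5 * (1 + mom2 (P j)) \<le> K * ?k ^ 5 * m" using mb[of j] that K(1) kp by (intro mult_left_mono) auto
      also have "... = \<theta> * r" using \<kappa> n by (simp add: eval_nat_numeral \<theta>_def r_def)
      finally show ?thesis using 1 by (simp add: c'r algebra_simps)
    qed
    have "fenergy ?k (P n) - c' n \<le> (free p + \<delta> n - c' n) / (1 + \<theta>) ^ n"
      using recursion_decay[of \<theta> n "\<lambda>j. fenergy ?k (P j)" "c' n" n] \<theta> rec fenergy_free[OF kp p] by (simp add: P_def \<delta>_def pos_le_divide_eq)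
    moreover have "free (P n) \<le> fenergy ?k (P n) + \<delta> n" using fenergy_free[OF kp dP[of n]] by (simp add: \<delta>_def)
    ultimately have "free (P n) \<le> B n" unfolding B_def \<theta>_def k4 by simp
    then show "0 < k n \<and> k n \<le> 1 \<and> free ((stepd (k n) ^^ n) p) \<le> B n \<and> mom2 ((stepd (k n) ^^ n) p) \<le> m"
      using kp mb[of n] unfolding P_def by simp
  qed
  with B show thesis by (rule that)
qed

section \<open>Passage to continuous time\<close>

fun euler :: "real \<Rightarrow> 'a \<Rightarrow> (nat \<Rightarrow> 'a) \<Rightarrow> nat \<Rightarrow> 'a" where
  "euler k x d 0 = x"
| "euler k x d (Suc j) = drift k (euler k x d j) + d j"

lemma drift_continuous: "0 < k \<Longrightarrow> continuous_on A (drift k)"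
  unfolding drift_def[abs_def] by (intro continuous_intros bm_continuous) auto

text \<open>A pathwise statement: the noise is additive and the scheme uses the exact increments of
  w, so w cancels in the equation for the error. Uniform continuity of the path, the Lipschitz drift
  and \<open>bm_close\<close> leave a local error \<open>?h * \<eta>\<close> for the discrete
  Gronwall inequality.\<close>

lemma euler_converges:
  fixes x w :: "real \<Rightarrow> 'a"
  assumes T: "T > 0" and cont: "continuous_on {t0..t0 + T} x"
    and sol: "\<And>t. t0 \<le> t \<Longrightarrow> t \<le> t0 + T \<Longrightarrow> x t = x t0 - integral {t0..t} (\<lambda>s. b (x s)) + (w t - w t0)"
  defines "k \<equiv> \<lambda>n. (T / real n) powr (1/4)"
  shows "(\<lambda>n. euler (k n) (x t0) (\<lambda>j. w (t0 + real (Suc j) * (T / n)) - w (t0 + real j * (T / n))) n) \<longlonglongrightarrow> x (t0 + T)"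
proof (rule LIMSEQ_I)
  let ?B = "\<lambda>n t0. euler (k n) (x t0) (\<lambda>j. w (t0 + real (Suc j) * (T / n)) - w (t0 + real j * (T / n))) n - x (t0 + T)"
  let ?A = "\<lambda>s. b (x s)"
  fix e :: real assume e: "e > 0"
  define g where "g n = L * sqrt (gc TYPE('a) * (k n)^2)" for n
  have k0: "k \<longlonglongrightarrow> 0" unfolding k_def using T by real_asymp
  have "g \<longlonglongrightarrow> L * sqrt (gc TYPE('a) * 0^2)" unfolding g_def by (intro tendsto_intros k0)
  then have g0: "g \<longlonglongrightarrow> 0" by simp
  \<comment> \<open>The Gronwall bound at the final time is
    \<open>exp (L * T) * (T * \<eta>)\<close>, hence at most \<open>e / 2\<close>.\<close>
  define \<eta> where "\<eta> = e / (2 * (T * exp (L * T) + 1))"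
  have Te: "T * exp (L * T) + 1 > 0" using T by (simp add: add_pos_pos)
  have \<eta>: "\<eta> > 0" using e Te by (simp add: \<eta>_def)
  have "uniformly_continuous_on {t0..t0 + T} x" using cont by (intro compact_uniformly_continuous) auto
  moreover have "\<eta> / (2 * (L + 1)) > 0" using \<eta> L_nonneg by simp
  ultimately obtain d where d: "d > 0" "\<And>s r. s \<in> {t0..t0 + T} \<Longrightarrow> r \<in> {t0..t0 + T} \<Longrightarrow> dist r s < d \<Longrightarrow> dist (x r) (x s) < \<eta> / (2 * (L + 1))"
    unfolding uniformly_continuous_on_def by auto
  have e1: "eventually (\<lambda>n. g n < \<eta> / 2) sequentially" using g0 \<eta> by (intro order_tendstoD) auto
  have e2: "eventually (\<lambda>n. T / real n < d) sequentially" using d(1) by real_asymp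
  have "eventually (\<lambda>n. norm (?B n t0) < e) sequentially" using e1 e2 eventually_gt_at_top[of 0]
  proof eventually_elim
    fix n :: nat assume n: "g n < \<eta> / 2" "T / real n < d" "0 < n"
    let ?h = "T / real n"
    have h: "?h > 0" using n T by simp
    have kp: "k n > 0" using n T by (simp add: k_def)
    have k4: "k n ^ 4 = ?h" using n T by (simp add: k_def powr_powr powr_realpow[symmetric])
    define t where "t j = t0 + real j * ?h" for j
    define y where "y = euler (k n) (x t0) (\<lambda>j. w (t (Suc j)) - w (t j))"
    have tin: "t j \<in> {t0..t0 + T}" if "j \<le> n" for j
    proof -
      have "real j * ?h \<le> real n * ?h" using that h by (intro mult_right_mono) auto
      then show ?thesis using n T by (simp add: t_def)
    qed
    have tn: "t n = t0 + T" using n by (simp add: t_def)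
    have bx: "continuous_on {t0..t0 + T} ?A" by (rule continuous_on_compose2[OF b_continuous[of UNIV] cont]) auto
    have step: "norm (y (Suc j) - x (t (Suc j))) \<le> (1 + L * ?h) * norm (y j - x (t j)) + ?h * \<eta>" if j: "j < n" for j
    proof -
      have t4: "t (Suc j) = t j + ?h" by (simp add: t_def distrib_right add_divide_distrib)
      have tj: "t j \<in> {t0..t0 + T}" "t (Suc j) \<in> {t0..t0 + T}" "t j \<le> t (Suc j)" "t (Suc j) = t j + ?h"
        using tin[of j] tin[of "Suc j"] j t4 by auto
      have i: "?A integrable_on {t0..t (Suc j)}"
        using bx tj by (intro integrable_continuous_interval) (auto elim: continuous_on_subset)
      have ii: "?A integrable_on {t j..t (Suc j)}"
        using bx tj by (intro integrable_continuous_interval) (auto elim: continuous_on_subset)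
      have isum: "integral {t0..t (Suc j)} ?A = integral {t0..t j} ?A + integral {t j..t (Suc j)} ?A"
        using tj i by (intro Henstock_Kurzweil_Integration.integral_combine[symmetric]) auto
      then have xs: "x (t (Suc j)) = x (t j) - integral {t j..t (Suc j)} ?A + (w (t (Suc j)) - w (t j))"
      proof -
        have b1: "t0 \<le> t j" "t j \<le> t0 + T" "t0 \<le> t (Suc j)" "t (Suc j) \<le> t0 + T" using tj(1,2) by auto
        show ?thesis unfolding sol[OF b1(1,2)] sol[OF b1(3,4)] isum by simp
      qed
      have ic: "integral {t j..t (Suc j)} (\<lambda>s. bm ((k n)^2) (y j)) = ?h *\<^sub>R bm ((k n)^2) (y j)"
        using tj by simp
      have idiff: "integral {t j..t (Suc j)} (\<lambda>s. b (x s) - bm ((k n)^2) (y j)) = integral {t j..t (Suc j)} ?A - ?h *\<^sub>R bm ((k n)^2) (y j)"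
        unfolding ic[symmetric] by (rule Henstock_Kurzweil_Integration.integral_diff[OF ii]) auto
      have yS: "y (Suc j) = y j - ?h *\<^sub>R bm ((k n)^2) (y j) + (w (t (Suc j)) - w (t j))"
        by (simp add: y_def drift_def k4)
      have "y (Suc j) - x (t (Suc j)) = (y j - x (t j)) + integral {t j..t (Suc j)} (\<lambda>s. b (x s) - bm ((k n)^2) (y j))"
        unfolding yS xs idiff by simp
      then have "norm (y (Suc j) - x (t (Suc j))) \<le> norm (y j - x (t j)) + norm (integral {t j..t (Suc j)} (\<lambda>s. b (x s) - bm ((k n)^2) (y j)))"
        by (simp add: norm_triangle_ineq)
      also have "norm (integral {t j..t (Suc j)} (\<lambda>s. b (x s) - bm ((k n)^2) (y j))) \<le> (L * norm (y j - x (t j)) + \<eta>) * (t (Suc j) - t j)"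
      proof (rule integral_bound)
        show "t j \<le> t (Suc j)" by (rule tj)
        show "continuous_on {t j..t (Suc j)} (\<lambda>s. b (x s) - bm ((k n)^2) (y j))"
          using bx tj by (intro continuous_intros) (auto elim: continuous_on_subset)
        fix s assume s: "s \<in> {t j..t (Suc j)}"
        have "dist (x s) (x (t j)) < \<eta> / (2 * (L + 1))" using s tj n by (intro d) (auto simp: dist_real_def)
        then have "L * norm (x s - x (t j)) \<le> L * (\<eta> / (2 * (L + 1)))"
          using L_nonneg by (intro mult_left_mono) (auto simp: dist_norm)
        also have "... \<le> \<eta> / 2" using L_nonneg \<eta> by (simp add: field_simps)
        finally have 1: "L * norm (x s - x (t j)) \<le> \<eta> / 2" .
        show "norm (b (x s) - bm ((k n)^2) (y j)) \<le> L * norm (y j - x (t j)) + \<eta>"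
          using norm_triangle_ineq[of "b (x s) - b (x (t j)) + (b (x (t j)) - b (y j))" "b (y j) - bm ((k n)^2) (y j)"] norm_triangle_ineq[of "b (x s) - b (x (t j))" "b (x (t j)) - b (y j)"] b_lip[of "x s" "x (t j)"] 1 b_lip[of "x (t j)" "y j"] bm_close[of "(k n)^2" "y j"] kp n by (simp add: norm_minus_commute g_def)
      qed
      finally show ?thesis using tj by (simp add: algebra_simps)
    qed
    have "norm (y n - x (t n)) \<le> exp (L * (real n * ?h)) * (real n * ?h * \<eta>)"
      by (rule discrete_gronwall[where n=n]) (use L_nonneg h \<eta> step in \<open>auto simp: y_def t_def\<close>)
    then have "norm (y n - x (t0 + T)) \<le> exp (L * T) * (T * \<eta>)" using n by (simp add: tn)
    also have "... \<le> (T * exp (L * T) + 1) * \<eta>" using \<eta> by simp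
    also have "... = e / 2"
    proof -
      have "y * (e / (2 * y)) = e / 2" if "y > 0" for y :: real using that by simp
      from this[OF Te] show ?thesis unfolding \<eta>_def .
    qed
    also have "... < e" using e by simp
    finally show "norm (?B n t0) < e" by (simp add: y_def t_def)
  qed
  then show "\<exists>no. \<forall>n\<ge>no. norm (?B n t0) < e" by (simp add: eventually_sequentially)
qed

text \<open>Only the independence of the current position from the next increment enters, because
  the next law depends on the joint law of these two alone.\<close>

lemma law_euler:
  fixes M :: "'w measure" and Y0 :: "'w \<Rightarrow> 'a" and d :: "nat \<Rightarrow> 'w \<Rightarrow> 'a"
  assumes M: "prob_space M" and k: "0 < k" "k \<le> 1" and p: "dens2 p"
    and Y0: "Y0 \<in> borel_measurable M" "distr M borel Y0 = edensity lborel p"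
    and d: "\<And>j. j < n \<Longrightarrow> d j \<in> borel_measurable M" "\<And>j. j < n \<Longrightarrow> distr M borel (d j) = gaussM (2 * k ^ 4)"
    and ind: "\<And>j. j < n \<Longrightarrow> prob_space.indep_var M borel (\<lambda>\<omega>. euler k (Y0 \<omega>) (\<lambda>j. d j \<omega>) j) borel (d j)"
    and j: "j \<le> n"
  shows "(\<lambda>\<omega>. euler k (Y0 \<omega>) (\<lambda>j. d j \<omega>) j) \<in> borel_measurable M \<and>
    distr M borel (\<lambda>\<omega>. euler k (Y0 \<omega>) (\<lambda>j. d j \<omega>) j) = edensity lborel ((stepd k ^^ j) p)"
  using j
proof (induction j)
  case 0 show ?case using Y0 by simp
next
  case (Suc j)
  interpret prob_space M by (rule M)
  let ?Y = "\<lambda>\<omega>. euler k (Y0 \<omega>) (\<lambda>j. d j \<omega>) j"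
  let ?p = "(stepd k ^^ j) p"
  have [measurable]: "?Y \<in> borel_measurable M" "d j \<in> borel_measurable M" using Suc d by auto
  note [measurable] = drift_measurable[OF k(1)]
  have dp: "dens2 ?p" by (rule dens2_iterate[OF k p])
  have joint: "distr M (borel \<Otimes>\<^sub>M borel) (\<lambda>\<omega>. (?Y \<omega>, d j \<omega>)) = edensity lborel ?p \<Otimes>\<^sub>M gaussM (2 * k ^ 4)"
    using indep_var_distribution_eq[of borel ?Y borel "d j"] ind[of j] Suc d(2)[of j] by simp
  have "distr M borel (\<lambda>\<omega>. drift k (?Y \<omega>) + d j \<omega>) = distr (distr M (borel \<Otimes>\<^sub>M borel) (\<lambda>\<omega>. (?Y \<omega>, d j \<omega>))) borel (\<lambda>(x, z). drift k x + z)"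
    by (subst distr_distr) (auto simp: comp_def)
  also have "... = edensity lborel (stepd k ?p)" unfolding joint by (rule step_summary(4)[OF k dp])
  finally show ?case by simp
qed

end

section \<open>Limits of laws and lower semicontinuity of relative entropy\<close>

lemma open_indicator_limit:
  fixes V :: "'a::euclidean_space set"
  assumes V: "open V"
  obtains f :: "nat \<Rightarrow> 'a \<Rightarrow> real" where "\<And>n. continuous_on UNIV (f n)" "\<And>n x. 0 \<le> f n x" "\<And>n x. f n x \<le> 1"
    "\<And>x. (\<lambda>n. f n x) \<longlonglongrightarrow> indicator V x"
proof
  define f where "f n x = (if V = UNIV then 1 else min 1 (real n * infdist x (- V)))" for n :: nat and x
  show "continuous_on UNIV (f n)" for n unfolding f_def by (cases "V = UNIV") (auto intro!: continuous_intros)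
  show "0 \<le> f n x" "f n x \<le> 1" for n x by (auto simp: f_def infdist_nonneg)
  show "(\<lambda>n. f n x) \<longlonglongrightarrow> indicator V x" for x
  proof (cases "V = UNIV")
    case False
    then have ne: "- V \<noteq> {}" by auto
    show ?thesis
    proof (cases "x \<in> V")
      case True
      have pos: "infdist x (- V) > 0"
        using in_closed_iff_infdist_zero[of "- V" x] V ne True infdist_nonneg[of x "- V"] by force
      obtain n0 :: nat where n0: "1 / infdist x (- V) < real n0" using reals_Archimedean2 by auto
      have "f n x = 1" if "n \<ge> n0" for n
      proof -
        have "1 / infdist x (- V) \<le> real n" using that n0 by simp
        then have "1 \<le> real n * infdist x (- V)" using pos by (simp add: pos_divide_le_eq)
        then show ?thesis by (simp add: f_def)
      qed
      then have "eventually (\<lambda>n. f n x = 1) sequentially" by (auto simp: eventually_sequentially)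
      then show ?thesis using True by (simp add: tendsto_eventually)
    next
      case f: False
      then show ?thesis using False by (simp add: f_def)
    qed
  qed (simp add: f_def)
qed

lemma nn_integral_bounded_limit:
  fixes u :: "nat \<Rightarrow> 'a \<Rightarrow> ennreal"
  assumes M: "finite_measure M" and [measurable]: "\<And>n. u n \<in> borel_measurable M" "v \<in> borel_measurable M"
    and lim: "AE x in M. (\<lambda>n. u n x) \<longlonglongrightarrow> v x" and bd: "\<And>n x. u n x \<le> 1"
  shows "(\<lambda>n. \<integral>\<^sup>+x. u n x \<partial>M) \<longlonglongrightarrow> (\<integral>\<^sup>+x. v x \<partial>M)"
  by (rule nn_integral_dominated_convergence[where w="\<lambda>_. 1"])
    (use finite_measure.emeasure_finite[OF M, of "space M"] lim bd in \<open>auto simp: less_top\<close>)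

lemma finite_measure_eqI_continuous:
  fixes M N :: "'a::euclidean_space measure"
  assumes fin: "finite_measure M" "finite_measure N" and sets: "sets M = sets borel" "sets N = sets borel"
    and eq: "\<And>f::'a \<Rightarrow> real. continuous_on UNIV f \<Longrightarrow> (\<And>x. 0 \<le> f x) \<Longrightarrow> (\<And>x. f x \<le> 1) \<Longrightarrow>
      (\<integral>\<^sup>+x. ennreal (f x) \<partial>M) = (\<integral>\<^sup>+x. ennreal (f x) \<partial>N)"
  shows "M = N"
proof (rule measure_eqI_generator_eq[where E="{V. open V}" and \<Omega>=UNIV and A="\<lambda>_. UNIV"])
  interpret M: finite_measure M by fact
  interpret N: finite_measure N by fact
  show "Int_stable {V::'a set. open V}" by (auto simp: Int_stable_def)
  show "sets M = sigma_sets UNIV {V. open V}" "sets N = sigma_sets UNIV {V. open V}" using sets by (simp_all add: borel_def)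
  show "emeasure M UNIV \<noteq> \<infinity>" by simp
  fix V :: "'a set" assume "V \<in> {V. open V}"
  then have V: "open V" by simp
  have [measurable]: "V \<in> sets borel" using V by simp
  obtain f :: "nat \<Rightarrow> 'a \<Rightarrow> real" where f: "\<And>n. continuous_on UNIV (f n)" "\<And>n x. 0 \<le> f n x" "\<And>n x. f n x \<le> 1"
    "\<And>x. (\<lambda>n. f n x) \<longlonglongrightarrow> indicator V x" using open_indicator_limit[OF V] by auto
  have [measurable]: "f n \<in> borel_measurable borel" for n by (intro borel_measurable_continuous_onI f)
  have lim: "(\<lambda>n. \<integral>\<^sup>+x. ennreal (f n x) \<partial>R) \<longlonglongrightarrow> emeasure R V" if R: "finite_measure R" "sets R = sets borel" for R
  proof -
    note [measurable_cong] = R(2)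
    have "(\<lambda>n. \<integral>\<^sup>+x. ennreal (f n x) \<partial>R) \<longlonglongrightarrow> (\<integral>\<^sup>+x. ennreal (indicator V x) \<partial>R)"
      by (rule nn_integral_bounded_limit[OF R(1)]) (use f in auto)
    then show ?thesis by (simp add: ennreal_indicator)
  qed
  show "emeasure M V = emeasure N V"
    using lim[OF fin(1) sets(1)] lim[OF fin(2) sets(2)] eq[OF f(1,2,3)] by (simp add: LIMSEQ_unique)
qed auto

text \<open>Independence is a product form of the joint law, and it passes to the limit when tested
  with bounded continuous functions, by dominated convergence first in the inner integral g and then
  in the outer one.\<close>

lemma (in prob_space) indep_var_limit:
  fixes Y :: "'a \<Rightarrow> 'b::euclidean_space" and Z :: "'a \<Rightarrow> 'b"
  assumes ind: "\<And>n. indep_var borel (Yn n) borel Z" and Y [measurable]: "Y \<in> borel_measurable M"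
    and lim: "AE w in M. (\<lambda>n. Yn n w) \<longlonglongrightarrow> Y w"
  shows "indep_var borel Y borel Z"
proof -
  have [measurable]: "Yn n \<in> borel_measurable M" "Z \<in> borel_measurable M" for n
    using ind[of n] by (simp_all add: indep_var_distribution_eq)
  interpret DY: prob_space "distr M borel Y" by (rule prob_space_distr) measurable
  interpret DZ: prob_space "distr M borel Z" by (rule prob_space_distr) measurable
  interpret DP: pair_prob_space "distr M borel Y" "distr M borel Z" ..
  have "distr M borel (\<lambda>w. (Y w, Z w)) = distr M borel Y \<Otimes>\<^sub>M distr M borel Z"
  proof (rule finite_measure_eqI_continuous)
    fix f :: "'b \<times> 'b \<Rightarrow> real" assume f: "continuous_on UNIV f" "\<And>x. 0 \<le> f x" "\<And>x. f x \<le> 1"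
    have [measurable]: "f \<in> borel_measurable (borel \<Otimes>\<^sub>M borel)"
      using borel_measurable_continuous_onI[OF f(1)] by (simp add: borel_prod)
    define g where "g y = (\<integral>\<^sup>+z. ennreal (f (y, z)) \<partial>distr M borel Z)" for y
    have [measurable]: "g \<in> borel_measurable borel" unfolding g_def by simp
    have lims: "(\<lambda>n. f (y n, z)) \<longlonglongrightarrow> f (l, z)" if "y \<longlonglongrightarrow> l" for y l z
      by (rule continuous_on_tendsto_compose[OF f(1) tendsto_Pair[OF that]]) auto
    have g1: "g y \<le> 1" for y
      using nn_integral_mono[of "distr M borel Z" "\<lambda>z. ennreal (f (y, z))" "\<lambda>_. 1"] DZ.emeasure_space_1 f(3) by (simp add: g_def)
    have gl: "(\<lambda>n. g (y n)) \<longlonglongrightarrow> g l" if "y \<longlonglongrightarrow> l" for y l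
      unfolding g_def by (rule nn_integral_bounded_limit[OF DZ.finite_measure_axioms]) (use lims[OF that] f(3) in auto)
    have "(\<integral>\<^sup>+w. ennreal (f (Yn n w, Z w)) \<partial>M) = (\<integral>\<^sup>+w. g (Yn n w) \<partial>M)" for n
    proof -
      have "(\<integral>\<^sup>+w. ennreal (f (Yn n w, Z w)) \<partial>M) = (\<integral>\<^sup>+x. ennreal (f x) \<partial>(distr M borel (Yn n) \<Otimes>\<^sub>M distr M borel Z))"
        using ind[of n] by (simp add: indep_var_distribution_eq nn_integral_distr)
      then show ?thesis by (simp add: DZ.nn_integral_fst[symmetric] g_def[symmetric] nn_integral_distr)
    qed
    moreover have "(\<lambda>n. \<integral>\<^sup>+w. ennreal (f (Yn n w, Z w)) \<partial>M) \<longlonglongrightarrow> (\<integral>\<^sup>+w. ennreal (f (Y w, Z w)) \<partial>M)"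
      by (rule nn_integral_bounded_limit) (use lim lims f(3) in \<open>auto simp: finite_measure_axioms elim!: eventually_mono\<close>)
    moreover have "(\<lambda>n. \<integral>\<^sup>+w. g (Yn n w) \<partial>M) \<longlonglongrightarrow> (\<integral>\<^sup>+w. g (Y w) \<partial>M)"
      by (rule nn_integral_bounded_limit) (use lim gl g1 in \<open>auto simp: finite_measure_axioms elim!: eventually_mono\<close>)
    ultimately have "(\<integral>\<^sup>+w. ennreal (f (Y w, Z w)) \<partial>M) = (\<integral>\<^sup>+w. g (Y w) \<partial>M)" by (simp add: LIMSEQ_unique)
    then show "(\<integral>\<^sup>+x. ennreal (f x) \<partial>distr M borel (\<lambda>w. (Y w, Z w))) = (\<integral>\<^sup>+x. ennreal (f x) \<partial>(distr M borel Y \<Otimes>\<^sub>M distr M borel Z))"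
      by (simp add: DZ.nn_integral_fst[symmetric] g_def[symmetric] nn_integral_distr borel_prod[symmetric])
  qed (auto simp: borel_prod[symmetric] DP.finite_measure_axioms intro!: finite_measure_distr)
  then show ?thesis by (simp add: indep_var_distribution_eq borel_prod)
qed

text \<open>Convexity of \<open>a * ln a\<close>: the left side is its tangent at h. With h a
  probability density this is the pointwise form of the nonnegativity of relative entropy; with a
  Gaussian h it bounds the negative part of an entropy.\<close>

lemma mult_ln_ge:
  fixes a h :: real
  assumes "0 \<le> a" "0 < h"
  shows "a * ln h + a - h \<le> a * ln a"
proof (cases "a = 0")
  case False
  then have a: "0 < a" using assms by simp
  have "a * ln (h / a) \<le> a * (h / a - 1)" using a assms by (intro mult_left_mono ln_le_minus_one) auto
  then show ?thesis using a assms by (simp add: ln_div right_diff_distrib)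
qed (use assms in simp)

text \<open>Fatou's lemma for \<open>T n + g\<close>, with bounds that may vary along a convergent
  sequence. It is applied to second moments and to truncated logarithms of densities.\<close>

lemma fatou_integrable:
  fixes u g :: "'a \<Rightarrow> real"
  assumes [measurable]: "u \<in> borel_measurable M" and g: "integrable M g" and T: "\<And>n::nat. integrable M (T n)"
    and ge: "\<And>n. AE x in M. - g x \<le> T n x" and lim: "AE x in M. (\<lambda>n. T n x) \<longlonglongrightarrow> u x"
    and B: "\<And>n. (\<integral>x. T n x \<partial>M) \<le> B n" "B \<longlonglongrightarrow> A"
  shows "integrable M u" "(\<integral>x. u x \<partial>M) \<le> A"
proof -
  have [measurable]: "g \<in> borel_measurable M" "T n \<in> borel_measurable M" for n using g T by auto
  have gT: "0 \<le> (\<integral>x. T n x \<partial>M) + (\<integral>x. g x \<partial>M)" for n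
  proof -
    have "AE x in M. 0 \<le> T n x + g x" using ge[of n] by auto
    from integral_nonneg_AE[OF this] show ?thesis using g T by simp
  qed
  have A0: "0 \<le> A + (\<integral>x. g x \<partial>M)"
    by (rule LIMSEQ_le_const[OF tendsto_add[OF B(2) tendsto_const]]) (use order_trans[OF gT add_right_mono[OF B(1)]] in auto)
  have "(\<integral>\<^sup>+x. ennreal (u x + g x) \<partial>M) = (\<integral>\<^sup>+x. liminf (\<lambda>n. ennreal (T n x + g x)) \<partial>M)"
    by (rule nn_integral_cong_AE)
      (use lim in \<open>eventually_elim, auto intro!: lim_imp_Liminf[symmetric] tendsto_intros\<close>)
  also have "... \<le> liminf (\<lambda>n. \<integral>\<^sup>+x. ennreal (T n x + g x) \<partial>M)" by (rule nn_integral_liminf) measurable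
  also have "... \<le> liminf (\<lambda>n. ennreal (B n + (\<integral>x. g x \<partial>M)))"
  proof (intro Liminf_mono always_eventually allI)
    fix n
    have "(\<integral>\<^sup>+x. ennreal (T n x + g x) \<partial>M) = ennreal (\<integral>x. T n x + g x \<partial>M)"
      by (rule nn_integral_eq_integral) (use g T ge[of n] in \<open>auto elim!: eventually_mono\<close>)
    then show "(\<integral>\<^sup>+x. ennreal (T n x + g x) \<partial>M) \<le> ennreal (B n + (\<integral>x. g x \<partial>M))"
      using g T B(1)[of n] by (simp add: ennreal_leI)
  qed
  also have "... = ennreal (A + (\<integral>x. g x \<partial>M))" by (intro lim_imp_Liminf tendsto_intros B(2)) simp
  finally have le: "(\<integral>\<^sup>+x. ennreal (u x + g x) \<partial>M) \<le> ennreal (A + (\<integral>x. g x \<partial>M))" .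
  have "AE x in M. \<forall>n. - g x \<le> T n x" using ge by (simp add: AE_all_countable)
  then have ug: "AE x in M. 0 \<le> u x + g x" using lim
  proof eventually_elim
    case (elim x)
    then have "- g x \<le> u x" by (intro LIMSEQ_le_const) auto
    then show ?case by simp
  qed
  have i: "integrable M (\<lambda>x. u x + g x)" by (rule integrableI_nonneg) (use le ug in \<open>auto simp: le_less_trans\<close>)
  show u: "integrable M u" using Bochner_Integration.integrable_diff[OF i g] by simp
  show "(\<integral>x. u x \<partial>M) \<le> A" using le A0 u g by (simp add: nn_integral_eq_integral[OF i ug])
qed

text \<open>The easy half of the Donsker-Varadhan formula, from Gibbs' inequality for
  \<open>exp (\<phi> x) / (f x * c)\<close>. The exponential moment is bounded as a nonnegative
  integral, so \<phi> may be unbounded; this is how exponential square moments become bounds of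
  second moments by entropy.\<close>

lemma entropy_variational:
  fixes \<pi> :: "'a measure" and f \<phi> :: "'a \<Rightarrow> real"
  assumes \<pi>: "prob_space \<pi>" and [measurable]: "f \<in> borel_measurable \<pi>" "\<phi> \<in> borel_measurable \<pi>"
    and f: "\<And>x. 0 \<le> f x" and m: "prob_space (edensity \<pi> f)"
    and ln: "integrable (edensity \<pi> f) (\<lambda>x. ln (f x))"
    and \<phi>: "integrable (edensity \<pi> f) \<phi>"
    and c: "c > 0" "(\<integral>\<^sup>+x. ennreal (exp (\<phi> x)) \<partial>\<pi>) \<le> ennreal c"
  shows "(\<integral>x. \<phi> x \<partial>edensity \<pi> f) \<le> (\<integral>x. ln (f x) \<partial>edensity \<pi> f) + ln c"
proof -
  let ?m = "edensity \<pi> f"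
  interpret m: prob_space ?m by (rule m)
  define u where "u x = exp (\<phi> x) / (f x * c)" for x
  have [measurable]: "u \<in> borel_measurable \<pi>" unfolding u_def by simp
  have pos: "AE x in ?m. f x > 0" by (subst AE_density) auto
  have ae: "AE x in ?m. ln (u x) = \<phi> x - ln (f x) - ln c"
    using pos by eventually_elim (use c in \<open>simp add: u_def ln_div ln_mult\<close>)
  have i: "integrable ?m (\<lambda>x. \<phi> x - ln (f x) - ln c)" using ln \<phi> by auto
  have "(\<integral>x. ln (u x) \<partial>?m) \<le> 0"
  proof (rule m.expectation_ln_le_0)
    show "u \<in> borel_measurable ?m" by simp
    show "AE x in ?m. 0 < u x" using pos by eventually_elim (use c in \<open>simp add: u_def\<close>)
    show "integrable ?m (\<lambda>x. ln (u x))" using ae i by (subst integrable_cong_AE) auto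
    have "(\<integral>\<^sup>+x. ennreal (u x) \<partial>?m) = (\<integral>\<^sup>+x. ennreal (f x) * ennreal (u x) \<partial>\<pi>)"
      by (rule nn_integral_density) measurable
    also have "... \<le> (\<integral>\<^sup>+x. ennreal (1 / c) * ennreal (exp (\<phi> x)) \<partial>\<pi>)"
    proof (rule nn_integral_mono)
      fix x
      show "ennreal (f x) * ennreal (u x) \<le> ennreal (1 / c) * ennreal (exp (\<phi> x))"
        using c f[of x] by (simp add: u_def ennreal_mult'[symmetric])
    qed
    also have "... \<le> ennreal (1 / c) * ennreal c" using c by (simp add: nn_integral_cmult mult_left_mono)
    also have "... = 1" using c by (simp add: ennreal_mult'[symmetric])
    finally show "(\<integral>\<^sup>+x. ennreal (u x) \<partial>?m) \<le> 1" .
  qed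
  also have "(\<integral>x. ln (u x) \<partial>?m) = (\<integral>x. \<phi> x - ln (f x) - ln c \<partial>?m)"
    using ae by (intro integral_cong_AE) auto
  also have "... = (\<integral>x. \<phi> x \<partial>?m) - (\<integral>x. ln (f x) \<partial>?m) - ln c"
    using ln \<phi> m.prob_space by simp
  finally show ?thesis by simp
qed

text \<open>The converse half of Donsker-Varadhan: a bound tested on bounded continuous functions,
  which is what survives weak limits, already yields a density. Absolute continuity comes first;
  then truncations of \<open>ln f\<close> are inserted as test functions and removed by
  Fatou.\<close>

lemma entropy_lower_semicontinuous:
  fixes \<pi> m :: "'a::euclidean_space measure"
  assumes \<pi>: "prob_space \<pi>" "sets \<pi> = sets borel" "absolutely_continuous lborel \<pi>"
    and m: "prob_space m" "sets m = sets borel"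
    and DV: "\<And>\<phi> c. continuous_on UNIV \<phi> \<Longrightarrow> (\<And>x. \<bar>\<phi> x\<bar> \<le> c) \<Longrightarrow> exp ((\<integral>x. \<phi> x \<partial>m) - A) \<le> (\<integral>x. exp (\<phi> x) \<partial>\<pi>)"
  obtains f where "f \<in> borel_measurable borel" "\<And>x. 0 \<le> f x" "m = edensity \<pi> f"
    "integrable m (\<lambda>x. ln (f x))" "(\<integral>x. ln (f x) \<partial>m) \<le> A"
proof -
  interpret \<pi>: prob_space \<pi> by fact
  interpret m: prob_space m by fact
  note [measurable_cong] = \<pi>(2) m(2)
  have [simp]: "space \<pi> = UNIV" "space m = UNIV"
    using sets_eq_imp_space_eq[OF \<pi>(2)] sets_eq_imp_space_eq[OF m(2)] by auto
  have DVlim: "exp ((\<integral>x. \<phi> x \<partial>m) - A) \<le> (\<integral>x. exp (\<phi> x) \<partial>\<pi>)"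
    if g: "\<And>n. continuous_on UNIV (g n)" "\<And>n x. \<bar>g n x\<bar> \<le> c" and [measurable]: "\<phi> \<in> borel_measurable borel"
      and l: "AE x in m. (\<lambda>n. g n x) \<longlonglongrightarrow> \<phi> x" "AE x in \<pi>. (\<lambda>n. g n x) \<longlonglongrightarrow> \<phi> x" for g :: "nat \<Rightarrow> 'a \<Rightarrow> real" and \<phi> c
  proof (rule LIMSEQ_le)
    have [measurable]: "g n \<in> borel_measurable borel" for n by (intro borel_measurable_continuous_onI g)
    show "(\<lambda>n. exp ((\<integral>x. g n x \<partial>m) - A)) \<longlonglongrightarrow> exp ((\<integral>x. \<phi> x \<partial>m) - A)"
      by (simp add: l g integral_dominated_convergence[where w="\<lambda>_. c"] tendsto_intros)
    show "(\<lambda>n. \<integral>x. exp (g n x) \<partial>\<pi>) \<longlonglongrightarrow> (\<integral>x. exp (\<phi> x) \<partial>\<pi>)"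
      by (rule integral_dominated_convergence[where w="\<lambda>_. exp c"])
        (use l(2) g(2) in \<open>auto intro: tendsto_exp abs_le_D1 elim!: eventually_mono\<close>)
  qed (use DV[OF g] in auto)
  have ac: "absolutely_continuous \<pi> m" unfolding absolutely_continuous_def
  proof
    fix B assume B: "B \<in> null_sets \<pi>"
    then have [measurable]: "B \<in> sets borel" and B0: "emeasure \<pi> B = 0" using \<pi>(2) by auto
    \<comment> \<open>An open V around the null set B with \<open>\<pi>\<close>-measure below
      \<open>exp (- c)\<close> keeps the exponential moment of c times its indicator below 2. Since
      c is arbitrary, \<open>measure m B\<close> must vanish.\<close>
    have small: "c * measure m B \<le> A + ln 2" if c: "c > 0" for c :: real
    proof -
      have "(INF V \<in> {V. B \<subseteq> V \<and> open V}. emeasure \<pi> V) < ennreal (exp (- c))"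
        using outer_regular[OF \<pi>(2), of B] B0 by simp
      then obtain V where V: "B \<subseteq> V" "open V" "measure \<pi> V < exp (- c)"
        by (auto simp: INF_less_iff \<pi>.emeasure_eq_measure ennreal_less_iff)
      have [measurable]: "V \<in> sets borel" using V by simp
      have iV: "integrable \<pi> (\<lambda>x. indicator V x :: real)" by (rule \<pi>.integrable_const_bound[where B=1]) auto
      obtain f :: "nat \<Rightarrow> 'a \<Rightarrow> real" where f: "\<And>n. continuous_on UNIV (f n)" "\<And>n x. 0 \<le> f n x" "\<And>n x. f n x \<le> 1"
        "\<And>x. (\<lambda>n. f n x) \<longlonglongrightarrow> indicator V x" using open_indicator_limit[OF V(2)] by auto
      have "exp ((\<integral>x. c * indicator V x \<partial>m) - A) \<le> (\<integral>x. exp (c * indicator V x) \<partial>\<pi>)"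
      proof (rule DVlim[of "\<lambda>n x. c * f n x" c])
        show "continuous_on UNIV (\<lambda>x. c * f n x)" for n by (intro continuous_intros f)
        show "\<bar>c * f n x\<bar> \<le> c" for n x using f(2,3)[of n x] c by simp
      qed (auto intro!: AE_I2 tendsto_intros f)
      also have "(\<integral>x. c * indicator V x \<partial>m) = c * measure m V" by simp
      also have "(\<integral>x. exp (c * indicator V x) \<partial>\<pi>) \<le> (\<integral>x. 1 + exp c * indicator V x \<partial>\<pi>)"
        using c by (intro integral_mono Bochner_Integration.integrable_add \<pi>.integrable_const_bound[where B="exp c"]) (auto simp: indicator_def)
      also have "... \<le> 2" using V(3) iV \<pi>.prob_space by (simp add: exp_minus field_simps)
      finally have "c * measure m V \<le> A + ln 2" by (simp add: ln_ge_iff[symmetric])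
      moreover have "c * measure m B \<le> c * measure m V" using V c by (intro mult_left_mono m.finite_measure_mono) auto
      ultimately show ?thesis by simp
    qed
    have "\<not> 0 < measure m B"
    proof
      assume "0 < measure m B"
      with small[of "(\<bar>A\<bar> + 2) / measure m B"] have "\<bar>A\<bar> + 2 \<le> A + ln 2" by simp
      then show False using ln_le_minus_one[of 2] by simp
    qed
    then show "B \<in> null_sets m" by (auto simp: m.emeasure_eq_measure zero_less_measure_iff)
  qed
  obtain f where f [measurable]: "f \<in> borel_measurable \<pi>" and fR: "AE x in \<pi>. RN_deriv \<pi> m x = ennreal (f x)"
    and fpos: "AE x in m. 0 < f x" and f0: "\<And>x. 0 \<le> f x" using \<pi>.real_RN_deriv[of m] ac \<pi>(2) m(2) by auto
  have "m = density \<pi> (RN_deriv \<pi> m)" using \<pi>.density_RN_deriv[OF ac] \<pi>(2) m(2) by simp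
  also have "... = edensity \<pi> f" by (rule density_cong) (use fR in auto)
  finally have mf: "m = edensity \<pi> f" .
  have fb [measurable]: "f \<in> borel_measurable borel" by simp
  have f1: "(\<integral>\<^sup>+x. ennreal (f x) \<partial>\<pi>) = 1" using m.emeasure_space_1 unfolding mf by (simp add: emeasure_density)
  then have fi: "integrable \<pi> f" "(\<integral>x. f x \<partial>\<pi>) = 1"
    using f0 by (auto intro!: integrableI_nonneg simp: integral_eq_nn_integral)
  \<comment> \<open>The truncation of \<open>ln f\<close> at the levels -c and c, with value -c
    where f vanishes. It satisfies \<open>exp (\<phi> c x) \<le> f x + exp (- c)\<close>, so its
    exponential moment is at most \<open>1 + exp (- c)\<close>.\<close>
  define \<phi> where "\<phi> c x = (if f x = 0 then - c else max (- c) (min c (ln (f x))))" for c x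
  have [measurable]: "\<phi> c \<in> borel_measurable borel" for c unfolding \<phi>_def by simp
  have \<phi>b: "\<bar>\<phi> c x\<bar> \<le> c" if "c > 0" for c x using that by (auto simp: \<phi>_def)
  have bound: "(\<integral>x. \<phi> c x \<partial>m) \<le> A + exp (- c)" if c: "c > 0" for c
  proof -
    \<comment> \<open>Approximation by continuous functions off a Lebesgue null set;
      \<open>\<pi>\<close> and m are absolutely continuous with respect to Lebesgue measure, so the
      convergence holds almost everywhere for both.\<close>
    have "\<phi> c measurable_on UNIV" by (rule lebesgue_measurable_imp_measurable_on) (auto simp: measurable_completion)
    then obtain N g where N: "negligible N" and g: "\<And>n. continuous_on UNIV (g n)" "\<And>x. x \<notin> N \<Longrightarrow> (\<lambda>n. g n x) \<longlonglongrightarrow> \<phi> c x"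
      by (auto simp: measurable_on_def)
    define g' where "g' n x = max (- c) (min c (g n x))" for n x
    have g': "(\<lambda>n. g' n x) \<longlonglongrightarrow> \<phi> c x" if "x \<notin> N" for x
    proof -
      have "(\<lambda>n. g' n x) \<longlonglongrightarrow> max (- c) (min c (\<phi> c x))" unfolding g'_def by (intro tendsto_intros g that)
      then show ?thesis using \<phi>b[OF c, of x] by simp
    qed
    have "AE x in lebesgue. x \<notin> N" using N by (intro AE_not_in) (simp add: negligible_iff_null_sets)
    then have "AE x in lborel. (\<lambda>n. g' n x) \<longlonglongrightarrow> \<phi> c x"
      using g' by (auto simp: AE_completion_iff)
    then have l\<pi>: "AE x in \<pi>. (\<lambda>n. g' n x) \<longlonglongrightarrow> \<phi> c x"
      using absolutely_continuous_AE[OF _ \<pi>(3)] \<pi>(2) by auto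
    then have lm: "AE x in m. (\<lambda>n. g' n x) \<longlonglongrightarrow> \<phi> c x"
      using absolutely_continuous_AE[OF _ ac] \<pi>(2) m(2) by auto
    have "exp ((\<integral>x. \<phi> c x \<partial>m) - A) \<le> (\<integral>x. exp (\<phi> c x) \<partial>\<pi>)"
    proof (rule DVlim[of g' c])
      show "continuous_on UNIV (g' n)" for n unfolding g'_def by (intro continuous_intros g)
    qed (use l\<pi> lm c in \<open>auto simp: g'_def\<close>)
    also have "... \<le> (\<integral>x. f x + exp (- c) \<partial>\<pi>)"
    proof (rule integral_mono)
      show "integrable \<pi> (\<lambda>x. exp (\<phi> c x))"
        by (rule \<pi>.integrable_const_bound[where B="exp c"]) (use \<phi>b[OF c] in \<open>auto simp: abs_le_iff\<close>)
      fix x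
      have "\<phi> c x \<le> ln (f x) \<or> \<phi> c x = - c" "f x \<noteq> 0 \<or> \<phi> c x = - c" by (auto simp: \<phi>_def)
      then show "exp (\<phi> c x) \<le> f x + exp (- c)"
        using f0[of x] exp_gt_zero[of "- c"] by (smt (verit) exp_le_cancel_iff exp_ln)
    qed (use fi in auto)
    also have "... \<le> exp (exp (- c))" using fi \<pi>.prob_space by simp
    finally show ?thesis by simp
  qed
  have neg: "integrable m (\<lambda>x. max 0 (- ln (f x)))"
  proof (rule integrableI_nonneg)
    have "(\<integral>\<^sup>+x. ennreal (max 0 (- ln (f x))) \<partial>m) = (\<integral>\<^sup>+x. ennreal (f x) * ennreal (max 0 (- ln (f x))) \<partial>\<pi>)"
      unfolding mf by (rule nn_integral_density) measurable
    also have "... \<le> (\<integral>\<^sup>+x. 1 \<partial>\<pi>)"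
    proof (rule nn_integral_mono)
      show "ennreal (f x) * ennreal (max 0 (- ln (f x))) \<le> 1" for x
        using mult_ln_ge[OF f0[of x] zero_less_one] f0[of x] by (auto simp: ennreal_mult'[symmetric])
    qed
    finally show "(\<integral>\<^sup>+x. ennreal (max 0 (- ln (f x))) \<partial>m) < \<infinity>" using \<pi>.emeasure_space_1 by (simp add: le_less_trans)
  qed auto
  have lim: "AE x in m. (\<lambda>n. \<phi> (real (Suc n)) x) \<longlonglongrightarrow> ln (f x)" using fpos
  proof eventually_elim
    case (elim x)
    obtain n0 :: nat where n0: "\<bar>ln (f x)\<bar> \<le> real n0" using real_arch_simple by auto
    have "eventually (\<lambda>n. \<phi> (real (Suc n)) x = ln (f x)) sequentially"
      using eventually_ge_at_top[of n0] by eventually_elim (use n0 elim in \<open>auto simp: \<phi>_def\<close>)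
    then show ?case by (rule tendsto_eventually)
  qed
  have i: "integrable m (\<phi> (real (Suc n)))" for n
    by (rule m.integrable_const_bound[where B="real (Suc n)"]) (use \<phi>b[of "real (Suc n)"] in auto)
  have ge: "AE x in m. - max 0 (- ln (f x)) \<le> \<phi> (real (Suc n)) x" for n
    using fpos by eventually_elim (auto simp: \<phi>_def)
  have "(\<lambda>n. A + exp (- real (Suc n))) \<longlonglongrightarrow> A" by real_asymp
  from fatou_integrable[OF _ neg i ge lim bound this] show thesis using that[of f] f0 mf by auto
qed

text \<open>W is the noise with the factor sqrt 2 included, hence the variance
  \<open>2 * (t - s)\<close>. Independence is asked for the initial value together with the
  increments over a finite time grid, which is what the Euler scheme consumes.\<close>

locale langevin = potential U b L + prob_space M
  for U :: "'a::euclidean_space \<Rightarrow> real" and b L and M :: "'w measure" +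
  fixes X W :: "real \<Rightarrow> 'w \<Rightarrow> 'a"
  assumes X_measurable: "\<And>t. 0 \<le> t \<Longrightarrow> X t \<in> borel_measurable M"
    and W_measurable: "\<And>t. 0 \<le> t \<Longrightarrow> W t \<in> borel_measurable M"
    and solution: "AE w in M. continuous_on {0..} (\<lambda>t. X t w) \<and>
      (\<forall>t\<ge>0. X t w = X 0 w - integral {0..t} (\<lambda>s. b (X s w)) + W t w)"
    and W_law: "\<And>s t. 0 \<le> s \<Longrightarrow> s < t \<Longrightarrow> distr M borel (\<lambda>w. W t w - W s w) = gaussM (2 * (t - s))"
    and independent: "\<And>(\<tau>::nat \<Rightarrow> real) n. 0 \<le> \<tau> 0 \<Longrightarrow> (\<And>k. k < n \<Longrightarrow> \<tau> k < \<tau> (Suc k)) \<Longrightarrow>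
      indep_vars (\<lambda>_. borel) (\<lambda>j w. case j of 0 \<Rightarrow> X 0 w | Suc k \<Rightarrow> W (\<tau> (Suc k)) w - W (\<tau> k) w) {..n}"
begin

lemma euler_tendsto:
  assumes "0 \<le> t0" "0 < T"
  shows "AE w in M. (\<lambda>n. euler ((T / real n) powr (1/4)) (X t0 w)
    (\<lambda>j. W (t0 + real (Suc j) * (T / real n)) w - W (t0 + real j * (T / real n)) w) n) \<longlonglongrightarrow> X (t0 + T) w"
  using solution
proof eventually_elim
  let ?A = "\<lambda>w. \<lambda>s. b (X s w)"
  case (elim w)
  then have e1: "continuous_on {0..} (\<lambda>t. X t w)"
    and e2: "\<And>t. 0 \<le> t \<Longrightarrow> X t w = X 0 w - integral {0..t} (?A w) + W t w" by blast+
  have bc: "continuous_on {0..} (?A w)" by (rule continuous_on_compose2[OF b_continuous[of UNIV] e1]) auto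
  show ?case
  proof (rule euler_converges[of T t0 "\<lambda>t. X t w" "\<lambda>t. W t w"])
    show "continuous_on {t0..t0 + T} (\<lambda>t. X t w)" using assms by (intro continuous_on_subset[OF e1]) auto
    fix t assume t: "t0 \<le> t" "t \<le> t0 + T"
    have It: "integral {0..t0} (?A w) + integral {t0..t} (?A w) = integral {0..t} (?A w)"
      using t assms by (intro Henstock_Kurzweil_Integration.integral_combine integrable_continuous_interval continuous_on_subset[OF bc]) auto
    have Xt: "X t w = X 0 w - integral {0..t} (?A w) + W t w"
      and Xt0: "X t0 w = X 0 w - integral {0..t0} (?A w) + W t0 w" by (intro e2, use t assms in linarith)+
    show "X t w = X t0 w - integral {t0..t} (?A w) + (W t w - W t0 w)" unfolding Xt Xt0 It[symmetric] by simp
  qed (use assms in auto)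
qed

lemma euler_continuous: "0 < k \<Longrightarrow> continuous_on UNIV (\<lambda>x. euler k x d j)"
proof (induction j)
  case (Suc j)
  then show ?case
    using continuous_on_compose2[OF drift_continuous[OF Suc.prems, of UNIV]] by (auto intro!: continuous_intros)
qed simp

lemma euler_measurable:
  assumes k: "0 < k" and x: "x \<in> borel_measurable N" and d: "\<And>i. i < j \<Longrightarrow> d i \<in> borel_measurable N"
  shows "(\<lambda>w. euler k (x w) (\<lambda>i. d i w) j) \<in> borel_measurable N" using d
proof (induction j)
  case (Suc j)
  note [measurable] = drift_measurable[OF k]
  have [measurable]: "(\<lambda>w. euler k (x w) (\<lambda>i. d i w) j) \<in> borel_measurable N" "d j \<in> borel_measurable N"
    using Suc by auto
  show ?case by simp
qed (use x in simp)

lemma euler_cong: "(\<And>i. i < j \<Longrightarrow> d i = d' i) \<Longrightarrow> euler k x d j = euler k x d' j"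
  by (induction j) simp_all

text \<open>Adaptedness is not assumed: \<open>X t0\<close> is independent of the later increments as a limit of Euler schemes started at time 0.\<close>

lemma euler_indep:
  assumes t0: "0 \<le> t0" and h: "0 < h" and k: "0 < k"
  shows "indep_var borel (\<lambda>w. euler k (X t0 w) (\<lambda>i. W (t0 + real (Suc i) * h) w - W (t0 + real i * h) w) j)
    borel (\<lambda>w. W (t0 + real (Suc j) * h) w - W (t0 + real j * h) w)"
proof -
  let ?A = "\<lambda>F w. \<lambda>i. F i w"
  let ?d = "\<lambda>w i. W (t0 + real (Suc i) * h) w - W (t0 + real i * h) w"
  \<comment> \<open>The number of Euler steps from 0 to t0. For \<open>t0 = 0\<close> the scheme is
    empty and returns \<open>X 0\<close>; otherwise \<open>Suc n\<close> avoids a division by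
    zero.\<close>
  define m where "m n = (if t0 = 0 then 0 else Suc n)" for n :: nat
  define k' where "k' n = (t0 / real (m n)) powr (1/4)" for n
  define P where "P n w = euler (k' n) (X 0 w) (\<lambda>l. W (0 + real (Suc l) * (t0 / real (m n))) w - W (0 + real l * (t0 / real (m n))) w) (m n)" for n w
  have k'pos: "0 < k' n" if "m n \<noteq> 0" for n using that by (auto simp: k'_def m_def)
  have Plim: "AE w in M. (\<lambda>n. P n w) \<longlonglongrightarrow> X t0 w"
  proof (cases "t0 = 0")
    case True then show ?thesis by (simp add: P_def m_def)
  next
    case False
    then have "t0 > 0" using t0 by simp
    from euler_tendsto[OF order_refl this] show ?thesis
    proof eventually_elim
      case (elim w)
      from LIMSEQ_Suc[OF elim] show ?case using False by (simp add: P_def m_def k'_def)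
    qed
  qed
  have ind: "indep_var borel (\<lambda>w. euler k (P n w) (?d w) j) borel (\<lambda>w. ?d w j)" for n
  proof -
    \<comment> \<open>One grid for both schemes: \<open>m n\<close> equal steps up to t0, then steps
      of length h. The position after j of the later steps is a function of \<open>X 0\<close> and
      of all increments before the last one.\<close>
    define \<tau> where "\<tau> l = (if l \<le> m n then real l * (t0 / real (m n)) else t0 + real (l - m n) * h)" for l
    have \<tau>m: "\<tau> (m n + i) = t0 + real i * h" for i by (cases i) (auto simp: \<tau>_def m_def)
    have \<tau>0: "0 \<le> \<tau> 0" by (simp add: \<tau>_def)
    have \<tau>mono: "\<tau> l < \<tau> (Suc l)" for l
    proof (cases "l < m n")
      case True
      then have "t0 > 0" using t0 by (auto simp: m_def split: if_splits)
      then have "real l * (t0 / real (m n)) < real (Suc l) * (t0 / real (m n))" using True by (intro mult_strict_right_mono) auto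
      then show ?thesis using True by (simp add: \<tau>_def)
    next
      case False
      then obtain i where i: "l = m n + i" by (metis le_iff_add not_less)
      show ?thesis using h \<tau>m[of i] \<tau>m[of "Suc i"] unfolding i by simp
    qed
    define F where "F l w = (case l of 0 \<Rightarrow> X 0 w | Suc i \<Rightarrow> W (\<tau> (Suc i)) w - W (\<tau> i) w)" for l w
    let ?N = "Suc (m n + j)"
    have "indep_vars (\<lambda>_. borel) F {..?N}"
      unfolding F_def[abs_def] using independent[OF \<tau>0 \<tau>mono, of ?N] by simp
    then have ir: "indep_var (PiM {..<?N} (\<lambda>_. borel)) (\<lambda>w. restrict (?A F w) {..<?N}) (PiM {?N} (\<lambda>_. borel)) (\<lambda>w. restrict (?A F w) {?N})"
      by (rule indep_var_restrict) auto
    define G where "G z = euler k (euler (k' n) (z 0) (\<lambda>l. z (Suc l)) (m n)) (\<lambda>i. z (Suc (m n + i))) j" for z :: "nat \<Rightarrow> 'a"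
    have "G \<in> borel_measurable (PiM {..<?N} (\<lambda>_. borel))" unfolding G_def
    proof (rule euler_measurable[OF k])
      show "(\<lambda>z. euler (k' n) (z 0) (\<lambda>l. z (Suc l)) (m n)) \<in> borel_measurable (PiM {..<?N} (\<lambda>_. borel))"
      proof (cases "m n = 0")
        case False
        then show ?thesis by (intro euler_measurable k'pos) auto
      qed simp
    qed auto
    moreover have "(\<lambda>z. z ?N) \<in> borel_measurable (PiM {?N} (\<lambda>_. borel))" by simp
    ultimately have "indep_var borel (G \<circ> (\<lambda>w. restrict (?A F w) {..<?N})) borel ((\<lambda>z. z ?N) \<circ> (\<lambda>w. restrict (?A F w) {?N}))"
      by (rule indep_var_compose[OF ir])
    moreover have "(G \<circ> (\<lambda>w. restrict (?A F w) {..<?N})) = (\<lambda>w. euler k (P n w) (?d w) j)"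
    proof
      fix w
      have 1: "euler (k' n) (X 0 w) (\<lambda>l. restrict (?A F w) {..<?N} (Suc l)) (m n) = P n w"
        unfolding P_def by (rule euler_cong) (auto simp: F_def \<tau>_def)
      have z0: "restrict (?A F w) {..<?N} 0 = X 0 w" by (simp add: F_def)
      have 2: "euler k (P n w) (\<lambda>i. restrict (?A F w) {..<?N} (Suc (m n + i))) j = euler k (P n w) (?d w) j"
      proof (rule euler_cong)
        fix i assume "i < j"
        then show "restrict (?A F w) {..<?N} (Suc (m n + i)) = ?d w i"
          using \<tau>m[of i] \<tau>m[of "Suc i"] by (simp add: F_def)
      qed
      show "(G \<circ> (\<lambda>w. restrict (?A F w) {..<?N})) w = euler k (P n w) (?d w) j"
        by (simp only: G_def comp_def z0 1 2)
    qed
    moreover have "((\<lambda>z. z ?N) \<circ> (\<lambda>w. restrict (?A F w) {?N})) = (\<lambda>w. ?d w j)"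
      using \<tau>m[of j] \<tau>m[of "Suc j"] by (simp add: fun_eq_iff F_def)
    ultimately show ?thesis by simp
  qed
  have Wm: "(\<lambda>w. ?d w i) \<in> borel_measurable M" for i
    using t0 h by (intro borel_measurable_diff W_measurable) auto
  show ?thesis
  proof (rule indep_var_limit[OF ind])
    show "(\<lambda>w. euler k (X t0 w) (?d w) j) \<in> borel_measurable M" by (intro euler_measurable k X_measurable t0 Wm)
    show "AE w in M. (\<lambda>n. euler k (P n w) (?d w) j) \<longlonglongrightarrow> euler k (X t0 w) (?d w) j"
      using Plim by eventually_elim (rule continuous_on_tendsto_compose[OF euler_continuous[OF k]], auto)
  qed
qed

lemma law_euler_scheme:
  assumes t0: "0 \<le> t0" and k: "0 < k" "k \<le> 1" and p: "dens2 p" and law: "distr M borel (X t0) = edensity lborel p"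
  shows "(\<lambda>w. euler k (X t0 w) (\<lambda>i. W (t0 + real (Suc i) * k ^ 4) w - W (t0 + real i * k ^ 4) w) n) \<in> borel_measurable M"
    and "distr M borel (\<lambda>w. euler k (X t0 w) (\<lambda>i. W (t0 + real (Suc i) * k ^ 4) w - W (t0 + real i * k ^ 4) w) n)
      = edensity lborel ((stepd k ^^ n) p)"
proof -
  let ?C = "\<lambda>i w. W (t0 + real (Suc i) * k ^ 4) w - W (t0 + real i * k ^ 4) w"
  let ?B = "\<lambda>i. \<lambda>w. ?C i w"
  let ?A = "\<lambda>w. euler k (X t0 w) (\<lambda>i. ?C i w) n"
  have h: "k ^ 4 > 0" using k by simp
  have "?A \<in> borel_measurable M \<and> distr M borel ?A = edensity lborel ((stepd k ^^ n) p)"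
  proof (rule law_euler[where n=n and d="\<lambda>i w. ?C i w", OF prob_space_axioms k p])
    show "X t0 \<in> borel_measurable M" by (rule X_measurable[OF t0])
    show "distr M borel (X t0) = edensity lborel p" by (rule law)
    show "(?B i) \<in> borel_measurable M" for i using t0 by (intro borel_measurable_diff W_measurable) auto
    show "distr M borel (?B i) = gaussM (2 * k ^ 4)" for i
    proof -
      have "0 \<le> t0 + real i * k ^ 4" "t0 + real i * k ^ 4 < t0 + real (Suc i) * k ^ 4" using t0 h by auto
      from W_law[OF this] show ?thesis by (simp add: algebra_simps)
    qed
    show "indep_var borel (\<lambda>w. euler k (X t0 w) (\<lambda>i. ?C i w) j)
      borel (\<lambda>w. W (t0 + real (Suc j) * k ^ 4) w - W (t0 + real j * k ^ 4) w)" for j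
      by (rule euler_indep[OF t0 h k(1)])
  qed simp
  then show "?A \<in> borel_measurable M"
    "distr M borel ?A = edensity lborel ((stepd k ^^ n) p)" by auto
qed

lemma integrable_distr_dens2:
  fixes g :: "'a \<Rightarrow> real"
  assumes "dens2 p" "Y \<in> borel_measurable M" "distr M borel Y = edensity lborel p" "g \<in> borel_measurable borel"
  shows "integrable M (\<lambda>w. g (Y w)) \<longleftrightarrow> integrable lborel (\<lambda>x. p x * g x)" "(\<integral>w. g (Y w) \<partial>M) = (LBINT x. p x * g x)"
  using integrable_distr_eq[OF assms(2,4)] integral_distr[OF assms(2,4)]
  unfolding assms(3) integrable_dens2_iff[OF assms(1,4)] integral_dens2[OF assms(1,4)] by auto

text \<open>\<open>X t\<close> is not known beforehand to have a density, so the energy bound of the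
  Euler laws is carried over as a variational inequality for bounded continuous test functions,
  which is stable under almost sure convergence of the scheme; Fatou supplies the second
  moment.\<close>

theorem free_decay:
  assumes t0: "0 \<le> t0" "t0 < t" and p: "dens2 p" and law: "distr M borel (X t0) = edensity lborel p"
    and \<kappa>: "0 < \<kappa>" and ineq: "\<And>p D. regdens p D \<Longrightarrow> fisher p D \<ge> \<kappa> * (free p - c)"
    and fin: "(\<integral>\<^sup>+x. ennreal (exp (- U x)) \<partial>lborel) < \<infinity>"
  obtains q where "dens2 q" "distr M borel (X t) = edensity lborel q"
    "free q \<le> c + (free p - c) * exp (- \<kappa> * (t - t0))"
proof -
  let ?A = "\<lambda>\<phi> \<pi>. (\<integral>x. exp (\<phi> x) \<partial>\<pi>)"
  let ?dm = "\<lambda>f. edensity lborel f"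
  define T where "T = t - t0"
  have T: "T > 0" "t = t0 + T" using t0 by (auto simp: T_def)
  define k where "k n = (T / real n) powr (1/4)" for n
  obtain B m where B: "B \<longlonglongrightarrow> c + (free p - c) * exp (- \<kappa> * T)"
    and ev: "eventually (\<lambda>n. 0 < k n \<and> k n \<le> 1 \<and> free ((stepd (k n) ^^ n) p) \<le> B n \<and> mom2 ((stepd (k n) ^^ n) p) \<le> m) sequentially"
    by (rule discrete_decay[OF \<kappa> T(1) p ineq, folded k_def])
  define A where "A = c + (free p - c) * exp (- \<kappa> * T)"
  obtain n0 where n0: "\<And>n. n \<ge> n0 \<Longrightarrow> 0 < n \<and> 0 < k n \<and> k n \<le> 1 \<and> free ((stepd (k n) ^^ n) p) \<le> B n \<and> mom2 ((stepd (k n) ^^ n) p) \<le> m"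
    using eventually_conj[OF eventually_gt_at_top[of 0] ev] by (auto simp: eventually_sequentially)
  define Y0 where "Y0 n \<omega> = euler (k n) (X t0 \<omega>) (\<lambda>j. W (t0 + real (Suc j) * (T / real n)) \<omega> - W (t0 + real j * (T / real n)) \<omega>) n" for n \<omega>
  define Y where "Y n = Y0 (n + n0)" for n
  define q where "q n = (stepd (k (n + n0)) ^^ (n + n0)) p" for n
  have Ylaw: "Y n \<in> borel_measurable M" "distr M borel (Y n) = ?dm (q n)" and q: "dens2 (q n)" "free (q n) \<le> B (n + n0)" "mom2 (q n) \<le> m" for n
  proof -
    note n = n0[of "n + n0"]
    have k4: "k (n + n0) ^ 4 = T / real (n + n0)" using n T by (simp add: k_def powr_powr powr_realpow[symmetric])
    show "Y n \<in> borel_measurable M" "distr M borel (Y n) = ?dm (q n)"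
      using law_euler_scheme[OF t0(1) _ _ p law, of "k (n + n0)" "n + n0"] n
      unfolding Y_def Y0_def[abs_def] q_def k4[symmetric] by auto
    show "dens2 (q n)" "free (q n) \<le> B (n + n0)" "mom2 (q n) \<le> m"
      using dens2_iterate[OF _ _ p, of "k (n + n0)" "n + n0"] n unfolding q_def by auto
  qed
  note [measurable] = Ylaw(1) dens2D(1)[OF q(1)]
  have Xt [measurable]: "X t \<in> borel_measurable M" using t0 by (intro X_measurable) auto
  have Ylim: "AE \<omega> in M. (\<lambda>n. Y n \<omega>) \<longlonglongrightarrow> X t \<omega>"
    using euler_tendsto[OF t0(1) T(1)] unfolding Y_def Y0_def k_def T(2)
    by eventually_elim (rule LIMSEQ_ignore_initial_segment)
  have X2: "integrable M (\<lambda>\<omega>. (norm (X t \<omega>))^2)"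
  proof (rule fatou_integrable[where g="\<lambda>_. 0" and T="\<lambda>n \<omega>. (norm (Y n \<omega>))^2" and B="\<lambda>_. m"])
    show "AE \<omega> in M. (\<lambda>n. (norm (Y n \<omega>))^2) \<longlonglongrightarrow> (norm (X t \<omega>))^2"
      using Ylim by eventually_elim (intro tendsto_intros)
    show "integrable M (\<lambda>\<omega>. (norm (Y n \<omega>))^2)" "(\<integral>\<omega>. (norm (Y n \<omega>))^2 \<partial>M) \<le> m" for n
      using integrable_distr_dens2[OF q(1)[of n] _ Ylaw(2), where g="\<lambda>x. (norm x)^2"] dens2D(4)[OF q(1)[of n]] q(3) by (auto simp: mom2_def)
  qed auto
  \<comment> \<open>z is the logarithm of the partition function, finite by \<open>fin\<close>.
    Entropy relative to the normalised measure \<open>\<pi>\<close> below is the free energy plus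
    z.\<close>
  obtain z where z: "(\<integral>\<^sup>+x. ennreal (exp (- (U x + z))) \<partial>lborel) = 1"
  proof -
    obtain r where r: "(\<integral>\<^sup>+x. ennreal (exp (- U x)) \<partial>lborel) = ennreal r" "0 \<le> r" using fin by (cases rule: ennreal_cases) auto
    have "r \<noteq> 0"
    proof
      assume "r = 0"
      then have "AE x in lborel. ennreal (exp (- U x)) = 0" using r by (subst nn_integral_0_iff_AE[symmetric]) auto
      then show False by (simp add: ae_filter_eq_bot_iff)
    qed
    then have e: "ennreal (exp (- (U x + ln r))) = ennreal (1 / r) * ennreal (exp (- U x))" for x
      using r(2) by (simp add: ennreal_mult'[symmetric] exp_diff exp_minus)
    show thesis
      by (rule that[of "ln r"], unfold e, subst nn_integral_cmult) (use \<open>r \<noteq> 0\<close> r in \<open>auto simp: ennreal_mult'[symmetric]\<close>)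
  qed
  define \<pi> where "\<pi> = ?dm (\<lambda>x. exp (- (U x + z)))"
  define mt where "mt = distr M borel (X t)"
  have \<pi>s [simp, measurable_cong]: "sets \<pi> = sets borel" by (simp add: \<pi>_def)
  interpret \<pi>: prob_space \<pi> using z by (intro prob_spaceI) (simp add: \<pi>_def emeasure_density)
  interpret mt: prob_space mt unfolding mt_def by (rule prob_space_distr) measurable
  have dens: "edensity \<pi> h = ?dm (\<lambda>x. h x * exp (- (U x + z)))"
    if [measurable]: "h \<in> borel_measurable borel" and "\<And>x. 0 \<le> h x" for h
    unfolding \<pi>_def by (subst density_density_eq) (auto simp: ennreal_mult' that mult.commute)
  have DV: "exp ((\<integral>x. \<phi> x \<partial>mt) - (A + z)) \<le> ?A \<phi> \<pi>"
    if \<phi>: "continuous_on UNIV \<phi>" "\<And>x. \<bar>\<phi> x\<bar> \<le> C" for \<phi> C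
  proof (rule LIMSEQ_le_const2)
    have [measurable]: "\<phi> \<in> borel_measurable borel" by (intro borel_measurable_continuous_onI \<phi>)
    have "(\<lambda>n. \<integral>\<omega>. \<phi> (Y n \<omega>) \<partial>M) \<longlonglongrightarrow> (\<integral>\<omega>. \<phi> (X t \<omega>) \<partial>M)"
    proof (rule integral_dominated_convergence[where w="\<lambda>_. C"])
      show "AE \<omega> in M. (\<lambda>n. \<phi> (Y n \<omega>)) \<longlonglongrightarrow> \<phi> (X t \<omega>)"
        using Ylim by eventually_elim (rule continuous_on_tendsto_compose[OF \<phi>(1)], auto)
    qed (use \<phi> in auto)
    also have "(\<integral>\<omega>. \<phi> (X t \<omega>) \<partial>M) = (\<integral>x. \<phi> x \<partial>mt)" unfolding mt_def by (simp add: integral_distr)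
    finally show "(\<lambda>n. exp ((\<integral>\<omega>. \<phi> (Y n \<omega>) \<partial>M) - (B (n + n0) + z))) \<longlonglongrightarrow> exp ((\<integral>x. \<phi> x \<partial>mt) - (A + z))"
      using LIMSEQ_ignore_initial_segment[OF B] unfolding A_def by (intro tendsto_intros)
    have "exp ((\<integral>\<omega>. \<phi> (Y n \<omega>) \<partial>M) - (B (n + n0) + z)) \<le> ?A \<phi> \<pi>" for n
    proof -
      define f where "f x = q n x * exp (U x + z)" for x
      have f0: "0 \<le> f x" for x using dens2D(2)[OF q(1)] by (simp add: f_def)
      have [measurable]: "f \<in> borel_measurable borel" unfolding f_def by simp
      have fe: "edensity \<pi> f = ?dm (q n)" using f0 by (simp add: dens) (simp add: f_def mult.assoc exp_add[symmetric])
      have lneq: "q n x * ln (f x) = q n x * ln (q n x) + q n x * U x + q n x * z" for x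
        by (cases "q n x = 0") (simp_all add: f_def ln_mult algebra_simps)
      have iq: "integrable lborel (\<lambda>x. q n x * U x)" "integrable lborel (\<lambda>x. q n x * ln (q n x))" "integrable lborel (q n)"
        using dens2_growth[OF q(1) _ U_growth] dens2D(5)[OF q(1)] dens2_growth[OF q(1), of "\<lambda>_. 1" 1] by auto
      have i\<phi>: "integrable (?dm (q n)) \<phi>"
        by (rule finite_measure.integrable_const_bound[OF prob_space.finite_measure[OF prob_space_dens2[OF q(1)]], where B=C]) (use \<phi> in auto)
      have ie: "integrable \<pi> (\<lambda>x. exp (\<phi> x))"
        by (rule \<pi>.integrable_const_bound[where B="exp C"]) (use \<phi>(2) in \<open>auto intro: abs_le_D1\<close>)
      have "exp (- C) \<le> ?A \<phi> \<pi>"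
        by (rule \<pi>.integral_ge_const[OF ie]) (use \<phi>(2) in \<open>auto simp: abs_le_iff minus_le_iff\<close>)
      then have pos: "(\<integral>x. exp (\<phi> x) \<partial>\<pi>) > 0" using exp_gt_zero[of "- C"] by arith
      have "(\<integral>x. \<phi> x \<partial>edensity \<pi> f) \<le> (\<integral>x. ln (f x) \<partial>edensity \<pi> f) + ln (\<integral>x. exp (\<phi> x) \<partial>\<pi>)"
      proof (rule entropy_variational)
        show "prob_space \<pi>" by unfold_locales
        show "prob_space (edensity \<pi> f)" unfolding fe by (rule prob_space_dens2[OF q(1)])
        show "integrable (edensity \<pi> f) (\<lambda>x. ln (f x))" "integrable (edensity \<pi> f) \<phi>"
          unfolding fe using iq i\<phi> by (simp_all add: integrable_dens2_iff[OF q(1)] lneq)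
        show "(\<integral>\<^sup>+x. ennreal (exp (\<phi> x)) \<partial>\<pi>) \<le> ennreal (\<integral>x. exp (\<phi> x) \<partial>\<pi>)"
          using ie by (simp add: nn_integral_eq_integral)
      qed (use f0 pos in auto)
      also have "(\<integral>x. ln (f x) \<partial>edensity \<pi> f) = free (q n) + z"
        unfolding fe free_def using iq integral_dens2_one[OF q(1)] by (simp add: integral_dens2[OF q(1)] lneq)
      also have "(\<integral>x. \<phi> x \<partial>edensity \<pi> f) = (\<integral>\<omega>. \<phi> (Y n \<omega>) \<partial>M)"
        unfolding fe Ylaw(2)[symmetric] by (simp add: integral_distr)
      finally have "(\<integral>\<omega>. \<phi> (Y n \<omega>) \<partial>M) - (B (n + n0) + z) \<le> ln (\<integral>x. exp (\<phi> x) \<partial>\<pi>)" using q(2)[of n] by simp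
      then show ?thesis using pos by (simp add: ln_ge_iff)
    qed
    then show "\<exists>N. \<forall>n\<ge>N. exp ((\<integral>\<omega>. \<phi> (Y n \<omega>) \<partial>M) - (B (n + n0) + z)) \<le> ?A \<phi> \<pi>" by simp
  qed
  have ac: "absolutely_continuous lborel \<pi>" unfolding \<pi>_def by (rule absolutely_continuousI_density) measurable
  obtain f where f [measurable]: "f \<in> borel_measurable borel" and f0: "\<And>x. 0 \<le> f x" and fm: "mt = edensity \<pi> f"
    and fl: "integrable mt (\<lambda>x. ln (f x))" "(\<integral>x. ln (f x) \<partial>mt) \<le> A + z"
  proof (rule entropy_lower_semicontinuous[OF \<pi>.prob_space_axioms \<pi>s ac mt.prob_space_axioms])
    show "exp ((\<integral>x. \<phi> x \<partial>mt) - (A + z)) \<le> ?A \<phi> \<pi>"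
      if "continuous_on UNIV \<phi>" "\<And>x. \<bar>\<phi> x\<bar> \<le> C" for \<phi> C by (rule DV[OF that])
  qed (auto simp: mt_def)
  define qt where "qt x = f x * exp (- (U x + z))" for x
  have qt0: "0 \<le> qt x" for x using f0 by (simp add: qt_def)
  have [measurable]: "qt \<in> borel_measurable borel" unfolding qt_def by simp
  have mq: "mt = ?dm qt" unfolding fm qt_def by (rule dens[OF f f0])
  have mL: "integrable mt g \<longleftrightarrow> integrable lborel (\<lambda>x. qt x * g x)" "(\<integral>x. g x \<partial>mt) = (LBINT x. qt x * g x)"
    if [measurable]: "g \<in> borel_measurable borel" for g :: "'a \<Rightarrow> real"
    unfolding mq using qt0 by (simp_all add: integrable_density integral_density)
  have eq: "qt x * ln (qt x) = qt x * ln (f x) - qt x * U x - qt x * z" for x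
    by (cases "f x = 0") (simp_all add: qt_def ln_mult algebra_simps)
  have m2: "integrable mt (\<lambda>x. (norm x)^2)" using X2 unfolding mt_def by (simp add: integrable_distr_eq)
  have "integrable mt U" using integrable_growth[OF mt.integrable_const _ _ _ U_growth, of 1] m2 by (simp add: mt_def)
  then have ii: "integrable lborel (\<lambda>x. qt x * ln (f x))" "integrable lborel (\<lambda>x. qt x * U x)" "integrable lborel qt" "(LBINT x. qt x) = 1"
    using fl(1) mL[of "\<lambda>_. 1"] mt.prob_space by (simp_all add: mL)
  have dq: "dens2 qt" unfolding dens2_def
  proof (intro conjI allI qt0)
    show "(\<integral>\<^sup>+x. ennreal (qt x) \<partial>lborel) = 1" using mt.emeasure_space_1 unfolding mq by (simp add: emeasure_density)
    show "integrable lborel (\<lambda>x. qt x * (norm x)^2)" using m2 by (simp add: mL)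
    show "integrable lborel (\<lambda>x. qt x * ln (qt x))" unfolding eq using ii by auto
  qed measurable
  have "free qt = (LBINT x. qt x * ln (f x)) - z" unfolding free_def eq using ii by simp
  also have "... \<le> A" using fl(2) by (simp add: mL)
  finally show thesis using that[OF dq] mq unfolding mt_def A_def T_def by simp
qed

end

section \<open>Mixtures and Wasserstein distances\<close>

lemma P2D:
  assumes "m \<in> P2"
  shows "prob_space m" "sets m = sets borel" "space m = UNIV" "integrable m (\<lambda>x. (norm x)^2)"
  using assms sets_eq_imp_space_eq[of m borel] by (auto simp: P2_def)

lemma P2_measurable: "m \<in> P2 \<Longrightarrow> f \<in> borel_measurable borel \<Longrightarrow> f \<in> borel_measurable m"
  using measurable_cong_sets[OF P2D(2) refl] by auto

lemma P2_growth:
  fixes f :: "'a::euclidean_space \<Rightarrow> real"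
  assumes m: "m \<in> P2" and f: "f \<in> borel_measurable borel" "\<And>x. \<bar>f x\<bar> \<le> C * (1 + (norm x)^2)"
  shows "integrable m f"
proof -
  interpret prob_space m using P2D[OF m] by simp
  show ?thesis using integrable_growth[OF _ _ _ P2_measurable[OF m f(1)] f(2), of "\<lambda>_. 1"] P2D(4)[OF m] by simp
qed

lemma distr_in_couplings:
  assumes [measurable]: "Y \<in> borel_measurable N" "Z \<in> borel_measurable N"
  shows "distr N (borel \<Otimes>\<^sub>M borel) (\<lambda>w. (Y w, Z w)) \<in> couplings (distr N borel Y) (distr N borel Z)"
  unfolding couplings_def by (auto simp: distr_distr comp_def)

lemma wasserstein_le:
  fixes m m' :: "'a::euclidean_space measure"
  assumes c: "\<pi> \<in> couplings m m'"
    and le: "(\<integral>\<^sup>+z. ennreal (dist (fst z) (snd z) powr p) \<partial>\<pi>) \<le> ennreal C" and C: "0 \<le> C" and p: "p > 0"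
  shows "wasserstein p m m' \<le> C powr (1 / p)"
  using c le p by (simp add: INF_lower2 enn2real_leI[OF C] powr_mono2 wasserstein_def)

lemma wasserstein_nonneg: "0 \<le> wasserstein p m m'" unfolding wasserstein_def by simp

lemma wasserstein1_distr:
  fixes Y Z :: "'w \<Rightarrow> 'a::euclidean_space"
  assumes [measurable]: "Y \<in> borel_measurable N" "Z \<in> borel_measurable N"
    and le: "(\<integral>\<^sup>+w. ennreal (dist (Y w) (Z w)) \<partial>N) \<le> ennreal C" and C: "0 \<le> C"
  shows "wasserstein 1 (distr N borel Y) (distr N borel Z) \<le> C"
  using wasserstein_le[OF distr_in_couplings[of Y N Z], of 1 C] le C by (simp add: nn_integral_distr)

lemma wasserstein2_distr:
  fixes Y Z :: "'w \<Rightarrow> 'a::euclidean_space"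
  assumes [measurable]: "Y \<in> borel_measurable N" "Z \<in> borel_measurable N"
    and le: "(\<integral>\<^sup>+w. ennreal ((dist (Y w) (Z w))^2) \<partial>N) \<le> ennreal C" and C: "0 \<le> C"
  shows "wasserstein 2 (distr N borel Y) (distr N borel Z) \<le> sqrt C"
  using wasserstein_le[OF distr_in_couplings[of Y N Z], of 2 C] le C by (simp add: nn_integral_distr powr_half_sqrt)

lemma integral_uniform_count:
  fixes f :: "'n::finite \<Rightarrow> real"
  shows "(\<integral>i. f i \<partial>uniform_count_measure UNIV) = (\<Sum>i\<in>UNIV. f i) / real CARD('n)"
  unfolding uniform_count_measure_def by (subst lebesgue_integral_point_measure_finite) (auto simp: sum_divide_distrib)

lemma nn_integral_uniform_count:
  fixes f :: "'n::finite \<Rightarrow> real"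
  assumes "\<And>i. 0 \<le> f i"
  shows "(\<integral>\<^sup>+i. ennreal (f i) \<partial>uniform_count_measure UNIV) = ennreal ((\<Sum>i\<in>UNIV. f i) / real CARD('n))"
proof -
  have "integrable (uniform_count_measure UNIV) f"
    unfolding uniform_count_measure_def by (rule integrable_point_measure_finite) simp
  then show ?thesis using assms by (subst nn_integral_eq_integral) (auto simp: integral_uniform_count)
qed

lemma integral_empirical:
  fixes f :: "'a::euclidean_space \<Rightarrow> real" and x :: "'a ^ 'n"
  assumes [measurable]: "f \<in> borel_measurable borel"
  shows "(\<integral>z. f z \<partial>empirical x) = (\<Sum>i\<in>UNIV. f (x $ i)) / real CARD('n)" "integrable (empirical x) f"
proof -
  show "(\<integral>z. f z \<partial>empirical x) = (\<Sum>i\<in>UNIV. f (x $ i)) / real CARD('n)"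
    unfolding empirical_def by (subst integral_distr) (auto simp: integral_uniform_count)
  show "integrable (empirical x) f" unfolding empirical_def uniform_count_measure_def
    by (subst integrable_distr_eq) (auto intro!: integrable_point_measure_finite)
qed

lemma empirical_P2: "empirical x \<in> P2" for x :: "'a::euclidean_space ^ 'n"
proof -
  interpret prob_space "uniform_count_measure (UNIV :: 'n set)" by (rule prob_space_uniform_count_measure) auto
  have "prob_space (empirical x)" unfolding empirical_def by (rule prob_space_distr) measurable
  moreover have "sets (empirical x) = sets borel" by (simp add: empirical_def)
  ultimately show ?thesis unfolding P2_def using integral_empirical(2)[of "\<lambda>z. (norm z)^2" x] by simp
qed

lemma wasserstein1_empirical: "wasserstein 1 (empirical x) (empirical y) \<le> (\<Sum>i\<in>UNIV. norm (x $ i - y $ i)) / real CARD('n)"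
  for x y :: "'a::euclidean_space ^ 'n" unfolding empirical_def
  by (rule wasserstein1_distr) (auto simp: nn_integral_uniform_count dist_norm sum_nonneg)

lemma wasserstein2_empirical: "wasserstein 2 (empirical x) (empirical y) \<le> sqrt ((\<Sum>i\<in>UNIV. (norm (x $ i - y $ i))^2) / real CARD('n))"
  for x y :: "'a::euclidean_space ^ 'n" unfolding empirical_def
  by (rule wasserstein2_distr) (auto simp: nn_integral_uniform_count dist_norm sum_nonneg)

definition unif01 :: "real measure" where
  "unif01 = density lborel (indicator {0..1})"

lemma sets_unif01 [simp, measurable_cong]: "sets unif01 = sets borel" and space_unif01 [simp]: "space unif01 = UNIV"
  by (simp_all add: unif01_def)

lemma prob_space_unif01: "prob_space unif01" by (rule prob_spaceI) (simp add: unif01_def emeasure_density)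

lemma nn_integral_unif01_interval:
  assumes "0 \<le> r" "r \<le> s" "s \<le> 1"
  shows "(\<integral>\<^sup>+u. indicator {r..<s} u \<partial>unif01) = ennreal (s - r)"
proof -
  have "(\<integral>\<^sup>+u. indicator {r..<s} u \<partial>unif01) = (\<integral>\<^sup>+u. indicator {0..1} u * indicator {r..<s} u \<partial>lborel)"
    unfolding unif01_def by (rule nn_integral_density) auto
  also have "... = (\<integral>\<^sup>+u. indicator {r..<s} u \<partial>lborel)"
    using assms by (intro nn_integral_cong) (auto simp: indicator_def)
  also have "... = ennreal (s - r)" using assms by simp
  finally show ?thesis .
qed

text \<open>A mixture as a random variable: a uniform u chooses between independent samples of the
  two measures. With the same (u, x, x') for two parameters r and s the values differ only if u lies
  between them, which is the coupling behind \<open>wasserstein2_mixture\<close>.\<close>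

definition mixvar :: "real \<Rightarrow> real \<times> 'a \<times> 'a \<Rightarrow> 'a" where
  "mixvar s = (\<lambda>(u, x, x'). if u < s then x' else x)"

locale P2_pair =
  fixes m m' :: "'a::euclidean_space measure"
  assumes m: "m \<in> P2" and m': "m' \<in> P2"
begin

interpretation m: prob_space m using P2D[OF m] by simp
interpretation m': prob_space m' using P2D[OF m'] by simp
interpretation U: prob_space unif01 by (rule prob_space_unif01)
interpretation mm: pair_prob_space m m' ..
interpretation Umm: pair_prob_space unif01 "m \<Otimes>\<^sub>M m'" ..

lemmas [measurable_cong] = P2D(2)[OF m] P2D(2)[OF m']
lemmas [simp] = P2D(3)[OF m] P2D(3)[OF m']

lemma mixvar_measurable [measurable]: "mixvar s \<in> borel_measurable (unif01 \<Otimes>\<^sub>M m \<Otimes>\<^sub>M m')"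
  unfolding mixvar_def by simp

lemma nn_integral_mixvar:
  assumes s: "0 \<le> s" "s \<le> 1" and [measurable]: "f \<in> borel_measurable borel"
  shows "(\<integral>\<^sup>+w. f (mixvar s w) \<partial>(unif01 \<Otimes>\<^sub>M m \<Otimes>\<^sub>M m')) = ennreal (1 - s) * (\<integral>\<^sup>+x. f x \<partial>m) + ennreal s * (\<integral>\<^sup>+x. f x \<partial>m')"
proof -
  let ?A = "\<integral>\<^sup>+x. f x \<partial>m'"
  let ?B = "\<integral>\<^sup>+x. f x \<partial>m"
  let ?C = "m \<Otimes>\<^sub>M m'"
  have 1: "(\<integral>\<^sup>+z. f (fst z) \<partial>?C) = ?B" "(\<integral>\<^sup>+z. f (snd z) \<partial>?C) = ?A"
    using m'.emeasure_space_1 m.emeasure_space_1 by (simp_all add: m'.nn_integral_fst[symmetric])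
  have "(\<integral>\<^sup>+w. f (mixvar s w) \<partial>(unif01 \<Otimes>\<^sub>M m \<Otimes>\<^sub>M m')) = (\<integral>\<^sup>+u. (\<integral>\<^sup>+z. f (mixvar s (u, z)) \<partial>?C) \<partial>unif01)"
    by (rule mm.nn_integral_fst[symmetric]) measurable
  also have "... = (\<integral>\<^sup>+u. indicator {s..1} u * ?B + indicator {0..<s} u * ?A \<partial>unif01)"
  proof (rule nn_integral_cong_AE)
    have "AE u in unif01. u \<in> {0..1}" unfolding unif01_def by (subst AE_density) (auto simp: indicator_def)
    then show "AE u in unif01. (\<integral>\<^sup>+z. f (mixvar s (u, z)) \<partial>?C) = indicator {s..1} u * ?B + indicator {0..<s} u * ?A"
    proof eventually_elim
      case (elim u)
      show ?case using elim 1 by (cases "u < s") (auto simp: mixvar_def case_prod_beta')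
    qed
  qed
  also have "... = (\<integral>\<^sup>+u. indicator {s..1} u \<partial>unif01) * ?B + (\<integral>\<^sup>+u. indicator {0..<s} u \<partial>unif01) * ?A"
    by (simp add: nn_integral_add nn_integral_multc)
  also have "(\<integral>\<^sup>+u. indicator {s..1} u \<partial>unif01) = (\<integral>\<^sup>+u. indicator {s..<1} u \<partial>unif01)"
  proof (rule nn_integral_cong_AE)
    have "AE u in lborel. u \<noteq> (1::real)" by (rule AE_lborel_singleton)
    then have "AE u in unif01. u \<noteq> 1" unfolding unif01_def by (subst AE_density) auto
    then show "AE u in unif01. indicator {s..1} u = (indicator {s..<1} u :: ennreal)" by eventually_elim (auto simp: indicator_def)
  qed
  finally show ?thesis using s by (simp add: nn_integral_unif01_interval del: nn_integral_indicator)
qed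

text \<open>\<open>mixture\<close> is built with \<open>measure_of\<close>, whose
  \<open>emeasure\<close> is the given set function only if that function is a measure. Exhibiting
  it as the law of \<open>mixvar s\<close> settles this and reduces integrals to those of a random
  variable.\<close>

lemma mixture_eq:
  assumes s: "0 \<le> s" "s \<le> 1"
  shows "mixture s m m' = distr (unif01 \<Otimes>\<^sub>M m \<Otimes>\<^sub>M m') borel (mixvar s)"
proof -
  let ?A = "\<lambda>A. ennreal (1 - s) * emeasure m A + ennreal s * emeasure m' A"
  let ?D = "distr (unif01 \<Otimes>\<^sub>M m \<Otimes>\<^sub>M m') borel (mixvar s)"
  have e: "emeasure ?D A = ?A A" if [measurable]: "A \<in> sets borel" for A
  proof -
    have "emeasure ?D A = (\<integral>\<^sup>+y. indicator A y \<partial>?D)" by simp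
    also have "... = (\<integral>\<^sup>+w. indicator A (mixvar s w) \<partial>(unif01 \<Otimes>\<^sub>M m \<Otimes>\<^sub>M m'))" by (rule nn_integral_distr) auto
    also have "... = ?A A" by (subst nn_integral_mixvar[OF s]) auto
    finally show ?thesis .
  qed
  have "mixture s m m' = measure_of (space ?D) (sets ?D) (\<lambda>A. ?A A)"
    unfolding mixture_def by (simp add: P2D(2)[OF m])
  also have "... = measure_of (space ?D) (sets ?D) (emeasure ?D)"
  proof (rule measure_of_eq)
    show "sets ?D \<subseteq> Pow (space ?D)" by simp
    fix A assume "A \<in> sigma_sets (space ?D) (sets ?D)"
    then have "A \<in> sets borel" by (simp only: sets.sigma_sets_eq) simp
    then show "?A A = emeasure ?D A" by (simp add: e)
  qed
  also have "... = ?D" by (rule measure_of_of_measure)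
  finally show ?thesis .
qed

lemma nn_integral_mixture:
  assumes s: "0 \<le> s" "s \<le> 1" and [measurable]: "f \<in> borel_measurable borel"
  shows "(\<integral>\<^sup>+x. f x \<partial>mixture s m m') = ennreal (1 - s) * (\<integral>\<^sup>+x. f x \<partial>m) + ennreal s * (\<integral>\<^sup>+x. f x \<partial>m')"
  unfolding mixture_eq[OF s] by (subst nn_integral_distr) (auto simp: nn_integral_mixvar[OF s])

lemma emeasure_mixture:
  assumes s: "0 \<le> s" "s \<le> 1" and [measurable]: "A \<in> sets borel"
  shows "emeasure (mixture s m m') A = ennreal (1 - s) * emeasure m A + ennreal s * emeasure m' A"
proof -
  have "emeasure (mixture s m m') A = (\<integral>\<^sup>+x. indicator A x \<partial>mixture s m m')"
    by (simp add: mixture_eq[OF s])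
  then show ?thesis by (simp add: nn_integral_mixture[OF s])
qed

lemma integral_mixture:
  fixes f :: "'a \<Rightarrow> real"
  assumes s: "0 \<le> s" "s \<le> 1" and [measurable]: "f \<in> borel_measurable borel" and i: "integrable m f" "integrable m' f"
  shows "integrable (mixture s m m') f" "(\<integral>x. f x \<partial>mixture s m m') = (1 - s) * (\<integral>x. f x \<partial>m) + s * (\<integral>x. f x \<partial>m')"
proof -
  have [measurable_cong]: "sets (mixture s m m') = sets borel" by (simp add: mixture_eq[OF s])
  have *: "integrable (mixture s m m') g \<and> (\<integral>x. g x \<partial>mixture s m m') = (1 - s) * (\<integral>x. g x \<partial>m) + s * (\<integral>x. g x \<partial>m')"
    if [measurable]: "g \<in> borel_measurable borel" and g: "\<And>x. 0 \<le> g x" "integrable m g" "integrable m' g" for g :: "'a \<Rightarrow> real"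
  proof -
    have "has_bochner_integral (mixture s m m') g ((1 - s) * (\<integral>x. g x \<partial>m) + s * (\<integral>x. g x \<partial>m'))"
      using s g by (simp add: nn_integral_eq_integral ennreal_mult' nn_integral_mixture[OF s] has_bochner_integral_nn_integral)
    then show ?thesis by (simp add: has_bochner_integral_iff)
  qed
  have p: "integrable m (\<lambda>x. max 0 (f x))" "integrable m' (\<lambda>x. max 0 (f x))" "integrable m (\<lambda>x. max 0 (- f x))" "integrable m' (\<lambda>x. max 0 (- f x))"
    using i by auto
  note P = *[of "\<lambda>x. max 0 (f x)"] and N = *[of "\<lambda>x. max 0 (- f x)"]
  have f: "f = (\<lambda>x. max 0 (f x) - max 0 (- f x))" by auto
  show "integrable (mixture s m m') f" by (subst f) (use P N p in auto)
  have "(\<integral>x. f x \<partial>R) = (\<integral>x. max 0 (f x) \<partial>R) - (\<integral>x. max 0 (- f x) \<partial>R)" if "integrable R f" for R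
    using that by (subst (1) f) (intro Bochner_Integration.integral_diff, auto)
  note e = this[OF i(1)] this[OF i(2)] this[OF \<open>integrable (mixture s m m') f\<close>]
  have e4: "(\<integral>x. max 0 (f x) \<partial>mixture s m m') = (1 - s) * (\<integral>x. max 0 (f x) \<partial>m) + s * (\<integral>x. max 0 (f x) \<partial>m')"
    "(\<integral>x. max 0 (- f x) \<partial>mixture s m m') = (1 - s) * (\<integral>x. max 0 (- f x) \<partial>m) + s * (\<integral>x. max 0 (- f x) \<partial>m')"
    using P N p by auto
  show "(\<integral>x. f x \<partial>mixture s m m') = (1 - s) * (\<integral>x. f x \<partial>m) + s * (\<integral>x. f x \<partial>m')"
    unfolding e e4 by (simp add: algebra_simps)
qed

lemma mixture_P2:
  assumes s: "0 \<le> s" "s \<le> 1"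
  shows "mixture s m m' \<in> P2" unfolding P2_def
proof safe
  show "prob_space (mixture s m m')" unfolding mixture_eq[OF s] by (rule Umm.prob_space_distr) measurable
  show "integrable (mixture s m m') (\<lambda>x. (norm x)^2)"
    using P2D(4)[OF m] P2D(4)[OF m'] by (intro integral_mixture[OF s]) auto
qed (simp_all add: mixture_eq[OF s])

lemma wasserstein2_mixture:
  assumes "0 \<le> r" "r \<le> 1" "0 \<le> s" "s \<le> 1"
  shows "wasserstein 2 (mixture r m m') (mixture s m m') \<le> sqrt (\<bar>r - s\<bar> * (2 * (\<integral>x. (norm x)^2 \<partial>m) + 2 * (\<integral>x. (norm x)^2 \<partial>m')))"
proof -
  let ?A = "m \<Otimes>\<^sub>M m'"
  let ?B = "\<integral>\<^sup>+z. ennreal ((dist (fst z) (snd z))^2) \<partial>?A"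
  define C where "C = 2 * (\<integral>x. (norm x)^2 \<partial>m) + 2 * (\<integral>x. (norm x)^2 \<partial>m')"
  have C0: "C \<ge> 0" by (simp add: C_def)
  let ?a = "min r s" and ?b = "max r s"
  have mmC: "?B \<le> ennreal C"
  proof -
    have "?B \<le> (\<integral>\<^sup>+z. ennreal (2 * (norm (fst z))^2) + ennreal (2 * (norm (snd z))^2) \<partial>?A)"
      by (intro nn_integral_mono) (auto simp: dist_norm ennreal_plus[symmetric] simp del: ennreal_plus intro!: norm_diff_square_le)
    also have "... = ennreal C"
      using m'.emeasure_space_1 m.emeasure_space_1 P2D(4)[OF m] P2D(4)[OF m'] by (simp add: m'.nn_integral_fst[symmetric] nn_integral_add nn_integral_eq_integral C_def)
    finally show ?thesis .
  qed
  have "(\<integral>\<^sup>+w. ennreal ((dist (mixvar r w) (mixvar s w))^2) \<partial>(unif01 \<Otimes>\<^sub>M m \<Otimes>\<^sub>M m'))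
    = (\<integral>\<^sup>+u. (\<integral>\<^sup>+z. ennreal ((dist (mixvar r (u, z)) (mixvar s (u, z)))^2) \<partial>?A) \<partial>unif01)"
    by (rule mm.nn_integral_fst[symmetric]) measurable
  also have "... \<le> (\<integral>\<^sup>+u. indicator {?a..<?b} u * ennreal C \<partial>unif01)"
  proof (rule nn_integral_mono)
    fix u
    have "(\<integral>\<^sup>+z. ennreal ((dist (mixvar r (u, z)) (mixvar s (u, z)))^2) \<partial>?A)
      = (\<integral>\<^sup>+z. indicator {?a..<?b} u * ennreal ((dist (fst z) (snd z))^2) \<partial>?A)"
      by (intro nn_integral_cong) (auto simp: mixvar_def indicator_def dist_commute)
    also have "... \<le> indicator {?a..<?b} u * ennreal C" using mmC by (simp add: nn_integral_cmult mult_left_mono)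
    finally show "(\<integral>\<^sup>+z. ennreal ((dist (mixvar r (u, z)) (mixvar s (u, z)))^2) \<partial>?A) \<le> indicator {?a..<?b} u * ennreal C" .
  qed
  also have "... = ennreal (?b - ?a) * ennreal C"
    using assms by (simp add: nn_integral_multc nn_integral_unif01_interval del: nn_integral_indicator)
  also have "... = ennreal (\<bar>r - s\<bar> * C)" by (simp add: ennreal_mult'[symmetric] abs_if)
  finally show ?thesis unfolding mixture_eq[OF assms(1,2)] mixture_eq[OF assms(3,4)] C_def[symmetric]
    by (intro wasserstein2_distr) (use C0 in auto)
qed

lemma wasserstein2_return_mixture:
  assumes s: "0 \<le> s" "s \<le> 1"
  shows "wasserstein 2 (return borel 0) (mixture s m m') \<le> sqrt ((\<integral>x. (norm x)^2 \<partial>m) + (\<integral>x. (norm x)^2 \<partial>m'))"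
proof -
  let ?A = "\<integral>x. (norm x)^2 \<partial>m'"
  let ?B = "\<integral>x. (norm x)^2 \<partial>m"
  let ?C = "mixture s m m'"
  interpret X: prob_space "mixture s m m'" using P2D(1)[OF mixture_P2[OF s]] .
  have [measurable_cong]: "sets ?C = sets borel" by (simp add: mixture_eq[OF s])
  have r: "return borel 0 = distr ?C borel (\<lambda>x. 0)" by simp
  have d: "mixture s m m' = distr ?C borel (\<lambda>x. x)" using P2D(2)[OF mixture_P2[OF s]] by (simp add: distr_id2)
  have i: "integrable ?C (\<lambda>x. (norm x)^2)" by (rule P2D(4)[OF mixture_P2[OF s]])
  have "(\<integral>x. (norm x)^2 \<partial>mixture s m m') = (1 - s) * ?B + s * ?A"
    using P2D(4)[OF m] P2D(4)[OF m'] by (intro integral_mixture[OF s]) auto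
  also have "... \<le> 1 * ?B + 1 * ?A" using s by (intro add_mono mult_right_mono) auto
  finally have "(\<integral>\<^sup>+x. ennreal ((dist 0 x)^2) \<partial>mixture s m m') \<le> ennreal (?B + ?A)"
    using i by (simp add: nn_integral_eq_integral del: ennreal_plus)
  then have "wasserstein 2 (distr ?C borel (\<lambda>x. 0)) (distr ?C borel (\<lambda>x. x)) \<le> sqrt (?B + ?A)"
    by (intro wasserstein2_distr) auto
  then show ?thesis unfolding r[symmetric] d[symmetric] .
qed

end

lemmas mixture_eq = P2_pair.mixture_eq[OF P2_pair.intro]
  and nn_integral_mixture = P2_pair.nn_integral_mixture[OF P2_pair.intro]
  and emeasure_mixture = P2_pair.emeasure_mixture[OF P2_pair.intro]
  and integral_mixture = P2_pair.integral_mixture[OF P2_pair.intro]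
  and mixture_P2 = P2_pair.mixture_P2[OF P2_pair.intro]
  and wasserstein2_mixture = P2_pair.wasserstein2_mixture[OF P2_pair.intro]
  and wasserstein2_return_mixture = P2_pair.wasserstein2_return_mixture[OF P2_pair.intro]

lemma mixture_mixture:
  assumes m: "m \<in> P2" "m' \<in> P2" and r: "0 \<le> r" "r \<le> 1" and s: "0 \<le> s" "s \<le> 1"
  shows "mixture r m (mixture s m m') = mixture (r * s) m m'"
proof (rule measure_eqI)
  let ?B = "ennreal (1 - r) + ennreal r * ennreal (1 - s)"
  let ?A = "mixture r m (mixture s m m')"
  have rs: "0 \<le> r * s" "r * s \<le> 1" using r s by (auto simp: mult_le_one)
  have M: "mixture s m m' \<in> P2" by (rule mixture_P2[OF m s])
  show "sets ?A = sets (mixture (r * s) m m')"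
    using P2D(2)[OF mixture_P2[OF m(1) M r]] P2D(2)[OF mixture_P2[OF m rs]] by simp
  fix A assume "A \<in> sets ?A"
  then have A: "A \<in> sets borel" using P2D(2)[OF mixture_P2[OF m(1) M r]] by simp
  have "emeasure ?A A = (?B) * emeasure m A + ennreal r * ennreal s * emeasure m' A"
    using emeasure_mixture[OF m(1) M r A] emeasure_mixture[OF m s A] by (simp add: algebra_simps)
  also have "?B = ennreal (1 - r * s)"
  proof -
    have "?B = ennreal ((1 - r) + r * (1 - s))" using r s by (simp add: ennreal_mult')
    then show ?thesis by (simp add: algebra_simps)
  qed
  also have "ennreal r * ennreal s = ennreal (r * s)" using r by (simp add: ennreal_mult')
  finally show "emeasure ?A A = emeasure (mixture (r * s) m m') A" using emeasure_mixture[OF m rs A] by simp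
qed

lemma mixture_0:
  assumes "m \<in> P2" "m' \<in> P2"
  shows "mixture 0 m m' = m"
proof (rule measure_eqI)
  show "sets (mixture 0 m m') = sets m" using P2D(2)[OF mixture_P2[OF assms, of 0]] P2D(2)[OF assms(1)] by simp
  fix A assume "A \<in> sets (mixture 0 m m')"
  then show "emeasure (mixture 0 m m') A = emeasure m A"
    using P2D(2)[OF mixture_P2[OF assms, of 0]] emeasure_mixture[OF assms, of 0 A] by simp
qed

section \<open>Linear derivative, tangent inequality and the N-particle potential\<close>

lemma norm_vec_square: "(norm x)^2 = (\<Sum>i\<in>UNIV. (norm (x $ i))^2)" for x :: "'a::real_inner ^ 'n"
  by (simp add: power2_norm_eq_inner inner_vec_def)

lemma sum_square_le_card:
  fixes a :: "'n::finite \<Rightarrow> real"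
  shows "(\<Sum>i\<in>UNIV. a i)^2 \<le> real CARD('n) * (\<Sum>i\<in>UNIV. (a i)^2)"
  using Cauchy_Schwarz_ineq_sum[of "\<lambda>_. 1" a UNIV] by simp

text \<open>\<open>K\<close> is the Lipschitz constant in the measure and \<open>Mx\<close> the
  Hessian bound, that is M_mm and M_mx of the statement.\<close>

locale mean_field =
  fixes F :: "'a::euclidean_space measure \<Rightarrow> real" and dF :: "'a measure \<Rightarrow> 'a \<Rightarrow> real"
    and DF :: "'a measure \<Rightarrow> 'a \<Rightarrow> 'a" and K Mx :: real
  assumes lfd: "linear_functional_derivative F dF"
    and idf: "intrinsic_derivative dF DF"
    and K: "K \<ge> 0" and Mx: "Mx \<ge> 0"
    and convex: "\<And>s m m'. s \<in> {0..1} \<Longrightarrow> m \<in> P2 \<Longrightarrow> m' \<in> P2 \<Longrightarrow> F (mixture s m m') \<le> (1 - s) * F m + s * F m'"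
    and lipschitz: "\<And>m m' x. m \<in> P2 \<Longrightarrow> m' \<in> P2 \<Longrightarrow> norm (DF m x - DF m' x) \<le> K * wasserstein 1 m m'"
    and hessian: "\<And>m x. m \<in> P2 \<Longrightarrow> \<exists>A. (DF m has_derivative A) (at x) \<and> onorm A \<le> Mx"
begin

lemma DF_lip:
  assumes "m \<in> P2"
  shows "norm (DF m y - DF m x) \<le> Mx * norm (y - x)"
proof -
  obtain A where A: "\<And>x. (DF m has_derivative A x) (at x)" "\<And>x. onorm (A x) \<le> Mx"
    using hessian[OF assms] by metis
  show ?thesis by (rule differentiable_bound[of UNIV "DF m" A]) (use A in auto)
qed

lemma dF_GDERIV: "m \<in> P2 \<Longrightarrow> GDERIV (dF m) x :> DF m x" using idf by (simp add: intrinsic_derivative_def)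

lemma dF_continuous: "m \<in> P2 \<Longrightarrow> continuous_on UNIV (dF m)"
  using dF_GDERIV by (meson continuous_at_imp_continuous_on gderiv_def has_derivative_continuous)

lemma dF_measurable: "m \<in> P2 \<Longrightarrow> dF m \<in> borel_measurable borel"
  by (intro borel_measurable_continuous_onI dF_continuous)

lemma dF_quad: "m \<in> P2 \<Longrightarrow> \<bar>dF m y - dF m x - DF m x \<bullet> (y - x)\<bar> \<le> Mx * (norm (y - x))^2"
  by (rule GDERIV_lipschitz_quadratic_bound[OF dF_GDERIV DF_lip])

text \<open>The kernels \<open>dF m\<close> and \<open>dF m'\<close> are compared through their
  gradients, so only increments in x of the difference are controlled and an additive constant stays
  free. Later comparisons of kernels are therefore centred.\<close>

lemma dF_diff_lip:
  assumes "m \<in> P2" "m' \<in> P2"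
  shows "\<bar>(dF m y - dF m' y) - (dF m x - dF m' x)\<bar> \<le> K * wasserstein 1 m m' * norm (y - x)"
proof -
  have g: "GDERIV (\<lambda>x. dF m x - dF m' x) x :> DF m x - DF m' x" for x by (intro GDERIV_diff dF_GDERIV assms)
  obtain r where "(dF m y - dF m' y) - (dF m x - dF m' x) = (DF m (x + r *\<^sub>R (y - x)) - DF m' (x + r *\<^sub>R (y - x))) \<bullet> (y - x)"
    using GDERIV_mvt[OF g] by metis
  then have "\<bar>(dF m y - dF m' y) - (dF m x - dF m' x)\<bar> \<le> norm (DF m (x + r *\<^sub>R (y - x)) - DF m' (x + r *\<^sub>R (y - x))) * norm (y - x)"
    by (simp add: Cauchy_Schwarz_ineq2)
  also have "... \<le> K * wasserstein 1 m m' * norm (y - x)" by (intro mult_right_mono lipschitz assms) auto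
  finally show ?thesis .
qed

lemma dF_bounded_growth:
  obtains C where "\<And>m x. m \<in> P2 \<Longrightarrow> wasserstein 2 (return borel 0) m \<le> R \<Longrightarrow> \<bar>dF m x\<bar> \<le> C * (1 + (norm x)^2)"
  using lfd unfolding linear_functional_derivative_def by metis

lemma dF_growth:
  assumes "m \<in> P2"
  obtains C where "\<And>x. \<bar>dF m x\<bar> \<le> C * (1 + (norm x)^2)"
  using dF_bounded_growth[of "wasserstein 2 (return borel 0) m"] assms by (metis order_refl)

lemma dF_integrable: "m \<in> P2 \<Longrightarrow> \<nu> \<in> P2 \<Longrightarrow> integrable \<nu> (dF m)"
  using dF_growth P2_growth dF_measurable by metis

lemma dF_continuous_measure:
  assumes "m \<in> P2" "\<epsilon> > 0"
  obtains \<delta> where "\<delta> > 0" "\<And>m' y. m' \<in> P2 \<Longrightarrow> wasserstein 2 m m' < \<delta> \<Longrightarrow> dist x y < \<delta> \<Longrightarrow> \<bar>dF m' y - dF m x\<bar> < \<epsilon>"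
  using conjunct1[OF lfd[unfolded linear_functional_derivative_def]] assms by force

lemma dF_tendsto:
  assumes "m \<in> P2" "\<And>n. mn n \<in> P2" "(\<lambda>n. wasserstein 2 m (mn n)) \<longlonglongrightarrow> 0" "xn \<longlonglongrightarrow> x"
  shows "(\<lambda>n. dF (mn n) (xn n)) \<longlonglongrightarrow> dF m x"
proof (rule LIMSEQ_I)
  fix e :: real assume "e > 0"
  then obtain d where d: "d > 0" "\<And>m' y. m' \<in> P2 \<Longrightarrow> wasserstein 2 m m' < d \<Longrightarrow> dist x y < d \<Longrightarrow> \<bar>dF m' y - dF m x\<bar> < e"
    using dF_continuous_measure[OF assms(1), of e x] by auto
  have "eventually (\<lambda>n. wasserstein 2 m (mn n) < d) sequentially" using assms(3) d(1) by (rule order_tendstoD)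
  moreover have "eventually (\<lambda>n. dist (xn n) x < d) sequentially" using assms(4) d(1) by (rule tendstoD)
  ultimately have "eventually (\<lambda>n. norm (dF (mn n) (xn n) - dF m x) < e) sequentially"
    by eventually_elim (use d assms(2) in \<open>auto simp: dist_commute\<close>)
  then show "\<exists>no. \<forall>n\<ge>no. norm (dF (mn n) (xn n) - dF m x) < e" by (simp add: eventually_sequentially)
qed

text \<open>The derivative at r of F along the segment from m to m'; \<open>F_mixture\<close> is the
  integrated form.\<close>

definition dir :: "'a measure \<Rightarrow> 'a measure \<Rightarrow> real \<Rightarrow> real" where
  "dir m m' r = (\<integral>x. dF (mixture r m m') x \<partial>m') - (\<integral>x. dF (mixture r m m') x \<partial>m)"

context
  fixes m m' :: "'a measure"
  assumes m: "m \<in> P2" "m' \<in> P2"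
begin

text \<open>All mixtures of the segment lie in one Wasserstein ball, so the growth bound of
  \<open>dF\<close> is uniform there and serves as dominating function; pointwise convergence is the
  joint continuity of \<open>dF\<close>.\<close>

lemma dir_continuous: "continuous_on {0..1} (dir m m')" unfolding continuous_on_sequentially
proof (intro allI ballI impI, elim conjE)
  fix u :: "nat \<Rightarrow> real" and r
  assume r: "r \<in> {0..1}" and u: "\<forall>n. u n \<in> {0..1}" "u \<longlonglongrightarrow> r"
  have P: "mixture (u n) m m' \<in> P2" "mixture r m m' \<in> P2" for n using u r by (auto intro!: mixture_P2 m)
  define R where "R = sqrt ((\<integral>x. (norm x)^2 \<partial>m) + (\<integral>x. (norm x)^2 \<partial>m'))"
  obtain C where C: "\<And>m x. m \<in> P2 \<Longrightarrow> wasserstein 2 (return borel 0) m \<le> R \<Longrightarrow> \<bar>dF m x\<bar> \<le> C * (1 + (norm x)^2)"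
    using dF_bounded_growth[of R] by auto
  have g: "\<bar>dF (mixture (u n) m m') x\<bar> \<le> C * (1 + (norm x)^2)" for n x
    using u wasserstein2_return_mixture[OF m, of "u n"] by (intro C P) (auto simp: R_def)
  define B where "B = 2 * (\<integral>x. (norm x)^2 \<partial>m) + 2 * (\<integral>x. (norm x)^2 \<partial>m')"
  have "(\<lambda>n. sqrt (\<bar>r - u n\<bar> * B)) \<longlonglongrightarrow> sqrt (\<bar>r - r\<bar> * B)" by (intro tendsto_intros u)
  then have "(\<lambda>n. sqrt (\<bar>r - u n\<bar> * B)) \<longlonglongrightarrow> 0" by simp
  then have w: "(\<lambda>n. wasserstein 2 (mixture r m m') (mixture (u n) m m')) \<longlonglongrightarrow> 0"
  proof (rule tendsto_sandwich[OF _ _ tendsto_const, rotated 2])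
    show "eventually (\<lambda>n. 0 \<le> wasserstein 2 (mixture r m m') (mixture (u n) m m')) sequentially" by (simp add: wasserstein_nonneg)
    show "eventually (\<lambda>n. wasserstein 2 (mixture r m m') (mixture (u n) m m') \<le> sqrt (\<bar>r - u n\<bar> * B)) sequentially"
      using u r wasserstein2_mixture[OF m] by (auto simp: B_def)
  qed
  have lim: "(\<lambda>n. \<integral>x. dF (mixture (u n) m m') x \<partial>\<nu>) \<longlonglongrightarrow> (\<integral>x. dF (mixture r m m') x \<partial>\<nu>)" if \<nu>: "\<nu> \<in> P2" for \<nu>
  proof (rule integral_dominated_convergence[where w="\<lambda>x. C * (1 + (norm x)^2)"])
    show "dF (mixture r m m') \<in> borel_measurable \<nu>" "dF (mixture (u n) m m') \<in> borel_measurable \<nu>" for n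
      by (intro P2_measurable[OF \<nu>] dF_measurable P)+
    interpret prob_space \<nu> using P2D[OF \<nu>] by simp
    show "integrable \<nu> (\<lambda>x. C * (1 + (norm x)^2))" using P2D(4)[OF \<nu>] by auto
    show "AE x in \<nu>. (\<lambda>n. dF (mixture (u n) m m') x) \<longlonglongrightarrow> dF (mixture r m m') x"
      by (intro AE_I2 dF_tendsto P w tendsto_const)
    show "AE x in \<nu>. norm (dF (mixture (u n) m m') x) \<le> C * (1 + (norm x)^2)" for n using g by auto
  qed
  show "(dir m m' \<circ> u) \<longlonglongrightarrow> dir m m' r" unfolding dir_def comp_def by (intro tendsto_diff lim m)
qed

lemma F_mixture:
  assumes s: "0 \<le> s" "s \<le> 1"
  shows "F (mixture s m m') - F m = integral {0..1} (\<lambda>t. s * dir m m' (t * s))"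
proof -
  let ?A = "mixture s m m'"
  have M: "mixture s m m' \<in> P2" by (rule mixture_P2[OF m s])
  have "F ?A - F m = integral {0..1} (\<lambda>t. (\<integral>x. dF (mixture t m ?A) x \<partial>mixture s m m')
      - (\<integral>x. dF (mixture t m ?A) x \<partial>m))" using lfd m M unfolding linear_functional_derivative_def by simp
  also have "... = integral {0..1} (\<lambda>t. s * dir m m' (t * s))"
  proof (rule Henstock_Kurzweil_Integration.integral_cong)
    fix t :: real assume t: "t \<in> {0..1}"
    then have ts: "0 \<le> t * s" "t * s \<le> 1" using s by (auto simp: mult_le_one)
    have e: "mixture t m ?A = mixture (t * s) m m'" using t s by (intro mixture_mixture m) auto
    have P: "mixture (t * s) m m' \<in> P2" by (rule mixture_P2[OF m ts])
    have "(\<integral>x. dF (mixture (t * s) m m') x \<partial>mixture s m m') = (1 - s) * (\<integral>x. dF (mixture (t * s) m m') x \<partial>m) + s * (\<integral>x. dF (mixture (t * s) m m') x \<partial>m')"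
      by (rule integral_mixture(2)[OF m s dF_measurable[OF P] dF_integrable[OF P m(1)] dF_integrable[OF P m(2)]])
    then show "(\<integral>x. dF (mixture t m ?A) x \<partial>mixture s m m') - (\<integral>x. dF (mixture t m ?A) x \<partial>m) = s * dir m m' (t * s)"
      unfolding e dir_def by (simp add: algebra_simps)
  qed
  finally show ?thesis .
qed

lemma F_derivative:
  assumes "\<eta> > 0"
  obtains s0 where "0 < s0" "s0 \<le> 1" "\<And>s. 0 < s \<Longrightarrow> s \<le> s0 \<Longrightarrow> \<bar>F (mixture s m m') - F m - s * dir m m' 0\<bar> \<le> \<eta> * s"
proof -
  obtain d where d: "d > 0" "\<And>r. r \<in> {0..1} \<Longrightarrow> dist r 0 < d \<Longrightarrow> dist (dir m m' r) (dir m m' 0) < \<eta>"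
    using dir_continuous assms unfolding continuous_on_iff by (metis atLeastAtMost_iff order_refl zero_le_one)
  define s0 where "s0 = min 1 (d / 2)"
  show thesis
  proof (rule that[of s0])
    show "0 < s0" "s0 \<le> 1" using d by (auto simp: s0_def)
    fix s assume s: "0 < s" "s \<le> s0"
    then have s1: "s \<le> 1" "s < d" by (auto simp: s0_def)
    have c: "continuous_on {0..1} (\<lambda>t. s * dir m m' (t * s))"
      using s s1 by (intro continuous_intros continuous_on_compose2[OF dir_continuous]) (auto simp: mult_le_one)
    have "F (mixture s m m') - F m - s * dir m m' 0 = integral {0..1} (\<lambda>t. s * dir m m' (t * s)) - integral {0..1} (\<lambda>t::real. s * dir m m' 0)"
      using F_mixture[of s] s s1 by simp
    also have "... = integral {0..1} (\<lambda>t. s * dir m m' (t * s) - s * dir m m' 0)"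
      using c by (intro Henstock_Kurzweil_Integration.integral_diff[symmetric] integrable_continuous_interval) auto
    also have "norm ... \<le> (\<eta> * s) * (1 - 0)"
    proof (rule integral_bound)
      show "continuous_on {0..1} (\<lambda>t. s * dir m m' (t * s) - s * dir m m' 0)" by (intro continuous_intros c)
      fix t :: real assume t: "t \<in> {0..1}"
      have "t * s \<le> s" using t s by auto
      then have "t * s < d" using s1 by simp
      then show "norm (s * dir m m' (t * s) - s * dir m m' 0) \<le> \<eta> * s"
        using d(2)[of "t * s"] t s s1 by (simp add: dist_real_def mult_le_one right_diff_distrib[symmetric] abs_mult)
    qed simp
    finally show "\<bar>F (mixture s m m') - F m - s * dir m m' 0\<bar> \<le> \<eta> * s" by simp
  qed
qed

lemma dir_0: "dir m m' 0 = (\<integral>x. dF m x \<partial>m') - (\<integral>x. dF m x \<partial>m)"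
  by (simp add: dir_def mixture_0[OF m])

text \<open>Convexity on a short segment, divided by its length, against the derivative at 0. The
  hypothesis \<open>convex\<close> acts through this tangent inequality alone.\<close>

lemma F_first_order: "(\<integral>x. dF m x \<partial>m') - (\<integral>x. dF m x \<partial>m) \<le> F m' - F m"
proof (rule field_le_epsilon)
  fix \<eta> :: real assume "\<eta> > 0"
  then obtain s0 where s0: "0 < s0" "s0 \<le> 1" "\<And>s. 0 < s \<Longrightarrow> s \<le> s0 \<Longrightarrow> \<bar>F (mixture s m m') - F m - s * dir m m' 0\<bar> \<le> \<eta> * s"
    using F_derivative by auto
  have "s0 * (dir m m' 0) \<le> s0 * (F m' - F m + \<eta>)"
    using s0(3)[of s0] convex[of s0 m m'] s0 m by (simp add: algebra_simps)
  then show "(\<integral>x. dF m x \<partial>m') - (\<integral>x. dF m x \<partial>m) \<le> F m' - F m + \<eta>"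
    using s0 by (simp add: dir_0)
qed

end

definition UU :: "'a ^ 'n \<Rightarrow> real" where
  "UU x = real CARD('n) * F (empirical x)"

text \<open>The gradient of \<open>UU\<close>, as \<open>potential_UU\<close> shows: the factor N
  cancels the weight 1/N of a particle in \<open>empirical x\<close>.\<close>

definition bN :: "'a ^ 'n \<Rightarrow> 'a ^ 'n" where
  "bN x = (\<chi> i. DF (empirical x) (x $ i))"

lemma empirical_first_order:
  fixes x y :: "'a ^ 'n"
  shows "(\<Sum>i\<in>UNIV. dF (empirical x) (y $ i) - dF (empirical x) (x $ i)) \<le> UU y - UU x"
proof -
  have "real CARD('n) * ((\<integral>z. dF (empirical x) z \<partial>empirical y) - (\<integral>z. dF (empirical x) z \<partial>empirical x)) \<le> real CARD('n) * (F (empirical y) - F (empirical x))"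
    by (intro mult_left_mono F_first_order empirical_P2) auto
  then show ?thesis
    using integral_empirical(1)[OF dF_measurable[OF empirical_P2[of x]], of y] integral_empirical(1)[OF dF_measurable[OF empirical_P2[of x]], of x]
    by (simp add: UU_def sum_subtractf algebra_simps)
qed

text \<open>Particles with the same index are coupled; the rest is Cauchy-Schwarz over the
  particles.\<close>

lemma K_W1_empirical:
  fixes x y :: "'a ^ 'n"
  shows "(wasserstein 1 (empirical x) (empirical y))^2 * real CARD('n) \<le> (norm (y - x))^2"
    and "wasserstein 1 (empirical x) (empirical y) * (\<Sum>i\<in>UNIV. norm (y $ i - x $ i)) \<le> (norm (y - x))^2"
proof -
  let ?A = "wasserstein 1 (empirical x) (empirical y)"
  let ?S = "\<Sum>i\<in>(UNIV::'n set). norm (y $ i - x $ i)" and ?n = "real CARD('n)"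
  have w: "?A \<le> ?S / ?n" using wasserstein1_empirical[of x y] by (simp add: norm_minus_commute)
  have S: "?S^2 \<le> ?n * (norm (y - x))^2" using sum_square_le_card[of "\<lambda>i::'n. norm (y $ i - x $ i)"] by (simp add: norm_vec_square)
  have S0: "0 \<le> ?S" by (simp add: sum_nonneg)
  have "(?A)^2 * ?n \<le> (?S / ?n)^2 * ?n" using w wasserstein_nonneg by (intro mult_right_mono power_mono) auto
  also have "... \<le> (norm (y - x))^2" using S by (simp add: power2_eq_square divide_le_eq mult.commute)
  finally show "(?A)^2 * ?n \<le> (norm (y - x))^2" .
  have "wasserstein 1 (empirical x) (empirical y) * ?S \<le> (?S / ?n) * ?S" using w S0 by (intro mult_right_mono) auto
  also have "... \<le> (norm (y - x))^2" using S by (simp add: power2_eq_square divide_le_eq mult.commute)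
  finally show "wasserstein 1 (empirical x) (empirical y) * ?S \<le> (norm (y - x))^2" .
qed

text \<open>No second derivative of F in the measure is available, so the two-sided Taylor bound
  comes from convexity: the tangent inequality at x bounds the increment from below, the one at y
  from above, and the change of kernel between them costs \<open>K\<close> times the Wasserstein
  distance. The constant c leaves room for normalising the energy.\<close>

lemma potential_UU: "potential (\<lambda>x::'a ^ 'n. UU x - c) bN (2 * (Mx + K))"
proof
  let ?A = "\<lambda>y. empirical y"
  let ?B = "\<lambda>x. empirical x"
  fix x y :: "'a ^ 'n"
  let ?W = "wasserstein 1 (?B x) (?A y)"
  have P: "empirical x \<in> P2" "empirical y \<in> P2" by (rule empirical_P2)+
  have in_bN: "bN x \<bullet> (y - x) = (\<Sum>i\<in>UNIV. DF (?B x) (x $ i) \<bullet> (y $ i - x $ i))" by (simp add: bN_def inner_vec_def)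
  have nv: "(\<Sum>i\<in>UNIV. (norm (y $ i - x $ i))^2) = (norm (y - x))^2" by (simp add: norm_vec_square)
  have "bN x \<bullet> (y - x) - Mx * (norm (y - x))^2 = (\<Sum>i\<in>UNIV. DF (?B x) (x $ i) \<bullet> (y $ i - x $ i) - Mx * (norm (y $ i - x $ i))^2)"
    unfolding in_bN by (simp add: sum_subtractf sum_distrib_left[symmetric] nv)
  also have "... \<le> (\<Sum>i\<in>UNIV. dF (?B x) (y $ i) - dF (?B x) (x $ i))"
    using dF_quad[OF P(1)] by (intro sum_mono) (smt (verit))
  also have "... \<le> UU y - UU x" by (rule empirical_first_order)
  finally have low: "bN x \<bullet> (y - x) - Mx * (norm (y - x))^2 \<le> UU y - UU x" .
  have "UU y - UU x \<le> (\<Sum>i\<in>UNIV. dF (?A y) (y $ i) - dF (?A y) (x $ i))"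
    using empirical_first_order[of y x] by (simp add: sum_subtractf)
  also have "... \<le> (\<Sum>i\<in>UNIV. DF (?B x) (x $ i) \<bullet> (y $ i - x $ i) + K * ?W * norm (y $ i - x $ i) + Mx * (norm (y $ i - x $ i))^2)"
  proof (rule sum_mono)
    fix i
    have "dF (?A y) (y $ i) - dF (?A y) (x $ i) \<le> DF (?A y) (x $ i) \<bullet> (y $ i - x $ i) + Mx * (norm (y $ i - x $ i))^2"
      using dF_quad[OF P(2), of "y $ i" "x $ i"] by simp
    moreover have "(DF (?A y) (x $ i) - DF (?B x) (x $ i)) \<bullet> (y $ i - x $ i) \<le> K * ?W * norm (y $ i - x $ i)"
    proof -
      have "(DF (?A y) (x $ i) - DF (?B x) (x $ i)) \<bullet> (y $ i - x $ i) \<le> norm (DF (?B x) (x $ i) - DF (?A y) (x $ i)) * norm (y $ i - x $ i)"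
        using norm_cauchy_schwarz by (metis norm_minus_commute)
      also have "... \<le> K * ?W * norm (y $ i - x $ i)" by (intro mult_right_mono lipschitz P) auto
      finally show ?thesis .
    qed
    ultimately show "dF (?A y) (y $ i) - dF (?A y) (x $ i) \<le> DF (?B x) (x $ i) \<bullet> (y $ i - x $ i) + K * ?W * norm (y $ i - x $ i) + Mx * (norm (y $ i - x $ i))^2"
      by (simp add: inner_diff_left)
  qed
  also have "... = bN x \<bullet> (y - x) + K * (?W * (\<Sum>i\<in>UNIV. norm (y $ i - x $ i))) + Mx * (norm (y - x))^2"
    unfolding in_bN by (simp add: sum.distrib sum_distrib_left[symmetric] nv)
  also have "... \<le> bN x \<bullet> (y - x) + K * (norm (y - x))^2 + Mx * (norm (y - x))^2"
    using K K_W1_empirical(2)[of x y] by (intro add_mono mult_left_mono order_refl)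
  finally have up: "UU y - UU x \<le> bN x \<bullet> (y - x) + (K + Mx) * (norm (y - x))^2" by (simp add: distrib_right)
  have "0 \<le> K * (norm (y - x))^2" "0 \<le> Mx * (norm (y - x))^2" using K Mx by auto
  then have "\<bar>UU y - UU x - bN x \<bullet> (y - x)\<bar> \<le> 2 * (Mx + K) * (norm (y - x))^2"
    using low up unfolding distrib_right distrib_left by simp
  then show "\<bar>(UU y - c) - (UU x - c) - bN x \<bullet> (y - x)\<bar> \<le> 2 * (Mx + K) * (norm (y - x))^2" by simp
  have "(norm (bN y - bN x))^2 = (\<Sum>i\<in>UNIV. (norm (DF (?A y) (y $ i) - DF (?B x) (x $ i)))^2)"
    unfolding norm_vec_square by (simp add: bN_def)
  also have "... \<le> (\<Sum>i\<in>(UNIV::'n set). 2 * (Mx * norm (y $ i - x $ i))^2 + 2 * (K * ?W)^2)"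
  proof (rule sum_mono)
    fix i
    have e: "DF (?A y) (y $ i) - DF (?B x) (x $ i) = (DF (?A y) (y $ i) - DF (?A y) (x $ i)) - (DF (?B x) (x $ i) - DF (?A y) (x $ i))" by simp
    have "(norm (DF (?A y) (y $ i) - DF (?B x) (x $ i)))^2 \<le> 2 * (norm (DF (?A y) (y $ i) - DF (?A y) (x $ i)))^2 + 2 * (norm (DF (?B x) (x $ i) - DF (?A y) (x $ i)))^2"
      unfolding e by (rule norm_diff_square_le)
    also have "... \<le> 2 * (Mx * norm (y $ i - x $ i))^2 + 2 * (K * ?W)^2"
      by (intro add_mono mult_left_mono power_mono DF_lip lipschitz P) auto
    finally show "(norm (DF (?A y) (y $ i) - DF (?B x) (x $ i)))^2 \<le> 2 * (Mx * norm (y $ i - x $ i))^2 + 2 * (K * ?W)^2" .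
  qed
  also have "... = 2 * Mx^2 * (norm (y - x))^2 + 2 * K^2 * (?W^2 * real CARD('n))"
    by (simp add: sum.distrib power_mult_distrib sum_distrib_left[symmetric] nv)
  also have "... \<le> 2 * Mx^2 * (norm (y - x))^2 + 2 * K^2 * (norm (y - x))^2"
    using K_W1_empirical(1)[of x y] by (intro add_left_mono mult_left_mono) auto
  also have "... \<le> (2 * (Mx + K))^2 * (norm (y - x))^2" using K Mx by (simp add: power2_eq_square algebra_simps)
  finally have "(norm (bN y - bN x))^2 \<le> (2 * (Mx + K) * norm (y - x))^2" by (simp add: power_mult_distrib)
  then show "norm (bN y - bN x) \<le> 2 * (Mx + K) * norm (y - x)" by (rule power2_le_imp_le) (use K Mx in auto)
qed

end

lemma rel_entropy_density:
  assumes "sigma_finite_measure \<gamma>" and f[measurable]: "f \<in> borel_measurable \<gamma>" and f0: "\<And>x. 0 \<le> f x"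
    and m: "m = edensity \<gamma> f" and i: "integrable m (\<lambda>x. ln (f x))"
  shows "rel_entropy m \<gamma> = ereal (\<integral>x. ln (f x) \<partial>m)"
proof -
  interpret sigma_finite_measure \<gamma> by fact
  have ac: "absolutely_continuous \<gamma> m" unfolding m by (rule absolutely_continuousI_density) measurable
  have "AE x in \<gamma>. ennreal (f x) = RN_deriv \<gamma> m x" by (rule RN_deriv_unique) (auto simp: m)
  then have "AE x in m. ennreal (f x) = RN_deriv \<gamma> m x" unfolding m by (subst AE_density) auto
  then have ae: "AE x in m. entropy_density (exp 1) \<gamma> m x = ln (f x)"
  proof eventually_elim
    case (elim x)
    show ?case using f0[of x] by (simp add: entropy_density_def log_def elim[symmetric])
  qed
  have e: "(\<integral>\<^sup>+x. ennreal (entropy_density (exp 1) \<gamma> m x) \<partial>m) = (\<integral>\<^sup>+x. ennreal (ln (f x)) \<partial>m)"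
    "(\<integral>\<^sup>+x. ennreal (- entropy_density (exp 1) \<gamma> m x) \<partial>m) = (\<integral>\<^sup>+x. ennreal (- ln (f x)) \<partial>m)"
    using ae by (auto intro!: nn_integral_cong_AE)
  have fin: "(\<integral>\<^sup>+x. ennreal (ln (f x)) \<partial>m) \<noteq> \<infinity>" "(\<integral>\<^sup>+x. ennreal (- ln (f x)) \<partial>m) \<noteq> \<infinity>"
    using i by auto
  have "enn2ereal a = ereal (enn2real a)" if "a \<noteq> \<infinity>" for a :: ennreal using that by (cases a) auto
  then show ?thesis using ac fin real_lebesgue_integral_def[OF i] by (simp add: rel_entropy_def e)
qed

section \<open>The minimizer is a Gibbs measure\<close>

lemma mult_ln_eq:
  fixes a h :: real
  assumes "0 \<le> a" "0 < h" "a * ln a = a * ln h + a - h"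
  shows "a = h"
proof -
  have "a \<noteq> 0" using assms by auto
  then have a: "0 < a" using assms by simp
  have "a * (ln h - ln a) = a * (h / a - 1)" using assms(3) a by (simp add: right_diff_distrib)
  then have "ln (h / a) = h / a - 1" using a assms(2) by (simp add: ln_div)
  then have "h / a = 1" using a assms(2) by (intro ln_eq_minus_one) auto
  then show ?thesis by simp
qed

lemma convex_mult_ln:
  fixes a b :: real
  assumes "0 \<le> s" "s \<le> 1" "0 \<le> a" "0 \<le> b"
  shows "((1 - s) * a + s * b) * ln ((1 - s) * a + s * b) \<le> (1 - s) * (a * ln a) + s * (b * ln b)"
proof -
  define h where "h = (1 - s) * a + s * b"
  have h0: "0 \<le> h" using assms by (simp add: h_def)
  show ?thesis
  proof (cases "h = 0")
    case True
    have "0 \<le> (1 - s) * a" "0 \<le> s * b" using assms by auto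
    then have "(1 - s) * a = 0" "s * b = 0" using True unfolding h_def by linarith+
    then have "(1 - s) * (a * ln a) = 0" "s * (b * ln b) = 0" by auto
    then show ?thesis using True unfolding h_def by auto
  next
    case False
    then have h: "0 < h" using h0 by simp
    have "(1 - s) * (a * ln h + a - h) + s * (b * ln h + b - h) \<le> (1 - s) * (a * ln a) + s * (b * ln b)"
      using assms h by (intro add_mono mult_left_mono mult_ln_ge) auto
    moreover have "(1 - s) * (a * ln h + a - h) + s * (b * ln h + b - h) = h * ln h" by (simp add: h_def algebra_simps)
    ultimately show ?thesis by (simp add: h_def)
  qed
qed

lemma integrable_exp_norm_square: "integrable lborel (\<lambda>x::'a::euclidean_space. exp (- (norm x)\<^sup>2))"
proof -
  have "integrable lborel (\<lambda>x::'a. gauss (1/2) x * sqrt pi ^ DIM('a))" by (intro integrable_mult_left integrable_gauss) simp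
  moreover have "gauss (1/2) x * sqrt pi ^ DIM('a) = exp (- (norm x)\<^sup>2)" for x :: 'a
    by (simp add: gauss_eq field_simps)
  ultimately show ?thesis by simp
qed

lemma dens2_P2: "dens2 p \<Longrightarrow> edensity lborel p \<in> P2"
  unfolding P2_def using prob_space_dens2[of p] dens2D(4)[of p] integrable_dens2_iff[of p "\<lambda>x. (norm x)^2"] by simp

lemma abs_entropy_density:
  assumes p: "dens2 p"
  shows "abs_entropy (edensity lborel p) = ereal (LBINT x. p x * ln (p x))"
proof -
  note [measurable] = dens2D(1)[OF p]
  have "abs_entropy (edensity lborel p) = ereal (\<integral>x. ln (p x) \<partial>edensity lborel p)"
    unfolding abs_entropy_def
    by (rule rel_entropy_density) (use dens2D[OF p] integrable_dens2_iff[OF p, of "\<lambda>x. ln (p x)"] in \<open>simp_all add: sigma_finite_lborel\<close>)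
  then show ?thesis using integral_dens2[OF p, of "\<lambda>x. ln (p x)"] by simp
qed

lemma abs_entropy_dens2:
  assumes m: "m \<in> P2" and fin: "abs_entropy m \<noteq> \<infinity>"
  obtains p where "dens2 p" "m = edensity lborel p"
proof -
  interpret m: prob_space m using P2D[OF m] by simp
  let ?e = "entropy_density (exp 1) lborel m"
  have ac: "absolutely_continuous lborel m" using fin by (auto simp: abs_entropy_def rel_entropy_def split: if_splits)
  have sm: "sets m = sets lborel" using P2D(2)[OF m] by simp
  define p where "p x = enn2real (RN_deriv lborel m x)" for x
  have [measurable]: "p \<in> borel_measurable borel" unfolding p_def[abs_def] by simp
  have p0: "0 \<le> p x" for x by (simp add: p_def)
  have "AE x in lborel. RN_deriv lborel m x \<noteq> \<infinity>"
    by (rule sigma_finite_measure.RN_deriv_finite[OF sigma_finite_lborel _ ac sm]) unfold_locales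
  then have "density lborel (RN_deriv lborel m) = edensity lborel p" by (intro density_cong) (auto simp: p_def less_top)
  then have mp: "m = edensity lborel p" using sigma_finite_measure.density_RN_deriv[OF sigma_finite_lborel ac sm] by simp
  have e: "?e x = ln (p x)" for x by (simp add: entropy_density_def log_def p_def)
  have p1: "(\<integral>\<^sup>+x. ennreal (p x) \<partial>lborel) = 1"
    using m.emeasure_space_1 by (simp add: mp emeasure_density)
  have p2: "integrable lborel (\<lambda>x. p x * (norm x)^2)"
    using P2D(4)[OF m] p0 unfolding mp by (subst (asm) integrable_density) auto
  have "(\<integral>\<^sup>+x. ennreal (- ln (p x)) \<partial>m) = (\<integral>\<^sup>+x. ennreal (p x) * ennreal (- ln (p x)) \<partial>lborel)"
    unfolding mp by (rule nn_integral_density) measurable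
  also have "... \<le> (\<integral>\<^sup>+x. ennreal (p x * (norm x)^2 + exp (- (norm x)\<^sup>2)) \<partial>lborel)"
  proof (rule nn_integral_mono)
    fix x
    \<comment> \<open>The tangent inequality at \<open>exp (- (norm x)^2)\<close>: the second moment
      controls the negative part of the entropy, so an entropy different from \<infinity> is already
      finite.\<close>
    have "p x * - ln (p x) \<le> p x * (norm x)^2 + exp (- (norm x)\<^sup>2)"
      using mult_ln_ge[OF p0, of "exp (- (norm x)\<^sup>2)" x] p0[of x] by simp
    then show "ennreal (p x) * ennreal (- ln (p x)) \<le> ennreal (p x * (norm x)^2 + exp (- (norm x)\<^sup>2))"
      using p0[of x] by (simp only: ennreal_mult'[symmetric]) (rule ennreal_leI)
  qed
  also have "... < \<infinity>"
    using Bochner_Integration.integrable_add[OF p2 integrable_exp_norm_square] p0 by (subst nn_integral_eq_integral) auto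
  finally have neg: "(\<integral>\<^sup>+x. ennreal (- ln (p x)) \<partial>m) < \<infinity>" .
  moreover have "(\<integral>\<^sup>+x. ennreal (ln (p x)) \<partial>m) \<noteq> \<infinity>"
    using fin ac neg unfolding abs_entropy_def rel_entropy_def e by auto
  ultimately have "integrable m (\<lambda>x. ln (p x))" unfolding real_integrable_def by (auto simp: mp)
  then have "integrable lborel (\<lambda>x. p x * ln (p x))" using p0 unfolding mp by (subst (asm) integrable_density) auto
  then show thesis using that[of p] p0 p1 p2 mp by (simp add: dens2_def)
qed

lemma dens2I:
  fixes p :: "'a::euclidean_space \<Rightarrow> real"
  assumes [measurable]: "h \<in> borel_measurable borel" and p: "\<And>x. p x = exp (h x)"
    and i: "integrable lborel p" "(LBINT x. p x) = 1" and p2: "integrable lborel (\<lambda>x. p x * (norm x)^2)"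
    and g: "\<And>x. \<bar>h x\<bar> \<le> C * (1 + (norm x)^2)"
  shows "dens2 p"
proof -
  have pe: "p = (\<lambda>x. exp (h x))" using p by auto
  have [measurable]: "p \<in> borel_measurable borel" unfolding pe by simp
  have "integrable lborel (\<lambda>x. p x * h x)" by (rule integrable_growth[OF i(1) p2 _ _ g]) (use p in auto)
  moreover have "(\<integral>\<^sup>+x. ennreal (p x) \<partial>lborel) = 1" using p by (subst nn_integral_eq_integral) (simp_all add: i)
  ultimately show ?thesis using p2 unfolding dens2_def by (auto simp: p)
qed

lemma lborel_integral_exp_pos:
  assumes "integrable lborel (\<lambda>x::'a::euclidean_space. exp (h x :: real))"
  shows "0 < (LBINT x. exp (h x))"
proof (rule ccontr)
  assume "\<not> 0 < (LBINT x. exp (h x))"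
  moreover have "0 \<le> (LBINT x. exp (h x))" by simp
  ultimately have "(LBINT x. exp (h x)) = 0" by simp
  then have "AE x::'a in lborel. False" using assms by (simp add: integral_nonneg_eq_0_iff_AE)
  then show False by (simp add: AE_iff_measurable[OF _ refl])
qed

text \<open>For integrability of the entropy of a mixture, convexity bounds the integrand from above
  and the tangent inequality at a Gaussian bounds it from below.\<close>

lemma dens2_mixture:
  assumes p: "dens2 p" and q: "dens2 q" and s: "0 \<le> s" "s \<le> 1"
  shows "dens2 (\<lambda>x. (1 - s) * p x + s * q x)"
    and "mixture s (edensity lborel p) (edensity lborel q)
      = edensity lborel (\<lambda>x. (1 - s) * p x + s * q x)" (is "?m = edensity lborel ?h")
proof -
  let ?A = "\<lambda>x. \<bar>p x * ln (p x)\<bar> + \<bar>q x * ln (q x)\<bar>"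
  note [measurable] = dens2D(1)[OF p] dens2D(1)[OF q]
  have nn: "0 \<le> (1 - s) * p x" "0 \<le> s * q x" for x using s dens2D(2)[OF p, of x] dens2D(2)[OF q, of x] by auto
  have P: "?m \<in> P2" by (rule mixture_P2[OF dens2_P2[OF p] dens2_P2[OF q] s])
  show m: "?m = edensity lborel ?h"
  proof (rule measure_eqI)
    show "sets ?m = sets (edensity lborel ?h)" using P2D(2)[OF P] by simp
    fix A assume "A \<in> sets ?m"
    then have A[measurable]: "A \<in> sets borel" using P2D(2)[OF P] by simp
    show "emeasure ?m A = emeasure (edensity lborel ?h) A"
      using s dens2D(2)[OF p] dens2D(2)[OF q] emeasure_mixture[OF dens2_P2[OF p] dens2_P2[OF q] s A] by (simp add: emeasure_density ennreal_mult' distrib_right mult.assoc nn_integral_add nn_integral_cmult)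
  qed
  have i2: "integrable lborel (\<lambda>x. ?h x * (norm x)^2)"
    using dens2D(4)[OF p] dens2D(4)[OF q] by (simp add: distrib_right mult.assoc)
  have "integrable lborel (\<lambda>x. ?h x * ln (?h x))"
  proof (rule integrable_of_le[where g="\<lambda>x. (?A x) + (?h x * (norm x)^2 + exp (- (norm x)\<^sup>2))"])
    show "integrable lborel (\<lambda>x. (?A x) + (?h x * (norm x)^2 + exp (- (norm x)\<^sup>2)))"
      by (intro Bochner_Integration.integrable_add i2 integrable_exp_norm_square integrable_abs dens2D(5) p q)
    show "norm (?h x * ln (?h x)) \<le> (?A x) + (?h x * (norm x)^2 + exp (- (norm x)\<^sup>2))" for x
    proof -
      have 1: "?h x * ln (?h x) \<le> (1 - s) * (p x * ln (p x)) + s * (q x * ln (q x))"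
        by (intro convex_mult_ln s dens2D(2) p q)
      have "(1 - s) * (p x * ln (p x)) \<le> 1 * \<bar>p x * ln (p x)\<bar>" "s * (q x * ln (q x)) \<le> 1 * \<bar>q x * ln (q x)\<bar>"
        using s by (intro order_trans[OF mult_left_mono[OF abs_ge_self] mult_right_mono]; simp)+
      moreover have "- (?h x * (norm x)^2) - exp (- (norm x)\<^sup>2) \<le> ?h x * ln (?h x)"
        using mult_ln_ge[of "?h x" "exp (- (norm x)\<^sup>2)"] nn[of x] by simp
      moreover have "0 \<le> ?h x * (norm x)^2" using nn[of x] by simp
      ultimately show ?thesis using 1 unfolding real_norm_def by (intro abs_leI) (use exp_ge_zero[of "- (norm x)\<^sup>2"] in linarith)+
    qed
  qed measurable
  moreover have "(\<integral>\<^sup>+x. ennreal (?h x) \<partial>lborel) = 1"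
    using prob_space.emeasure_space_1[OF P2D(1)[OF P]] P2D(3)[OF P] unfolding m by (simp add: emeasure_density)
  ultimately show "dens2 ?h" using nn i2 by (auto simp: dens2_def)
qed

context mean_field
begin

text \<open>First variation towards near-Gibbs densities \<open>n k\<close>, then k to infinity: the
  result \<open>fin\<close> says that the density f of m has nonpositive entropy relative to the
  Gibbs density w. The equality case of the tangent inequality for \<open>a * ln a\<close> forces f
  = w almost everywhere.\<close>

lemma minimizer_gibbs:
  assumes min: "is_arg_min (free_energy F) (\<lambda>m. m \<in> P2) m" and i: "integrable lborel (\<lambda>x. exp (- dF m x))"
  defines "w \<equiv> \<lambda>x. exp (- dF m x - ln (LBINT x. exp (- dF m x)))"
  shows "dens2 w" "m = edensity lborel w"
proof -
  let ?A = "\<lambda>f. LBINT x. f x * ln (f x)"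
  let ?B = "\<lambda>k n. LBINT x. n k x * ln (n k x)"
  have m: "m \<in> P2" and le: "\<And>\<nu>. \<nu> \<in> P2 \<Longrightarrow> free_energy F m \<le> free_energy F \<nu>"
    using min by (auto simp: is_arg_min_def)
  define g where "g = dF m"
  note i = i[folded g_def]
  have [measurable]: "g \<in> borel_measurable borel" unfolding g_def by (rule dF_measurable[OF m])
  obtain Cg where Cg: "\<And>x. \<bar>g x\<bar> \<le> Cg * (1 + (norm x)^2)" using dF_growth[OF m] unfolding g_def by auto
  define Z where "Z = (LBINT x. exp (- g x))"
  text \<open>The Gibbs density is not known to have a second moment, so the competitors carry a Gaussian factor.\<close>
  define ep where "ep k = 1 / real (Suc k)" for k
  have ep: "0 < ep k" "ep k \<le> 1" for k by (auto simp: ep_def)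
  define e where "e k x = exp (- g x - ep k * (norm x)^2)" for k and x :: 'a
  have [measurable]: "e k \<in> borel_measurable borel" for k unfolding e_def[abs_def] by simp
  have e_le: "e k x \<le> exp (- g x)" for k x using ep(1)[of k] by (simp add: e_def)
  have ei: "integrable lborel (e k)" for k by (rule integrable_of_le[OF i]) (use e_le in \<open>auto simp: e_def\<close>)
  define Zk where "Zk k = (LBINT x. e k x)" for k
  have Zpos: "0 < Z" "0 < Zk k" for k
    using lborel_integral_exp_pos[of "\<lambda>x. - g x"] lborel_integral_exp_pos[of "\<lambda>x. - g x - ep k * (norm x)^2"] i ei[of k]
    unfolding e_def Z_def Zk_def by auto
  have Zlim: "Zk \<longlonglongrightarrow> Z" unfolding Zk_def[abs_def] Z_def
  proof (rule integral_dominated_convergence[OF _ _ i])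
    have "ep \<longlonglongrightarrow> 0" using LIMSEQ_inverse_real_of_nat by (simp add: ep_def[abs_def] inverse_eq_divide)
    then have "(\<lambda>k. e k x) \<longlonglongrightarrow> exp (- g x - 0 * (norm x)^2)" for x unfolding e_def by (intro tendsto_intros)
    then show "AE x in lborel. (\<lambda>k. e k x) \<longlonglongrightarrow> exp (- g x)" by simp
    show "AE x in lborel. norm (e k x) \<le> exp (- g x)" for k using e_le by (auto simp: e_def)
  qed measurable
  define n where "n k x = exp (- g x - ep k * (norm x)^2 - ln (Zk k))" for k x
  have n_e: "n k x = e k x / Zk k" for k x using Zpos(2)[of k] by (simp add: n_def e_def exp_diff)
  have n2: "dens2 (n k)" for k
  proof (rule dens2I[where h="\<lambda>x. - g x - ep k * (norm x)^2 - ln (Zk k)"])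
    show "integrable lborel (n k)" "(LBINT x. n k x) = 1" unfolding n_e using ei[of k] Zpos(2)[of k] by (auto simp: Zk_def)
    show "\<bar>- g x - ep k * (norm x)^2 - ln (Zk k)\<bar> \<le> (Cg + 1 + \<bar>ln (Zk k)\<bar>) * (1 + (norm x)^2)" for x
    proof -
      have "ep k * (norm x)^2 \<le> 1 * (1 + (norm x)^2)" "0 \<le> ep k * (norm x)^2" using ep[of k] mult_right_mono[of "ep k" 1 "(norm x)^2"] by auto
      moreover have "\<bar>ln (Zk k)\<bar> * 1 \<le> \<bar>ln (Zk k)\<bar> * (1 + (norm x)^2)" by (intro mult_left_mono) auto
      ultimately show ?thesis using Cg[of x] unfolding distrib_right by simp
    qed
    show "integrable lborel (\<lambda>x. n k x * (norm x)^2)"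
    proof (rule integrable_of_le)
      show "integrable lborel (\<lambda>x. exp (- g x) * (1 / (ep k * Zk k)))" using i by simp
      show "norm (n k x * (norm x)^2) \<le> exp (- g x) * (1 / (ep k * Zk k))" for x
      proof -
        have "ep k * (norm x)^2 \<le> exp (ep k * (norm x)^2)" using exp_ge_add_one_self[of "ep k * (norm x)^2"] by arith
        then have "exp (- g x - ep k * (norm x)^2) * (ep k * (norm x)^2) \<le> exp (- g x - ep k * (norm x)^2) * exp (ep k * (norm x)^2)" by simp
        also have "... = exp (- g x)" by (simp add: exp_add[symmetric])
        finally show ?thesis unfolding n_e e_def using ep(1)[of k] Zpos(2)[of k] by (simp add: field_simps)
      qed
    qed (auto simp: n_def)
  qed (auto simp: n_def)
  have "free_energy F m \<le> free_energy F (edensity lborel (n 0))" by (rule le[OF dens2_P2[OF n2]])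
  then have "abs_entropy m \<noteq> \<infinity>" by (auto simp: free_energy_def abs_entropy_density[OF n2])
  then obtain f where f: "dens2 f" "m = edensity lborel f" using abs_entropy_dens2[OF m] by auto
  note [measurable] = dens2D(1)[OF f(1)]
  have gi: "integrable lborel (\<lambda>x. f x * g x)" "integrable lborel (\<lambda>x. n k x * g x)" for k
    by (rule dens2_growth[OF f(1) _ Cg] dens2_growth[OF n2 _ Cg]; measurable)+
  have main: "(?A f) + (LBINT x. f x * g x) \<le> (?B k n) + (LBINT x. n k x * g x)" for k
  proof (rule field_le_epsilon)
    fix \<eta> :: real assume "\<eta> > 0"
    let ?\<nu> = "edensity lborel (n k)"
    have \<nu>: "?\<nu> \<in> P2" by (rule dens2_P2[OF n2])
    obtain s where s: "0 < s" "s \<le> 1" "\<bar>F (mixture s m ?\<nu>) - F m - s * dir m ?\<nu> 0\<bar> \<le> \<eta> * s"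
      using F_derivative[OF m \<nu> \<open>\<eta> > 0\<close>] by (metis order_refl)
    let ?h = "\<lambda>x. (1 - s) * f x + s * n k x"
    have h: "dens2 ?h" and mix: "mixture s m ?\<nu> = edensity lborel ?h"
      using dens2_mixture[OF f(1) n2, of s k] s f(2) by auto
    have "free_energy F m \<le> free_energy F (mixture s m ?\<nu>)" unfolding mix by (rule le[OF dens2_P2[OF h]])
    then have "F m + (?A f) \<le> F (mixture s m ?\<nu>) + (LBINT x. ?h x * ln (?h x))"
      using abs_entropy_density[OF f(1)] abs_entropy_density[OF h] unfolding mix free_energy_def f(2)[symmetric] by simp
    \<comment> \<open>Convexity of the entropy replaces its directional derivative, which need not
      be finite; only F is expanded to first order before dividing by s.\<close>
    also have "(LBINT x. ?h x * ln (?h x)) \<le> (LBINT x. (1 - s) * (f x * ln (f x)) + s * (n k x * ln (n k x)))"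
      using s dens2D(5)[OF h] dens2D(5)[OF f(1)] dens2D(5)[OF n2[of k]] dens2D(2)[OF f(1)] dens2D(2)[OF n2[of k]]
      by (intro integral_mono convex_mult_ln) auto
    also have "... = (1 - s) * (?A f) + s * (?B k n)" using dens2D(5)[OF f(1)] dens2D(5)[OF n2[of k]] by simp
    finally have "s * (?A f) \<le> s * (?B k n) + s * dir m ?\<nu> 0 + \<eta> * s" using s(3) by (simp add: algebra_simps)
    then have "s * (?A f) \<le> s * ((?B k n) + dir m ?\<nu> 0 + \<eta>)" by (simp add: algebra_simps)
    moreover have "dir m ?\<nu> 0 = (LBINT x. n k x * g x) - (LBINT x. f x * g x)"
      using integral_dens2[OF n2[of k], of g] integral_dens2[OF f(1), of g] by (simp add: dir_0[OF m \<nu>] g_def[symmetric] f(2)[symmetric])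
    ultimately show "(?A f) + (LBINT x. f x * g x) \<le> (?B k n) + (LBINT x. n k x * g x) + \<eta>" using s(1) by simp
  qed
  have "(?B k n) + (LBINT x. n k x * g x) \<le> - ln (Zk k)" for k
  proof -
    have "(?B k n) + (LBINT x. n k x * g x) = (LBINT x. n k x * ln (n k x) + n k x * g x)"
      using gi(2)[of k] dens2D(5)[OF n2[of k]] by simp
    also have "... \<le> (LBINT x. - ln (Zk k) * n k x)"
    proof (rule integral_mono)
      show "n k x * ln (n k x) + n k x * g x \<le> - ln (Zk k) * n k x" for x
        using ep(1)[of k] by (simp add: n_def algebra_simps)
    qed (use gi(2)[of k] dens2D(5)[OF n2[of k]] integral_dens2_one[OF n2[of k]] in auto)
    finally show ?thesis using integral_dens2_one[OF n2[of k]] by simp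
  qed
  then have bound: "(?A f) + (LBINT x. f x * g x) \<le> - ln (Zk k)" for k using main[of k] by (rule order_trans[rotated])
  have "(\<lambda>k. - ln (Zk k)) \<longlonglongrightarrow> - ln Z" using Zlim Zpos by (intro tendsto_intros) auto
  then have fin: "(?A f) + (LBINT x. f x * g x) \<le> - ln Z" using bound by (intro LIMSEQ_le_const) auto
  have we: "w = (\<lambda>x. exp (- g x - ln Z))" by (simp add: w_def g_def Z_def)
  have [measurable]: "w \<in> borel_measurable borel" unfolding we by simp
  have w1: "integrable lborel w" "(LBINT x. w x) = 1" unfolding we using i Zpos(1) by (auto simp: exp_diff Z_def)
  \<comment> \<open>The integrand of the entropy of f relative to w in the form
    \<open>f * ln (f / w) - f + w\<close>: pointwise nonnegative, and with integral at most 0 by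
    \<open>fin\<close>.\<close>
  let ?r = "\<lambda>x. f x * ln (f x) + f x * g x + ln Z * f x - f x + w x"
  have ri: "integrable lborel ?r" using w1 dens2D(5)[OF f(1)] gi(1) integral_dens2_one[OF f(1)] by simp
  have rr: "?r x = f x * ln (f x) - (f x * ln (w x) + f x - w x)" for x by (simp add: we algebra_simps)
  have r0: "0 \<le> ?r x" for x unfolding rr using mult_ln_ge[OF dens2D(2)[OF f(1)], of "w x" x] by (simp add: we)
  have "(LBINT x. ?r x) \<le> 0" using w1 dens2D(5)[OF f(1)] gi(1) integral_dens2_one[OF f(1)] fin by simp
  moreover have "0 \<le> (LBINT x. ?r x)" using r0 by simp
  ultimately have "AE x in lborel. ?r x = 0" using ri r0 by (subst integral_nonneg_eq_0_iff_AE[symmetric]) auto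
  then have "AE x in lborel. f x = w x"
  proof eventually_elim
    case (elim x)
    then show ?case unfolding rr by (intro mult_ln_eq[OF dens2D(2)[OF f(1)]]) (auto simp: we)
  qed
  then show mw: "m = edensity lborel w" using f(2) by (auto intro!: density_cong)
  show "dens2 w"
  proof (rule dens2I[where h="\<lambda>x. - g x - ln Z"])
    show "integrable lborel (\<lambda>x. w x * (norm x)^2)"
      using P2D(4)[OF m] unfolding mw by (subst (asm) integrable_density) (auto simp: we)
    show "\<bar>- g x - ln Z\<bar> \<le> (Cg + \<bar>ln Z\<bar>) * (1 + (norm x)^2)" for x
    proof -
      have "\<bar>ln Z\<bar> * 1 \<le> \<bar>ln Z\<bar> * (1 + (norm x)^2)" by (intro mult_left_mono) auto
      then show ?thesis using Cg[of x] unfolding distrib_right[of Cg] by simp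
    qed
  qed (use w1 in \<open>auto simp: we\<close>)
qed

end

section \<open>Consequences of the log-Sobolev inequality\<close>

lemma abs_exp_minus_one_le: "\<bar>exp y - 1\<bar> \<le> \<bar>y\<bar> * exp \<bar>y\<bar>" for y :: real
proof (cases "0 \<le> y")
  case True
  have "exp y * (1 - y) \<le> exp y * exp (- y)" using exp_ge_add_one_self[of "- y"] by simp
  then have "exp y - 1 \<le> y * exp y" by (simp add: exp_minus right_diff_distrib mult.commute)
  then show ?thesis using True by simp
next
  case False
  have "exp y \<le> 1" using False by simp
  then have "\<bar>exp y - 1\<bar> \<le> \<bar>y\<bar> * 1" using exp_ge_add_one_self[of y] by arith
  also have "... \<le> \<bar>y\<bar> * exp \<bar>y\<bar>" by (intro mult_left_mono) auto
  finally show ?thesis .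
qed

lemma exp_quadratic_bound: "\<bar>exp y - 1 - y\<bar> \<le> y^2 * exp \<bar>y\<bar>" for y :: real
proof -
  have 1: "0 \<le> exp y - 1 - y" using exp_ge_add_one_self[of y] by arith
  have "exp y * (1 - y) \<le> exp y * exp (- y)" using exp_ge_add_one_self[of "- y"] by simp
  then have "exp y - 1 - y \<le> y * (exp y - 1)" by (simp add: exp_minus right_diff_distrib mult.commute)
  also have "... \<le> \<bar>y\<bar> * \<bar>exp y - 1\<bar>" by (simp add: abs_mult[symmetric])
  also have "... \<le> \<bar>y\<bar> * (\<bar>y\<bar> * exp \<bar>y\<bar>)" by (intro mult_left_mono abs_exp_minus_one_le) auto
  also have "... = y^2 * exp \<bar>y\<bar>" by (simp add: power2_eq_square)
  finally show ?thesis using 1 by simp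
qed

lemma DERIV_of_quadratic_bound:
  fixes H :: "real \<Rightarrow> real"
  assumes "\<And>t. \<bar>t - s\<bar> \<le> 1 \<Longrightarrow> \<bar>H t - H s - D * (t - s)\<bar> \<le> C * (t - s)^2"
  shows "(H has_real_derivative D) (at s)"
proof -
  have "((\<lambda>t. C * \<bar>t - s\<bar>) \<longlongrightarrow> C * \<bar>s - s\<bar>) (at s)" by (intro tendsto_intros)
  then have l: "((\<lambda>t. C * \<bar>t - s\<bar>) \<longlongrightarrow> 0) (at s)" by simp
  have "((\<lambda>t. (H t - H s) / (t - s) - D) \<longlongrightarrow> 0) (at s)"
  proof (rule Lim_null_comparison[OF _ l])
    have "norm ((H t - H s) / (t - s) - D) \<le> C * \<bar>t - s\<bar>" if t: "t \<noteq> s" "\<bar>t - s\<bar> \<le> 1" for t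
    proof -
      have "(H t - H s) / (t - s) - D = (H t - H s - D * (t - s)) / (t - s)" using t by (simp add: field_simps)
      also have "norm ... \<le> C * (t - s)^2 / \<bar>t - s\<bar>" using assms[OF t(2)] by (simp add: divide_right_mono)
      also have "... = C * \<bar>t - s\<bar>" by (simp add: power2_eq_square abs_mult_self_eq[of "t - s", symmetric] del: abs_mult_self_eq)
      finally show ?thesis .
    qed
    then show "eventually (\<lambda>t. norm ((H t - H s) / (t - s) - D) \<le> C * \<bar>t - s\<bar>) (at s)"
      unfolding eventually_at by (intro exI[of _ 1]) (auto simp: dist_real_def)
  qed
  then have "((\<lambda>t. (H t - H s) / (t - s)) \<longlongrightarrow> D) (at s)" by (simp add: LIM_zero_iff)
  then show ?thesis by (simp add: has_field_derivative_iff)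
qed

lemma GDERIV_compose:
  assumes "GDERIV f x :> g" "(h has_real_derivative h') (at (f x))"
  shows "GDERIV (\<lambda>x. h (f x)) x :> h' *\<^sub>R g" using GDERIV_DERIV_compose[OF assms] .

text \<open>Herbst's argument: with \<open>H s\<close> the exponential moment of
  \<open>s * \<phi>\<close>, the log-Sobolev inequality for \<open>exp (s / 2 * \<phi> x)\<close>
  says that \<open>ln (H s) / s\<close> has derivative at most \<open>c^2 / (4 * \<rho>)\<close>.
  Compare 1 with a small \<epsilon>, where the quotient is close to the mean of \<phi>. Boundedness
  of \<phi> makes H differentiable.\<close>

lemma herbst:
  fixes m :: "'a::euclidean_space measure" and \<phi> :: "'a \<Rightarrow> real"
  assumes m: "prob_space m" "sets m = sets borel" and lsi: "log_sobolev \<rho> m" and \<rho>: "\<rho> > 0"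
    and d: "\<And>x. GDERIV \<phi> x :> D x" "continuous_on UNIV D" and B: "\<And>x. \<bar>\<phi> x\<bar> \<le> B" and c: "\<And>x. norm (D x) \<le> c"
  shows "(\<integral>x. exp (\<phi> x) \<partial>m) \<le> exp ((\<integral>x. \<phi> x \<partial>m) + c^2 / (4 * \<rho>))"
proof -
  let ?A = "\<lambda>s x. s * \<phi> x"
  let ?B = "\<lambda>s. \<bar>s\<bar> * B"
  interpret prob_space m by (rule m)
  have sp: "space m = UNIV" using sets_eq_imp_space_eq[OF m(2)] by simp
  have B0: "0 \<le> B" using B[of undefined] by simp
  have \<phi>c: "continuous_on UNIV \<phi>"
    using d(1) by (meson continuous_at_imp_continuous_on gderiv_def has_derivative_continuous)
  have [measurable]: "\<phi> \<in> borel_measurable m"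
    using borel_measurable_continuous_onI[OF \<phi>c] measurable_cong_sets[OF m(2) refl] by auto
  have bdd: "integrable m f" if [measurable]: "f \<in> borel_measurable m" and "\<And>x. \<bar>f x\<bar> \<le> C" for f and C :: real
    by (rule integrable_const_bound[where B=C]) (use that in auto)
  have s\<phi>: "\<bar>s * \<phi> x\<bar> \<le> \<bar>s\<bar> * B" for s x using B[of x] by (simp add: abs_mult mult_left_mono)
  have es: "exp (?A s x) \<le> exp (?B s)" for s x using s\<phi>[of s x] by simp
  have i: "integrable m (\<lambda>x. exp (?A s x))" "integrable m (\<lambda>x. \<phi> x * exp (?A s x))" for s
  proof -
    show "integrable m (\<lambda>x. exp (?A s x))" by (rule bdd[of _ "exp (?B s)"]) (use es[of s] in simp_all)
    have "\<bar>\<phi> x * exp (?A s x)\<bar> \<le> B * exp (?B s)" for x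
      unfolding abs_mult abs_exp_cancel by (intro mult_mono B es B0) simp
    then show "integrable m (\<lambda>x. \<phi> x * exp (?A s x))" by (intro bdd) simp_all
  qed
  define H where "H s = (\<integral>x. exp (?A s x) \<partial>m)" for s
  define H1 where "H1 s = (\<integral>x. \<phi> x * exp (?A s x) \<partial>m)" for s
  have Hpos: "0 < H s" for s
  proof -
    have "(\<integral>x. exp (- (?B s)) \<partial>m) \<le> H s" unfolding H_def
    proof (rule integral_mono[OF _ i(1)])
      show "exp (- (?B s)) \<le> exp (?A s x)" for x using s\<phi>[of s x] by simp
    qed simp
    then have "exp (- (?B s)) \<le> H s" using prob_space by simp
    then show ?thesis using exp_gt_zero less_le_trans by blast
  qed
  have quad: "\<bar>H t - H s - H1 s * (t - s)\<bar> \<le> (exp (?B s) * B^2 * exp B) * (t - s)^2" if t: "\<bar>t - s\<bar> \<le> 1" for s t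
  proof -
    have e: "H t - H s - H1 s * (t - s) = (\<integral>x. exp (t * \<phi> x) - exp (?A s x) - \<phi> x * exp (?A s x) * (t - s) \<partial>m)"
      using i[of s] i[of t] by (simp add: H_def H1_def)
    have "\<bar>H t - H s - H1 s * (t - s)\<bar> \<le> (\<integral>x. \<bar>exp (t * \<phi> x) - exp (?A s x) - \<phi> x * exp (?A s x) * (t - s)\<bar> \<partial>m)" unfolding e by simp
    also have "... \<le> (\<integral>x. (exp (?B s) * B^2 * exp B) * (t - s)^2 \<partial>m)"
    proof (rule integral_mono)
      fix x
      define y where "y = (t - s) * \<phi> x"
      have y: "\<bar>y\<bar> \<le> B" using mult_mono[OF t B[of x] zero_le_one abs_ge_zero] unfolding y_def abs_mult by simp
      have y2: "y^2 \<le> (t - s)^2 * B^2" using B[of x] power_mono[of "\<bar>\<phi> x\<bar>" B 2] by (simp add: y_def power_mult_distrib mult_left_mono)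
      have e: "exp (t * \<phi> x) - exp (?A s x) - \<phi> x * exp (?A s x) * (t - s) = exp (?A s x) * (exp y - 1 - y)"
        by (simp add: y_def algebra_simps exp_add[symmetric])
      have "\<bar>exp (t * \<phi> x) - exp (?A s x) - \<phi> x * exp (?A s x) * (t - s)\<bar> \<le> exp (?B s) * (((t - s)^2 * B^2) * exp B)"
        unfolding e abs_mult using es[of s x] y by (intro mult_mono order_trans[OF exp_quadratic_bound] y2) auto
      then show "\<bar>exp (t * \<phi> x) - exp (?A s x) - \<phi> x * exp (?A s x) * (t - s)\<bar> \<le> (exp (?B s) * B^2 * exp B) * (t - s)^2"
        by (simp add: algebra_simps)
    qed (use i[of s] i[of t] in auto)
    finally show ?thesis using prob_space by simp
  qed
  have Hd: "(H has_real_derivative H1 s) (at s)" for s by (rule DERIV_of_quadratic_bound[OF quad])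
  have ineq: "s * H1 s - H s * ln (H s) \<le> s^2 * (c^2 / (4 * \<rho>)) * H s" if s: "0 < s" "s \<le> 1" for s
  proof -
    let ?f = "\<lambda>x. exp (s / 2 * \<phi> x)" and ?g = "\<lambda>x. (exp (s / 2 * \<phi> x) * (s / 2)) *\<^sub>R D x"
    have g2: "(norm (?g x))^2 \<le> s^2 * c^2 / 4 * exp (?A s x)" for x
      using c[of x] by (simp add: power_mult_distrib exp_double[symmetric] power_divide mult_left_mono power_mono)
    have "\<rho> * Ent m (\<lambda>x. (?f x)^2) \<le> (\<integral>x. (norm (?g x))^2 \<partial>m)"
    proof (rule lsi[unfolded log_sobolev_def, rule_format], intro conjI allI)
      show "GDERIV ?f x :> ?g x" for x
        by (rule GDERIV_compose[OF d(1), of "\<lambda>y. exp (s / 2 * y)"]) (auto intro!: derivative_eq_intros)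
      show "continuous_on UNIV ?g" by (intro continuous_intros \<phi>c d(2))
      have "norm (?f x) \<le> exp (\<bar>s / 2\<bar> * B)" for x using es[of "s / 2" x] by simp
      then show "bounded (range ?f)" unfolding bounded_iff by blast
      have "norm (?g x) \<le> (exp (\<bar>s / 2\<bar> * B) * (s / 2)) * c" for x
        unfolding norm_scaleR abs_mult abs_exp_cancel using s by (intro mult_mono es c) auto
      then show "bounded (range ?g)" unfolding bounded_iff by blast
    qed
    also have "... \<le> (\<integral>x. s^2 * c^2 / 4 * exp (?A s x) \<partial>m)"
      by (rule integral_mono_AE') (use i(1)[of s] g2 in auto)
    also have "... = s^2 * c^2 / 4 * H s" by (simp add: H_def)
    also have "Ent m (\<lambda>x. (?f x)^2) = s * H1 s - H s * ln (H s)"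
    proof -
      have "(?f x)^2 = exp (?A s x)" for x by (simp add: exp_double[symmetric])
      moreover have "(\<integral>x. exp (?A s x) * (?A s x) \<partial>m) = s * H1 s"
        unfolding H1_def by (subst integral_mult_right_zero[symmetric]) (simp add: algebra_simps)
      ultimately show ?thesis by (simp add: Ent_def H_def)
    qed
    finally show ?thesis using \<rho> by (simp add: field_simps)
  qed
  define k where "k = c^2 / (4 * \<rho>)"
  have k0: "0 \<le> k" using \<rho> by (simp add: k_def)
  have "ln (H 1) \<le> expectation \<phi> + k"
  proof (rule field_le_epsilon)
    fix \<eta> :: real assume \<eta>: "\<eta> > 0"
    define A where "A = B^2 * exp B"
    have A0: "0 \<le> A" by (simp add: A_def)
    define \<epsilon> where "\<epsilon> = min 1 (\<eta> / (A + 1))"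
    have \<epsilon>: "0 < \<epsilon>" "\<epsilon> \<le> 1" "A * \<epsilon> \<le> \<eta>"
    proof -
      show "0 < \<epsilon>" "\<epsilon> \<le> 1" using \<eta> A0 by (auto simp: \<epsilon>_def)
      have "A * \<epsilon> \<le> (A + 1) * (\<eta> / (A + 1))" using \<eta> A0 by (intro mult_mono) (auto simp: \<epsilon>_def)
      then show "A * \<epsilon> \<le> \<eta>" using A0 by simp
    qed
    have "ln (H 1) / 1 - k * 1 \<le> ln (H \<epsilon>) / \<epsilon> - k * \<epsilon>"
    proof (rule DERIV_nonpos_imp_nonincreasing[OF \<epsilon>(2)])
      fix s assume s: "\<epsilon> \<le> s" "s \<le> 1"
      then have s0: "0 < s" using \<epsilon> by simp
      show "\<exists>y. ((\<lambda>s. ln (H s) / s - k * s) has_real_derivative y) (at s) \<and> y \<le> 0"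
      proof (intro exI conjI)
        show "((\<lambda>s. ln (H s) / s - k * s) has_real_derivative ((H1 s / H s) * s - ln (H s)) / s^2 - k) (at s)"
          using Hpos[of s] s0 by (auto intro!: derivative_eq_intros Hd simp: power2_eq_square)
        show "((H1 s / H s) * s - ln (H s)) / s^2 - k \<le> 0"
          using Hpos[of s] ineq[OF s0 s(2)] s0 by (simp add: field_simps k_def)
      qed
    qed
    also have "... \<le> ln (H \<epsilon>) / \<epsilon>" using k0 \<epsilon> by simp
    also have "... \<le> (H \<epsilon> - 1) / \<epsilon>" using \<epsilon> Hpos by (intro divide_right_mono ln_le_minus_one) auto
    also have "... \<le> expectation \<phi> + A * \<epsilon>"
      using prob_space quad[of \<epsilon> 0] \<epsilon> by (simp add: H_def H1_def A_def power2_eq_square algebra_simps divide_le_eq)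
    finally show "ln (H 1) \<le> expectation \<phi> + k + \<eta>" using \<epsilon> by simp
  qed
  then have "exp (ln (H 1)) \<le> exp (expectation \<phi> + k)" by simp
  then have "H 1 \<le> exp (expectation \<phi> + k)" using Hpos[of 1] by simp
  then show ?thesis by (simp add: H_def k_def)
qed

text \<open>A linear function is unbounded; \<open>(n + 1) * sin ((u \<bullet> x) / (n + 1))\<close>
  is bounded with gradient at most \<open>norm u\<close>, is dominated by the linear function and
  converges to it. Fatou on the left and dominated convergence on the right remove the
  truncation.\<close>

lemma log_sobolev_exp_linear:
  fixes m :: "'a::euclidean_space measure"
  assumes m: "m \<in> P2" and lsi: "log_sobolev \<rho> m" and \<rho>: "\<rho> > 0"
  shows "(\<integral>\<^sup>+x. ennreal (exp (u \<bullet> x)) \<partial>m) \<le> ennreal (exp ((\<integral>x. u \<bullet> x \<partial>m) + (norm u)^2 / (4 * \<rho>)))"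
proof -
  let ?A = "exp ((\<integral>x. u \<bullet> x \<partial>m) + (norm u)^2 / (4 * \<rho>))"
  interpret prob_space m using P2D[OF m] by simp
  note [measurable_cong] = P2D(2)[OF m]
  define \<phi> where "\<phi> n x = real (Suc n) * sin ((u \<bullet> x) / real (Suc n))" for n x
  have [measurable]: "\<phi> n \<in> borel_measurable borel" for n unfolding \<phi>_def[abs_def] by simp
  have lim: "(\<lambda>n. \<phi> n x) \<longlonglongrightarrow> u \<bullet> x" for x unfolding \<phi>_def by real_asymp
  have le: "\<bar>\<phi> n x\<bar> \<le> \<bar>u \<bullet> x\<bar>" for n x
    using mult_left_mono[OF abs_sin_x_le_abs_x[of "(u \<bullet> x) / real (Suc n)"], of "real (Suc n)"] by (simp add: \<phi>_def abs_mult)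
  have ui: "integrable m (\<lambda>x. u \<bullet> x)"
  proof (rule P2_growth[OF m, where C="norm u"])
    show "\<bar>u \<bullet> x\<bar> \<le> norm u * (1 + (norm x)^2)" for x
      using order_trans[OF Cauchy_Schwarz_ineq2 mult_left_mono[of "norm x" "1 + (norm x)^2" "norm u"]] abs_le_one_plus_square[of "norm x"] by simp
  qed simp
  have bound: "(\<integral>\<^sup>+x. ennreal (exp (\<phi> n x)) \<partial>m) \<le> ennreal (exp (expectation (\<phi> n) + (norm u)^2 / (4 * \<rho>)))" for n
  proof -
    have B: "\<bar>\<phi> n x\<bar> \<le> real (Suc n)" for x unfolding \<phi>_def abs_mult by simp
    have "(\<integral>\<^sup>+x. ennreal (exp (\<phi> n x)) \<partial>m) = ennreal (\<integral>x. exp (\<phi> n x) \<partial>m)"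
      using B[THEN abs_le_D1] by (simp add: integrable_const_bound[where B="exp (real (Suc n))"] nn_integral_eq_integral)
    also have "... \<le> ennreal (exp (expectation (\<phi> n) + (norm u)^2 / (4 * \<rho>)))"
    proof (intro ennreal_leI herbst[OF _ _ lsi \<rho> _ _ B])
      show "GDERIV (\<phi> n) x :> cos ((u \<bullet> x) / real (Suc n)) *\<^sub>R u" for x
      proof -
        have "GDERIV (\<lambda>x. u \<bullet> x) x :> u" unfolding gderiv_def by (auto intro!: derivative_eq_intros simp: inner_commute)
        moreover have "((\<lambda>r. real (Suc n) * sin (r / real (Suc n))) has_real_derivative cos ((u \<bullet> x) / real (Suc n))) (at (u \<bullet> x))"
          by (auto intro!: derivative_eq_intros)
        ultimately show ?thesis using GDERIV_compose unfolding \<phi>_def[abs_def] by blast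
      qed
      show "norm (cos ((u \<bullet> x) / real (Suc n)) *\<^sub>R u) \<le> norm u" for x
        using mult_right_mono[OF abs_cos_le_one, of "norm u"] by simp
    qed (use P2D[OF m] in \<open>auto intro!: continuous_intros\<close>)
    finally show ?thesis .
  qed
  have r: "(\<lambda>n. ennreal (exp (expectation (\<phi> n) + (norm u)^2 / (4 * \<rho>)))) \<longlonglongrightarrow> ennreal ?A"
    by (simp add: ui lim le integral_dominated_convergence[where w="\<lambda>x. \<bar>u \<bullet> x\<bar>"] tendsto_intros)
  have "(\<integral>\<^sup>+x. ennreal (exp (u \<bullet> x)) \<partial>m) = (\<integral>\<^sup>+x. liminf (\<lambda>n. ennreal (exp (\<phi> n x))) \<partial>m)"
    by (intro nn_integral_cong lim_imp_Liminf[symmetric] tendsto_ennrealI tendsto_exp lim) simp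
  also have "... \<le> liminf (\<lambda>n. \<integral>\<^sup>+x. ennreal (exp (\<phi> n x)) \<partial>m)" by (rule nn_integral_liminf) measurable
  also have "... \<le> liminf (\<lambda>n. ennreal (exp (expectation (\<phi> n) + (norm u)^2 / (4 * \<rho>))))"
    by (intro Liminf_mono always_eventually allI bound)
  also have "... = ennreal ?A" by (rule lim_imp_Liminf[OF _ r]) simp
  finally show ?thesis .
qed

definition barycenter :: "'a::euclidean_space measure \<Rightarrow> 'a" where
  "barycenter m = (\<integral>x. x \<partial>m)"

lemma P2_norm_integrable: "m \<in> P2 \<Longrightarrow> integrable m (\<lambda>x::'a::euclidean_space. norm x)"
proof (rule P2_growth[where C=1])
  show "\<bar>norm x\<bar> \<le> 1 * (1 + (norm x)^2)" for x :: 'a using abs_le_one_plus_square[of "norm x"] by simp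
qed auto

lemma P2_dist_square_integrable: "m \<in> P2 \<Longrightarrow> integrable m (\<lambda>x::'a::euclidean_space. (norm (x - c))^2)"
proof (rule P2_growth[where C="2 + 2 * (norm c)^2"])
  fix x :: 'a
  have "0 \<le> (norm c)^2 * (norm x)^2" by simp
  moreover have "(2 + 2 * (norm c)^2) * (1 + (norm x)^2) = 2 + 2 * (norm x)^2 + 2 * (norm c)^2 + 2 * ((norm c)^2 * (norm x)^2)"
    by (simp add: algebra_simps)
  ultimately show "\<bar>(norm (x - c))^2\<bar> \<le> (2 + 2 * (norm c)^2) * (1 + (norm x)^2)"
    using norm_diff_square_le[of x c] unfolding abs_of_nonneg[OF zero_le_power2] by arith
qed auto

text \<open>Gaussian linearisation: the exponential of \<rho>/2 times |v|^2 is the mean of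
  \<open>exp (v \<bullet> z)\<close> for z normal of variance \<rho>. After Fubini the linear
  estimate contributes \<open>exp ((norm z)^2 / (4 * \<rho>))\<close>, exactly the weight that
  \<open>exp_gauss\<close> integrates.\<close>

lemma log_sobolev_exp_square:
  fixes m :: "'a::euclidean_space measure"
  assumes m: "m \<in> P2" and lsi: "log_sobolev \<rho> m" and \<rho>: "\<rho> > 0"
  shows "(\<integral>\<^sup>+x. ennreal (exp (\<rho> / 2 * (norm (x - barycenter m))^2)) \<partial>m) \<le> sqrt 2 ^ DIM('a)"
proof -
  interpret m: prob_space m using P2D[OF m] by simp
  interpret pair_sigma_finite m "lborel :: 'a measure" by unfold_locales
  note [measurable_cong] = P2D(2)[OF m]
  define c where "c = barycenter m"
  have xi: "integrable m (\<lambda>x. x)"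
    by (rule integrable_norm_cancel[OF P2_norm_integrable[OF m]], rule P2_measurable[OF m]) measurable
  have lin: "(\<integral>\<^sup>+x. ennreal (exp ((x - c) \<bullet> z)) \<partial>m) \<le> ennreal (exp ((norm z)^2 / (4 * \<rho>)))" for z
  proof -
    have "(\<integral>\<^sup>+x. ennreal (exp ((x - c) \<bullet> z)) \<partial>m) = (\<integral>\<^sup>+x. ennreal (exp (- (c \<bullet> z))) * ennreal (exp (z \<bullet> x)) \<partial>m)"
      by (intro nn_integral_cong) (simp add: ennreal_mult'[symmetric] exp_add[symmetric] inner_diff_left inner_commute[of z])
    also have "... \<le> ennreal (exp (- (c \<bullet> z))) * ennreal (exp ((\<integral>x. z \<bullet> x \<partial>m) + (norm z)^2 / (4 * \<rho>)))"
      by (simp add: nn_integral_cmult mult_left_mono log_sobolev_exp_linear[OF m lsi \<rho>])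
    also have "(\<integral>x. z \<bullet> x \<partial>m) = c \<bullet> z" using xi by (simp add: c_def barycenter_def inner_commute)
    also have "ennreal (exp (- (c \<bullet> z))) * ennreal (exp (c \<bullet> z + (norm z)^2 / (4 * \<rho>))) = ennreal (exp ((norm z)^2 / (4 * \<rho>)))"
      by (simp add: ennreal_mult'[symmetric] exp_add[symmetric])
    finally show ?thesis .
  qed
  have "(\<integral>\<^sup>+x. ennreal (exp (\<rho> / 2 * (norm (x - c))^2)) \<partial>m) = (\<integral>\<^sup>+x. (\<integral>\<^sup>+z. ennreal (exp ((x - c) \<bullet> z)) * ennreal (gauss \<rho> z) \<partial>lborel) \<partial>m)"
    using nn_integral_exp_inner_gauss[OF \<rho>, of "_ - c"] by (simp add: ennreal_mult')
  also have "... = (\<integral>\<^sup>+z. (\<integral>\<^sup>+x. ennreal (exp ((x - c) \<bullet> z)) * ennreal (gauss \<rho> z) \<partial>m) \<partial>lborel)"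
    by (rule Fubini'[symmetric]) measurable
  also have "... = (\<integral>\<^sup>+z. (\<integral>\<^sup>+x. ennreal (exp ((x - c) \<bullet> z)) \<partial>m) * ennreal (gauss \<rho> z) \<partial>lborel)"
    by (intro nn_integral_cong nn_integral_multc) measurable
  also have "... \<le> (\<integral>\<^sup>+z. ennreal (exp ((norm z)^2 / (4 * \<rho>))) * ennreal (gauss \<rho> (z::'a)) \<partial>lborel)"
    by (rule nn_integral_mono, rule mult_right_mono[OF lin]) simp
  also have "... = sqrt 2 ^ DIM('a)" using nn_integral_exp_gauss[OF \<rho>, where 'a='a] by (simp add: ennreal_mult')
  finally show ?thesis by (simp add: c_def)
qed

lemma ln_sqrt2_power: "ln (sqrt 2 ^ n) \<le> real n / 2"
proof -
  have "ln (sqrt 2 ^ n) = real n * (ln 2 / 2)" by (simp add: ln_realpow ln_sqrt)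
  also have "... \<le> real n * (1 / 2)" using ln_le_minus_one[of 2] by (intro mult_left_mono) auto
  finally show ?thesis by simp
qed

text \<open>The variational inequality with density 1, that is Jensen's inequality for the
  exponential square moment.\<close>

lemma log_sobolev_variance:
  fixes m :: "'a::euclidean_space measure"
  assumes m: "m \<in> P2" and lsi: "log_sobolev \<rho> m" and \<rho>: "\<rho> > 0"
  shows "(\<integral>x. (norm (x - barycenter m))^2 \<partial>m) \<le> DIM('a) / \<rho>"
proof -
  interpret m: prob_space m using P2D[OF m] by simp
  let ?\<phi> = "\<lambda>x. \<rho> / 2 * (norm (x - barycenter m))^2"
  have [measurable]: "?\<phi> \<in> borel_measurable m" by (rule P2_measurable[OF m]) measurable
  have 1: "density m (\<lambda>x. ennreal 1) = m" by (simp add: density_1)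
  have "(\<integral>x. ?\<phi> x \<partial>density m (\<lambda>x. ennreal 1)) \<le> (\<integral>x. ln 1 \<partial>density m (\<lambda>x. ennreal 1)) + ln (sqrt 2 ^ DIM('a))"
    using log_sobolev_exp_square[OF m lsi \<rho>] P2_dist_square_integrable[OF m, of "barycenter m"] m.prob_space_axioms
    by (intro entropy_variational) (simp_all only: 1, auto simp: ennreal_power[symmetric])
  then show ?thesis using ln_sqrt2_power[of "DIM('a)"] \<rho> by (simp add: density_1 field_simps)
qed

section \<open>Cutoffs and the log-Sobolev inequality for the Fisher information\<close>

lemma bounded_range_compact_support:
  fixes h :: "'a::euclidean_space \<Rightarrow> 'b::real_normed_vector"
  assumes c: "continuous_on UNIV h" and z: "\<And>x. norm x > R \<Longrightarrow> h x = 0"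
  shows "bounded (range h)"
proof -
  have "compact (h ` cball 0 R)" using c by (intro compact_continuous_image) (auto intro: continuous_on_subset)
  then have "bounded (insert 0 (h ` cball 0 R))" by (simp add: compact_imp_bounded)
  moreover have "range h \<subseteq> insert 0 (h ` cball 0 R)" using z by force
  ultimately show ?thesis by (rule bounded_subset)
qed

lemma DERIV_max_square: "((\<lambda>t. (max 0 t)^2) has_real_derivative 2 * max 0 t) (at t)" for t :: real
proof (rule DERIV_of_quadratic_bound[where C=1])
  fix s :: real
  have "(max 0 s)^2 - (max 0 t)^2 - 2 * max 0 t * (s - t) = (max 0 s - max 0 t)^2 + 2 * max 0 t * (max 0 s - s)"
    by (cases "0 \<le> t") (auto simp: power2_eq_square algebra_simps)
  moreover have "0 \<le> 2 * max 0 t * (max 0 s - s)" by simp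
  moreover have "(max 0 s - max 0 t)^2 + 2 * max 0 t * (max 0 s - s) \<le> (s - t)^2"
  proof (cases "0 \<le> t"; cases "0 \<le> s")
    assume "0 \<le> t" "\<not> 0 \<le> s"
    then show ?thesis by (simp add: power2_eq_square algebra_simps)
  next
    assume "\<not> 0 \<le> t" "0 \<le> s"
    then have "s^2 \<le> (s - t)^2" by simp
    show ?thesis using \<open>\<not> 0 \<le> t\<close> \<open>0 \<le> s\<close> by simp
  qed (auto simp: max_def)
  ultimately show "\<bar>(max 0 s)^2 - (max 0 t)^2 - 2 * max 0 t * (s - t)\<bar> \<le> 1 * (s - t)^2" by simp
qed

text \<open>The outer square makes the truncated paraboloid continuously differentiable, as
  admissible test functions must be; the support has radius k + 1 and the gradient is at most 4 / (k
  + 1).\<close>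

definition cutoff :: "nat \<Rightarrow> 'a::euclidean_space \<Rightarrow> real" where
  "cutoff k x = (max 0 (1 - (norm x)^2 / (real (Suc k))^2))^2"

definition gcutoff :: "nat \<Rightarrow> 'a::euclidean_space \<Rightarrow> 'a" where
  "gcutoff k x = (- 4 * max 0 (1 - (norm x)^2 / (real (Suc k))^2) / (real (Suc k))^2) *\<^sub>R x"

lemma cutoff_GDERIV: "GDERIV (cutoff k) x :> gcutoff k x"
proof -
  have "GDERIV (\<lambda>x::'a. 1 - c * (norm x)^2) x :> (- 2 * c) *\<^sub>R x" for c
    unfolding gderiv_def power2_norm_eq_inner by (auto intro!: derivative_eq_intros simp: inner_commute)
  from this[of "1 / (real (Suc k))^2"]
  have "GDERIV (\<lambda>x. 1 - (norm x)^2 / (real (Suc k))^2) x :> (- 2 / (real (Suc k))^2) *\<^sub>R x" by simp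
  from GDERIV_compose[OF this DERIV_max_square] show ?thesis unfolding cutoff_def[abs_def] gcutoff_def by simp
qed

lemma cutoff_continuous: "continuous_on A (cutoff k)" "continuous_on A (gcutoff k)"
  unfolding cutoff_def[abs_def] gcutoff_def[abs_def] by (intro continuous_intros; simp)+

lemma cutoff_zero: "norm x > real (Suc k) \<Longrightarrow> cutoff k x = 0" "norm x > real (Suc k) \<Longrightarrow> gcutoff k x = 0"
  by (auto simp: cutoff_def gcutoff_def)

lemma cutoff_range: "0 \<le> cutoff k x" "cutoff k x \<le> 1"
proof -
  have "max 0 (1 - (norm x)^2 / (real (Suc k))^2) \<le> 1" by simp
  show "cutoff k x \<le> 1" unfolding cutoff_def by (intro power_le_one) auto
qed (simp add: cutoff_def)

lemma gcutoff_le: "norm (gcutoff k x) \<le> 4 / real (Suc k)"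
proof (cases "norm x > real (Suc k)")
  case False
  have "norm (gcutoff k x) = 4 * max 0 (1 - (norm x)^2 / (real (Suc k))^2) / (real (Suc k))^2 * norm x"
    by (simp add: gcutoff_def)
  also have "... \<le> 4 * 1 / (real (Suc k))^2 * real (Suc k)" using False by (intro mult_mono divide_right_mono) auto
  also have "... = 4 / real (Suc k)" unfolding power2_eq_square by (simp only: times_divide_eq_left nonzero_mult_divide_mult_cancel_right[OF of_nat_neq_0])
  finally show ?thesis .
qed (simp add: cutoff_zero)

lemma cutoff_tendsto: "(\<lambda>k. cutoff k x) \<longlonglongrightarrow> 1" "(\<lambda>k. gcutoff k x) \<longlonglongrightarrow> 0"
proof -
  have "(\<lambda>k. (max 0 (1 - (norm x)^2 / (real (Suc k))^2))^2) \<longlonglongrightarrow> (max 0 1)^2" by real_asymp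
  then show "(\<lambda>k. cutoff k x) \<longlonglongrightarrow> 1" by (simp add: cutoff_def)
  have "(\<lambda>k. 4 / real (Suc k)) \<longlonglongrightarrow> 0" by real_asymp
  then show "(\<lambda>k. gcutoff k x) \<longlonglongrightarrow> 0"
    by (rule Lim_null_comparison[rotated]) (intro always_eventually allI gcutoff_le)
qed

lemma abs_mult_ln_le_one:
  fixes a :: real
  assumes "0 \<le> a" "a \<le> 1"
  shows "\<bar>a * ln a\<bar> \<le> 1"
proof (cases "a = 0")
  case False
  then have "a * ln a \<le> 0" using assms by (intro mult_nonneg_nonpos) auto
  then show ?thesis using mult_ln_ge[of a 1] assms by simp
qed simp

context potential
begin

text \<open>The inequality is extended from bounded test functions to \<open>sqrt (p / exp (- U))\<close> by cutoffs.\<close>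

lemma log_sobolev_free:
  assumes lsi: "log_sobolev \<rho> (edensity lborel (\<lambda>x. exp (- U x)))" and p: "regdens p D"
  shows "4 * \<rho> * free p \<le> fisher p D"
proof -
  let ?B = "\<lambda>x. \<bar>p x * ln (p x)\<bar> + \<bar>p x * U x\<bar> + p x"
  let ?A = "\<lambda>k x. cutoff k x / 2"
  have p2: "dens2 p" and pp: "\<And>x. p x > 0" and pd: "\<And>x. GDERIV p x :> D x" and Dc: "continuous_on UNIV D"
    and Di: "integrable lborel (\<lambda>x. (norm (D x))^2 / p x)" using p by (auto simp: regdens_def)
  have pc: "continuous_on UNIV p" using pd by (meson continuous_at_imp_continuous_on gderiv_def has_derivative_continuous)
  note [measurable] = dens2D(1)[OF p2] borel_measurable_continuous_onI[OF Dc]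
    borel_measurable_continuous_onI[OF cutoff_continuous(1)] borel_measurable_continuous_onI[OF cutoff_continuous(2)]
  have pne: "p x \<noteq> 0" for x using pp[of x] by simp
  define s where "s x = (1 / p x) *\<^sub>R D x + b x" for x
  define f where "f x = exp ((ln (p x) + U x) / 2)" for x
  have [measurable]: "s \<in> borel_measurable borel" "f \<in> borel_measurable borel" unfolding s_def[abs_def] f_def[abs_def] by auto
  have sc: "continuous_on UNIV s" unfolding s_def[abs_def] by (intro continuous_intros pc Dc b_continuous) (use pne in auto)
  have fc: "continuous_on UNIV f" unfolding f_def[abs_def] by (intro continuous_intros pc U_continuous) (use pne in auto)
  have f2: "(f x)^2 = p x * exp (U x)" for x using pp[of x] unfolding f_def exp_double[symmetric] by (simp add: exp_add add_divide_distrib)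
  \<comment> \<open>f is the square root of the density of p relative to \<open>exp (- U)\<close>.
    The 1/2 is squared in the energy of f, which is where the 4 in the conclusion comes
    from.\<close>
  have fd: "GDERIV f x :> (f x / 2) *\<^sub>R s x" for x
  proof -
    have "GDERIV (\<lambda>x. ln (p x)) x :> (1 / p x) *\<^sub>R D x"
      by (rule GDERIV_compose[OF pd]) (auto intro!: derivative_eq_intros simp: pp)
    then have "GDERIV (\<lambda>x. ln (p x) + U x) x :> s x" unfolding s_def by (intro GDERIV_add U_GDERIV)
    then show ?thesis unfolding f_def[abs_def]
      by (rule GDERIV_compose[of "\<lambda>x. ln (p x) + U x" _ _ "\<lambda>y. exp (y / 2)"]) (auto intro!: derivative_eq_intros)
  qed
  define a where "a k x = (cutoff k x)^2" for k and x :: 'a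
  have a: "0 \<le> a k x" "a k x \<le> 1" for k x using cutoff_range[of k x] by (auto simp: a_def power_le_one)
  have [measurable]: "a k \<in> borel_measurable borel" for k unfolding a_def[abs_def] by simp
  have al: "(\<lambda>k. a k x) \<longlonglongrightarrow> 1" for x
    using tendsto_power[OF cutoff_tendsto(1)[of x], of 2] by (simp add: a_def)
  have Ui: "integrable lborel (\<lambda>x. p x * U x)" by (rule dens2_growth[OF p2 _ U_growth]) measurable
  note i1 = integral_dens2_one[OF p2]
  have si: "integrable lborel (\<lambda>x. p x * (norm (s x))^2)" using fisher_integrable[OF p] by (simp only: s_def)
  let ?m = "edensity lborel (\<lambda>x. exp (- U x))"
  have dens: "(\<integral>x. g x \<partial>?m) = (LBINT x. exp (- U x) * g x)" if [measurable]: "g \<in> borel_measurable borel" for g :: "'a \<Rightarrow> real"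
    by (subst integral_density) auto
  \<comment> \<open>The entropy integrand of the squared test function: with a the square of the
    cutoff, the logarithm splits into three terms, each dominated by an integrable function, and the
    one with \<open>a k x * ln (a k x)\<close> tends to 0.\<close>
  let ?E = "\<lambda>k x. a k x * (p x * ln (p x)) + a k x * (p x * U x) + p x * (a k x * ln (a k x))" and ?S = "\<lambda>k x. (norm ((?A k x) *\<^sub>R s x + gcutoff k x))^2"
  define A where "A k = (LBINT x. ?E k x)" for k
  define B where "B k = (LBINT x. a k x * p x)" for k
  define R where "R k = (LBINT x. p x * ?S k x)" for k
  have ineq: "\<rho> * (A k - B k * ln (B k)) \<le> R k" for k
  proof -
    let ?f = "\<lambda>x. cutoff k x * f x" and ?g = "\<lambda>x. f x *\<^sub>R ((?A k x) *\<^sub>R s x + gcutoff k x)"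
    have "\<rho> * Ent ?m (\<lambda>x. (?f x)^2) \<le> (\<integral>x. (norm (?g x))^2 \<partial>?m)"
    proof (rule lsi[unfolded log_sobolev_def, rule_format], intro conjI allI)
      show "GDERIV ?f x :> ?g x" for x using GDERIV_mult[OF cutoff_GDERIV fd, of k x] by (simp add: algebra_simps)
      show c: "continuous_on UNIV ?g" by (intro continuous_intros fc sc cutoff_continuous) auto
      show "bounded (range ?g)" by (rule bounded_range_compact_support[OF c, of "real (Suc k)"]) (simp add: cutoff_zero)
      show "bounded (range ?f)"
        by (simp add: continuous_intros fc cutoff_continuous cutoff_zero bounded_range_compact_support[of _ "real (Suc k)"])
    qed
    also have "(\<integral>x. (norm (?g x))^2 \<partial>?m) = R k"
    proof -
      have "(\<integral>x. (norm (?g x))^2 \<partial>?m) = (LBINT x. exp (- U x) * (norm (?g x))^2)" by (rule dens) measurable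
      also have "... = R k" unfolding R_def
      proof (rule Bochner_Integration.integral_cong[OF refl])
        show "exp (- U x) * (norm (?g x))^2 = p x * ?S k x" for x by (simp add: power_mult_distrib f2 exp_minus)
      qed
      finally show ?thesis .
    qed
    also have "Ent ?m (\<lambda>x. (?f x)^2) = A k - B k * ln (B k)"
    proof -
      have sq: "(?f x)^2 = a k x * (p x * exp (U x))" for x by (simp add: power_mult_distrib f2 a_def)
      have 1: "(\<integral>x. (?f x)^2 \<partial>?m) = B k"
      proof -
        have "(\<integral>x. (?f x)^2 \<partial>?m) = (LBINT x. exp (- U x) * (?f x)^2)" by (rule dens) measurable
        also have "... = B k" unfolding B_def by (intro Bochner_Integration.integral_cong) (simp_all add: sq exp_minus)
        finally show ?thesis .
      qed
      have "(\<integral>x. (?f x)^2 * ln ((?f x)^2) \<partial>?m) = (LBINT x. exp (- U x) * ((?f x)^2 * ln ((?f x)^2)))" by (rule dens) measurable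
      also have "... = A k" unfolding A_def
      proof (rule Bochner_Integration.integral_cong[OF refl])
        fix x
        show "exp (- U x) * ((?f x)^2 * ln ((?f x)^2)) = ?E k x"
        proof (cases "a k x = 0")
          case False
          then have "ln (a k x * (p x * exp (U x))) = ln (a k x) + (ln (p x) + U x)" using pp[of x] by (simp add: ln_mult)
          then show ?thesis unfolding sq by (simp add: exp_minus field_simps)
        qed (simp add: sq)
      qed
      finally show ?thesis using 1 by (simp add: Ent_def)
    qed
    finally show ?thesis .
  qed
  have A: "A \<longlonglongrightarrow> free p"
  proof -
    have "A \<longlonglongrightarrow> (LBINT x. p x * ln (p x) + p x * U x)" unfolding A_def[abs_def]
    proof (rule integral_dominated_convergence[where w="\<lambda>x. ?B x"])
      show "integrable lborel (\<lambda>x. ?B x)" using Ui dens2D(5)[OF p2] i1(1) by auto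
      have "(\<lambda>k. ?E k x) \<longlonglongrightarrow> 1 * (p x * ln (p x)) + 1 * (p x * U x) + p x * (1 * ln 1)" for x
        by (intro tendsto_intros al) simp
      then show "AE x in lborel. (\<lambda>k. ?E k x) \<longlonglongrightarrow> p x * ln (p x) + p x * U x" by simp
      have "\<bar>?E k x\<bar> \<le> ?B x" for k x
      proof -
        have 1: "\<bar>a k x * r\<bar> \<le> \<bar>r\<bar>" for r using a[of k x] by (simp add: abs_mult mult_left_le_one_le)
        moreover have "\<bar>p x * (a k x * ln (a k x))\<bar> \<le> p x * 1"
          unfolding abs_mult[of "p x"] using pp[of x] abs_mult_ln_le_one[OF a] by simp
        ultimately show ?thesis using 1[of "p x * ln (p x)"] 1[of "p x * U x"] by arith
      qed
      then show "AE x in lborel. norm (?E k x) \<le> ?B x" for k by simp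
    qed measurable
    then show ?thesis using Ui dens2D(5)[OF p2] by (simp add: free_def)
  qed
  have B: "B \<longlonglongrightarrow> 1"
  proof -
    have "B \<longlonglongrightarrow> (LBINT x. p x)" unfolding B_def[abs_def]
    proof (rule integral_dominated_convergence[where w=p])
      show "AE x in lborel. (\<lambda>k. a k x * p x) \<longlonglongrightarrow> p x" using tendsto_mult_right[OF al] by simp
      show "AE x in lborel. norm (a k x * p x) \<le> p x" for k using a pp by (simp add: less_imp_le)
    qed (use i1 in auto)
    then show ?thesis using i1 by simp
  qed
  have R: "R \<longlonglongrightarrow> fisher p D / 4"
  proof -
    have "R \<longlonglongrightarrow> (LBINT x. p x * (norm (s x))^2 / 4)" unfolding R_def[abs_def]
    proof (rule integral_dominated_convergence[where w="\<lambda>x. p x * (norm (s x))^2 + 32 * p x"])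
      show "integrable lborel (\<lambda>x. p x * (norm (s x))^2 + 32 * p x)" using si i1 by simp
      have "(\<lambda>k. p x * ?S k x) \<longlonglongrightarrow> p x * (norm ((1 / 2) *\<^sub>R s x + 0))^2" for x
        by (intro tendsto_intros cutoff_tendsto) simp
      then show "AE x in lborel. (\<lambda>k. p x * ?S k x) \<longlonglongrightarrow> p x * (norm (s x))^2 / 4"
        by (simp add: power_divide)
      have "p x * ?S k x \<le> p x * (norm (s x))^2 + 32 * p x" for k x
      proof -
        have "norm ((?A k x) *\<^sub>R s x) \<le> (1 / 2) * norm (s x)"
          unfolding norm_scaleR using cutoff_range[of k x] by (intro mult_right_mono) auto
        then have 1: "(norm ((?A k x) *\<^sub>R s x))^2 \<le> ((1 / 2) * norm (s x))^2" by simp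
        have "4 / real (Suc k) \<le> 4" by (simp add: divide_le_eq)
        then have 2: "(norm (gcutoff k x))^2 \<le> 4^2" using gcutoff_le[of k x] by (intro power_mono) auto
        have "?S k x \<le> 2 * ((1 / 2) * norm (s x))^2 + 2 * 4^2"
          using norm_add_square_le[of "(?A k x) *\<^sub>R s x" "gcutoff k x"] 1 2 by arith
        also have "... \<le> (norm (s x))^2 + 32" by (simp add: power2_eq_square)
        finally have "p x * ?S k x \<le> p x * ((norm (s x))^2 + 32)" using pp[of x] by simp
        then show ?thesis by (simp add: algebra_simps)
      qed
      then show "AE x in lborel. norm (p x * ?S k x) \<le> p x * (norm (s x))^2 + 32 * p x" for k
        using pp by (simp add: less_imp_le)
    qed measurable
    then show ?thesis by (simp add: fisher_def s_def)
  qed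
  have "(\<lambda>k. \<rho> * (A k - B k * ln (B k))) \<longlonglongrightarrow> \<rho> * (free p - 1 * ln 1)"
    by (intro tendsto_intros A B) simp
  then have "\<rho> * (free p - 1 * ln 1) \<le> fisher p D / 4" using R by (rule LIMSEQ_le) (use ineq in auto)
  then show ?thesis by simp
qed

end

section \<open>Powers of a measure on the configuration space\<close>

lemma vec_nth_measurable [measurable (raw)]:
  "f \<in> borel_measurable M \<Longrightarrow> (\<lambda>x. f x $ i) \<in> borel_measurable M" for f :: "_ \<Rightarrow> 'a::euclidean_space ^ 'n"
  by (rule measurable_compose[of f _ borel]) (auto intro!: borel_measurable_continuous_onI linear_continuous_on)

lemma vec_lambda_measurable:
  fixes f :: "_ \<Rightarrow> 'n::finite \<Rightarrow> 'a::euclidean_space"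
  assumes [measurable]: "\<And>i. (\<lambda>x. f x i) \<in> borel_measurable M"
  shows "(\<lambda>x. \<chi> i. f x i) \<in> borel_measurable M"
  by (subst borel_measurable_euclidean_space) (auto simp: Basis_vec_def inner_axis)

lemma prod_Basis_vec: "(\<Prod>b\<in>Basis. g b) = (\<Prod>i\<in>UNIV. \<Prod>u\<in>Basis. g (axis i u))"
  for g :: "'a::euclidean_space ^ 'n \<Rightarrow> real"
proof -
  have B: "(Basis :: ('a ^ 'n) set) = (\<lambda>(i, u). axis i u) ` (UNIV \<times> Basis)" by (auto simp: Basis_vec_def)
  have inj: "inj_on (\<lambda>(i::'n, u). axis i u) (UNIV \<times> (Basis :: 'a set))" by (auto simp: inj_on_def axis_eq_axis)
  show ?thesis unfolding B by (subst prod.reindex[OF inj]) (simp add: prod.cartesian_product case_prod_beta')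
qed

lemma vec_lambda_PiM_measurable:
  assumes "sets m = sets borel"
  shows "(\<lambda>x. \<chi> i. x i) \<in> (\<Pi>\<^sub>M i\<in>(UNIV :: 'n::finite set). m) \<rightarrow>\<^sub>M (borel :: ('a::euclidean_space ^ 'n) measure)"
proof (rule vec_lambda_measurable)
  fix i :: 'n
  show "(\<lambda>x. x i) \<in> borel_measurable (\<Pi>\<^sub>M i\<in>(UNIV :: 'n set). m)"
    using measurable_cong_sets[OF refl assms] by force
qed

lemma lborel_vec: "(lborel :: ('a::euclidean_space ^ 'n) measure) = tensor_power lborel"
proof (rule lborel_eqI)
  interpret product_sigma_finite "\<lambda>_::'n. lborel :: 'a measure" by standard
  fix l u :: "'a ^ 'n"
  assume le: "\<And>b. b \<in> Basis \<Longrightarrow> l \<bullet> b \<le> u \<bullet> b"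
  have le': "l $ i \<bullet> v \<le> u $ i \<bullet> v" if "v \<in> Basis" for i v using le[of "axis i v"] that by (simp add: inner_axis)
  have "emeasure (tensor_power lborel) (box l u) = emeasure (\<Pi>\<^sub>M i\<in>(UNIV :: 'n set). lborel) (\<Pi>\<^sub>E i\<in>UNIV. box (l $ i) (u $ i))"
    unfolding tensor_power_def
  proof (subst emeasure_distr[OF vec_lambda_PiM_measurable])
    have "vec_lambda -` box l u \<inter> space (\<Pi>\<^sub>M i\<in>(UNIV :: 'n set). lborel) = (\<Pi>\<^sub>E i\<in>UNIV. box (l $ i) (u $ i))"
      by (auto simp: space_PiM mem_box Basis_vec_def inner_axis PiE_iff)
    then show "emeasure (Pi\<^sub>M UNIV (\<lambda>i. lborel)) (vec_lambda -` box l u \<inter> space (Pi\<^sub>M UNIV (\<lambda>i. lborel))) = emeasure (\<Pi>\<^sub>M i\<in>(UNIV :: 'n set). lborel) (\<Pi>\<^sub>E i\<in>UNIV. box (l $ i) (u $ i))"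
      by simp
  qed simp_all
  also have "... = ennreal (\<Prod>b\<in>Basis. (u - l) \<bullet> b)"
    using le' by (simp add: emeasure_PiM prod_Basis_vec inner_axis inner_diff_left prod_nonneg prod_ennreal)
  finally show "emeasure (tensor_power lborel) (box l u) = ennreal (\<Prod>b\<in>Basis. (u - l) \<bullet> b)" .
qed (simp add: tensor_power_def)

lemma tensor_power_density:
  fixes w :: "'a::euclidean_space \<Rightarrow> real"
  assumes [measurable]: "w \<in> borel_measurable borel" and w: "\<And>x. 0 \<le> w x"
    and P: "prob_space (edensity lborel w)"
  shows "(tensor_power (edensity lborel w) :: ('a ^ 'n) measure) = edensity lborel (\<lambda>y. \<Prod>i\<in>UNIV. w (y $ i))"
proof -
  let ?A = "\<lambda>x. \<Prod>i\<in>UNIV. ennreal (w (x i))"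
  let ?m = "edensity lborel w" and ?L = "\<Pi>\<^sub>M i\<in>(UNIV :: 'n set). (lborel :: 'a measure)"
  let ?v = "(\<lambda>x. \<chi> i. x i) :: ('n \<Rightarrow> 'a) \<Rightarrow> 'a ^ 'n"
  interpret P: prob_space ?m by (rule P)
  interpret L: product_sigma_finite "\<lambda>_::'n. lborel :: 'a measure" by standard
  interpret m: product_sigma_finite "\<lambda>_::'n. ?m" by standard
  have v[measurable]: "?v \<in> ?L \<rightarrow>\<^sub>M borel" by (rule vec_lambda_PiM_measurable) simp
  have "density ?L ?A = (\<Pi>\<^sub>M i\<in>(UNIV :: 'n set). ?m)"
  proof (rule m.PiM_eqI)
    show "sets (density ?L ?A) = sets (\<Pi>\<^sub>M i\<in>(UNIV :: 'n set). ?m)" by (auto intro!: sets_PiM_cong)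
    fix A :: "'n \<Rightarrow> 'a set" assume "\<And>i. i \<in> UNIV \<Longrightarrow> A i \<in> sets ?m"
    then have A[measurable]: "A i \<in> sets borel" for i by simp
    have PA: "Pi\<^sub>E UNIV A \<in> sets ?L" by simp
    have "emeasure (density ?L ?A) (Pi\<^sub>E UNIV A) = (\<integral>\<^sup>+x. (\<Prod>i\<in>UNIV. ennreal (w (x i))) * indicator (Pi\<^sub>E UNIV A) x \<partial>?L)"
      by (subst emeasure_density) (use in auto)
    also have "... = (\<integral>\<^sup>+x. (\<Prod>i\<in>UNIV. ennreal (w (x i)) * indicator (A i) (x i)) \<partial>?L)"
      by (intro nn_integral_cong) (auto simp: indicator_def PiE_iff)
    also have "... = (\<Prod>i\<in>(UNIV :: 'n set). \<integral>\<^sup>+x. ennreal (w x) * indicator (A i) x \<partial>lborel)"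
      by (rule L.product_nn_integral_prod) auto
    also have "... = (\<Prod>i\<in>UNIV. emeasure ?m (A i))" by (simp add: emeasure_density)
    finally show "emeasure (density ?L ?A) (Pi\<^sub>E UNIV A) = (\<Prod>i\<in>UNIV. emeasure ?m (A i))" .
  qed simp
  then have "tensor_power ?m = distr (edensity ?L (\<lambda>x. \<Prod>i\<in>UNIV. w (?v x $ i))) borel ?v"
    unfolding tensor_power_def using w by (simp add: prod_ennreal)
  also have "... = edensity (distr ?L borel ?v) (\<lambda>y. \<Prod>i\<in>UNIV. w (y $ i))"
    by (rule density_distr[symmetric]) measurable
  also have "distr ?L borel ?v = lborel" unfolding lborel_vec tensor_power_def ..
  finally show ?thesis .
qed

section \<open>Product measures and subadditivity of entropy\<close>

definition subst_at :: "'a ^ 'n \<Rightarrow> 'n \<Rightarrow> 'a \<Rightarrow> 'a ^ 'n" where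
  "subst_at y i z = (\<chi> j. if j = i then z else y $ j)"

lemma subst_at_nth [simp]: "subst_at y i z $ j = (if j = i then z else y $ j)" by (simp add: subst_at_def)

lemma subst_at_same [simp]: "subst_at (subst_at y i z) i z' = subst_at y i z'" "subst_at y i (y $ i) = y"
  by (simp_all add: vec_eq_iff)

lemma subst_at_commute: "i \<noteq> j \<Longrightarrow> subst_at (subst_at y i z) j z' = subst_at (subst_at y j z') i z"
  by (simp add: vec_eq_iff)

lemma subst_at_measurable [measurable (raw)]:
  fixes f :: "_ \<Rightarrow> 'a::euclidean_space ^ 'n"
  assumes [measurable]: "f \<in> borel_measurable M" "g \<in> borel_measurable M"
  shows "(\<lambda>x. subst_at (f x) i (g x)) \<in> borel_measurable M"
  unfolding subst_at_def by (rule vec_lambda_measurable) measurable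

locale product_base = prob_space m for m :: "'a::euclidean_space measure" +
  assumes sets_m [measurable_cong]: "sets m = sets borel"
begin

lemma space_m [simp]: "space m = UNIV" using sets_eq_imp_space_eq[OF sets_m] by simp

lemma tensor_power_measurable: "(\<lambda>x. \<chi> i. x i) \<in> (\<Pi>\<^sub>M i\<in>(UNIV :: 'n::finite set). m) \<rightarrow>\<^sub>M (borel :: ('a ^ 'n) measure)"
  by (rule vec_lambda_PiM_measurable[OF sets_m])

lemma sets_tensor_power [simp, measurable_cong]: "sets (tensor_power m :: ('a ^ 'n) measure) = sets borel"
  and space_tensor_power [simp]: "space (tensor_power m :: ('a ^ 'n) measure) = UNIV" by (simp_all add: tensor_power_def)

lemma prob_space_tensor_power: "prob_space (tensor_power m :: ('a ^ 'n) measure)"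
proof -
  interpret P: product_prob_space "\<lambda>_. m" "UNIV :: 'n set" ..
  show ?thesis unfolding tensor_power_def by (rule P.prob_space_distr[OF tensor_power_measurable])
qed

text \<open>Replacing one coordinate by a fresh independent sample does not change the product law.
  Conditioning on the other coordinates is expressed by this identity instead of by a
  disintegration.\<close>

lemma resample: "distr ((tensor_power m :: ('a ^ 'n) measure) \<Otimes>\<^sub>M m) borel (\<lambda>(y, z). subst_at y i z) = tensor_power m"
proof -
  let ?A = "\<lambda>i. \<lambda>(x, z). x(i := z)"
  interpret P: product_prob_space "\<lambda>_. m" "UNIV :: 'n set" ..
  let ?\<Pi> = "\<Pi>\<^sub>M i\<in>(UNIV :: 'n set). m" and ?v = "(\<lambda>x. \<chi> i. x i) :: ('n \<Rightarrow> 'a) \<Rightarrow> 'a ^ 'n"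
  note [measurable] = tensor_power_measurable
  have upd[measurable]: "(?A i) \<in> ?\<Pi> \<Otimes>\<^sub>M m \<rightarrow>\<^sub>M ?\<Pi>"
    by (auto intro!: measurable_PiM_single')
  have "distr (?\<Pi> \<Otimes>\<^sub>M m) ?\<Pi> (?A i) = ?\<Pi>"
  proof (rule P.PiM_eqI)
    fix A :: "'n \<Rightarrow> 'a set" assume A: "\<And>j. j \<in> UNIV \<Longrightarrow> A j \<in> sets m"
    have PA: "Pi\<^sub>E UNIV A \<in> sets ?\<Pi>" using A by simp
    have "emeasure (distr (?\<Pi> \<Otimes>\<^sub>M m) ?\<Pi> (?A i)) (Pi\<^sub>E UNIV A) = emeasure (?\<Pi> \<Otimes>\<^sub>M m) (Pi\<^sub>E UNIV (A(i := UNIV)) \<times> A i)"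
    proof (subst emeasure_distr[OF upd PA])
      have "(?A i) -` Pi\<^sub>E UNIV A \<inter> space (?\<Pi> \<Otimes>\<^sub>M m) = Pi\<^sub>E UNIV (A(i := UNIV)) \<times> A i"
        by (auto simp: space_pair_measure space_PiM PiE_iff split: if_splits)
      then show "emeasure (?\<Pi> \<Otimes>\<^sub>M m) ((?A i) -` Pi\<^sub>E UNIV A \<inter> space (?\<Pi> \<Otimes>\<^sub>M m)) = emeasure (?\<Pi> \<Otimes>\<^sub>M m) (Pi\<^sub>E UNIV (A(i := UNIV)) \<times> A i)" by simp
    qed
    also have "... = emeasure ?\<Pi> (Pi\<^sub>E UNIV (A(i := UNIV))) * emeasure m (A i)"
      using A by (intro emeasure_pair_measure_Times sets_PiM_I_finite) auto
    also have "emeasure ?\<Pi> (Pi\<^sub>E UNIV (A(i := UNIV))) = emeasure m UNIV * (\<Prod>j\<in>UNIV - {i}. emeasure m (A j))"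
      using A by (simp add: P.emeasure_PiM prod.remove[of UNIV i])
    also have "emeasure m UNIV = 1" using emeasure_space_1 by simp
    also have "1 * (\<Prod>j\<in>UNIV - {i}. emeasure m (A j)) * emeasure m (A i) = (\<Prod>j\<in>UNIV. emeasure m (A j))"
      by (subst prod.remove[of UNIV i]) (auto simp: mult.commute)
    finally show "emeasure (distr (?\<Pi> \<Otimes>\<^sub>M m) ?\<Pi> (?A i)) (Pi\<^sub>E UNIV A) = (\<Prod>j\<in>UNIV. emeasure m (A j))" .
  qed auto
  then have "tensor_power m = distr (distr (?\<Pi> \<Otimes>\<^sub>M m) ?\<Pi> (?A i)) borel ?v" by (simp add: tensor_power_def)
  also have "... = distr (?\<Pi> \<Otimes>\<^sub>M m) borel (\<lambda>(x, z). subst_at (?v x) i z)"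
    by (subst distr_distr) (auto simp: vec_eq_iff intro!: distr_cong)
  also have "... = distr (distr (?\<Pi> \<Otimes>\<^sub>M m) (borel \<Otimes>\<^sub>M borel) (\<lambda>(x, z). (?v x, z))) borel (\<lambda>(y, z). subst_at y i z)"
    by (subst distr_distr) (auto simp: comp_def case_prod_beta')
  also have "distr (?\<Pi> \<Otimes>\<^sub>M m) (borel \<Otimes>\<^sub>M borel) (\<lambda>(x, z). (?v x, z)) = distr ?\<Pi> borel ?v \<Otimes>\<^sub>M distr m borel (\<lambda>z. z)"
    by (rule pair_measure_distr[symmetric]) (auto intro!: prob_space_imp_sigma_finite prob_space_distr)
  also have "distr m borel (\<lambda>z. z) = m" by (rule distr_id2) (simp add: sets_m)
  also have "distr ?\<Pi> borel ?v = tensor_power m" by (simp add: tensor_power_def)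
  finally show ?thesis ..
qed

text \<open>The conditional expectation given all coordinates except i under the product law, in an
  everywhere defined version with values in \<open>ennreal\<close>.\<close>

definition avg :: "'n \<Rightarrow> ('a ^ 'n \<Rightarrow> ennreal) \<Rightarrow> 'a ^ 'n \<Rightarrow> ennreal" where
  "avg i \<phi> y = (\<integral>\<^sup>+z. \<phi> (subst_at y i z) \<partial>m)"

lemma avg_measurable [measurable]:
  assumes [measurable]: "\<phi> \<in> borel_measurable borel"
  shows "avg i \<phi> \<in> borel_measurable borel" unfolding avg_def[abs_def] by simp

lemma nn_integral_avg:
  fixes \<phi> :: "'a ^ 'n \<Rightarrow> ennreal"
  assumes [measurable]: "\<phi> \<in> borel_measurable borel"
  shows "(\<integral>\<^sup>+y. avg i \<phi> y \<partial>tensor_power m) = (\<integral>\<^sup>+y. \<phi> y \<partial>tensor_power m)"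
proof -
  have "(\<integral>\<^sup>+y. \<phi> y \<partial>tensor_power m) = (\<integral>\<^sup>+w. \<phi> (case w of (y, z) \<Rightarrow> subst_at y i z) \<partial>((tensor_power m :: ('a ^ 'n) measure) \<Otimes>\<^sub>M m))"
    by (subst resample[of i, symmetric]) (simp add: nn_integral_distr)
  then show ?thesis unfolding avg_def by (simp add: nn_integral_fst[symmetric])
qed

lemma integral_resample:
  fixes \<phi> :: "'a ^ 'n \<Rightarrow> real"
  assumes i: "integrable (tensor_power m) \<phi>"
  shows "AE y in tensor_power m. integrable m (\<lambda>z. \<phi> (subst_at y i z))"
    "integrable (tensor_power m) (\<lambda>y. \<integral>z. \<phi> (subst_at y i z) \<partial>m)"
    "(\<integral>y. (\<integral>z. \<phi> (subst_at y i z) \<partial>m) \<partial>tensor_power m) = (\<integral>y. \<phi> y \<partial>tensor_power m)"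
proof -
  let ?A = "(tensor_power m :: ('a ^ 'n) measure) \<Otimes>\<^sub>M m"
  let ?B = "\<integral>y. (\<integral>z. \<phi> (subst_at y i z) \<partial>m) \<partial>tensor_power m"
  interpret T: prob_space "tensor_power m :: ('a ^ 'n) measure" by (rule prob_space_tensor_power)
  interpret pair_sigma_finite "tensor_power m :: ('a ^ 'n) measure" m ..
  have [measurable]: "\<phi> \<in> borel_measurable borel" using i by simp
  have "integrable (distr ?A borel (\<lambda>(y, z). subst_at y i z)) \<phi>" unfolding resample by (rule i)
  then have 1: "integrable ?A (\<lambda>(y, z). \<phi> (subst_at y i z))"
    by (subst (asm) integrable_distr_eq) (auto simp: case_prod_beta')
  show "AE y in tensor_power m. integrable m (\<lambda>z. \<phi> (subst_at y i z))" using AE_integrable_fst'[OF 1] by simp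
  show "integrable (tensor_power m) (\<lambda>y. \<integral>z. \<phi> (subst_at y i z) \<partial>m)"
    using integrable_fst'[OF 1] by simp
  have "(\<integral>y. \<phi> y \<partial>tensor_power m) = (\<integral>w. \<phi> (case w of (y, z) \<Rightarrow> subst_at y i z) \<partial>?A)"
    by (subst resample[of i, symmetric]) (simp add: integral_distr)
  also have "... = ?B" using integral_fst'[OF 1] by (simp add: case_prod_beta')
  finally show "?B = (\<integral>y. \<phi> y \<partial>tensor_power m)" ..
qed

lemma avg_mult:
  assumes [measurable]: "\<phi> \<in> borel_measurable borel" and g: "\<And>z. g (subst_at y i z) = g y"
  shows "avg i (\<lambda>y. \<phi> y * g y) y = avg i \<phi> y * g y"
  unfolding avg_def g by (rule nn_integral_multc) measurable

lemma avg_pos: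
  assumes [measurable]: "\<phi> \<in> borel_measurable borel" and "\<And>y. \<phi> y > 0"
  shows "avg i \<phi> y > 0"
proof -
  have "avg i \<phi> y \<noteq> 0"
  proof
    assume "avg i \<phi> y = 0"
    then have "AE z in m. \<phi> (subst_at y i z) = 0" unfolding avg_def by (subst (asm) nn_integral_0_iff_AE) auto
    then have "AE z in m. False" by eventually_elim (use assms(2) in \<open>metis less_irrefl\<close>)
    then show False by simp
  qed
  then show ?thesis by (simp add: zero_less_iff_neq_zero)
qed

lemma avg_fold:
  fixes \<phi> :: "'a ^ 'n \<Rightarrow> ennreal"
  assumes [measurable]: "\<phi> \<in> borel_measurable borel"
  shows "fold avg xs \<phi> \<in> borel_measurable borel"
    "(\<integral>\<^sup>+y. fold avg xs \<phi> y \<partial>tensor_power m) = (\<integral>\<^sup>+y. \<phi> y \<partial>tensor_power m)"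
    "(\<And>y. \<phi> y > 0) \<Longrightarrow> fold avg xs \<phi> y > 0"
    "i \<in> set xs \<Longrightarrow> fold avg xs \<phi> (subst_at y i z) = fold avg xs \<phi> y"
proof (induction xs arbitrary: y z rule: rev_induct)
  case (snoc j xs)
  {
    case 4
    show ?case
    proof (cases "i = j")
      case False
      then have "fold avg xs \<phi> (subst_at (subst_at y j z') i z) = fold avg xs \<phi> (subst_at y j z')" for z' using 4 snoc.IH(4) by simp
      then show ?thesis using False by (simp add: avg_def[of j "fold avg xs \<phi>"] subst_at_commute[of i j])
    qed (simp add: avg_def[of j "fold avg xs \<phi>"])
  }
qed (use assms in \<open>simp_all add: nn_integral_avg avg_pos\<close>)

text \<open>A function insensitive to each single coordinate is constant, hence equal to its mean,
  and averaging preserves the mean.\<close>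

lemma avg_fold_UNIV:
  fixes \<phi> :: "'a ^ 'n \<Rightarrow> ennreal"
  assumes [measurable]: "\<phi> \<in> borel_measurable borel" and xs: "set xs = UNIV"
  shows "fold avg xs \<phi> y = (\<integral>\<^sup>+y. \<phi> y \<partial>tensor_power m)"
proof -
  interpret T: prob_space "tensor_power m :: ('a ^ 'n) measure" by (rule prob_space_tensor_power)
  have J: "fold avg xs \<phi> (\<chi> j. if j \<in> J then y' $ j else y $ j) = fold avg xs \<phi> y" if "finite J" for J y'
    using that
  proof (induction J)
    case (insert i J)
    have "(\<chi> j. if j \<in> insert i J then y' $ j else y $ j) = subst_at (\<chi> j. if j \<in> J then y' $ j else y $ j) i (y' $ i)"
      by (simp add: vec_eq_iff)
    then show ?case using avg_fold(4)[of \<phi> i xs] xs insert by simp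
  qed simp
  have c: "fold avg xs \<phi> y' = fold avg xs \<phi> y" for y' using J[of UNIV y'] by simp
  have "(\<integral>\<^sup>+y. \<phi> y \<partial>tensor_power m) = (\<integral>\<^sup>+y'. fold avg xs \<phi> y' \<partial>tensor_power m)" by (simp add: avg_fold(2))
  also have "... = (\<integral>\<^sup>+y'. fold avg xs \<phi> y \<partial>(tensor_power m :: ('a ^ 'n) measure))" by (intro nn_integral_cong c)
  also have "... = fold avg xs \<phi> y" using T.emeasure_space_1 by simp
  finally show ?thesis ..
qed

lemma ennreal_mult_divide_le: "a * (b / a) \<le> b" for a b :: ennreal
proof (cases "a = 0 \<or> a = top")
  case False
  then have "b * a / a = b" by (intro ennreal_mult_divide_eq) auto
  then show ?thesis by (simp add: ennreal_times_divide mult.commute)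
qed auto

text \<open>Telescoping over an enumeration of the coordinates: \<open>G xs\<close> averages out
  those in xs. In each step the ratio u has f-mean at most 1, and \<open>ln u \<le> u - 1\<close> is
  summed pointwise, R collecting the u. The logarithms of the intermediate \<open>G xs\<close>
  cancel before anything is integrated, so their integrability is never at stake; the last G is
  1.\<close>

lemma tensorization:
  fixes f :: "'a ^ 'n \<Rightarrow> real"
  assumes [measurable]: "f \<in> borel_measurable borel" and f: "\<And>y. f y > 0"
    and f1: "(\<integral>\<^sup>+y. ennreal (f y) \<partial>tensor_power m) = 1"
  defines "Mf \<equiv> \<lambda>i y. enn2real (avg i (\<lambda>y. ennreal (f y)) y)"
  assumes i: "integrable (tensor_power m) (\<lambda>y. f y * ln (f y))" "\<And>i. integrable (tensor_power m) (\<lambda>y. f y * ln (Mf i y))"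
  shows "(\<integral>y. f y * ln (f y) \<partial>tensor_power m) \<le> (\<Sum>i\<in>UNIV. (\<integral>y. f y * ln (f y) \<partial>tensor_power m) - (\<integral>y. f y * ln (Mf i y) \<partial>tensor_power m))"
proof -
  let ?T = "tensor_power m :: ('a ^ 'n) measure"
  interpret T: prob_space ?T by (rule prob_space_tensor_power)
  define \<phi> where "\<phi> y = ennreal (f y)" for y
  have [measurable]: "\<phi> \<in> borel_measurable borel" unfolding \<phi>_def[abs_def] by simp
  have \<phi>0: "\<phi> y > 0" for y using f by (simp add: \<phi>_def)
  have Mf: "Mf i y = enn2real (avg i \<phi> y)" for i y by (simp add: Mf_def \<phi>_def[abs_def])
  have [measurable]: "Mf i \<in> borel_measurable borel" for i unfolding Mf[abs_def] by simp
  define G where "G xs = fold avg xs \<phi>" for xs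
  have G[measurable]: "G xs \<in> borel_measurable borel" and G0: "G xs y > 0" and G1: "(\<integral>\<^sup>+y. G xs y \<partial>?T) = 1" for xs y
    using avg_fold(1,2,3)[of \<phi> xs] \<phi>0 f1 by (simp_all add: G_def \<phi>_def[symmetric])
  have fin: "AE y in ?T. 0 < enn2real (\<psi> y) \<and> ennreal (enn2real (\<psi> y)) = \<psi> y"
    if [measurable]: "\<psi> \<in> borel_measurable borel" and p: "\<And>y. \<psi> y > 0" and i1: "(\<integral>\<^sup>+y. \<psi> y \<partial>?T) = 1" for \<psi>
  proof -
    have "AE y in ?T. \<psi> y \<noteq> \<infinity>" by (rule nn_integral_noteq_infinite) (use i1 in auto)
    then show ?thesis by eventually_elim (use p in \<open>auto simp: enn2real_positive_iff less_top\<close>)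
  qed
  have Mi: "(\<integral>\<^sup>+y. avg i \<phi> y \<partial>?T) = 1" for i using f1 by (simp add: nn_integral_avg \<phi>_def)
  have step: "\<exists>R. R \<in> borel_measurable borel \<and> (\<forall>y. 0 \<le> R y) \<and> (\<integral>\<^sup>+y. ennreal (f y * R y) \<partial>?T) \<le> of_nat (length xs) \<and>
      (AE y in ?T. ln (f y) + (\<Sum>i\<leftarrow>xs. ln (Mf i y) - ln (f y)) - ln (enn2real (G xs y)) \<le> R y - real (length xs))" for xs
  proof (induction xs rule: rev_induct)
    case Nil
    show ?case by (intro exI[of _ "\<lambda>_. 0"]) (use f in \<open>auto simp: G_def \<phi>_def less_imp_le\<close>)
  next
    case (snoc i xs)
    then obtain R where R[measurable]: "R \<in> borel_measurable borel" and R0: "\<And>y. 0 \<le> R y"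
      and Ri: "(\<integral>\<^sup>+y. ennreal (f y * R y) \<partial>?T) \<le> of_nat (length xs)"
      and RA: "AE y in ?T. ln (f y) + (\<Sum>i\<leftarrow>xs. ln (Mf i y) - ln (f y)) - ln (enn2real (G xs y)) \<le> R y - real (length xs)" by auto
    let ?G = "G xs" and ?G' = "G (xs @ [i])"
    have G': "?G' = avg i ?G" by (simp add: G_def)
    \<comment> \<open>A quotient of two conditional densities of coordinate i: given the coordinates
      outside \<open>xs @ [i]\<close>, over given all other coordinates.\<close>
    define u where "u y = enn2real (?G y) * Mf i y / (enn2real (?G' y) * f y)" for y
    have [measurable]: "u \<in> borel_measurable borel" unfolding u_def[abs_def] by simp
    have u0: "0 \<le> u y" for y using f[of y] by (auto simp: u_def Mf)
    note a1 = fin[OF G G0 G1, of xs] and a2 = fin[OF G G0 G1, of "xs @ [i]"]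
    have a3: "AE y in ?T. 0 < enn2real (avg i \<phi> y) \<and> ennreal (enn2real (avg i \<phi> y)) = avg i \<phi> y"
      by (intro fin avg_pos Mi \<phi>0) measurable
    have "(\<integral>\<^sup>+y. ennreal (f y * u y) \<partial>?T) = (\<integral>\<^sup>+y. ?G y * (avg i \<phi> y / ?G' y) \<partial>?T)"
    proof (rule nn_integral_cong_AE)
      show "AE y in ?T. ennreal (f y * u y) = ?G y * (avg i \<phi> y / ?G' y)" using a1 a2 a3
      proof (simp, eventually_elim)
        case (elim y)
        then obtain g g' h where e: "?G y = ennreal g" "?G' y = ennreal g'" "avg i \<phi> y = ennreal h" "0 < g" "0 < g'" "0 < h"
          by force
        have "f y * u y = g * (h / g')" using e f[of y] by (simp add: u_def Mf)
        then have "ennreal (f y * u y) = ennreal g * ennreal (h / g')" using e by (simp only: ennreal_mult')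
        then show ?case using e by (simp add: divide_ennreal)
      qed
    qed
    also have "... = (\<integral>\<^sup>+y. avg i (\<lambda>y. ?G y * (avg i \<phi> y / ?G' y)) y \<partial>?T)"
      by (rule nn_integral_avg[symmetric]) measurable
    also have "... = (\<integral>\<^sup>+y. ?G' y * (avg i \<phi> y / ?G' y) \<partial>?T)"
    proof (rule nn_integral_cong)
      show "avg i (\<lambda>y. ?G y * (avg i \<phi> y / ?G' y)) y = ?G' y * (avg i \<phi> y / ?G' y)" for y
        unfolding G' by (rule avg_mult) (simp_all add: avg_def)
    qed
    also have "... \<le> (\<integral>\<^sup>+y. avg i \<phi> y \<partial>?T)" by (intro nn_integral_mono ennreal_mult_divide_le)
    finally have ui: "(\<integral>\<^sup>+y. ennreal (f y * u y) \<partial>?T) \<le> 1" by (simp add: Mi)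
    show ?case
    proof (intro exI[of _ "\<lambda>y. R y + u y"] conjI allI)
      show "(\<lambda>y. R y + u y) \<in> borel_measurable borel" by simp
      show "0 \<le> R y + u y" for y using R0[of y] u0[of y] by simp
      have "(\<integral>\<^sup>+y. ennreal (f y * (R y + u y)) \<partial>?T) = (\<integral>\<^sup>+y. ennreal (f y * R y) + ennreal (f y * u y) \<partial>?T)"
        using R0 u0 f by (intro nn_integral_cong) (simp add: distrib_left ennreal_plus[symmetric] less_imp_le del: ennreal_plus)
      also have "... \<le> of_nat (length xs) + 1" by (simp add: nn_integral_add add_mono Ri ui)
      finally show "(\<integral>\<^sup>+y. ennreal (f y * (R y + u y)) \<partial>?T) \<le> of_nat (length (xs @ [i]))" by (simp add: add.commute)
      show "AE y in ?T. ln (f y) + (\<Sum>i\<leftarrow>xs @ [i]. ln (Mf i y) - ln (f y)) - ln (enn2real (?G' y)) \<le> R y + u y - real (length (xs @ [i]))"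
        using RA a1 a2 a3
      proof (simp, eventually_elim)
        case (elim y)
        then have p: "0 < enn2real (?G y)" "0 < enn2real (?G' y)" "0 < Mf i y" by (auto simp: Mf)
        then have "ln (u y) \<le> u y - 1" using f[of y] by (simp add: u_def ln_le_minus_one)
        moreover have "ln (u y) = ln (enn2real (?G y)) + ln (Mf i y) - ln (enn2real (?G' y)) - ln (f y)"
          using p f[of y] by (simp add: u_def ln_div ln_mult)
        ultimately show ?case using elim by simp
      qed
    qed
  qed
  obtain xs :: "'n list" where xs: "set xs = UNIV" "distinct xs" using finite_distinct_list[of "UNIV :: 'n set"] by auto
  obtain R where R[measurable]: "R \<in> borel_measurable borel" and R0: "\<And>y. 0 \<le> R y"
    and Ri: "(\<integral>\<^sup>+y. ennreal (f y * R y) \<partial>?T) \<le> of_nat (length xs)"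
    and RA: "AE y in ?T. ln (f y) + (\<Sum>i\<leftarrow>xs. ln (Mf i y) - ln (f y)) - ln (enn2real (G xs y)) \<le> R y - real (length xs)"
    using step[of xs] by auto
  have Gx: "G xs y = 1" for y using avg_fold_UNIV[of \<phi> xs y] xs f1 by (simp add: G_def \<phi>_def)
  have fR: "integrable ?T (\<lambda>y. f y * R y)"
    using Ri R0 f by (intro integrableI_nonneg) (auto simp: less_imp_le le_less_trans[OF _ of_nat_less_top])
  have "ennreal (\<integral>y. f y * R y \<partial>?T) \<le> of_nat (length xs)"
    using Ri R0 f by (subst nn_integral_eq_integral[OF fR, symmetric]) (auto simp: less_imp_le)
  then have fRle: "(\<integral>y. f y * R y \<partial>?T) \<le> real (length xs)" by simp
  have fi: "integrable ?T f" "(\<integral>y. f y \<partial>?T) = 1"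
    using f1 f by (auto intro!: integrableI_nonneg simp: less_imp_le integral_eq_nn_integral)
  have "(\<integral>y. f y * ln (f y) + (\<Sum>i\<in>UNIV. f y * ln (Mf i y) - f y * ln (f y)) \<partial>?T) \<le> (\<integral>y. f y * R y - real (length xs) * f y \<partial>?T)"
  proof (rule integral_mono_AE)
    show "integrable ?T (\<lambda>y. f y * ln (f y) + (\<Sum>i\<in>UNIV. f y * ln (Mf i y) - f y * ln (f y)))"
      using i by simp
    show "integrable ?T (\<lambda>y. f y * R y - real (length xs) * f y)" using fR fi by simp
    show "AE y in ?T. f y * ln (f y) + (\<Sum>i\<in>UNIV. f y * ln (Mf i y) - f y * ln (f y)) \<le> f y * R y - real (length xs) * f y"
      using RA
    proof eventually_elim
      case (elim y)
      have s: "(\<Sum>i\<leftarrow>xs. ln (Mf i y) - ln (f y)) = (\<Sum>i\<in>UNIV. ln (Mf i y) - ln (f y))"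
        by (simp add: sum_list_distinct_conv_sum_set[OF xs(2)] xs(1))
      have "f y * (ln (f y) + (\<Sum>i\<in>UNIV. ln (Mf i y) - ln (f y))) \<le> f y * (R y - real (length xs))"
        using elim f[of y] by (intro mult_left_mono) (auto simp: Gx s)
      then show ?case by (simp add: distrib_left right_diff_distrib sum_distrib_left mult.commute)
    qed
  qed
  also have "... \<le> 0" using fR fi fRle by simp
  finally show ?thesis using i by (simp add: sum_subtractf)
qed

end

section \<open>The log-Sobolev inequality on slices\<close>

lemma subst_at_axis: "subst_at y i z = y + axis i (z - y $ i)" for y :: "'a::real_vector ^ 'n"
  by (simp add: vec_eq_iff axis_def)

lemma GDERIV_subst_at:
  fixes p :: "'a::euclidean_space ^ 'n \<Rightarrow> real"
  assumes "\<And>x. GDERIV p x :> D x"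
  shows "GDERIV (\<lambda>z. p (subst_at y i z)) z :> D (subst_at y i z) $ i"
proof -
  have l: "bounded_linear (axis i :: 'a \<Rightarrow> 'a ^ 'n)"
    by (auto intro!: linear_conv_bounded_linear[THEN iffD1] linearI simp: vec_eq_iff axis_def)
  have "((\<lambda>z. y + axis i (z - y $ i)) has_derivative (\<lambda>h. axis i h)) (at z)"
    by (auto intro!: derivative_eq_intros bounded_linear.has_derivative[OF l])
  from has_derivative_compose[OF this assms[unfolded gderiv_def]]
  show ?thesis unfolding gderiv_def subst_at_axis[symmetric] by (simp add: inner_axis')
qed

lemma continuous_subst_at: "continuous_on A (\<lambda>z. subst_at y i z)" for y :: "'a::euclidean_space ^ 'n"
  unfolding subst_at_def
proof (rule continuous_on_vec_lambda)
  show "continuous_on A (\<lambda>z. if j = i then z else y $ j)" for j by (cases "j = i") auto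
qed

locale gibbs_base = product_base m for m :: "'a::euclidean_space measure" +
  fixes w :: "'a \<Rightarrow> real" and Cw :: real
  assumes w: "dens2 w" and m_w: "m = edensity lborel w"
    and w_pos: "\<And>x. w x > 0" and ln_w: "\<And>x. \<bar>ln (w x)\<bar> \<le> Cw * (1 + (norm x)^2)"
begin

lemmas w_measurable [measurable] = dens2D(1)[OF w]

definition Wn :: "'a ^ 'n \<Rightarrow> real" where
  "Wn y = (\<Prod>i\<in>UNIV. w (y $ i))"

lemma Wn_pos: "Wn y > 0" unfolding Wn_def by (intro prod_pos w_pos)

lemma Wn_nonzero [simp]: "Wn y \<noteq> 0" "0 \<le> Wn y" using Wn_pos[of y] by auto

lemma Wn_measurable [measurable]: "Wn \<in> borel_measurable borel" unfolding Wn_def[abs_def] by simp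

lemma tensor_power_Wn: "tensor_power m = edensity lborel Wn" unfolding m_w Wn_def
  by (rule tensor_power_density) (use w_pos prob_space_axioms in \<open>auto simp: m_w less_imp_le\<close>)

lemma ln_Wn: "ln (Wn y) = (\<Sum>i\<in>UNIV. ln (w (y $ i)))"
  unfolding Wn_def by (rule ln_prod) (simp_all add: w_pos[THEN less_imp_neq, symmetric])

lemma integral_m:
  fixes \<phi> :: "'a \<Rightarrow> real"
  assumes [measurable]: "\<phi> \<in> borel_measurable borel"
  shows "integrable m \<phi> \<longleftrightarrow> integrable lborel (\<lambda>x. w x * \<phi> x)" "(\<integral>x. \<phi> x \<partial>m) = (LBINT x. w x * \<phi> x)"
  unfolding m_w using integrable_dens2_iff[OF w assms] integral_dens2[OF w assms] by auto

lemma integral_rel_density: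
  fixes g p :: "'a ^ 'n \<Rightarrow> real"
  assumes [measurable]: "p \<in> borel_measurable borel" "g \<in> borel_measurable borel"
  shows "integrable (tensor_power m) (\<lambda>y. p y / Wn y * g y) \<longleftrightarrow> integrable lborel (\<lambda>y. p y * g y)"
    "(\<integral>y. p y / Wn y * g y \<partial>tensor_power m) = (LBINT y. p y * g y)"
  by (auto simp: integrable_density integral_density tensor_power_Wn)

lemma tensor_power_density_eq:
  fixes p :: "'a ^ 'n \<Rightarrow> real"
  assumes [measurable]: "p \<in> borel_measurable borel" and p: "\<And>y. 0 \<le> p y"
  shows "edensity (tensor_power m) (\<lambda>y. p y / Wn y) = edensity lborel p"
  by (simp add: ennreal_mult'[symmetric] density_density_eq tensor_power_Wn)

lemma ln_Wn_growth: "\<bar>ln (Wn y)\<bar> \<le> Cw * (real CARD('n) + 1) * (1 + (norm y)^2)" for y :: "'a ^ 'n"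
proof -
  have Cw: "0 \<le> Cw" using ln_w[of 0] by auto
  have "\<bar>ln (Wn y)\<bar> \<le> (\<Sum>i\<in>UNIV. Cw * (1 + (norm (y $ i))^2))"
    unfolding ln_Wn by (intro order_trans[OF sum_abs] sum_mono ln_w)
  also have "... = Cw * (real CARD('n) + (norm y)^2)"
    by (simp add: norm_vec_square sum_distrib_left sum.distrib distrib_left)
  also have "... \<le> Cw * ((real CARD('n) + 1) * (1 + (norm y)^2))"
    using Cw by (intro mult_left_mono) (simp_all add: algebra_simps)
  finally show ?thesis by simp
qed

context
  fixes p :: "'a ^ 'n \<Rightarrow> real" and D :: "'a ^ 'n \<Rightarrow> 'a ^ 'n"
  assumes p: "regdens p D"
begin

definition f :: "'a ^ 'n \<Rightarrow> real" where
  "f y = p y / Wn y"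

definition Mf :: "'n \<Rightarrow> 'a ^ 'n \<Rightarrow> real" where
  "Mf i y = enn2real (avg i (\<lambda>y. ennreal (f y)) y)"

lemma regdens_facts:
  shows p2: "dens2 p" and p_pos: "\<And>y. p y > 0" and p_GDERIV: "\<And>y. GDERIV p y :> D y" and D_continuous: "continuous_on UNIV D"
    and fisher_int: "integrable lborel (\<lambda>y. (norm (D y))^2 / p y)" and p_meas: "p \<in> borel_measurable borel"
    and D_meas: "D \<in> borel_measurable borel" and f_meas: "f \<in> borel_measurable borel" and f_pos: "\<And>y. f y > 0"
proof -
  show p2: "dens2 p" and pp: "\<And>y. p y > 0" and "\<And>y. GDERIV p y :> D y" and Dc: "continuous_on UNIV D"
    and "integrable lborel (\<lambda>y. (norm (D y))^2 / p y)" using p by (auto simp: regdens_def)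
  show [measurable]: "p \<in> borel_measurable borel" by (rule dens2D(1)[OF p2])
  show "D \<in> borel_measurable borel" by (rule borel_measurable_continuous_onI[OF Dc])
  show "f \<in> borel_measurable borel" unfolding f_def[abs_def] by simp
  show "f y > 0" for y using pp by (simp add: f_def Wn_pos)
qed

lemma Mf_measurable: "Mf i \<in> borel_measurable borel" unfolding Mf_def[abs_def] using f_meas by simp

lemma f_integral:
  assumes "g \<in> borel_measurable borel"
  shows "integrable (tensor_power m) (\<lambda>y. f y * g y) \<longleftrightarrow> integrable lborel (\<lambda>y. p y * g y)"
    "(\<integral>y. f y * g y \<partial>tensor_power m) = (LBINT y. p y * g y)"
  using integral_rel_density[OF p_meas assms] by (simp_all add: f_def)

lemma f_growth:
  assumes "g \<in> borel_measurable borel" "\<And>y. \<bar>g y\<bar> \<le> C * (1 + (norm y)^2)"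
  shows "integrable (tensor_power m) (\<lambda>y. f y * g y)"
  using f_integral(1)[OF assms(1)] dens2_growth[OF p2 assms] by simp

lemma f_one: "integrable (tensor_power m) f" "(\<integral>y. f y \<partial>tensor_power m) = 1" "(\<integral>\<^sup>+y. ennreal (f y) \<partial>tensor_power m) = 1"
  using f_integral[of "\<lambda>_. 1"] integral_dens2_one[OF p2] f_pos by (auto simp: less_imp_le nn_integral_eq_integral)

lemma f_ln_f: "integrable (tensor_power m) (\<lambda>y. f y * ln (f y))"
  "(\<integral>y. f y * ln (f y) \<partial>tensor_power m) = (LBINT y. p y * ln (p y)) - (LBINT y. p y * ln (Wn y))"
proof -
  note [measurable] = p_meas f_meas
  have e: "p y * ln (f y) = p y * ln (p y) - p y * ln (Wn y)" for y by (simp add: f_def ln_div right_diff_distrib)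
  have i: "integrable lborel (\<lambda>y. p y * ln (Wn y))" by (rule dens2_growth[OF p2 _ ln_Wn_growth]) measurable
  show "integrable (tensor_power m) (\<lambda>y. f y * ln (f y))" "(\<integral>y. f y * ln (f y) \<partial>tensor_power m) = (LBINT y. p y * ln (p y)) - (LBINT y. p y * ln (Wn y))"
    using i dens2D(5)[OF p2] by (simp_all add: f_integral e)
qed

text \<open>With the other coordinates fixed, \<open>log_sobolev_free\<close> is applied to the
  normalised slice of p in coordinate i, with reference potential \<open>h y\<close>; by
  \<open>inv\<close> it does not change along the slice, so each slice has one reference measure. T
  and R are integrable substitutes for \<open>ln w + h\<close> and for the Fisher integrand.
  Integration over y by \<open>integral_resample\<close> returns global integrals.\<close>

lemma slice_inequality:
  fixes h :: "'a ^ 'n \<Rightarrow> 'a \<Rightarrow> real" and Dh :: "'a ^ 'n \<Rightarrow> 'a \<Rightarrow> 'a" and T R :: "'a ^ 'n \<Rightarrow> real"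
  assumes h: "\<And>y. potential (h y) (Dh y) L" and lsi: "\<And>y. log_sobolev \<rho> (edensity lborel (\<lambda>x. exp (- h y x)))"
    and inv: "\<And>y z. h (subst_at y i z) = h y" "\<And>y z. Dh (subst_at y i z) = Dh y" and \<rho>: "0 \<le> \<rho>"
    and T: "\<And>y. T y \<le> ln (w (y $ i)) + h y (y $ i)" "integrable (tensor_power m) (\<lambda>y. f y * T y)"
    and R: "\<And>y. (norm ((1 / p y) *\<^sub>R D y $ i + Dh y (y $ i)))^2 \<le> R y" "integrable (tensor_power m) (\<lambda>y. f y * R y)"
  shows "integrable (tensor_power m) (\<lambda>y. f y * ln (Mf i y))"
    "4 * \<rho> * ((\<integral>y. f y * ln (f y) \<partial>tensor_power m) + (\<integral>y. f y * T y \<partial>tensor_power m) - (\<integral>y. f y * ln (Mf i y) \<partial>tensor_power m))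
      \<le> (\<integral>y. f y * R y \<partial>tensor_power m)"
proof -
  let ?B = "\<lambda>g. \<integral>z. g z * ln (g z) \<partial>m"
  let ?C = "\<lambda>y. norm ((1 / p y) *\<^sub>R D y $ i)"
  let ?A = "\<lambda>y. ennreal (f y)"
  let ?T = "tensor_power m :: ('a ^ 'n) measure"
  interpret T: prob_space ?T by (rule prob_space_tensor_power)
  note [measurable] = p_meas D_meas f_meas Mf_measurable
  have i2: "integrable ?T (\<lambda>y. f y * (norm (y $ i))^2)"
  proof (rule f_growth[where C=1])
    show "\<bar>(norm (y $ i))^2\<bar> \<le> 1 * (1 + (norm y)^2)" for y :: "'a ^ 'n"
    proof -
      have "(norm (y $ i))^2 \<le> (norm y)^2" by (intro power_mono Finite_Cartesian_Product.norm_nth_le) auto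
      then have "(norm (y $ i))^2 \<le> 1 + (norm y)^2" by arith
      then show ?thesis by simp
    qed
  qed measurable
  have i4: "integrable ?T (\<lambda>y. f y * (?C y)^2)"
  proof (subst f_integral(1), measurable)
    show "integrable lborel (\<lambda>y. p y * (?C y)^2)"
    proof (rule integrable_of_le[OF fisher_int])
      show "norm (p y * (?C y)^2) \<le> (norm (D y))^2 / p y" for y
      proof -
        have "p y * (?C y)^2 = (norm (D y $ i))^2 / p y" by (simp add: power2_eq_square)
        also have "... \<le> (norm (D y))^2 / p y"
          using p_pos[of y] by (intro divide_right_mono power_mono Finite_Cartesian_Product.norm_nth_le) auto
        finally show ?thesis using p_pos[of y] by simp
      qed
    qed measurable
  qed
  let ?s = "\<lambda>y z. subst_at y i z"
  have Mfs: "Mf i (?s y z) = Mf i y" for y z by (simp add: Mf_def avg_def)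
  have AE_Mf: "AE y in ?T. integrable m (\<lambda>z. f (?s y z)) \<and> Mf i y = (\<integral>z. f (?s y z) \<partial>m) \<and> 0 < Mf i y
      \<and> avg i ?A y = ennreal (Mf i y)" using integral_resample(1)[OF f_one(1), of i]
  proof eventually_elim
    case (elim y)
    have a: "avg i ?A y = ennreal (\<integral>z. f (?s y z) \<partial>m)"
      unfolding avg_def using elim f_pos by (intro nn_integral_eq_integral) (auto simp: less_imp_le)
    have "0 < avg i ?A y" by (rule avg_pos) (use f_pos in auto)
    then have "0 < (\<integral>z. f (?s y z) \<partial>m)" unfolding a by simp
    then show ?case using elim a by (simp add: Mf_def)
  qed
  have slice: "AE y in ?T. 4 * \<rho> * ((\<integral>z. f (?s y z) * ln (f (?s y z)) \<partial>m) + (\<integral>z. f (?s y z) * T (?s y z) \<partial>m) - Mf i y * ln (Mf i y))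
      \<le> (\<integral>z. f (?s y z) * R (?s y z) \<partial>m) \<and> \<bar>Mf i y * ln (Mf i y)\<bar> \<le> \<bar>\<integral>z. f (?s y z) * ln (f (?s y z)) \<partial>m\<bar> + 1"
    using AE_Mf integral_resample(1)[OF i2, of i] integral_resample(1)[OF f_ln_f(1), of i] integral_resample(1)[OF i4, of i]
      integral_resample(1)[OF T(2), of i] integral_resample(1)[OF R(2), of i]
  proof eventually_elim
    case (elim y)
    \<comment> \<open>P is the mass of the slice g relative to m. It normalises the slice to the
      probability density q below; multiplying by P afterwards returns integrals against f.\<close>
    define P where "P = Mf i y"
    define g where "g z = f (?s y z)" for z
    have P: "P > 0" and P_g: "P = (\<integral>z. g z \<partial>m)" using elim by (auto simp: P_def g_def)
    have g0: "g z > 0" for z using f_pos by (simp add: g_def)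
    have [measurable]: "g \<in> borel_measurable borel" unfolding g_def[abs_def] by simp
    have gi: "integrable m g" "integrable m (\<lambda>z. g z * (norm z)^2)" "integrable m (\<lambda>z. g z * ln (g z))"
      "integrable m (\<lambda>z. g z * (norm ((1 / p (?s y z)) *\<^sub>R D (?s y z) $ i))^2)"
      "integrable m (\<lambda>z. g z * T (?s y z))" "integrable m (\<lambda>z. g z * R (?s y z))"
      using elim unfolding g_def[abs_def] by auto
    have grow: "integrable m (\<lambda>z. g z * \<psi> z)" if [measurable]: "\<psi> \<in> borel_measurable borel" and b: "\<And>z. \<bar>\<psi> z\<bar> \<le> C * (1 + (norm z)^2)" for \<psi> C
      by (rule integrable_growth[OF gi(1,2) less_imp_le[OF g0] _ b]) measurable
    define r where "r = (\<Prod>j\<in>UNIV - {i}. w (y $ j))"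
    have r: "r > 0" unfolding r_def by (intro prod_pos w_pos)
    have Ws: "Wn (?s y z) = w z * r" for z unfolding Wn_def r_def by (subst prod.remove[of UNIV i]) auto
    have gp: "p (?s y z) = w z * g z * r" for z using Ws[of z] w_pos[of z] r by (simp add: g_def f_def)
    define q where "q z = w z * g z / P" for z
    define Dq where "Dq z = (1 / (r * P)) *\<^sub>R D (?s y z) $ i" for z
    have q_p: "q = (\<lambda>z. p (?s y z) * (1 / (r * P)))" using r by (auto simp: q_def gp)
    have q0: "q z > 0" for z using g0[of z] w_pos[of z] P by (simp add: q_def)
    have qint: "integrable lborel (\<lambda>z. q z * \<psi> z) \<longleftrightarrow> integrable m (\<lambda>z. g z * \<psi> z)" "(LBINT z. q z * \<psi> z) = (\<integral>z. g z * \<psi> z \<partial>m) / P"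
      if [measurable]: "\<psi> \<in> borel_measurable borel" for \<psi>
    proof -
      have e: "q z * \<psi> z = inverse P * (w z * (g z * \<psi> z))" for z by (simp add: q_def field_simps)
      show "integrable lborel (\<lambda>z. q z * \<psi> z) \<longleftrightarrow> integrable m (\<lambda>z. g z * \<psi> z)" unfolding e integrable_mult_right_iff using P by (subst integral_m(1)) auto
      show "(LBINT z. q z * \<psi> z) = (\<integral>z. g z * \<psi> z \<partial>m) / P" unfolding e by (subst integral_m(2)) (auto simp: field_simps)
    qed
    have lnq: "ln (q z) = ln (g z) + ln (w z) - ln P" for z using g0[of z] w_pos[of z] P by (simp add: q_def ln_div ln_mult)
    have [measurable]: "q \<in> borel_measurable borel" unfolding q_def[abs_def] by simp
    have gw: "integrable m (\<lambda>z. g z * ln (w z))" by (rule grow[OF _ ln_w]) measurable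
    have i_lnq: "integrable m (\<lambda>z. g z * ln (q z))" unfolding lnq using gi gw by (simp add: distrib_left right_diff_distrib)
    have Dq_q: "(1 / q z) *\<^sub>R Dq z = (1 / p (?s y z)) *\<^sub>R D (?s y z) $ i" for z
      using r P by (simp add: q_p Dq_def)
    have reg: "regdens q Dq" unfolding regdens_def dens2_def
    proof (intro conjI allI)
      show "(\<integral>\<^sup>+z. ennreal (q z) \<partial>lborel) = 1"
        using qint[of "\<lambda>_. 1"] gi(1) P P_g q0 by (subst nn_integral_eq_integral) (auto simp: less_imp_le)
      show "integrable lborel (\<lambda>z. q z * (norm z)^2)" "integrable lborel (\<lambda>z. q z * ln (q z))"
        using gi i_lnq by (simp_all add: qint)
      show "GDERIV q z :> Dq z" for z unfolding q_p Dq_def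
        using GDERIV_mult[OF GDERIV_subst_at[OF p_GDERIV] GDERIV_const[of "1 / (r * P)"], of y i z] by simp
      show "continuous_on UNIV Dq" unfolding Dq_def[abs_def]
        by (intro continuous_intros continuous_on_compose2[OF D_continuous continuous_subst_at]) auto
      have "(norm (Dq z))^2 / q z = q z * (norm ((1 / p (?s y z)) *\<^sub>R D (?s y z) $ i))^2" for z
        by (simp add: Dq_q[symmetric] power2_eq_square)
      then show "integrable lborel (\<lambda>z. (norm (Dq z))^2 / q z)" using gi(4) by (simp add: qint)
    qed (use q0 in \<open>auto simp: less_imp_le\<close>)
    interpret pot: potential "h y" "Dh y" L by (rule h)
    have hi: "integrable m (\<lambda>z. g z * h y z)" by (rule grow[OF pot.U_measurable pot.U_growth])
    have ineq: "4 * \<rho> * pot.free q \<le> pot.fisher q Dq" by (rule pot.log_sobolev_free[OF lsi reg])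
    have P_lnP: "(\<integral>z. g z * ln P \<partial>m) = P * ln P" using P_g by simp
    have "pot.free q = (\<integral>z. g z * ln (q z) \<partial>m) / P + (\<integral>z. g z * h y z \<partial>m) / P"
      unfolding pot.free_def by (simp add: qint)
    also have "(\<integral>z. g z * ln (q z) \<partial>m) = (?B g) + (\<integral>z. g z * ln (w z) \<partial>m) - P * ln P"
      unfolding lnq P_lnP[symmetric] using gi gw by (simp add: distrib_left right_diff_distrib)
    finally have free: "P * pot.free q = (?B g) + ((\<integral>z. g z * ln (w z) \<partial>m) + (\<integral>z. g z * h y z \<partial>m)) - P * ln P"
      using P by (simp add: field_simps)
    have "(\<integral>z. g z * T (?s y z) \<partial>m) \<le> (\<integral>z. g z * ln (w z) + g z * h y z \<partial>m)"
    proof (rule integral_mono)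
      show "g z * T (?s y z) \<le> g z * ln (w z) + g z * h y z" for z
        using mult_left_mono[OF T(1)[of "?s y z"], of "g z"] g0[of z] by (simp add: inv distrib_left)
    qed (use gi gw hi in auto)
    then have Tle: "(\<integral>z. g z * T (?s y z) \<partial>m) \<le> (\<integral>z. g z * ln (w z) \<partial>m) + (\<integral>z. g z * h y z \<partial>m)" using gw hi by simp
    have Dhm[measurable]: "Dh y \<in> borel_measurable borel" by simp
    have "P * pot.fisher q Dq = (\<integral>z. g z * (norm ((1 / p (?s y z)) *\<^sub>R D (?s y z) $ i + Dh y z))^2 \<partial>m)"
      unfolding pot.fisher_def Dq_q using P by (simp add: qint)
    also have "... \<le> (\<integral>z. g z * R (?s y z) \<partial>m)"
    proof (rule integral_mono_AE')
      have R0: "0 \<le> R y" for y using R(1)[of y] zero_le_power2 order_trans by blast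
      show "AE z in m. g z * (norm ((1 / p (?s y z)) *\<^sub>R D (?s y z) $ i + Dh y z))^2 \<le> g z * R (?s y z)"
        using R(1)[of "?s y _"] g0 by (intro AE_I2) (auto simp: inv)
      show "AE z in m. 0 \<le> g z * R (?s y z)" using g0 R0 by (simp add: less_imp_le)
    qed (rule gi)
    finally have fish: "P * pot.fisher q Dq \<le> (\<integral>z. g z * R (?s y z) \<partial>m)" .
    have "4 * \<rho> * ((?B g) + (\<integral>z. g z * T (?s y z) \<partial>m) - P * ln P) \<le> 4 * \<rho> * (P * pot.free q)"
      unfolding free using Tle \<rho> by (intro mult_left_mono) auto
    also have "... \<le> P * pot.fisher q Dq" using ineq P by simp
    finally have A: "4 * \<rho> * ((?B g) + (\<integral>z. g z * T (?s y z) \<partial>m) - P * ln P) \<le> (\<integral>z. g z * R (?s y z) \<partial>m)"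
      using fish by simp
    \<comment> \<open>The tangent inequality gives Jensen's bound by the slice entropy from above,
      and at height 1 the bound -1 from below. Together they make
      \<open>Mf i y * ln (Mf i y)\<close> integrable over y.\<close>
    have "P * ln P = (\<integral>z. g z * ln P + g z - P \<partial>m)" using gi(1) P_g prob_space by simp
    also have "... \<le> (?B g)" using gi(1,3) g0 P by (intro integral_mono mult_ln_ge) (auto simp: less_imp_le)
    finally have "P * ln P \<le> (?B g)" .
    moreover have "- 1 \<le> P * ln P" using mult_ln_ge[of P 1] P by simp
    ultimately have "\<bar>P * ln P\<bar> \<le> \<bar>\<integral>z. g z * ln (g z) \<partial>m\<bar> + 1" by simp
    then show ?case using A unfolding g_def P_def by simp
  qed
  have PP: "integrable ?T (\<lambda>y. Mf i y * ln (Mf i y))"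
  proof (rule Bochner_Integration.integrable_bound[where f="\<lambda>y. \<bar>\<integral>z. f (?s y z) * ln (f (?s y z)) \<partial>m\<bar> + 1"])
    show "integrable ?T (\<lambda>y. \<bar>\<integral>z. f (?s y z) * ln (f (?s y z)) \<partial>m\<bar> + 1)" using integral_resample(2)[OF f_ln_f(1), of i] by simp
    show "AE y in ?T. norm (Mf i y * ln (Mf i y)) \<le> norm (\<bar>\<integral>z. f (?s y z) * ln (f (?s y z)) \<partial>m\<bar> + 1)"
      using slice by simp
  qed measurable
  show fM: "integrable ?T (\<lambda>y. f y * ln (Mf i y))"
  proof (rule integrableI_bounded)
    have "(\<integral>\<^sup>+y. ennreal (norm (f y * ln (Mf i y))) \<partial>?T) = (\<integral>\<^sup>+y. avg i (\<lambda>y. ennreal (f y) * ennreal \<bar>ln (Mf i y)\<bar>) y \<partial>?T)"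
      using f_pos by (subst nn_integral_avg) (auto simp: abs_mult ennreal_mult less_imp_le)
    also have "... = (\<integral>\<^sup>+y. avg i ?A y * ennreal \<bar>ln (Mf i y)\<bar> \<partial>?T)"
      by (intro nn_integral_cong avg_mult) (auto simp: Mfs)
    also have "... = (\<integral>\<^sup>+y. ennreal (norm (Mf i y * ln (Mf i y))) \<partial>?T)"
    proof (rule nn_integral_cong_AE)
      show "AE y in ?T. avg i ?A y * ennreal \<bar>ln (Mf i y)\<bar> = ennreal (norm (Mf i y * ln (Mf i y)))"
        using AE_Mf by eventually_elim (auto simp: abs_mult ennreal_mult)
    qed
    also have "... < \<infinity>" using PP by (simp add: integrable_iff_bounded)
    finally show "(\<integral>\<^sup>+y. ennreal (norm (f y * ln (Mf i y))) \<partial>?T) < \<infinity>" .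
  qed measurable
  have "(\<integral>y. f y * ln (Mf i y) \<partial>?T) = (\<integral>y. (\<integral>z. f (?s y z) * ln (Mf i (?s y z)) \<partial>m) \<partial>?T)"
    by (rule integral_resample(3)[OF fM, symmetric])
  also have "... = (\<integral>y. Mf i y * ln (Mf i y) \<partial>?T)"
  proof (rule integral_cong_AE)
    show "AE y in ?T. (\<integral>z. f (?s y z) * ln (Mf i (?s y z)) \<partial>m) = Mf i y * ln (Mf i y)"
      using AE_Mf by eventually_elim (simp add: Mfs)
    show "(\<lambda>y. \<integral>z. f (?s y z) * ln (Mf i (?s y z)) \<partial>m) \<in> borel_measurable ?T" by simp
  qed measurable
  finally have fMP: "(\<integral>y. f y * ln (Mf i y) \<partial>?T) = (\<integral>y. Mf i y * ln (Mf i y) \<partial>?T)" .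
  note r1 = integral_resample[OF f_ln_f(1), of i] and r2 = integral_resample[OF T(2), of i] and r3 = integral_resample[OF R(2), of i]
  have "(\<integral>y. 4 * \<rho> * ((\<integral>z. f (?s y z) * ln (f (?s y z)) \<partial>m) + (\<integral>z. f (?s y z) * T (?s y z) \<partial>m) - Mf i y * ln (Mf i y)) \<partial>?T)
      \<le> (\<integral>y. (\<integral>z. f (?s y z) * R (?s y z) \<partial>m) \<partial>?T)"
    using slice by (intro integral_mono_AE integrable_mult_right Bochner_Integration.integrable_diff Bochner_Integration.integrable_add r1 r2 r3 PP) auto
  then show "4 * \<rho> * ((\<integral>y. f y * ln (f y) \<partial>?T) + (\<integral>y. f y * T y \<partial>?T) - (\<integral>y. f y * ln (Mf i y) \<partial>?T)) \<le> (\<integral>y. f y * R y \<partial>?T)"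
    using r1(2) r2(2) PP unfolding fMP by (simp add: r1(3) r2(3) r3(3))
qed

end

end

section \<open>The functional inequality for the particle system\<close>

text \<open>The reciprocals of the two weights add up to 1, and the defect is a perfect square. The
  first weight is what lowers the rate from \<open>4 * \<rho>\<close> to
  \<open>4 * \<rho>'\<close>.\<close>

lemma norm_add_square_weighted:
  fixes a d :: "'a::real_normed_vector"
  assumes "0 < r'" "r' < r"
  shows "(norm (a + d))^2 \<le> r / r' * (norm a)^2 + r / (r - r') * (norm d)^2"
proof -
  let ?a = "norm a" and ?d = "norm d"
  have "(norm (a + d))^2 \<le> (?a + ?d)^2" by (intro power_mono norm_triangle_ineq) auto
  also have "... \<le> r / r' * ?a^2 + r / (r - r') * ?d^2"
  proof -
    have "r / r' * ?a^2 + r / (r - r') * ?d^2 - (?a + ?d)^2 = ((r - r') * ?a - r' * ?d)^2 / (r' * (r - r'))"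
      using assms by (simp add: divide_simps power2_eq_square) (simp add: algebra_simps)
    moreover have "0 \<le> ((r - r') * ?a - r' * ?d)^2 / (r' * (r - r'))" using assms by simp
    ultimately show ?thesis by simp
  qed
  finally show ?thesis .
qed

lemma (in product_base) nn_integral_tensor_power_prod:
  assumes [measurable]: "g \<in> borel_measurable borel"
  shows "(\<integral>\<^sup>+y. (\<Prod>i\<in>UNIV. g (y $ i)) \<partial>(tensor_power m :: ('a ^ 'n) measure)) = (\<integral>\<^sup>+x. g x \<partial>m) ^ CARD('n)"
proof -
  interpret P: product_prob_space "\<lambda>_. m" "UNIV :: 'n set" ..
  have "(\<integral>\<^sup>+y. (\<Prod>i\<in>UNIV. g (y $ i)) \<partial>(tensor_power m :: ('a ^ 'n) measure)) = (\<integral>\<^sup>+x. (\<Prod>i\<in>(UNIV :: 'n set). g (x i)) \<partial>(\<Pi>\<^sub>M i\<in>UNIV. m))"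
    unfolding tensor_power_def by (subst nn_integral_distr[OF tensor_power_measurable]) auto
  also have "... = (\<Prod>i\<in>(UNIV :: 'n set). \<integral>\<^sup>+x. g x \<partial>m)" by (rule P.product_nn_integral_prod) auto
  finally show ?thesis by simp
qed

text \<open>G is the energy, H the relative entropy, S the mean of the summed squared distances to
  the barycenter, V the variance of \<open>m_inf\<close>, I the Fisher information, N the number of
  particles. Inserting the bounds on S and V into \<open>main\<close>, scaled by
  \<open>\<rho>' / \<rho>\<close>, gives the coefficients 12, 2, 8 and 1, which are below the stated
  16, 6, 10 and 3.\<close>

lemma entropy_inequality_arith:
  fixes K \<rho> \<rho>' N d G I S V H :: real
  assumes K: "0 \<le> K" and \<rho>: "0 < \<rho>'" "\<rho>' < \<rho>" and N: "1 \<le> N" and d: "0 \<le> d" and H: "0 \<le> H" "H \<le> G"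
    and S: "S \<le> 2 / \<rho> * (H + N * d / 2)" and V: "V \<le> d / \<rho>"
    and main: "4 * \<rho> * (G - K / N * (3 / 2 * S + N * V / 2)) \<le> \<rho> / \<rho>' * I + \<rho> / (\<rho> - \<rho>') * ((K / N)^2 * S)"
  shows "(4 * \<rho>' - K * (16 + 6 * K * \<rho>' / (\<rho> * (\<rho> - \<rho>'))) / N) * G - d * K * (10 + 3 * K * \<rho>' / (\<rho> * (\<rho> - \<rho>'))) \<le> I"
proof -
  let ?A = "\<rho> - \<rho>'"
  have r: "0 < \<rho>" "0 < \<rho> - \<rho>'" using \<rho> by auto
  define X where "X = 2 / \<rho> * (G + N * d / 2)"
  define A where "A = K * (K * \<rho>' / (\<rho> * ?A))"
  have A0: "0 \<le> A" using K \<rho> by (simp add: A_def)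
  have G0: "0 \<le> G" using H by simp
  have SX: "S \<le> X" unfolding X_def by (rule order_trans[OF S mult_left_mono]) (use H r in auto)
  have m: "\<rho>' / \<rho> * (4 * \<rho> * (G - E)) = 4 * \<rho>' * G - 4 * \<rho>' * E" "\<rho>' / \<rho> * (\<rho> / \<rho>' * I + \<rho> / ?A * E) = I + \<rho>' / ?A * E" for E
    using \<rho> by (simp_all add: field_simps)
  have "\<rho>' / \<rho> * (4 * \<rho> * (G - K / N * (3 / 2 * S + N * V / 2))) \<le> \<rho>' / \<rho> * (\<rho> / \<rho>' * I + \<rho> / ?A * ((K / N)^2 * S))"
    using main \<rho> by (intro mult_left_mono) auto
  then have 1: "4 * \<rho>' * G - 4 * \<rho>' * (K / N * (3 / 2 * S + N * V / 2)) \<le> I + \<rho>' / ?A * ((K / N)^2 * S)"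
    unfolding m .
  have "4 * \<rho>' * (K / N * (3 / 2 * S + N * V / 2)) \<le> 4 * \<rho>' * (K / N * (3 / 2 * X + N * (d / \<rho>) / 2))"
    using K \<rho> N SX V by (intro mult_left_mono add_mono divide_right_mono) auto
  also have "... = \<rho>' / \<rho> * (12 * (K * (G / N)) + 8 * (K * d))" using N r by (simp add: X_def field_simps)
  also have "... \<le> 1 * (12 * (K * (G / N)) + 8 * (K * d))" using K N G0 d r by (intro mult_right_mono) auto
  finally have 2: "4 * \<rho>' * (K / N * (3 / 2 * S + N * V / 2)) \<le> 12 * (K * (G / N)) + 8 * (K * d)" by simp
  have "\<rho>' / ?A * ((K / N)^2 * S) \<le> \<rho>' / ?A * ((K / N)^2 * X)" using \<rho> SX by (intro mult_left_mono) auto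
  also have "... = A * (2 * (G / N) + d) * (1 / N)" by (simp add: X_def A_def divide_simps power2_eq_square)
  also have "... \<le> A * (2 * (G / N) + d) * 1" using A0 G0 N d by (intro mult_left_mono) auto
  finally have 3: "\<rho>' / ?A * ((K / N)^2 * S) \<le> 2 * (A * (G / N)) + A * d" by (simp add: algebra_simps)
  have nn: "0 \<le> K * (G / N)" "0 \<le> A * (G / N)" "0 \<le> K * d" "0 \<le> A * d" using K N G0 d A0 by auto
  have e: "(4 * \<rho>' - K * (16 + 6 * K * \<rho>' / (\<rho> * ?A)) / N) * G = 4 * \<rho>' * G - 16 * (K * (G / N)) - 6 * (A * (G / N))"
    "d * K * (10 + 3 * K * \<rho>' / (\<rho> * ?A)) = 10 * (K * d) + 3 * (A * d)"
    by (simp_all add: A_def add_divide_distrib algebra_simps)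
  show ?thesis unfolding e using 1 2 3 nn by simp
qed

section \<open>The minimizer as reference measure\<close>

locale mean_field_gibbs = mean_field F dF DF K Mx
  for F :: "'a::euclidean_space measure \<Rightarrow> real" and dF :: "'a measure \<Rightarrow> 'a \<Rightarrow> real"
    and DF :: "'a measure \<Rightarrow> 'a \<Rightarrow> 'a" and K Mx :: real +
  fixes \<rho> :: real and m_inf :: "'a measure"
  assumes \<rho>: "\<rho> > 0"
    and lsi: "\<And>m. m \<in> P2 \<Longrightarrow> integrable lborel (\<lambda>x. exp (- dF m x)) \<and> log_sobolev \<rho> (hat_measure dF m)"
    and minimizer: "is_arg_min (free_energy F) (\<lambda>m. m \<in> P2) m_inf"
begin

lemma m_inf: "m_inf \<in> P2" using minimizer by (simp add: is_arg_min_def)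

definition lnZ :: "'a measure \<Rightarrow> real" where
  "lnZ m = ln (LBINT x. exp (- dF m x))"

definition w :: "'a \<Rightarrow> real" where
  "w x = exp (- dF m_inf x - lnZ m_inf)"

text \<open>A choice, because \<open>dF_growth\<close> asserts only the existence of a growth
  constant while the sublocale below needs a term for its parameter.\<close>

definition Cw :: real where
  "Cw = (SOME C. \<forall>x. \<bar>ln (w x)\<bar> \<le> C * (1 + (norm x)^2))"

lemma w_Gibbs: "dens2 w" "m_inf = edensity lborel w"
  using minimizer_gibbs[OF minimizer conjunct1[OF lsi[OF m_inf]]] unfolding w_def[abs_def] lnZ_def by auto

sublocale gibbs_base m_inf w Cw
proof (intro gibbs_base.intro product_base.intro product_base_axioms.intro gibbs_base_axioms.intro)
  obtain C where C: "\<And>x. \<bar>dF m_inf x\<bar> \<le> C * (1 + (norm x)^2)" using dF_growth[OF m_inf] by auto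
  have "\<bar>ln (w x)\<bar> \<le> (C + \<bar>lnZ m_inf\<bar>) * (1 + (norm x)^2)" for x
  proof -
    have "\<bar>lnZ m_inf\<bar> * 1 \<le> \<bar>lnZ m_inf\<bar> * (1 + (norm x)^2)" by (intro mult_left_mono) auto
    then show ?thesis using C[of x] unfolding distrib_right[of C] by (simp add: w_def)
  qed
  then have "\<forall>x. \<bar>ln (w x)\<bar> \<le> Cw * (1 + (norm x)^2)" unfolding Cw_def by (intro someI_ex[of "\<lambda>C. \<forall>x. \<bar>ln (w x)\<bar> \<le> C * (1 + (norm x)^2)"]) blast
  then show "\<bar>ln (w x)\<bar> \<le> Cw * (1 + (norm x)^2)" for x by simp
  show "0 < w x" for x by (simp add: w_def)
qed (rule P2D(1,2)[OF m_inf] w_Gibbs)+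

lemma Z_pos: "m \<in> P2 \<Longrightarrow> 0 < (LBINT x. exp (- dF m x))"
  using lborel_integral_exp_pos[of "\<lambda>x. - dF m x"] lsi[of m] by auto

lemma hat_measure_eq: "m \<in> P2 \<Longrightarrow> hat_measure dF m = edensity lborel (\<lambda>x. exp (- (dF m x + lnZ m)))"
  unfolding hat_measure_def lnZ_def using Z_pos[of m] by (simp add: exp_diff)

lemma potential_dF: "m \<in> P2 \<Longrightarrow> potential (\<lambda>x. dF m x + c) (DF m) Mx"
  by unfold_locales (use dF_quad DF_lip in auto)

lemma log_sobolev_m_inf: "log_sobolev \<rho> m_inf"
proof -
  have "hat_measure dF m_inf = m_inf" unfolding hat_measure_eq[OF m_inf] by (subst (2) w_Gibbs(2)) (simp add: w_def)
  then show ?thesis using lsi[OF m_inf] by simp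
qed

text \<open>Jensen's inequality for the ratio of the partition functions.\<close>

lemma lnZ_diff_ge:
  assumes m: "m \<in> P2"
  shows "- (\<integral>x. dF m x - dF m_inf x \<partial>m_inf) \<le> lnZ m - lnZ m_inf"
proof -
  note [measurable] = dF_measurable[OF m] dF_measurable[OF m_inf]
  define g where "g x = dF m x - dF m_inf x" for x
  have [measurable]: "g \<in> borel_measurable borel" unfolding g_def[abs_def] by simp
  have gi: "integrable m_inf g" unfolding g_def[abs_def] by (intro Bochner_Integration.integrable_diff dF_integrable m m_inf)
  define a where "a = (\<integral>x. g x \<partial>m_inf)"
  have e: "w x * exp (- g x) = exp (- dF m x) * exp (- lnZ m_inf)" for x by (simp add: w_def g_def exp_add[symmetric])
  have ei: "integrable m_inf (\<lambda>x. exp (- g x))" "(\<integral>x. exp (- g x) \<partial>m_inf) = (LBINT x. exp (- dF m x)) * exp (- lnZ m_inf)"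
    using lsi[OF m] by (auto simp: integral_m e)
  have "exp (- a) = (\<integral>x. exp (- a) * (1 + a - g x) \<partial>m_inf)" using gi prob_space by (simp add: a_def)
  also have "... \<le> (\<integral>x. exp (- g x) \<partial>m_inf)"
  proof (rule integral_mono)
    show "exp (- a) * (1 + a - g x) \<le> exp (- g x)" for x
    proof -
      have "1 + (a - g x) \<le> exp (a - g x)" by simp
      then have "exp (- a) * (1 + a - g x) \<le> exp (- a) * exp (a - g x)" by (intro mult_left_mono) (simp_all only: exp_ge_zero)
      then show ?thesis by (simp add: exp_add[symmetric])
    qed
  qed (use gi ei in auto)
  also have "... = exp (lnZ m - lnZ m_inf)"
    unfolding ei(2) using Z_pos[OF m] by (simp add: lnZ_def exp_diff exp_minus field_simps)
  finally show ?thesis by (simp add: a_def g_def)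
qed

definition ctr :: 'a where "ctr = barycenter m_inf"

definition V0 :: real where "V0 = (\<integral>x. (norm (x - ctr))^2 \<partial>m_inf)"

text \<open>The difference of the kernels at the empirical measure and at \<open>m_inf\<close>,
  centred under \<open>m_inf\<close>. Centring removes the additive constants of \<open>dF\<close>,
  which \<open>dF_diff_lip\<close> leaves free.\<close>

definition T0 :: "'n \<Rightarrow> 'a ^ 'n \<Rightarrow> real" where
  "T0 i y = (dF (empirical y) (y $ i) - dF m_inf (y $ i)) - (\<integral>x. dF (empirical y) x - dF m_inf x \<partial>m_inf)"

text \<open>\<open>\<Psi>\<close> is \<open>N\<close> times the gap in the first-order convexity inequality for \<open>F\<close> between \<open>\<mu>\<^sub>y\<close> and \<open>m_inf\<close>.\<close>

definition \<Psi> :: "'a ^ 'n \<Rightarrow> real" where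
  "\<Psi> y = UU y - real CARD('n) * F m_inf - (\<Sum>i\<in>UNIV. dF m_inf (y $ i) - (\<integral>x. dF m_inf x \<partial>m_inf))"

text \<open>N times the free energy of \<open>m_inf\<close>, see \<open>free_energy_m_inf\<close>,
  computed from the Gibbs form of its density. Subtracting it from \<open>UU\<close> normalises the
  energy to the quantity in the theorem.\<close>

definition c0 :: "'n::finite itself \<Rightarrow> real" where
  "c0 _ = real CARD('n) * (F m_inf - (\<integral>x. dF m_inf x \<partial>m_inf) - lnZ m_inf)"

text \<open>Integrated against a law, this splits its energy into the entropy relative to the power
  of \<open>m_inf\<close> and the mean of \<Psi>. As \<Psi> is nonnegative, the first inequality of
  the theorem follows.\<close>

lemma UU_decomposition: "UU y - c0 TYPE('n) = - ln (Wn y) + \<Psi> y" for y :: "'a ^ 'n"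
  unfolding ln_Wn \<Psi>_def c0_def w_def by (simp add: sum_subtractf sum_negf algebra_simps)

lemma \<Psi>_nonneg: "0 \<le> \<Psi> y" for y :: "'a ^ 'n"
proof -
  have "real CARD('n) * ((\<integral>z. dF m_inf z \<partial>empirical y) - (\<integral>z. dF m_inf z \<partial>m_inf)) \<le> real CARD('n) * (F (empirical y) - F m_inf)"
    by (intro mult_left_mono F_first_order empirical_P2 m_inf) auto
  then show ?thesis
    using integral_empirical(1)[OF dF_measurable[OF m_inf], of y] by (simp add: \<Psi>_def UU_def sum_subtractf algebra_simps)
qed

text \<open>The tangent inequality at \<open>empirical y\<close> instead of at \<open>m_inf\<close>.
  It replaces the nonlinear gap by a sum over particles, which slices can handle.\<close>

lemma \<Psi>_le: "\<Psi> y \<le> (\<Sum>i\<in>UNIV. T0 i y)" for y :: "'a ^ 'n"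
proof -
  have P: "empirical y \<in> P2" by (rule empirical_P2)
  have "real CARD('n) * ((\<integral>z. dF (empirical y) z \<partial>m_inf) - (\<integral>z. dF (empirical y) z \<partial>empirical y)) \<le> real CARD('n) * (F m_inf - F (empirical y))"
    by (intro mult_left_mono F_first_order P m_inf) auto
  moreover have "(\<integral>x. dF (empirical y) x - dF m_inf x \<partial>m_inf) = (\<integral>x. dF (empirical y) x \<partial>m_inf) - (\<integral>x. dF m_inf x \<partial>m_inf)"
    using dF_integrable[OF P m_inf] dF_integrable[OF m_inf m_inf] by simp
  ultimately show ?thesis using integral_empirical(1)[OF dF_measurable[OF P], of y]
    unfolding T0_def by (simp add: \<Psi>_def UU_def sum_subtractf right_diff_distrib)
qed

lemma \<Psi>_continuous: "continuous_on UNIV (\<Psi> :: 'a ^ 'n \<Rightarrow> real)"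
proof -
  interpret potential "\<lambda>x::'a ^ 'n. UU x - 0" bN "2 * (Mx + K)" by (rule potential_UU)
  have c: "continuous_on UNIV (\<lambda>y::'a ^ 'n. dF m_inf (y $ i))" for i
    by (intro continuous_on_compose2[OF dF_continuous[OF m_inf]] continuous_intros) auto
  show ?thesis unfolding \<Psi>_def[abs_def] using U_continuous[of UNIV] by (intro continuous_intros c) simp
qed

text \<open>Serves to make \<open>T0 i\<close> measurable. Along a convergent sequence of
  configurations the empirical measures converge in Wasserstein distance and stay in a ball, so
  joint continuity and uniform growth of \<open>dF\<close> apply, pointwise and under the
  integral.\<close>

lemma T0_continuous: "continuous_on UNIV (T0 i :: 'a ^ 'n \<Rightarrow> real)" unfolding continuous_on_sequentially
proof (intro allI ballI impI, elim conjE)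
  fix u :: "nat \<Rightarrow> 'a ^ 'n" and y assume u: "u \<longlonglongrightarrow> y"
  note P = empirical_P2
  have w0: "(\<lambda>n. wasserstein 2 (empirical y) (empirical (u n))) \<longlonglongrightarrow> 0"
  proof (rule tendsto_sandwich[OF _ _ tendsto_const, rotated 2])
    have "(\<lambda>n. sqrt ((norm (y - u n))^2 / real CARD('n))) \<longlonglongrightarrow> sqrt ((norm (y - y))^2 / real CARD('n))" by (intro tendsto_intros u) simp
    then show "(\<lambda>n. sqrt ((norm (y - u n))^2 / real CARD('n))) \<longlonglongrightarrow> 0" by simp
    show "eventually (\<lambda>n. wasserstein 2 (empirical y) (empirical (u n)) \<le> sqrt ((norm (y - u n))^2 / real CARD('n))) sequentially"
      using wasserstein2_empirical[of y] by (intro always_eventually) (simp add: norm_vec_square)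
  qed (simp add: wasserstein_nonneg)
  have un: "(\<lambda>n. u n $ i) \<longlonglongrightarrow> y $ i" by (intro tendsto_intros u)
  obtain B where B: "\<And>n. norm (u n) \<le> B" using convergent_imp_Bseq[of u] u by (auto simp: convergent_def Bseq_def)
  have B0: "0 \<le> B" using B[of 0] norm_ge_zero order_trans by blast
  have e0: "empirical (0 :: 'a ^ 'n) = return borel 0"
  proof -
    interpret U: prob_space "uniform_count_measure (UNIV :: 'n set)" by (rule prob_space_uniform_count_measure) auto
    have "distr (uniform_count_measure (UNIV :: 'n set)) borel (\<lambda>i. (0 :: 'a ^ 'n) $ i) = return borel 0" by simp
    then show ?thesis unfolding empirical_def .
  qed
  obtain C where C: "\<And>m x. m \<in> P2 \<Longrightarrow> wasserstein 2 (return borel 0) m \<le> B \<Longrightarrow> \<bar>dF m x\<bar> \<le> C * (1 + (norm x)^2)"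
    using dF_bounded_growth[of B] by auto
  have g: "\<bar>dF (empirical (u n)) x\<bar> \<le> C * (1 + (norm x)^2)" for n x
  proof (rule C[OF P])
    have "wasserstein 2 (return borel 0) (empirical (u n)) \<le> sqrt ((norm (u n))^2 / real CARD('n))"
      using wasserstein2_empirical[of 0 "u n"] by (simp add: e0 norm_vec_square)
    also have "... \<le> sqrt ((norm (u n))^2 / 1)" by (intro real_sqrt_le_mono divide_left_mono) auto
    finally show "wasserstein 2 (return borel 0) (empirical (u n)) \<le> B" using B[of n] by simp
  qed
  have "(\<lambda>n. \<integral>x. dF (empirical (u n)) x - dF m_inf x \<partial>m_inf) \<longlonglongrightarrow> (\<integral>x. dF (empirical y) x - dF m_inf x \<partial>m_inf)"
  proof (rule integral_dominated_convergence[where w="\<lambda>x. C * (1 + (norm x)^2) + \<bar>dF m_inf x\<bar>"])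
    show "integrable m_inf (\<lambda>x. C * (1 + (norm x)^2) + \<bar>dF m_inf x\<bar>)" using P2D(4)[OF m_inf] dF_integrable[OF m_inf m_inf] by auto
    show "AE x in m_inf. (\<lambda>n. dF (empirical (u n)) x - dF m_inf x) \<longlonglongrightarrow> dF (empirical y) x - dF m_inf x"
      by (intro AE_I2 tendsto_diff dF_tendsto P w0 tendsto_const)
    show "AE x in m_inf. norm (dF (empirical (u n)) x - dF m_inf x) \<le> C * (1 + (norm x)^2) + \<bar>dF m_inf x\<bar>" for n
      using g by (intro AE_I2) (auto intro: order_trans[OF abs_triangle_ineq4 add_right_mono])
  qed (auto intro!: borel_measurable_diff P2_measurable[OF m_inf] dF_measurable P m_inf)
  moreover have "(\<lambda>n. dF m_inf (u n $ i)) \<longlonglongrightarrow> dF m_inf (y $ i)"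
    by (rule continuous_on_tendsto_compose[OF dF_continuous[OF m_inf] un]) auto
  ultimately show "(T0 i \<circ> u) \<longlonglongrightarrow> T0 i y"
    unfolding T0_def comp_def by (intro tendsto_diff dF_tendsto[OF P P w0 un])
qed

lemma integral_kernel_diff:
  assumes \<mu>: "\<mu> \<in> P2" "\<nu> \<in> P2" and W: "wasserstein 1 \<mu> \<nu> \<le> W"
  shows "\<bar>(dF \<mu> x - dF \<nu> x) - (\<integral>z. dF \<mu> z - dF \<nu> z \<partial>m_inf)\<bar> \<le> K * W * (\<integral>z. norm (x - z) \<partial>m_inf)"
proof -
  let ?B = "\<lambda>z. dF \<mu> z - dF \<nu> z"
  let ?A = "dF \<mu> x - dF \<nu> x"
  have i: "integrable m_inf (\<lambda>z. ?B z)" by (intro Bochner_Integration.integrable_diff dF_integrable \<mu> m_inf)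
  have ni: "integrable m_inf (\<lambda>z. norm (x - z))"
    by (rule integrable_of_le[of _ "\<lambda>z. norm x + norm z"]) (use P2_norm_integrable[OF m_inf] in \<open>auto simp: norm_triangle_ineq4\<close>)
  have "?A - (\<integral>z. ?B z \<partial>m_inf) = (\<integral>z. ?A - (?B z) \<partial>m_inf)" using i prob_space by simp
  then have "\<bar>?A - (\<integral>z. ?B z \<partial>m_inf)\<bar> \<le> (\<integral>z. \<bar>?A - (?B z)\<bar> \<partial>m_inf)"
    by simp
  also have "... \<le> (\<integral>z. K * W * norm (x - z) \<partial>m_inf)"
  proof (rule integral_mono)
    show "\<bar>?A - (?B z)\<bar> \<le> K * W * norm (x - z)" for z
    proof -
      have "\<bar>?A - (?B z)\<bar> \<le> K * wasserstein 1 \<mu> \<nu> * norm (x - z)" by (rule dF_diff_lip[OF \<mu>])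
      also have "... \<le> K * W * norm (x - z)" using W K by (intro mult_right_mono mult_left_mono) auto
      finally show ?thesis .
    qed
  qed (use i ni in auto)
  finally show ?thesis by simp
qed

lemma norm_diff_integral_le: "(\<integral>z. norm (x - z) \<partial>m_inf) \<le> norm (x - ctr) + sqrt V0"
proof -
  let ?A = "\<integral>z. norm (ctr - z) \<partial>m_inf"
  have ni: "integrable m_inf (\<lambda>z. norm (c - z))" for c
    by (rule integrable_of_le[of _ "\<lambda>z. norm c + norm z"]) (use P2_norm_integrable[OF m_inf] in \<open>auto simp: norm_triangle_ineq4\<close>)
  have "(\<integral>z. norm (x - z) \<partial>m_inf) \<le> (\<integral>z. norm (x - ctr) + norm (ctr - z) \<partial>m_inf)"
    using ni by (intro integral_mono) (auto intro: norm_diff_triangle_le)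
  also have "... = norm (x - ctr) + ?A" using ni prob_space by simp
  also have "?A \<le> sqrt V0"
  proof (rule real_le_rsqrt)
    show "?A^2 \<le> V0"
      using expectation_square_le[of "\<lambda>z. norm (ctr - z)"] P2_dist_square_integrable[OF m_inf, of ctr] by (simp add: norm_minus_commute V0_def)
  qed
  finally show ?thesis by simp
qed

text \<open>Comparison with the configuration 0: its Wasserstein distance is at most
  \<open>norm y\<close>, and the centred kernel difference multiplies this by a distance that is
  linear in \<open>norm y\<close>, so the total is quadratic.\<close>

lemma T0_growth: obtains C where "\<And>y :: 'a ^ 'n. \<bar>T0 i y\<bar> \<le> C * (1 + (norm y)^2)"
proof -
  let ?e0 = "empirical (0 :: 'a ^ 'n)"
  note P = empirical_P2
  obtain C1 where C1: "\<And>x. \<bar>dF ?e0 x\<bar> \<le> C1 * (1 + (norm x)^2)" using dF_growth[OF P] by auto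
  obtain C2 where C2: "\<And>x. \<bar>dF m_inf x\<bar> \<le> C2 * (1 + (norm x)^2)" using dF_growth[OF m_inf] by auto
  define J where "J = \<bar>\<integral>z. dF ?e0 z - dF m_inf z \<partial>m_inf\<bar>"
  define B where "B = norm ctr + sqrt V0"
  have B0: "0 \<le> B" by (simp add: B_def V0_def)
  have C12: "0 \<le> C1 + C2" using C1[of 0] C2[of 0] by simp
  have "\<bar>T0 i y\<bar> \<le> (K * (2 + B) + C1 + C2 + J) * (1 + (norm y)^2)" for y :: "'a ^ 'n"
  proof -
    let ?Y = "1 + (norm y)^2"
    have n1: "norm y \<le> ?Y" using abs_le_one_plus_square[of "norm y"] by simp
    have ni: "norm (y $ j) \<le> norm y" for j by (rule Finite_Cartesian_Product.norm_nth_le)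
    have "wasserstein 1 (empirical y) ?e0 \<le> (\<Sum>j\<in>UNIV. norm (y $ j)) / real CARD('n)" using wasserstein1_empirical[of y 0] by simp
    also have "... \<le> (\<Sum>j\<in>(UNIV :: 'n set). norm y) / real CARD('n)" by (intro divide_right_mono sum_mono ni) auto
    finally have W: "wasserstein 1 (empirical y) ?e0 \<le> norm y" by simp
    have "\<bar>(dF (empirical y) (y $ i) - dF ?e0 (y $ i)) - (\<integral>z. dF (empirical y) z - dF ?e0 z \<partial>m_inf)\<bar> \<le> K * norm y * (\<integral>z. norm (y $ i - z) \<partial>m_inf)"
      by (rule integral_kernel_diff[OF P P W])
    also have "... \<le> K * norm y * (norm y + B)"
    proof (intro mult_left_mono)
      show "(\<integral>z. norm (y $ i - z) \<partial>m_inf) \<le> norm y + B"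
        using norm_triangle_ineq4[of "y $ i" ctr] ni[of i] norm_diff_integral_le[of "y $ i"] by (simp add: B_def)
    qed (use K in auto)
    also have "... = K * ((norm y)^2 + norm y * B)" by (simp add: power2_eq_square algebra_simps)
    also have "... \<le> K * (?Y + ?Y * B)" using K n1 B0 by (intro mult_left_mono add_mono mult_right_mono) auto
    also have "... \<le> K * (2 + B) * ?Y" using K by (simp add: algebra_simps)
    finally have 1: "\<bar>(dF (empirical y) (y $ i) - dF ?e0 (y $ i)) - (\<integral>z. dF (empirical y) z - dF ?e0 z \<partial>m_inf)\<bar> \<le> K * (2 + B) * ?Y" .
    have "(C1 + C2) * (1 + (norm (y $ i))^2) \<le> (C1 + C2) * ?Y" using C12 by (simp add: ni mult_left_mono)
    then have 2: "\<bar>dF ?e0 (y $ i)\<bar> + \<bar>dF m_inf (y $ i)\<bar> \<le> (C1 + C2) * ?Y"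
      using C1[of "y $ i"] C2[of "y $ i"] unfolding distrib_right[of C1] by simp
    have "J * 1 \<le> J * ?Y" unfolding J_def by (intro mult_left_mono) auto
    then have 3: "\<bar>\<integral>z. dF ?e0 z - dF m_inf z \<partial>m_inf\<bar> \<le> J * ?Y" unfolding J_def by simp
    have "(\<integral>z. dF (empirical y) z - dF m_inf z \<partial>m_inf) = (\<integral>z. dF (empirical y) z - dF ?e0 z \<partial>m_inf) + (\<integral>z. dF ?e0 z - dF m_inf z \<partial>m_inf)"
      by (simp add: dF_integrable[OF P m_inf] dF_integrable[OF m_inf m_inf])
    then have "\<bar>T0 i y\<bar> \<le> K * (2 + B) * ?Y + (C1 + C2) * ?Y + J * ?Y" unfolding T0_def using 1 2 3 by simp
    also have "... = (K * (2 + B) + C1 + C2 + J) * ?Y" by (simp only: distrib_right)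
    finally show ?thesis .
  qed
  then show thesis by (rule that)
qed

end

section \<open>Lower bound of the Fisher information by the energy\<close>

context mean_field_gibbs
begin

definition dsum :: "'a ^ 'n \<Rightarrow> real" where
  "dsum y = (\<Sum>i\<in>UNIV. (norm (y $ i - ctr))^2)"

text \<open>Cost of moving particle \<open>i\<close> to the barycenter in \<open>T0 i\<close>.\<close>

definition err :: "'n \<Rightarrow> 'a ^ 'n \<Rightarrow> real" where
  "err i y = K / real CARD('n) * (3 / 2 * (norm (y $ i - ctr))^2 + V0 / 2)"

lemma V0_nonneg: "0 \<le> V0" by (simp add: V0_def)

lemma wasserstein1_subst_at:
  fixes y :: "'a ^ 'n"
  shows "wasserstein 1 (empirical y) (empirical (subst_at y i ctr)) \<le> norm (y $ i - ctr) / real CARD('n)"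
    "wasserstein 1 (empirical (subst_at y i ctr)) (empirical y) \<le> norm (y $ i - ctr) / real CARD('n)"
proof -
  have e: "norm (y $ j - subst_at y i ctr $ j) = (if j = i then norm (y $ i - ctr) else 0)"
    "norm (subst_at y i ctr $ j - y $ j) = (if j = i then norm (y $ i - ctr) else 0)" for j
    by (simp_all add: norm_minus_commute)
  show "wasserstein 1 (empirical y) (empirical (subst_at y i ctr)) \<le> norm (y $ i - ctr) / real CARD('n)"
    "wasserstein 1 (empirical (subst_at y i ctr)) (empirical y) \<le> norm (y $ i - ctr) / real CARD('n)"
    using wasserstein1_empirical[of y "subst_at y i ctr"] wasserstein1_empirical[of "subst_at y i ctr" y] unfolding e by auto
qed

lemma T0_le:
  fixes y :: "'a ^ 'n" and i :: 'n
  defines "\<mu> \<equiv> empirical (subst_at y i ctr)"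
  shows "T0 i y - err i y \<le> ln (w (y $ i)) + (dF \<mu> (y $ i) + lnZ \<mu>)"
proof -
  let ?A = "\<integral>z. dF (empirical y) z - dF \<mu> z \<partial>m_inf"
  let ?x = "y $ i" and ?N = "real CARD('n)"
  have P: "empirical y \<in> P2" "\<mu> \<in> P2" unfolding \<mu>_def by (rule empirical_P2)+
  have "\<bar>(dF (empirical y) ?x - dF \<mu> ?x) - ?A\<bar> \<le> K * (norm (?x - ctr) / ?N) * (\<integral>z. norm (?x - z) \<partial>m_inf)"
    unfolding \<mu>_def by (rule integral_kernel_diff[OF empirical_P2 empirical_P2 wasserstein1_subst_at(1)])
  also have "... \<le> K * (norm (?x - ctr) / ?N) * (norm (?x - ctr) + sqrt V0)"
    using K by (intro mult_left_mono norm_diff_integral_le) auto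
  also have "... = K / ?N * ((norm (?x - ctr))^2 + norm (?x - ctr) * sqrt V0)" by (simp add: power2_eq_square algebra_simps add_divide_distrib)
  also have "... \<le> err i y" unfolding err_def
  proof (rule mult_left_mono)
    \<comment> \<open>Young's inequality for the product of distance and standard deviation; this is
      the origin of 3/2 and 1/2 in \<open>err\<close>.\<close>
    have "0 \<le> (norm (?x - ctr) - sqrt V0)^2" by simp
    then show "(norm (?x - ctr))^2 + norm (?x - ctr) * sqrt V0 \<le> 3 / 2 * (norm (?x - ctr))^2 + V0 / 2"
      unfolding power2_diff using V0_nonneg by simp
  qed (use K in simp)
  finally have "(dF (empirical y) ?x - dF \<mu> ?x) - ?A \<le> err i y" by simp
  moreover have "?A = (\<integral>z. dF (empirical y) z - dF m_inf z \<partial>m_inf) - (\<integral>z. dF \<mu> z - dF m_inf z \<partial>m_inf)"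
    using dF_integrable[OF P(1) m_inf] dF_integrable[OF P(2) m_inf] dF_integrable[OF m_inf m_inf] by simp
  ultimately show ?thesis using lnZ_diff_ge[OF P(2)] unfolding T0_def w_def by simp
qed

lemma log_sobolev_hat: "m \<in> P2 \<Longrightarrow> log_sobolev \<rho> (edensity lborel (\<lambda>x. exp (- (dF m x + lnZ m))))"
  using lsi[of m] hat_measure_eq[of m] by simp

lemma T0_measurable [measurable]: "(T0 i :: 'a ^ 'n \<Rightarrow> real) \<in> borel_measurable borel"
  by (rule borel_measurable_continuous_onI[OF T0_continuous])

lemma dsum_growth: "\<bar>dsum y\<bar> \<le> (2 + 2 * real CARD('n) * (norm ctr)^2) * (1 + (norm y)^2)" for y :: "'a ^ 'n"
proof -
  have "dsum y \<le> (\<Sum>i\<in>(UNIV :: 'n set). 2 * (norm (y $ i))^2 + 2 * (norm ctr)^2)"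
    unfolding dsum_def by (intro sum_mono norm_diff_square_le)
  also have "... = 2 * (norm y)^2 + 2 * real CARD('n) * (norm ctr)^2"
    by (simp add: sum.distrib sum_distrib_left norm_vec_square)
  also have "... \<le> (2 + 2 * real CARD('n) * (norm ctr)^2) * (1 + (norm y)^2)" by (simp add: algebra_simps)
  finally show ?thesis by (simp add: dsum_def sum_nonneg)
qed

lemma dsum_measurable [measurable]: "dsum \<in> borel_measurable borel" unfolding dsum_def[abs_def] by simp

abbreviation energy :: "('a ^ 'n \<Rightarrow> real) \<Rightarrow> real" where
  "energy p \<equiv> potential.free (\<lambda>y. UU y - c0 TYPE('n)) p"

lemma \<Psi>_growth: "\<exists>C. \<forall>y :: 'a ^ 'n. \<bar>\<Psi> y\<bar> \<le> C * (1 + (norm y)^2)"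
proof -
  interpret potential "\<lambda>y::'a ^ 'n. UU y - c0 TYPE('n)" bN "2 * (Mx + K)" by (rule potential_UU)
  obtain C where C: "\<And>y. \<bar>UU y - c0 TYPE('n)\<bar> \<le> C * (1 + (norm (y :: 'a ^ 'n))^2)" using U_growth by auto
  have "\<bar>\<Psi> y\<bar> \<le> (C + Cw * (real CARD('n) + 1)) * (1 + (norm y)^2)" for y :: "'a ^ 'n"
    using C[of y] ln_Wn_growth[of y] UU_decomposition[of y] unfolding distrib_right[of C] by simp
  then show ?thesis by auto
qed

lemma \<Psi>_measurable [measurable]: "(\<Psi> :: 'a ^ 'n \<Rightarrow> real) \<in> borel_measurable borel"
  by (rule borel_measurable_continuous_onI[OF \<Psi>_continuous])

lemma energy_eq:
  fixes p :: "'a ^ 'n \<Rightarrow> real"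
  assumes p: "dens2 p"
  shows "integrable lborel (\<lambda>y. p y * ln (Wn y))" "integrable lborel (\<lambda>y. p y * \<Psi> y)" "integrable lborel (\<lambda>y. p y * UU y)"
    "energy p = (LBINT y. p y * ln (p y)) - (LBINT y. p y * ln (Wn y)) + (LBINT y. p y * \<Psi> y)"
    "energy p = (LBINT y. p y * ln (p y)) + (LBINT y. p y * UU y) - c0 TYPE('n)"
proof -
  interpret potential "\<lambda>y::'a ^ 'n. UU y - 0" bN "2 * (Mx + K)" by (rule potential_UU)
  interpret pot: potential "\<lambda>y::'a ^ 'n. UU y - c0 TYPE('n)" bN "2 * (Mx + K)" by (rule potential_UU)
  show i1: "integrable lborel (\<lambda>y. p y * ln (Wn y))" by (rule dens2_growth[OF p _ ln_Wn_growth]) measurable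
  obtain C where C: "\<And>y. \<bar>\<Psi> y\<bar> \<le> C * (1 + (norm (y :: 'a ^ 'n))^2)" using \<Psi>_growth by auto
  show i2: "integrable lborel (\<lambda>y. p y * \<Psi> y)" by (rule dens2_growth[OF p _ C]) measurable
  show i3: "integrable lborel (\<lambda>y. p y * UU y)" using dens2_growth[OF p U_measurable U_growth] by simp
  have "p y * (UU y - c0 TYPE('n)) = p y * \<Psi> y - p y * ln (Wn y)" for y unfolding UU_decomposition by (simp add: algebra_simps)
  then show "energy p = (LBINT y. p y * ln (p y)) - (LBINT y. p y * ln (Wn y)) + (LBINT y. p y * \<Psi> y)"
    unfolding pot.free_def using i1 i2 by simp
  show "energy p = (LBINT y. p y * ln (p y)) + (LBINT y. p y * UU y) - c0 TYPE('n)"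
    unfolding pot.free_def using i3 integral_dens2_one[OF p] by (simp add: right_diff_distrib)
qed

text \<open>\<open>slice_inequality\<close> is used for each particle with its frozen potential;
  \<open>tensorization\<close> assembles the entropies and \<open>\<Psi>_le\<close> the interaction
  terms. All errors are multiples of the mean of \<open>dsum\<close> or of the variance of
  \<open>m_inf\<close>.\<close>

theorem fisher_ge_energy:
  fixes p :: "'a ^ 'n \<Rightarrow> real"
  assumes p: "regdens p D" and \<rho>': "0 < \<rho>'" "\<rho>' < \<rho>"
  shows "(4 * \<rho>' - K * (16 + 6 * K * \<rho>' / (\<rho> * (\<rho> - \<rho>'))) / real CARD('n)) * energy p
      - real DIM('a) * K * (10 + 3 * K * \<rho>' / (\<rho> * (\<rho> - \<rho>'))) \<le> potential.fisher bN p D"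
proof (rule entropy_inequality_arith[OF K \<rho>'])
  let ?C = "(sqrt 2 ^ DIM('a)) ^ CARD('n)"
  let ?B = "\<lambda>T. \<Sum>i\<in>UNIV. \<integral>y. p y * T i y \<partial>lborel"
  let ?A = "\<lambda>y. ennreal (f p y)"
  let ?T = "tensor_power m_inf :: ('a ^ 'n) measure" and ?N = "real CARD('n)"
  interpret pot: potential "\<lambda>y::'a ^ 'n. UU y - c0 TYPE('n)" bN "2 * (Mx + K)" by (rule potential_UU)
  interpret T: prob_space ?T by (rule prob_space_tensor_power)
  note p2 = p2[OF p] and pp = p_pos[OF p] and fpos = f_pos[OF p]
  note [measurable] = p_meas[OF p] D_meas[OF p] f_meas[OF p] pot.b_measurable
  have bNm[measurable]: "(\<lambda>y. bN y $ i) \<in> borel_measurable borel" for i :: 'n by simp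
  define H where "H = (\<integral>y. f p y * ln (f p y) \<partial>?T)"
  define S where "S = (LBINT y. p y * dsum y)"
  have Ht: "H = (LBINT y. p y * ln (p y)) - (LBINT y. p y * ln (Wn y))" unfolding H_def by (rule f_ln_f(2)[OF p])
  note en = energy_eq[OF p2]
  have Hen: "energy p = H + (LBINT y. p y * \<Psi> y)" using en(4) Ht by simp
  show "1 \<le> ?N" by simp
  show "0 \<le> real DIM('a)" by simp
  show "0 \<le> H"
  proof -
    have "(\<integral>y. f p y - 1 \<partial>?T) \<le> H" unfolding H_def
      using f_one(1)[OF p] f_ln_f(1)[OF p] fpos mult_ln_ge[of "f p _" 1] by (intro integral_mono) (auto simp: less_imp_le)
    then show ?thesis using f_one[OF p] T.prob_space by simp
  qed
  show "H \<le> energy p" by (simp add: \<Psi>_nonneg less_imp_le[OF pp] Hen)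
  show "V0 \<le> real DIM('a) / \<rho>" unfolding V0_def ctr_def by (rule log_sobolev_variance[OF m_inf log_sobolev_m_inf \<rho>])
  have Sint: "integrable lborel (\<lambda>y. p y * dsum y)" by (rule dens2_growth[OF p2 _ dsum_growth]) measurable
  \<comment> \<open>The variational inequality with test function
    \<open>\<rho> / 2 * dsum y\<close>: under the product law its exponential moment is the N-th
    power of the one-particle moment, so the price is only N times d/2.\<close>
  show "S \<le> 2 / \<rho> * (H + ?N * real DIM('a) / 2)"
  proof -
    have de: "density ?T ?A = edensity lborel p"
      unfolding f_def[OF p] by (rule tensor_power_density_eq) (use pp in \<open>auto simp: less_imp_le\<close>)
    have di: "integrable (density ?T ?A) g \<longleftrightarrow> integrable lborel (\<lambda>y. p y * g y)"
      "(\<integral>y. g y \<partial>density ?T ?A) = (LBINT y. p y * g y)" if "g \<in> borel_measurable borel" for g :: "'a ^ 'n \<Rightarrow> real"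
      unfolding de using integrable_dens2_iff[OF p2 that] integral_dens2[OF p2 that] by auto
    have lf: "integrable lborel (\<lambda>y. p y * ln (f p y))" "(LBINT y. p y * ln (f p y)) = H"
      using f_ln_f(1)[OF p] f_integral[OF p, of "\<lambda>y. ln (f p y)"] by (auto simp: H_def)
    have exp_le: "(\<integral>\<^sup>+y. ennreal (exp (\<rho> / 2 * dsum y)) \<partial>?T) \<le> ennreal (?C)"
    proof -
      have "(\<integral>\<^sup>+y. ennreal (exp (\<rho> / 2 * dsum y)) \<partial>?T) = (\<integral>\<^sup>+y. (\<Prod>i\<in>UNIV. ennreal (exp (\<rho> / 2 * (norm (y $ i - ctr))^2))) \<partial>?T)"
        unfolding dsum_def sum_distrib_left by (simp add: exp_sum prod_ennreal)
      also have "... = (\<integral>\<^sup>+x. ennreal (exp (\<rho> / 2 * (norm (x - ctr))^2)) \<partial>m_inf) ^ CARD('n)"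
        by (rule nn_integral_tensor_power_prod) measurable
      also have "... \<le> ?C"
        unfolding ctr_def using log_sobolev_exp_square[OF m_inf log_sobolev_m_inf \<rho>] by (subst ennreal_power[symmetric]) (auto intro!: power_mono)
      finally show ?thesis .
    qed
    have "(\<integral>y. \<rho> / 2 * dsum y \<partial>density ?T ?A) \<le> (\<integral>y. ln (f p y) \<partial>density ?T ?A) + ln (?C)"
    proof (rule entropy_variational)
      show "prob_space (density ?T ?A)" unfolding de by (rule prob_space_dens2[OF p2])
      show "integrable (density ?T ?A) (\<lambda>y. ln (f p y))" by (subst di) (auto simp: lf)
      show "integrable (density ?T ?A) (\<lambda>y. \<rho> / 2 * dsum y)" using Sint by (subst di) (auto simp: mult.left_commute)
    qed (use exp_le fpos in \<open>auto simp: prob_space_tensor_power less_imp_le\<close>)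
    also have "(\<integral>y. \<rho> / 2 * dsum y \<partial>density ?T ?A) = \<rho> / 2 * S"
      unfolding S_def using di(2)[of dsum] by simp
    also have "(\<integral>y. ln (f p y) \<partial>density ?T ?A) = H" by (subst di(2)) (auto simp: lf)
    also have "ln (?C) \<le> ?N * (real DIM('a) / 2)"
      using mult_left_mono[OF ln_sqrt2_power[of "DIM('a)"], of ?N] by (simp add: ln_realpow)
    finally show ?thesis using \<rho> by (simp add: field_simps)
  qed
  show "4 * \<rho> * (energy p - K / ?N * (3 / 2 * S + ?N * V0 / 2)) \<le> \<rho> / \<rho>' * potential.fisher bN p D + \<rho> / (\<rho> - \<rho>') * ((K / ?N)^2 * S)"
  proof -
    define si where "si i y = (1 / p y) *\<^sub>R D y $ i + bN y $ i" for i and y :: "'a ^ 'n"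
    have [measurable]: "si i \<in> borel_measurable borel" for i unfolding si_def[abs_def] by simp
    define R where "R i y = \<rho> / \<rho>' * (norm (si i y))^2 + \<rho> / (\<rho> - \<rho>') * (K / ?N * norm (y $ i - ctr))^2" for i y
    have [measurable]: "R i \<in> borel_measurable borel" for i unfolding R_def[abs_def] by simp
    have nsi: "(norm ((1 / p y) *\<^sub>R D y + bN y))^2 = (\<Sum>i\<in>UNIV. (norm (si i y))^2)" for y by (simp add: norm_vec_square si_def)
    have fi: "integrable lborel (\<lambda>y. p y * (norm (si i y))^2)" for i
    proof (rule integrable_of_le[OF pot.fisher_integrable[OF p]])
      have "(norm (si i y))^2 \<le> (norm ((1 / p y) *\<^sub>R D y + bN y))^2" for y
        unfolding nsi by (rule member_le_sum) auto
      then show "norm (p y * (norm (si i y))^2) \<le> p y * (norm ((1 / p y) *\<^sub>R D y + bN y))^2" for y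
        using p_pos[OF p, of y] by simp
    qed measurable
    have di: "integrable lborel (\<lambda>y. p y * (norm (y $ i - ctr))^2)" for i
    proof (rule integrable_of_le[OF Sint])
      have "(norm (y $ i - ctr))^2 \<le> dsum y" for y :: "'a ^ 'n" unfolding dsum_def by (rule member_le_sum) auto
      then show "norm (p y * (norm (y $ i - ctr))^2) \<le> p y * dsum y" for y using p_pos[OF p, of y] by simp
    qed measurable
    have pR: "p y * R i y = \<rho> / \<rho>' * (p y * (norm (si i y))^2) + \<rho> / (\<rho> - \<rho>') * (K / ?N)^2 * (p y * (norm (y $ i - ctr))^2)" for i y
      unfolding R_def power_mult_distrib by (simp only: distrib_left mult_ac)
    have Ri: "integrable lborel (\<lambda>y. p y * R i y)" for i unfolding pR using fi[of i] di[of i] by simp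
    have Rsum: "(\<Sum>i\<in>UNIV. \<integral>y. p y * R i y \<partial>lborel) = \<rho> / \<rho>' * potential.fisher bN p D + \<rho> / (\<rho> - \<rho>') * ((K / ?N)^2 * S)"
      by (simp add: fi di sum.distrib sum_distrib_left mult.assoc pR pot.fisher_def nsi S_def dsum_def)
    define T where "T i y = T0 i y - err i y" for i and y :: "'a ^ 'n"
    have [measurable]: "T i \<in> borel_measurable borel" for i unfolding T_def[abs_def] err_def by simp
    have T0i: "integrable lborel (\<lambda>y. p y * T0 i y)" for i
    proof -
      obtain C where C: "\<And>y :: 'a ^ 'n. \<bar>T0 i y\<bar> \<le> C * (1 + (norm y)^2)" using T0_growth by auto
      show ?thesis by (rule dens2_growth[OF p2 _ C]) measurable
    qed
    have perr: "p y * err i y = K / ?N * (3 / 2 * (p y * (norm (y $ i - ctr))^2) + V0 / 2 * p y)" for i y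
      unfolding err_def by (simp add: algebra_simps)
    have erri: "integrable lborel (\<lambda>y. p y * err i y)" for i
      unfolding perr using di[of i] integral_dens2_one[OF p2] by simp
    have pT: "p y * T i y = p y * T0 i y - p y * err i y" for i y by (simp add: T_def right_diff_distrib)
    have Ti: "integrable lborel (\<lambda>y. p y * T i y)" for i unfolding pT using T0i[of i] erri[of i] by simp
    have errs: "(\<Sum>i\<in>UNIV. err i y) = K / ?N * (3 / 2 * dsum y + ?N * V0 / 2)" for y :: "'a ^ 'n"
      unfolding err_def dsum_def sum_distrib_left[symmetric] sum.distrib by simp
    have Tsum: "(LBINT y. p y * \<Psi> y) - K / ?N * (3 / 2 * S + ?N * V0 / 2) \<le> (?B T)"
    proof -
      have "(LBINT y. p y * \<Psi> y) - K / ?N * (3 / 2 * S + ?N * V0 / 2) = (LBINT y. p y * \<Psi> y - K / ?N * (3 / 2 * (p y * dsum y) + ?N * V0 / 2 * p y))"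
        unfolding S_def using en(2) Sint integral_dens2_one[OF p2] by simp
      also have "... \<le> (LBINT y. (\<Sum>i\<in>UNIV. p y * T i y))"
      proof (rule integral_mono)
        show "p y * \<Psi> y - K / ?N * (3 / 2 * (p y * dsum y) + ?N * V0 / 2 * p y) \<le> (\<Sum>i\<in>UNIV. p y * T i y)" for y
        proof -
          have "\<Psi> y - K / ?N * (3 / 2 * dsum y + ?N * V0 / 2) \<le> (\<Sum>i\<in>UNIV. T i y)"
            using \<Psi>_le[of y] unfolding T_def sum_subtractf errs by simp
          then have "p y * (\<Psi> y - K / ?N * (3 / 2 * dsum y + ?N * V0 / 2)) \<le> p y * (\<Sum>i\<in>UNIV. T i y)"
            using pp[of y] by simp
          then show ?thesis by (simp add: sum_distrib_left algebra_simps)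
        qed
      qed (use en(2) Sint integral_dens2_one[OF p2] Ti in auto)
      also have "... = (?B T)" by (intro Bochner_Integration.integral_sum Ti)
      finally show ?thesis .
    qed
    have slice: "integrable ?T (\<lambda>y. f p y * ln (Mf p i y))"
      "4 * \<rho> * (H + (LBINT y. p y * T i y) - (\<integral>y. f p y * ln (Mf p i y) \<partial>?T)) \<le> (LBINT y. p y * R i y)" for i
    proof -
      let ?\<mu> = "\<lambda>y :: 'a ^ 'n. empirical (subst_at y i ctr)"
      have R1: "(norm ((1 / p y) *\<^sub>R D y $ i + DF (?\<mu> y) (y $ i)))^2 \<le> R i y" for y
      proof -
        let ?d = "DF (?\<mu> y) (y $ i) - bN y $ i"
        have "norm ?d \<le> K * wasserstein 1 (?\<mu> y) (empirical y)" unfolding bN_def by (simp add: lipschitz empirical_P2)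
        also have "... \<le> K * (norm (y $ i - ctr) / ?N)" using K by (intro mult_left_mono wasserstein1_subst_at)
        finally have d: "(norm ?d)^2 \<le> (K / ?N * norm (y $ i - ctr))^2" by (intro power_mono) simp_all
        have "(1 / p y) *\<^sub>R D y $ i + DF (?\<mu> y) (y $ i) = si i y + ?d" by (simp add: si_def)
        then have "(norm ((1 / p y) *\<^sub>R D y $ i + DF (?\<mu> y) (y $ i)))^2 \<le> \<rho> / \<rho>' * (norm (si i y))^2 + \<rho> / (\<rho> - \<rho>') * (norm ?d)^2"
          using norm_add_square_weighted[OF \<rho>'] by metis
        also have "... \<le> R i y" unfolding R_def using d \<rho>' by (intro add_left_mono mult_left_mono) auto
        finally show ?thesis .
      qed
      have a: "integrable ?T (\<lambda>y. f p y * T i y)" "integrable ?T (\<lambda>y. f p y * R i y)"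
        using f_integral(1)[OF p, of "T i"] f_integral(1)[OF p, of "R i"] Ti[of i] Ri[of i] by auto
      note s = slice_inequality[OF p potential_dF[OF empirical_P2] log_sobolev_hat[OF empirical_P2], of "\<lambda>y. subst_at y i ctr" i "T i" "R i"]
      have s': "T i y \<le> ln (w (y $ i)) + (dF (?\<mu> y) (y $ i) + lnZ (?\<mu> y))" for y unfolding T_def by (rule T0_le)
      show "integrable ?T (\<lambda>y. f p y * ln (Mf p i y))" by (rule s(1)[OF _ _ _ s' a(1) R1 a(2)]) (use \<rho> in auto)
      have "4 * \<rho> * ((\<integral>y. f p y * ln (f p y) \<partial>?T) + (\<integral>y. f p y * T i y \<partial>?T) - (\<integral>y. f p y * ln (Mf p i y) \<partial>?T)) \<le> (\<integral>y. f p y * R i y \<partial>?T)"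
        by (rule s(2)[OF _ _ _ s' a(1) R1 a(2)]) (use \<rho> in auto)
      then show "4 * \<rho> * (H + (LBINT y. p y * T i y) - (\<integral>y. f p y * ln (Mf p i y) \<partial>?T)) \<le> (LBINT y. p y * R i y)"
        using f_integral(2)[OF p, of "T i"] f_integral(2)[OF p, of "R i"] by (simp add: H_def)
    qed
    have tens: "H \<le> (\<Sum>i\<in>UNIV. H - (\<integral>y. f p y * ln (Mf p i y) \<partial>?T))"
      unfolding H_def Mf_def[OF p]
      by (rule tensorization[OF f_meas[OF p] fpos f_one(3)[OF p] f_ln_f(1)[OF p]]) (rule slice(1)[unfolded Mf_def[OF p]])
    have "4 * \<rho> * (energy p - K / ?N * (3 / 2 * S + ?N * V0 / 2))
        \<le> 4 * \<rho> * ((\<Sum>i\<in>UNIV. H - (\<integral>y. f p y * ln (Mf p i y) \<partial>?T)) + (?B T))"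
      unfolding Hen using tens Tsum \<rho> by simp
    also have "... = (\<Sum>i\<in>UNIV. 4 * \<rho> * (H + (LBINT y. p y * T i y) - (\<integral>y. f p y * ln (Mf p i y) \<partial>?T)))"
      unfolding sum.distrib[symmetric] sum_distrib_left[symmetric] by (simp add: algebra_simps)
    also have "... \<le> (\<Sum>i\<in>UNIV. \<integral>y. p y * R i y \<partial>lborel)" by (intro sum_mono slice(2))
    finally show ?thesis unfolding Rsum .
  qed
qed

end

lemma gaussM_scale:
  assumes s: "s > 0" and c: "c > 0"
  shows "distr (gaussM s) borel (\<lambda>x::'a::euclidean_space. c *\<^sub>R x) = gaussM (c^2 * s)"
proof -
  have cs: "c^2 * s > 0" using s c by simp
  have g: "c ^ DIM('a) * gauss (c^2 * s) (c *\<^sub>R x) = gauss s x" for x :: 'a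
    using c by (simp add: real_sqrt_mult power_divide power_mult_distrib gauss_eq[OF s] gauss_eq[OF cs])
  show ?thesis
  proof (rule measure_eqI)
    fix A assume "A \<in> sets (distr (gaussM s) borel (\<lambda>x::'a. c *\<^sub>R x))"
    then have [measurable]: "A \<in> sets (borel :: 'a measure)" by simp
    have "emeasure (gaussM (c^2 * s)) A = (\<integral>\<^sup>+x. ennreal (gauss (c^2 * s) x) * indicator A x \<partial>lborel)"
      unfolding gaussM_def by (simp add: emeasure_density)
    also have "... = (\<integral>\<^sup>+x. ennreal (c ^ DIM('a)) * (ennreal (gauss (c^2 * s) (c *\<^sub>R x)) * indicator A (c *\<^sub>R x)) \<partial>lborel)"
      using c by (subst lborel_affine[of c 0]) (simp_all add: nn_integral_density nn_integral_distr)
    also have "... = (\<integral>\<^sup>+x. ennreal (gauss s x) * indicator A (c *\<^sub>R x) \<partial>lborel)"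
      unfolding g[symmetric] using c by (simp add: ennreal_mult' mult.assoc)
    also have "... = (\<integral>\<^sup>+x. indicator A (c *\<^sub>R x) \<partial>gaussM s)"
      unfolding gaussM_def by (subst nn_integral_density) auto
    also have "... = (\<integral>\<^sup>+x. indicator A x \<partial>distr (gaussM s) borel (\<lambda>x. c *\<^sub>R x))"
      by (subst nn_integral_distr) auto
    also have "... = emeasure (distr (gaussM s) borel (\<lambda>x. c *\<^sub>R x)) A" by simp
    finally show "emeasure (distr (gaussM s) borel (\<lambda>x. c *\<^sub>R x)) A = emeasure (gaussM (c^2 * s)) A" ..
  qed simp
qed

lemma tensor_power_gaussM:
  assumes "s > 0"
  shows "(tensor_power (gaussM s) :: ('a::euclidean_space ^ 'n) measure) = gaussM s"
proof -
  have "(\<Prod>i\<in>UNIV. gauss s (y $ i)) = gauss s y" for y :: "'a ^ 'n"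
    by (simp add: gauss_def prod_Basis_vec inner_axis)
  moreover have "(tensor_power (density lborel (\<lambda>x::'a. ennreal (gauss s x))) :: ('a ^ 'n) measure) = edensity lborel (\<lambda>y. \<Prod>i\<in>UNIV. gauss s (y $ i))"
    using assms by (intro tensor_power_density prob_space_gauss) (auto simp: gauss_pos less_imp_le)
  ultimately show ?thesis unfolding gaussM_def by simp
qed

section \<open>The particle system as a Langevin diffusion\<close>

lemma (in prob_space) indep_vars_finiteI:
  assumes I: "I \<noteq> {}" "finite I" and rv: "\<And>i. i \<in> I \<Longrightarrow> random_variable (M' i) (X i)"
    and eq: "\<And>A. (\<And>i. i \<in> I \<Longrightarrow> A i \<in> sets (M' i)) \<Longrightarrow> prob (\<Inter>j\<in>I. X j -` A j \<inter> space M) = (\<Prod>j\<in>I. prob (X j -` A j \<inter> space M))"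
  shows "indep_vars M' X I"
proof (subst indep_vars_finite[OF I, where E="\<lambda>i. sets (M' i)"])
  show "\<forall>A\<in>(\<Pi> i\<in>I. sets (M' i)). prob (\<Inter>j\<in>I. X j -` A j \<inter> space M) = (\<Prod>j\<in>I. prob (X j -` A j \<inter> space M))"
    by (intro ballI eq) auto
qed (use rv in \<open>auto simp: sets.sigma_sets_eq Int_stable_def dest: sets.sets_into_space\<close>)

context
  fixes DF :: "'a::euclidean_space measure \<Rightarrow> 'a \<Rightarrow> 'a" and M :: "'w measure" and W :: "'n::finite \<Rightarrow> real \<Rightarrow> 'w \<Rightarrow> 'a"
    and X :: "real \<Rightarrow> 'w \<Rightarrow> 'a ^ 'n"
  assumes ps: "particle_system DF M W X"
begin

interpretation prob_space M using ps by (simp add: particle_system_def)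

text \<open>The factor sqrt 2 is included, as in the driving process of
  \<open>langevin\<close>.\<close>

definition noise :: "real \<Rightarrow> 'w \<Rightarrow> 'a ^ 'n" where
  "noise t w = sqrt 2 *\<^sub>R (\<chi> i. W i t w)"

lemma particle_systemD:
  shows "brownian_motion M (W i)"
    and "indep_vars (\<lambda>_. \<Pi>\<^sub>M t\<in>{0..}. borel) (\<lambda>i w. \<lambda>t\<in>{0..}. W i t w) UNIV"
    and "0 \<le> t \<Longrightarrow> X t \<in> borel_measurable M"
    and "indep_set (sets (vimage_algebra (space M) (X 0) borel))
      (sets (vimage_algebra (space M) (\<lambda>w. \<lambda>(i, t)\<in>UNIV \<times> {0..}. W i t w) (\<Pi>\<^sub>M (i, t)\<in>UNIV \<times> {0..}. borel)))"
    and "AE w in M. continuous_on {0..} (\<lambda>t. X t w) \<and> (\<forall>t\<ge>0. \<forall>i. X t w $ i = X 0 w $ i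
         - integral {0..t} (\<lambda>s. DF (empirical (X s w)) (X s w $ i)) + sqrt 2 *\<^sub>R W i t w)"
  using ps unfolding particle_system_def by auto

lemma W_meas: "0 \<le> t \<Longrightarrow> W i t \<in> borel_measurable M"
  using particle_systemD(1) by (simp add: brownian_motion_def)

lemma noise_measurable: "0 \<le> t \<Longrightarrow> noise t \<in> borel_measurable M"
  unfolding noise_def[abs_def] by (intro borel_measurable_scaleR borel_measurable_const vec_lambda_measurable W_meas)

lemma noise_diff: "noise t w - noise s w = sqrt 2 *\<^sub>R (\<chi> i. W i t w - W i s w)"
  by (simp add: noise_def vec_eq_iff scaleR_diff_right)

lemma path_functional_measurable:
  assumes "0 \<le> s" "0 \<le> t"
  shows "(\<lambda>u. u t - u s) \<in> borel_measurable (\<Pi>\<^sub>M t\<in>{0::real..}. (borel :: 'a measure))"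
  using assms by simp

text \<open>Independence across particles makes the joint increment a power of one Gaussian, which
  is again Gaussian by \<open>tensor_power_gaussM\<close>; scaling by sqrt 2 doubles the
  variance.\<close>

lemma noise_law:
  assumes "0 \<le> s" "s < t"
  shows "distr M borel (\<lambda>w. noise t w - noise s w) = gaussM (2 * (t - s))"
proof -
  let ?D = "\<lambda>i w. W i t w - W i s w"
  have [measurable]: "?D i \<in> borel_measurable M" for i using assms by (intro borel_measurable_diff W_meas) auto
  have law: "distr M borel (?D i) = gaussM (t - s)" for i
  proof -
    have "distr M lborel (?D i) = gaussM (t - s)"
      using particle_systemD(1)[of i] assms by (simp add: brownian_motion_def gauss_def distributed_def gaussM_def)
    then show ?thesis by (metis distr_cong sets_lborel)
  qed
  have "indep_vars (\<lambda>_. borel) (\<lambda>i. (\<lambda>u. u t - u s) \<circ> (\<lambda>w. \<lambda>t\<in>{0..}. W i t w)) UNIV"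
    using assms by (intro indep_vars_compose[OF particle_systemD(2)]) auto
  then have PiM: "distr M (\<Pi>\<^sub>M i\<in>UNIV. borel) (\<lambda>w i. ?D i w) = (\<Pi>\<^sub>M i\<in>(UNIV::'n set). gaussM (t - s))"
    using assms by (simp add: comp_def indep_vars_iff_distr_eq_PiM law restrict_def)
  have "distr M borel (\<lambda>w. \<chi> i. ?D i w) = distr (distr M (\<Pi>\<^sub>M i\<in>UNIV. borel) (\<lambda>w i. ?D i w)) borel (\<lambda>x. \<chi> i. x i)"
    by (subst distr_distr[OF vec_lambda_PiM_measurable]) (auto simp: comp_def intro!: measurable_PiM_single')
  also have "... = gaussM (t - s)" unfolding PiM using tensor_power_gaussM[of "t - s", where 'a='a and 'n='n] assms by (simp add: tensor_power_def)
  finally have D: "distr M borel (\<lambda>w. \<chi> i. ?D i w) = gaussM (t - s)" .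
  have "distr M borel (\<lambda>w. noise t w - noise s w) = distr (distr M borel (\<lambda>w. \<chi> i. ?D i w)) borel (\<lambda>x. sqrt 2 *\<^sub>R x)"
    unfolding noise_diff by (subst distr_distr) (auto simp: comp_def intro!: vec_lambda_measurable)
  also have "... = gaussM ((sqrt 2)^2 * (t - s))" unfolding D using assms by (intro gaussM_scale) auto
  finally show ?thesis by simp
qed

context
  fixes \<tau> :: "nat \<Rightarrow> real" and n :: nat
  assumes \<tau>: "0 \<le> \<tau> 0" "\<And>k. k < n \<Longrightarrow> \<tau> k < \<tau> (Suc k)"
begin

lemma \<tau>_nonneg: "k \<le> n \<Longrightarrow> 0 \<le> \<tau> k"
  by (induction k) (use \<tau> in \<open>auto intro: order_trans[OF _ less_imp_le] simp: Suc_le_eq\<close>)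

text \<open>Independence across particles is given for whole paths, independence in time for each
  particle separately. An event on all increments is an intersection over particles of path events,
  so its probability factors first over i and then over k.\<close>

lemma increments_indep:
  assumes n: "0 < n"
  shows "indep_vars (\<lambda>_. borel) (\<lambda>(i, k) w. W i (\<tau> (Suc k)) w - W i (\<tau> k) w) (UNIV \<times> {..<n})"
proof (rule indep_vars_finiteI)
  let ?A = "\<lambda>i. \<lambda>w. \<lambda>t\<in>{0..}. W i t w"
  let ?D = "\<lambda>i k w. W i (\<tau> (Suc k)) w - W i (\<tau> k) w"
  let ?P = "\<Pi>\<^sub>M t\<in>{0::real..}. (borel :: 'a measure)"
  have Dm: "?D i k \<in> borel_measurable M" if "k < n" for i k
    using that by (intro borel_measurable_diff W_meas \<tau>_nonneg) auto
  show "(UNIV :: 'n set) \<times> {..<n} \<noteq> {}" "finite ((UNIV :: 'n set) \<times> {..<n})" using n by auto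
  show "random_variable borel (case j of (i, k) \<Rightarrow> ?D i k)" if "j \<in> UNIV \<times> {..<n}" for j using that Dm by auto
  fix A :: "'n \<times> nat \<Rightarrow> 'a set" assume A: "\<And>j. j \<in> UNIV \<times> {..<n} \<Longrightarrow> A j \<in> sets borel"
  \<comment> \<open>These path events depend on finitely many times, hence belong to the product
    sigma-algebra on paths.\<close>
  define S where "S i = {u \<in> space ?P. \<forall>k\<in>{..<n}. u (\<tau> (Suc k)) - u (\<tau> k) \<in> A (i, k)}" for i
  have S: "S i \<in> sets ?P" for i unfolding S_def
  proof (rule sets.sets_Collect_finite_All')
    fix k assume k: "k \<in> {..<n}"
    have "(\<lambda>u. u (\<tau> (Suc k)) - u (\<tau> k)) \<in> borel_measurable ?P"
      using k by (intro path_functional_measurable \<tau>_nonneg) auto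
    from measurable_sets[OF this A[of "(i, k)"]] k
    show "{u \<in> space ?P. u (\<tau> (Suc k)) - u (\<tau> k) \<in> A (i, k)} \<in> sets ?P" by (simp add: Int_def conj_commute)
  qed (use n in auto)
  have ev: "(?A i) -` S i \<inter> space M = (\<Inter>k\<in>{..<n}. ?D i k -` A (i, k) \<inter> space M)" for i
    using n \<tau>_nonneg by (auto simp: S_def space_PiM)
  have "(\<Inter>j\<in>UNIV \<times> {..<n}. (case j of (i, k) \<Rightarrow> ?D i k) -` A j \<inter> space M) = (\<Inter>i\<in>UNIV. (?A i) -` S i \<inter> space M)"
    unfolding ev by auto
  then have "prob (\<Inter>j\<in>UNIV \<times> {..<n}. (case j of (i, k) \<Rightarrow> ?D i k) -` A j \<inter> space M) = (\<Prod>i\<in>UNIV. prob ((?A i) -` S i \<inter> space M))"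
    using indep_varsD_finite[OF particle_systemD(2), of S] S by simp
  also have "... = (\<Prod>i\<in>UNIV. \<Prod>k\<in>{..<n}. prob (?D i k -` A (i, k) \<inter> space M))"
  proof (intro prod.cong refl)
    fix i
    have "indep_vars (\<lambda>_. borel) (\<lambda>k. ?D i k) {..<n}" using particle_systemD(1)[of i] \<tau> unfolding brownian_motion_def by simp
    from indep_varsD_finite[OF this, of "\<lambda>k. A (i, k)"]
    show "prob ((?A i) -` S i \<inter> space M) = (\<Prod>k\<in>{..<n}. prob (?D i k -` A (i, k) \<inter> space M))"
      unfolding ev using n A by auto
  qed
  also have "... = (\<Prod>j\<in>UNIV \<times> {..<n}. prob ((case j of (i, k) \<Rightarrow> ?D i k) -` A j \<inter> space M))"
    by (simp add: prod.cartesian_product case_prod_beta')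
  finally show "prob (\<Inter>j\<in>UNIV \<times> {..<n}. (case j of (i, k) \<Rightarrow> ?D i k) -` A j \<inter> space M) = (\<Prod>j\<in>UNIV \<times> {..<n}. prob ((case j of (i, k) \<Rightarrow> ?D i k) -` A j \<inter> space M))" .
qed

lemma noise_increments_indep:
  assumes n: "0 < n"
  shows "indep_vars (\<lambda>_. borel) (\<lambda>k w. noise (\<tau> (Suc k)) w - noise (\<tau> k) w) {..<n}"
proof -
  let ?D = "\<lambda>(i, k) w. W i (\<tau> (Suc k)) w - W i (\<tau> k) w"
  let ?K = "\<lambda>k. (UNIV :: 'n set) \<times> {k}"
  have 1: "indep_vars (\<lambda>k. \<Pi>\<^sub>M j\<in>?K k. borel) (\<lambda>k w. restrict (\<lambda>j. ?D j w) (?K k)) {..<n}"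
    by (rule indep_vars_restrict[OF increments_indep[OF n]]) (auto simp: disjoint_family_on_def)
  have "indep_vars (\<lambda>_. borel) (\<lambda>k. (\<lambda>u. sqrt 2 *\<^sub>R (\<chi> i. u (i, k))) \<circ> (\<lambda>w. restrict (\<lambda>j. ?D j w) (?K k))) {..<n}"
    by (rule indep_vars_compose[OF 1]) (intro borel_measurable_scaleR vec_lambda_measurable; simp)
  then show ?thesis by (simp add: comp_def noise_diff)
qed

text \<open>The initial value is independent of the sigma-algebra generated by all paths together.
  The noise increments are measurable with respect to it, and among themselves they are independent
  by \<open>noise_increments_indep\<close>.\<close>

lemma initial_noise_indep:
  "indep_vars (\<lambda>_. borel) (\<lambda>j w. case j of 0 \<Rightarrow> X 0 w | Suc k \<Rightarrow> noise (\<tau> (Suc k)) w - noise (\<tau> k) w) {..n}"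
proof (rule indep_vars_finiteI)
  let ?Y = "\<lambda>j w. case j of 0 \<Rightarrow> X 0 w | Suc k \<Rightarrow> noise (\<tau> (Suc k)) w - noise (\<tau> k) w"
  let ?V = "\<lambda>k w. noise (\<tau> (Suc k)) w - noise (\<tau> k) w"
  show "random_variable borel (?Y j)" if "j \<in> {..n}" for j
    using that \<tau>_nonneg by (cases j) (auto intro!: borel_measurable_diff noise_measurable particle_systemD(3))
  fix A :: "nat \<Rightarrow> ('a ^ 'n) set" assume A: "\<And>j. j \<in> {..n} \<Longrightarrow> A j \<in> sets borel"
  let ?a = "X 0 -` A 0 \<inter> space M" and ?b = "(\<Inter>k\<in>{..<n}. ?V k -` A (Suc k) \<inter> space M)"
  show "prob (\<Inter>j\<in>{..n}. ?Y j -` A j \<inter> space M) = (\<Prod>j\<in>{..n}. prob (?Y j -` A j \<inter> space M))"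
  proof (cases "n = 0")
    case False
    have s: "{..n} = insert 0 (Suc ` {..<n})" using lessThan_Suc_eq_insert_0[of n] by force
    have Int: "(\<Inter>j\<in>{..n}. ?Y j -` A j \<inter> space M) = ?a \<inter> ?b" unfolding s by auto
    have b: "prob ?b = (\<Prod>k\<in>{..<n}. prob (?V k -` A (Suc k) \<inter> space M))"
      using False A by (intro indep_varsD_finite[OF noise_increments_indep]) auto
    let ?f = "\<lambda>w. \<lambda>(i, t)\<in>(UNIV :: 'n set) \<times> {0..}. W i t w" and ?P = "\<Pi>\<^sub>M (i, t)\<in>(UNIV :: 'n set) \<times> {0::real..}. (borel :: 'a measure)"
    let ?G = "vimage_algebra (space M) ?f ?P"
    have f: "?f \<in> ?G \<rightarrow>\<^sub>M ?P" by (rule measurable_vimage_algebra1) (auto simp: space_PiM)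
    have Wm: "W i t \<in> borel_measurable ?G" if "0 \<le> t" for i t
    proof -
      have "(\<lambda>u. u (i, t)) \<in> ?P \<rightarrow>\<^sub>M (case (i, t) of (i, t) \<Rightarrow> borel)" using that by (intro measurable_component_singleton) auto
      from measurable_compose[OF f this] show ?thesis using that by simp
    qed
    have Vm: "?V k \<in> borel_measurable ?G" if "k < n" for k unfolding noise_def using that \<tau>_nonneg
      by (intro borel_measurable_diff borel_measurable_scaleR vec_lambda_measurable Wm) auto
    have "?b \<in> sets ?G" using False measurable_sets[OF Vm A] by (intro sets.finite_INT) auto
    moreover have "?a \<in> sets (vimage_algebra (space M) (X 0) borel)" using A[of 0] by (intro in_vimage_algebra) auto
    ultimately have "prob (?a \<inter> ?b) = prob ?a * prob ?b" by (intro indep_setD[OF particle_systemD(4)])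
    moreover have "(\<Prod>j\<in>{..n}. prob (?Y j -` A j \<inter> space M)) = prob ?a * (\<Prod>k\<in>{..<n}. prob (?V k -` A (Suc k) \<inter> space M))"
      unfolding s by (subst prod.insert) (auto simp: prod.reindex)
    ultimately show ?thesis unfolding Int by (simp only: b)
  qed simp
qed auto

end

lemma langevin_particle_system:
  assumes pot: "potential U b L" and b: "\<And>x. b x = (\<chi> i. DF (empirical x) (x $ i))"
  shows "langevin U b L M X noise"
proof -
  interpret potential U b L by (rule pot)
  show ?thesis
  proof (intro langevin.intro langevin_axioms.intro pot prob_space_axioms)
    show "AE w in M. continuous_on {0..} (\<lambda>t. X t w) \<and> (\<forall>t\<ge>0. X t w = X 0 w - integral {0..t} (\<lambda>s. b (X s w)) + noise t w)"
      using particle_systemD(5)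
    proof eventually_elim
      case (elim w)
      then have c: "continuous_on {0..} (\<lambda>t. X t w)" by simp
      have "X t w = X 0 w - integral {0..t} (\<lambda>s. b (X s w)) + noise t w" if t: "0 \<le> t" for t
      proof -
        have "(\<lambda>s. b (X s w)) integrable_on {0..t}"
          by (intro integrable_continuous_interval continuous_on_compose2[OF b_continuous continuous_on_subset[OF c]]) auto
        from integral_linear[OF this bounded_linear_vec_nth]
        have "integral {0..t} (\<lambda>s. b (X s w)) $ i = integral {0..t} (\<lambda>s. DF (empirical (X s w)) (X s w $ i))" for i
          by (simp add: comp_def b)
        moreover have "X t w $ i = X 0 w $ i - integral {0..t} (\<lambda>s. DF (empirical (X s w)) (X s w $ i)) + sqrt 2 *\<^sub>R W i t w" for i
          using elim t by blast
        ultimately show ?thesis by (simp add: vec_eq_iff noise_def)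
      qed
      then show ?case using c by blast
    qed
  qed (rule particle_systemD(3) noise_measurable noise_law initial_noise_indep; assumption)+
qed

end

section \<open>Conclusion for the particle system\<close>

context mean_field_gibbs
begin

lemma free_energy_m_inf: "ereal (real CARD('n)) * free_energy F m_inf = ereal (c0 TYPE('n::finite))"
proof -
  have "(LBINT x. w x * ln (w x)) = (\<integral>x. - dF m_inf x - lnZ m_inf \<partial>m_inf)"
    using dF_measurable[OF m_inf] by (subst integral_m) (auto simp: w_def)
  also have "... = - (\<integral>x. dF m_inf x \<partial>m_inf) - lnZ m_inf"
    using dF_integrable[OF m_inf m_inf] prob_space by simp
  finally have "abs_entropy m_inf = ereal (- (\<integral>x. dF m_inf x \<partial>m_inf) - lnZ m_inf)"
    using abs_entropy_density[OF w_Gibbs(1)] w_Gibbs(2) by simp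
  then show ?thesis by (simp add: free_energy_def c0_def)
qed

text \<open>The gap in the second claim is the mean of \<Psi>, by the splitting of the energy in
  \<open>energy_eq\<close>.\<close>

lemma particle_energy_eq:
  fixes q :: "'a ^ 'n \<Rightarrow> real"
  assumes q: "dens2 q"
  shows "particle_free_energy F (edensity lborel q) - ereal (real CARD('n)) * free_energy F m_inf = ereal (energy q)"
    and "rel_entropy (edensity lborel q) (tensor_power m_inf) \<le> ereal (energy q)"
proof -
  let ?A = "\<lambda>y. ennreal (q y)"
  interpret pot: potential "\<lambda>y::'a ^ 'n. UU y - 0" bN "2 * (Mx + K)" by (rule potential_UU)
  have UUm: "(UU :: 'a ^ 'n \<Rightarrow> real) \<in> borel_measurable borel" using pot.U_measurable by simp
  note [measurable] = dens2D(1)[OF q] UUm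
  have "real CARD('n) * (\<integral>x. F (empirical x) \<partial>density lborel ?A) = (\<integral>x. UU x \<partial>density lborel ?A)"
    by (simp add: UU_def)
  also have "... = (LBINT y. q y * UU y)" by (rule integral_dens2[OF q UUm])
  finally show "particle_free_energy F (density lborel ?A) - ereal (real CARD('n)) * free_energy F m_inf = ereal (energy q)"
    unfolding particle_free_energy_def abs_entropy_density[OF q] free_energy_m_inf energy_eq(5)[OF q] by simp
  let ?q = "density lborel ?A"
  interpret T: prob_space "tensor_power m_inf :: ('a ^ 'n) measure" by (rule prob_space_tensor_power)
  have q0: "0 \<le> q y" for y by (rule dens2D(2)[OF q])
  have e: "q y * ln (q y / Wn y) = q y * ln (q y) - q y * ln (Wn y)" for y
    by (cases "q y = 0") (auto simp: ln_div right_diff_distrib)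
  have i: "integrable ?q (\<lambda>y. ln (q y / Wn y))" "(\<integral>y. ln (q y / Wn y) \<partial>?q) = (LBINT y. q y * ln (q y)) - (LBINT y. q y * ln (Wn y))"
    using energy_eq(1)[OF q] dens2D(5)[OF q] by (simp_all add: integrable_dens2_iff[OF q] integral_dens2[OF q] e)
  have "rel_entropy ?q (tensor_power m_inf) = ereal (\<integral>y. ln (q y / Wn y) \<partial>?q)"
  proof (rule rel_entropy_density)
    show "?q = edensity (tensor_power m_inf) (\<lambda>y. q y / Wn y)" using q0 by (intro tensor_power_density_eq[symmetric]) auto
  qed (use q0 i(1) T.sigma_finite_measure_axioms in auto)
  moreover have "0 \<le> (LBINT y. q y * \<Psi> y)" by (intro Bochner_Integration.integral_nonneg mult_nonneg_nonneg \<Psi>_nonneg q0)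
  ultimately show "rel_entropy ?q (tensor_power m_inf) \<le> ereal (energy q)" unfolding i(2) energy_eq(4)[OF q] by simp
qed

text \<open>\<open>fisher_ge_energy\<close> bounds the Fisher information below by
  \<open>\<kappa> * (energy p - C2 / \<kappa>)\<close>, so the energy decays to the level
  \<open>C2 / \<kappa>\<close>; the negative term this leaves in front of the exponential is
  dropped. Time \<open>t = t0\<close> is separate because \<open>free_decay\<close> needs a positive
  duration.\<close>

theorem particle_decay:
  fixes X :: "real \<Rightarrow> 'w \<Rightarrow> 'a ^ 'n"
  assumes ps: "particle_system DF M W X" and t: "0 \<le> t0" "t0 \<le> t"
    and P2: "distr M borel (X t0) \<in> P2" and fin: "abs_entropy (distr M borel (X t0)) \<noteq> \<infinity>" and \<rho>': "0 < \<rho>'" "\<rho>' < \<rho>"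
  defines "\<kappa> \<equiv> 4 * \<rho>' - K * (16 + 6 * K * \<rho>' / (\<rho> * (\<rho> - \<rho>'))) / real CARD('n)"
    and "C2 \<equiv> real DIM('a) * K * (10 + 3 * K * \<rho>' / (\<rho> * (\<rho> - \<rho>')))"
  assumes \<kappa>: "0 < \<kappa>"
  obtains p q where "dens2 p" "distr M borel (X t0) = edensity lborel p"
    "dens2 q" "distr M borel (X t) = edensity lborel q"
    "energy q \<le> energy p * exp (- \<kappa> * (t - t0)) + C2 / \<kappa>"
proof -
  obtain p where p: "dens2 p" "distr M borel (X t0) = edensity lborel p" using abs_entropy_dens2[OF P2 fin] by auto
  have "0 \<le> C2" using K \<rho>' by (simp add: C2_def)
  show thesis
  proof (cases "t = t0")
    case True
    then show thesis using that[OF p p[folded True]] \<open>0 \<le> C2\<close> \<kappa> by simp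
  next
    case False
    interpret L: langevin "\<lambda>y. UU y - c0 TYPE('n)" bN "2 * (Mx + K)" M X "noise W"
      by (rule langevin_particle_system[OF ps potential_UU]) (simp add: bN_def)
    obtain q where q: "dens2 q" "distr M borel (X t) = edensity lborel q"
      "energy q \<le> C2 / \<kappa> + (energy p - C2 / \<kappa>) * exp (- \<kappa> * (t - t0))"
    proof (rule L.free_decay[OF t(1) _ p \<kappa>])
      show "t0 < t" using t False by simp
      show "\<kappa> * (energy p - C2 / \<kappa>) \<le> potential.fisher bN p D" if "regdens p D" for p :: "'a ^ 'n \<Rightarrow> real" and D
        using fisher_ge_energy[OF that \<rho>'] \<kappa> unfolding \<kappa>_def[symmetric] C2_def[symmetric] by (simp add: right_diff_distrib)
      interpret T: prob_space "tensor_power m_inf :: ('a ^ 'n) measure" by (rule prob_space_tensor_power)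
      \<comment> \<open>Nonnegativity of \<Psi> bounds the Gibbs weight of the N-particle system by
        the density \<open>Wn\<close> of the power of \<open>m_inf\<close>, so its partition
        function is at most 1.\<close>
      have "(\<integral>\<^sup>+y. ennreal (exp (- (UU y - c0 TYPE('n)))) \<partial>(lborel :: ('a ^ 'n) measure)) \<le> (\<integral>\<^sup>+y. ennreal (Wn y) \<partial>(lborel :: ('a ^ 'n) measure))"
      proof (intro nn_integral_mono ennreal_leI)
        fix y :: "'a ^ 'n"
        show "exp (- (UU y - c0 TYPE('n))) \<le> Wn y"
          unfolding UU_decomposition using \<Psi>_nonneg[of y] Wn_pos[of y] by (simp add: exp_diff divide_simps)
      qed
      also have "... = emeasure (tensor_power m_inf :: ('a ^ 'n) measure) UNIV"
        unfolding tensor_power_Wn by (simp add: emeasure_density)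
      finally show "(\<integral>\<^sup>+y. ennreal (exp (- (UU y - c0 TYPE('n)))) \<partial>(lborel :: ('a ^ 'n) measure)) < \<infinity>"
        using T.emeasure_space_1 by (simp add: le_less_trans)
    qed blast
    have "0 \<le> C2 / \<kappa> * exp (- \<kappa> * (t - t0))" using \<open>0 \<le> C2\<close> \<kappa> by simp
    then show thesis using that[OF p q(1,2)] q(3) by (simp add: left_diff_distrib)
  qed
qed

end

theorem theorem2p6:
  fixes F :: "(real ^ 'd) measure \<Rightarrow> real"
    and dF :: "(real ^ 'd) measure \<Rightarrow> real ^ 'd \<Rightarrow> real"
    and DF :: "(real ^ 'd) measure \<Rightarrow> real ^ 'd \<Rightarrow> real ^ 'd"
    and Mmm Mmx \<rho> \<rho>' C1 C2 t0 t :: real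
    and m_inf :: "(real ^ 'd) measure"
    and M :: "'w measure"
    and W :: "'n::finite \<Rightarrow> real \<Rightarrow> 'w \<Rightarrow> real ^ 'd"
    and X :: "real \<Rightarrow> 'w \<Rightarrow> real ^ 'd ^ 'n"
    and law :: "real \<Rightarrow> (real ^ 'd ^ 'n) measure"
  assumes "linear_functional_derivative F dF"
    and "intrinsic_derivative dF DF"
    and "Mmm \<ge> 0" and "Mmx \<ge> 0" and "\<rho> > 0"
    and convex: "\<And>s m m'. s \<in> {0..1} \<Longrightarrow> m \<in> P2 \<Longrightarrow> m' \<in> P2 \<Longrightarrow>
          F (mixture s m m') \<le> (1 - s) * F m + s * F m'"
    and lipschitz: "\<And>m m' x. m \<in> P2 \<Longrightarrow> m' \<in> P2 \<Longrightarrow>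
          norm (DF m x - DF m' x) \<le> Mmm * wasserstein 1 m m'"
    and lsi: "\<And>m. m \<in> P2 \<Longrightarrow>
          integrable lborel (\<lambda>x. exp (- dF m x)) \<and> log_sobolev \<rho> (hat_measure dF m)"
    and bounded_hessian: "\<And>m x. m \<in> P2 \<Longrightarrow>
          \<exists>A. (DF m has_derivative A) (at x) \<and> onorm A \<le> Mmx"
    and minimizer: "is_arg_min (free_energy F) (\<lambda>m. m \<in> P2) m_inf"
    and "CARD('n) \<ge> 2"
    and "particle_system DF M W X"
    and law: "\<And>s. law s = distr M borel (X s)"
    and "t0 \<ge> 0" and "law t0 \<in> P2" and "\<bar>abs_entropy (law t0)\<bar> \<noteq> \<infinity>"
    and "0 < \<rho>'" and "\<rho>' < \<rho>"
    and C1: "C1 = Mmm * (16 + 6 * Mmm * \<rho>' / (\<rho> * (\<rho> - \<rho>')))"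
    and C2: "C2 = real CARD('d) * Mmm * (10 + 3 * Mmm * \<rho>' / (\<rho> * (\<rho> - \<rho>')))"
    and "real CARD('n) > C1 / (4 * \<rho>')"
    and "t \<ge> t0"
  shows "rel_entropy (law t) (tensor_power m_inf)
           \<le> particle_free_energy F (law t) - ereal (real CARD('n)) * free_energy F m_inf
       \<and> particle_free_energy F (law t) - ereal (real CARD('n)) * free_energy F m_inf
           \<le> (particle_free_energy F (law t0) - ereal (real CARD('n)) * free_energy F m_inf)
               * ereal (exp (- (4 * \<rho>' - C1 / real CARD('n)) * (t - t0)))
             + ereal (C2 / (4 * \<rho>' - C1 / real CARD('n)))"
proof -
  interpret mean_field_gibbs F dF DF Mmm Mmx \<rho> m_inf by unfold_locales (fact assms)+
  \<comment> \<open>The lower bound on the number of particles says exactly that the rate is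
    positive.\<close>
  have \<kappa>: "0 < 4 * \<rho>' - Mmm * (16 + 6 * Mmm * \<rho>' / (\<rho> * (\<rho> - \<rho>'))) / real CARD('n)"
    using \<open>real CARD('n) > C1 / (4 * \<rho>')\<close> \<open>0 < \<rho>'\<close> unfolding C1[symmetric]
    by (simp add: divide_less_eq mult.commute)
  have fin: "abs_entropy (distr M borel (X t0)) \<noteq> \<infinity>" and P2: "distr M borel (X t0) \<in> P2"
    using \<open>\<bar>abs_entropy (law t0)\<bar> \<noteq> \<infinity>\<close> \<open>law t0 \<in> P2\<close> by (auto simp: law)
  obtain p q where p: "dens2 p" "distr M borel (X t0) = edensity lborel p"
    and q: "dens2 q" "distr M borel (X t) = edensity lborel q"
    and le: "energy q \<le> energy p * exp (- (4 * \<rho>' - C1 / real CARD('n)) * (t - t0)) + C2 / (4 * \<rho>' - C1 / real CARD('n))"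
    using particle_decay[OF \<open>particle_system DF M W X\<close> \<open>t0 \<ge> 0\<close> \<open>t \<ge> t0\<close> P2 fin \<open>0 < \<rho>'\<close> \<open>\<rho>' < \<rho>\<close> \<kappa>]
    unfolding C1 C2 by auto
  show ?thesis unfolding law p(2) q(2) particle_energy_eq(1)[OF p(1)] particle_energy_eq(1)[OF q(1)]
    using particle_energy_eq(2)[OF q(1)] le by simp
qed

end
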